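(* Let $p_1=p_2\in(2,4)$, $\beta>0$, $\mu>0$ and $\sigma_1<\sigma_2$ be real numbers, and let $U=(u_1,u_2)$ be a ground state of $F$ at mass $\mu$, multiplied by a phase factor so that the charges $q_1,q_2$ of $u_1,u_2$ are positive. Then: (i) $q_2<q_1$; (ii) for any fixed $\sigma_1\in\mathbb{R}$ (and fixed $p_1=p_2$, $\beta$, $\mu$), as $\sigma_2\to+\infty$ (with $U=U_{\sigma_2}$ any ground state at mass $\mu$ of the functional $F=F^{(\sigma_2)}$ corresponding to $\sigma_2$) it holds that $$\|u_1\|_{L^2(\mathbb{R}^2)}^2\to\mu\quad\text{and}\quad F(U)\to\mathcal{F}_1(\mu).$$
   Context: All functions are complex-valued. For $\lambda>0$, $\mathcal{G}_\lambda$ denotes the Green's function of $-\Delta+\lambda$ on $\mathbb{R}^2$, i.e. the $L^2(\mathbb{R}^2)$ solution of $(-\Delta+\lambda)\mathcal{G}_\lambda=\delta_0$ (it lies in $L^2(\mathbb{R}^2)\setminus H^1(\mathbb{R}^2)$). Let $\mathcal{D}:=\{u\in L^2(\mathbb{R}^2):\exists\, q\in\mathbb{C},\ u-q\mathcal{G}_1=:\phi\in H^1(\mathbb{R}^2)\}$. The (uniquely determined) number $q$ is called the charge of $u$. For $p>2$, $\sigma\in\mathbb{R}$ and $u=\phi+q\mathcal{G}_1\in\mathcal{D}$ set $$F_{p,\sigma}(u):=\frac12\left(\|\phi\|_{H^1(\mathbb{R}^2)}^2-\|u\|_{L^2(\mathbb{R}^2)}^2\right)+\frac{|q|^2}{2}\left(\sigma+\frac{\gamma-\log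 2}{2\pi}\right)-\frac1p\|u\|_{L^p(\mathbb{R}^2)}^p,$$ where $\gamma$ is the Euler–Mascheroni constant and $\|\phi\|_{H^1}^2=\|\nabla\phi\|_{L^2}^2+\|\phi\|_{L^2}^2$. Let $\Lambda:=\mathcal{D}\times\mathcal{D}$. For $U=(u_1,u_2)\in\Lambda$, with $q_i$ the charge of $u_i$, set $$F(U):=F_{p_1,\sigma_1}(u_1)+F_{p_2,\sigma_2}(u_2)-\beta\,\mathrm{Re}\{q_1\overline{q_2}\}.$$ For $\mu>0$ let $\Lambda_\mu:=\{(u_1,u_2)\in\Lambda:\|u_1\|_{L^2(\mathbb{R}^2)}^2+\|u_2\|_{L^2(\mathbb{R}^2)}^2=\mu\}$. A ground state of $F$ at mass $\mu$ is a $U\in\Lambda_\mu$ with $F(U)=\inf_{V\in\Lambda_\mu}F(V)$. Ground states exist for every $\mu>0$, and when $\beta>0$ every ground state can be multiplied by a constant phase factor $e^{i\theta}$ so that both charges are positive. Finally, $\mathcal{F}_1(\mu):=\inf\{F_{p_1,\sigma_1}(v):v\in\mathcal{D},\ \|v\|_{L^2(\mathbb{R}^2)}^2=\mu\}$. *)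

theory Defs
  imports "HOL-Analysis.Analysis"
begin

text \<open>
  Elements of \<open>L\<^sup>p(\<real>\<^sup>2)\<close> are represented by Borel measurable functions \<^typ>\<open>real ^ 2 \<Rightarrow> complex\<close>
  rather than by equivalence classes. What is defined for such elements below does not depend on the
  representative; pointwise derivatives are only applied to test functions.
\<close>

type_synonym fn = "real ^ 2 \<Rightarrow> complex"

definition Lp :: "real \<Rightarrow> fn set" where
  "Lp p = {f. f \<in> borel_measurable lborel \<and> integrable lborel (\<lambda>x. norm (f x) powr p)}"

text \<open>Only meaningful for \<open>f \<in> Lp p\<close>, since the Bochner integral of a non-integrable function is 0.\<close>

definition Lp_norm :: "real \<Rightarrow> fn \<Rightarrow> real" where
  "Lp_norm p f = (\<integral>x. norm (f x) powr p \<partial>lborel) powr (1 / p)"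

definition pderiv :: "2 \<Rightarrow> fn \<Rightarrow> fn" where
  "pderiv i f x = frechet_derivative f (at x) (axis i 1)"

definition laplacian :: "fn \<Rightarrow> fn" where
  "laplacian f x = (\<Sum>i\<in>UNIV. pderiv i (pderiv i f) x)"

fun Ck :: "nat \<Rightarrow> fn \<Rightarrow> bool" where
  "Ck 0 f \<longleftrightarrow> continuous_on UNIV f"
| "Ck (Suc k) f \<longleftrightarrow> (\<forall>x. f differentiable (at x)) \<and> (\<forall>i. Ck k (pderiv i f))"

definition test_fun :: "fn \<Rightarrow> bool" where
  "test_fun \<psi> \<longleftrightarrow> (\<forall>k. Ck k \<psi>) \<and> compact (closure {x. \<psi> x \<noteq> 0})"

definition is_weak_pderiv :: "2 \<Rightarrow> fn \<Rightarrow> fn \<Rightarrow> bool" where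
  "is_weak_pderiv i f g \<longleftrightarrow>
     (\<forall>\<psi>. test_fun \<psi> \<longrightarrow>
        (\<integral>x. f x * pderiv i \<psi> x \<partial>lborel) = - (\<integral>x. g x * \<psi> x \<partial>lborel))"

definition H1 :: "fn set" where
  "H1 = {f \<in> Lp 2. \<forall>i. \<exists>g\<in>Lp 2. is_weak_pderiv i f g}"

text \<open>Weak derivatives are unique up to null sets, so the choice does not affect the norm.\<close>

definition weak_pderiv :: "2 \<Rightarrow> fn \<Rightarrow> fn" where
  "weak_pderiv i f = (SOME g. g \<in> Lp 2 \<and> is_weak_pderiv i f g)"

definition H1_norm :: "fn \<Rightarrow> real" where
  "H1_norm f = sqrt ((\<Sum>i\<in>UNIV. (Lp_norm 2 (weak_pderiv i f))\<^sup>2) + (Lp_norm 2 f)\<^sup>2)"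

text \<open>
  \<open>(-\<Delta> + \<omega>) g = \<delta>\<^sub>0\<close> in the sense of distributions. For \<open>\<omega> > 0\<close> there is exactly one solution in
  \<open>L\<^sup>2\<close> up to null sets, and \<open>green \<omega>\<close> is some representative of it.
\<close>

definition is_green :: "real \<Rightarrow> fn \<Rightarrow> bool" where
  "is_green \<omega> g \<longleftrightarrow> g \<in> Lp 2 \<and>
     (\<forall>\<psi>. test_fun \<psi> \<longrightarrow>
        (\<integral>x. g x * (- laplacian \<psi> x + of_real \<omega> * \<psi> x) \<partial>lborel) = \<psi> 0)"

definition green :: "real \<Rightarrow> fn" where
  "green \<omega> = (SOME g. is_green \<omega> g)"

definition energy_dom :: "fn set" where
  "energy_dom = {u \<in> Lp 2. \<exists>q. (\<lambda>x. u x - q * green 1 x) \<in> H1}"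

definition charge :: "fn \<Rightarrow> complex" where
  "charge u = (THE q. (\<lambda>x. u x - q * green 1 x) \<in> H1)"

definition regular_part :: "fn \<Rightarrow> fn" where
  "regular_part u = (\<lambda>x. u x - charge u * green 1 x)"

definition energy1 :: "real \<Rightarrow> real \<Rightarrow> fn \<Rightarrow> real" where
  "energy1 p \<sigma> u =
     1 / 2 * ((H1_norm (regular_part u))\<^sup>2 - (Lp_norm 2 u)\<^sup>2)
     + (norm (charge u))\<^sup>2 / 2 * (\<sigma> + (euler_mascheroni - ln 2) / (2 * pi))
     - 1 / p * Lp_norm p u powr p"

definition energy ::
  "real \<Rightarrow> real \<Rightarrow> real \<Rightarrow> real \<Rightarrow> real \<Rightarrow> fn \<times> fn \<Rightarrow> real" where
  "energy p1 p2 \<sigma>1 \<sigma>2 \<beta> U =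
     energy1 p1 \<sigma>1 (fst U) + energy1 p2 \<sigma>2 (snd U)
     - \<beta> * Re (charge (fst U) * cnj (charge (snd U)))"

definition mass_constraint :: "real \<Rightarrow> (fn \<times> fn) set" where
  "mass_constraint \<mu> =
     {U \<in> energy_dom \<times> energy_dom. (Lp_norm 2 (fst U))\<^sup>2 + (Lp_norm 2 (snd U))\<^sup>2 = \<mu>}"

text \<open>
  Infima of energies are taken in \<^typ>\<open>ereal\<close>, so that they are meaningful without first knowing
  that the energy is bounded below (\<^const>\<open>Inf\<close> on \<^typ>\<open>real\<close> is not).
\<close>

definition ground_state ::
  "real \<Rightarrow> real \<Rightarrow> real \<Rightarrow> real \<Rightarrow> real \<Rightarrow> real \<Rightarrow> fn \<times> fn \<Rightarrow> bool" where
  "ground_state p1 p2 \<sigma>1 \<sigma>2 \<beta> \<mu> U \<longleftrightarrow> U \<in> mass_constraint \<mu> \<and>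
     ereal (energy p1 p2 \<sigma>1 \<sigma>2 \<beta> U)
       = (INF V\<in>mass_constraint \<mu>. ereal (energy p1 p2 \<sigma>1 \<sigma>2 \<beta> V))"

definition energy1_inf :: "real \<Rightarrow> real \<Rightarrow> real \<Rightarrow> ereal" where
  "energy1_inf p \<sigma> \<mu> = (INF v\<in>{v \<in> energy_dom. (Lp_norm 2 v)\<^sup>2 = \<mu>}. ereal (energy1 p \<sigma> v))"

end

theory Submission
  imports Defs "HOL-Probability.Distributions"
begin

text \<open>
  For (i), exchanging the components of a ground state changes the energy by
  \<open>(\<sigma>\<^sub>2 - \<sigma>\<^sub>1) (q\<^sub>1\<^sup>2 - q\<^sub>2\<^sup>2) / 2\<close>, so \<open>q\<^sub>2 \<le> q\<^sub>1\<close>; equality is excluded by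
  rotating the pair \<open>(u\<^sub>1, u\<^sub>2)\<close>.

  For (ii), the infimum of the single-component energy is subadditive in the mass, so that
  \<open>F(U) \<ge> \<F>\<^sub>1(\<mu>) + (\<sigma>\<^sub>2 - \<sigma>\<^sub>1) |q\<^sub>2|\<^sup>2 / 2 - \<beta> |q\<^sub>1| |q\<^sub>2|\<close>, while
  \<open>F(U) \<le> \<F>\<^sub>1(\<mu>)\<close> by testing with \<open>(v, 0)\<close>. Hence \<open>q\<^sub>2\<close> tends to 0 and \<open>F(U)\<close> to
  \<open>\<F>\<^sub>1(\<mu>)\<close>. If \<open>u\<^sub>2\<close> kept mass at least \<open>\<epsilon>\<close>, this would contradict the following gap: the energy of
  functions in \<open>H\<^sup>1\<close> with mass at least \<open>\<epsilon>\<close> and bounded norm exceeds the infimum at their mass by a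
  positive constant. Such an \<open>f\<close> either has a small \<open>L\<^sup>p\<close> norm and thus energy far above the infimum,
  which is negative, or some average of \<open>f\<close> on a small ball stays away from 0. Translating that
  ball to the origin and adding a small multiple of the Green's function \<open>\<G>\<close> then lowers the energy to
  first order, because \<open>\<langle>f, \<G>\<rangle>\<close> in \<open>H\<^sup>1\<close> formally equals \<open>f(0)\<close>.
\<close>

section \<open>Smooth functions and test functions\<close>

text \<open>The obstacle throughout is that the Green's function is not in H^1, so that gradients
  control neither translations nor the L^p norm of a general element of the energy domain. They are
  replaced by bounds of the form |u(.+z) - u|_2^2 \<le> A |z|^a with a < 2, which hold for H^1
  functions and for the Green's function alike and still yield a Gagliardo-Nirenberg inequality for
  p < 2 + a. That the charge is well defined, and that its square is bounded by a small multiple of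
  the squared H^1 norm of the regular part plus a multiple of the mass, both come from points having
  zero H^1 capacity in the plane. This makes the energy coercive whatever the signs of the coupling
  constants. Since an H^1 function has no point values, the formal identity behind the gap is
  applied to a mollified Green's function, whose pairing with f is the same mollification of f at 0.
  No compactness enters: all constants are fixed before the function to which they are
  applied.\<close>

lemma pderivI: "(f has_derivative f') (at x) \<Longrightarrow> pderiv i f x = f' (axis i 1)"
  unfolding pderiv_def using frechet_derivative_at by metis

lemma pderiv_has_vector_derivative:
  assumes "f differentiable (at (x + s *\<^sub>R axis i 1))"
  shows "((\<lambda>s. f (x + s *\<^sub>R axis i 1)) has_vector_derivative pderiv i f (x + s *\<^sub>R axis i 1)) (at s)"
proof -
  let ?L = "\<lambda>s. x + s *\<^sub>R axis i 1 :: real ^ 2"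
  have "(f has_derivative frechet_derivative f (at (?L s))) (at (?L s))"
    using assms frechet_derivative_works by blast
  moreover have "(?L has_derivative (\<lambda>h. h *\<^sub>R axis i 1)) (at s)"
    by (auto intro!: derivative_eq_intros)
  ultimately have d: "((\<lambda>s. f (?L s)) has_derivative
      (\<lambda>h. frechet_derivative f (at (?L s)) (h *\<^sub>R axis i 1))) (at s)"
    using has_derivative_compose by blast
  have "linear (frechet_derivative f (at (?L s)))"
    using assms linear_frechet_derivative by blast
  then show ?thesis
    using d by (simp add: has_vector_derivative_def pderiv_def linear_scale)
qed

lemma Ck_imp_continuous: "Ck k f \<Longrightarrow> continuous_on UNIV f"
  by (cases k) (auto simp: continuous_at_imp_continuous_on differentiable_imp_continuous_within)

definition smooth :: "fn \<Rightarrow> bool" where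
  "smooth f \<longleftrightarrow> (\<forall>k. Ck k f)"

lemma smooth_differentiable: "smooth f \<Longrightarrow> f differentiable (at x)"
  unfolding smooth_def by (metis Ck.simps(2))

lemma smooth_pderiv: "smooth f \<Longrightarrow> smooth (pderiv i f)"
  unfolding smooth_def by (metis Ck.simps(2))

lemma smooth_continuous: "smooth f \<Longrightarrow> continuous_on UNIV f"
  unfolding smooth_def using Ck_imp_continuous by blast

lemma pderiv_add:
  "f differentiable (at x) \<Longrightarrow> g differentiable (at x) \<Longrightarrow>
    pderiv i (\<lambda>x. f x + g x) x = pderiv i f x + pderiv i g x"
  by (subst pderivI[OF has_derivative_add]) (auto simp: frechet_derivative_works pderiv_def)

lemma pderiv_cmult:
  "f differentiable (at x) \<Longrightarrow> pderiv i (\<lambda>x. c * f x) x = c * pderiv i f x"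
  by (subst pderivI[OF has_derivative_mult_right]) (auto simp: frechet_derivative_works pderiv_def)

lemma has_derivative_affine_arg:
  fixes f :: fn
  assumes "f differentiable (at (t + c *\<^sub>R x))"
  shows "((\<lambda>x. f (t + c *\<^sub>R x)) has_derivative
           (\<lambda>h. frechet_derivative f (at (t + c *\<^sub>R x)) (c *\<^sub>R h))) (at x)"
proof -
  have "((\<lambda>x. t + c *\<^sub>R x) has_derivative (\<lambda>h. c *\<^sub>R h)) (at x)"
    by (auto intro!: derivative_eq_intros)
  from has_derivative_compose[OF this] show ?thesis
    using assms by (auto simp: frechet_derivative_works)
qed

lemma pderiv_affine:
  assumes "f differentiable (at (t + c *\<^sub>R x))"
  shows "pderiv i (\<lambda>x. f (t + c *\<^sub>R x)) x = of_real c * pderiv i f (t + c *\<^sub>R x)"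
proof -
  have "linear (frechet_derivative f (at (t + c *\<^sub>R x)))"
    using assms linear_frechet_derivative by blast
  then show ?thesis
    by (subst pderivI[OF has_derivative_affine_arg[OF assms]])
       (simp add: pderiv_def linear_scale scaleR_conv_of_real[where 'a=complex])
qed

lemma Ck_add: "Ck k f \<Longrightarrow> Ck k g \<Longrightarrow> Ck k (\<lambda>x. f x + g x)"
proof (induction k arbitrary: f g)
  case 0
  then show ?case by (auto intro: continuous_intros)
next
  case (Suc k)
  then have "pderiv i (\<lambda>x. f x + g x) = (\<lambda>x. pderiv i f x + pderiv i g x)" for i
    using pderiv_add by (auto intro!: ext)
  with Suc show ?case by auto
qed

lemma Ck_cmult: "Ck k f \<Longrightarrow> Ck k (\<lambda>x. c * f x)"
proof (induction k arbitrary: f)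
  case 0
  then show ?case by (auto intro: continuous_intros)
next
  case (Suc k)
  then have "pderiv i (\<lambda>x. c * f x) = (\<lambda>x. c * pderiv i f x)" for i
    using pderiv_cmult by (auto intro!: ext)
  with Suc show ?case by (auto intro!: differentiable_mult)
qed

lemma Ck_affine: "Ck k f \<Longrightarrow> Ck k (\<lambda>x. f (t + c *\<^sub>R x))"
proof (induction k arbitrary: f)
  case 0
  have "continuous_on UNIV (f \<circ> (\<lambda>x. t + c *\<^sub>R x))"
    by (rule continuous_on_compose) (use 0 in \<open>auto intro!: continuous_intros intro: continuous_on_subset\<close>)
  then show ?case by (simp add: o_def)
next
  case (Suc k)
  then have "pderiv i (\<lambda>x. f (t + c *\<^sub>R x)) = (\<lambda>x. of_real c * pderiv i f (t + c *\<^sub>R x))" for i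
    using pderiv_affine by (auto intro!: ext)
  with Suc show ?case
    by (auto intro!: Ck_cmult intro: differentiableI[OF has_derivative_affine_arg])
qed

text \<open>Compactness of the closed support is boundedness in finite dimension; supports are
  handled below only through a radius \<open>R\<close> outside of which the function
  vanishes.\<close>

lemma bounded_support: "test_fun f \<longleftrightarrow> smooth f \<and> (\<exists>R. \<forall>x. R < norm x \<longrightarrow> f x = 0)"
proof -
  have "compact (closure {x. f x \<noteq> 0}) \<longleftrightarrow> bounded {x. f x \<noteq> 0}"
    using compact_closure by blast
  also have "\<dots> \<longleftrightarrow> (\<exists>R. \<forall>x. R < norm x \<longrightarrow> f x = 0)"
    unfolding bounded_iff by (auto simp: not_le[symmetric])
  finally show ?thesis unfolding test_fun_def smooth_def by simp
qed

lemma test_fun_smooth: "test_fun f \<Longrightarrow> smooth f"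
  by (simp add: bounded_support)

lemma test_fun_support:
  assumes "test_fun f" obtains R where "0 < R" "\<And>x. R < norm x \<Longrightarrow> f x = 0"
proof -
  obtain R where "\<forall>x. R < norm x \<longrightarrow> f x = 0" using assms by (auto simp: bounded_support)
  then show ?thesis by (intro that[of "max R 1"]) auto
qed

lemma pderiv_eq_0:
  assumes "open S" "x \<in> S" "\<And>y. y \<in> S \<Longrightarrow> f y = 0"
  shows "pderiv i f x = 0"
proof -
  have "(f has_derivative (\<lambda>_. 0)) (at x)"
    by (rule has_derivative_transform_within_open[OF has_derivative_const assms(1,2)])
       (use assms(3) in auto)
  then show ?thesis by (simp add: pderivI)
qed

lemma pderiv_outside_support:
  assumes "\<And>x. R < norm x \<Longrightarrow> f x = 0" "R < norm x"
  shows "pderiv i f x = 0"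
proof (rule pderiv_eq_0)
  show "open {x :: real ^ 2. R < norm x}" by (intro open_Collect_less continuous_intros)
qed (use assms in auto)

lemma test_fun_pderiv: "test_fun f \<Longrightarrow> test_fun (pderiv i f)"
  unfolding bounded_support using pderiv_outside_support smooth_pderiv by blast

lemma test_fun_add:
  assumes "test_fun f" "test_fun g" shows "test_fun (\<lambda>x. f x + g x)"
proof -
  obtain R S where "\<And>x. R < norm x \<Longrightarrow> f x = 0" "\<And>x. S < norm x \<Longrightarrow> g x = 0"
    using assms test_fun_support by metis
  then have "\<forall>x. max R S < norm x \<longrightarrow> f x + g x = 0" by auto
  then show ?thesis
    using assms unfolding bounded_support smooth_def by (blast intro: Ck_add)
qed

lemma test_fun_cmult: "test_fun f \<Longrightarrow> test_fun (\<lambda>x. c * f x)"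
  unfolding bounded_support smooth_def using Ck_cmult by fastforce

lemma test_fun_sum:
  assumes "finite A" "A \<noteq> {}" "\<And>a. a \<in> A \<Longrightarrow> test_fun (f a)"
  shows "test_fun (\<lambda>x. \<Sum>a\<in>A. f a x)"
  using assms by (induction A rule: finite_ne_induct) (auto intro: test_fun_add)

lemma test_fun_affine:
  assumes "test_fun f" "c \<noteq> 0" shows "test_fun (\<lambda>x. f (t + c *\<^sub>R x))"
proof -
  obtain R where R: "\<And>x. R < norm x \<Longrightarrow> f x = 0" using assms test_fun_support by metis
  have "f (t + c *\<^sub>R x) = 0" if "(R + norm t) / \<bar>c\<bar> < norm x" for x
  proof (rule R)
    have "R + norm t < \<bar>c\<bar> * norm x" using that assms(2) by (simp add: field_simps)
    moreover have "\<bar>c\<bar> * norm x \<le> norm (t + c *\<^sub>R x) + norm t"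
      by (metis add.commute add_diff_cancel_left' norm_scaleR norm_triangle_ineq4)
    ultimately show "R < norm (t + c *\<^sub>R x)" by simp
  qed
  then show ?thesis using assms unfolding bounded_support smooth_def by (blast intro: Ck_affine)
qed

lemma test_fun_laplacian: "test_fun f \<Longrightarrow> test_fun (laplacian f)"
  unfolding laplacian_def[abs_def] by (intro test_fun_sum test_fun_pderiv) auto

text \<open>One statement covers all substitutions made below: translations (\<open>c = 1\<close>),
  reflection at a point (\<open>c = - 1\<close>) and dilations such as
  \<open>c = 2 ^ k\<close>.\<close>

lemma smooth_laplacian_affine:
  assumes "smooth f"
  shows "pderiv i (\<lambda>x. f (t + c *\<^sub>R x)) = (\<lambda>x. of_real c * pderiv i f (t + c *\<^sub>R x))"
    and "laplacian (\<lambda>x. f (t + c *\<^sub>R x)) x = of_real (c\<^sup>2) * laplacian f (t + c *\<^sub>R x)"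
proof -
  have 1: "pderiv i (\<lambda>x. f (t + c *\<^sub>R x)) = (\<lambda>x. of_real c * pderiv i f (t + c *\<^sub>R x))"
    if "smooth f" for i f
    using pderiv_affine smooth_differentiable[OF that] by (auto intro!: ext)
  show "pderiv i (\<lambda>x. f (t + c *\<^sub>R x)) = (\<lambda>x. of_real c * pderiv i f (t + c *\<^sub>R x))"
    by (rule 1[OF assms])
  have d: "(\<lambda>x. pderiv i f (t + c *\<^sub>R x)) differentiable (at x)" for i
    using has_derivative_affine_arg[OF smooth_differentiable[OF smooth_pderiv[OF assms]]]
    by (blast intro: differentiableI)
  have "pderiv i (pderiv i (\<lambda>x. f (t + c *\<^sub>R x))) x
      = of_real (c\<^sup>2) * pderiv i (pderiv i f) (t + c *\<^sub>R x)" for i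
    unfolding 1[OF assms] pderiv_cmult[OF d] 1[OF smooth_pderiv[OF assms]]
    by (simp add: power2_eq_square)
  then show "laplacian (\<lambda>x. f (t + c *\<^sub>R x)) x = of_real (c\<^sup>2) * laplacian f (t + c *\<^sub>R x)"
    by (simp add: laplacian_def sum_distrib_left)
qed

lemma smooth_measurable: "smooth f \<Longrightarrow> f \<in> borel_measurable borel"
  using smooth_continuous borel_measurable_continuous_onI by blast

text \<open>Lets complex conjugation pass through mollifications by the derivatives of a real
  mollifier.\<close>

lemma pderiv_real:
  assumes "\<And>x. f x \<in> \<real>" "f differentiable (at x)" shows "pderiv i f x \<in> \<real>"
proof -
  have "((\<lambda>x. Im (f x)) has_derivative (\<lambda>h. Im (frechet_derivative f (at x) h))) (at x)"
    using assms(2) frechet_derivative_works has_derivative_Im by blast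
  moreover have "(\<lambda>x. Im (f x)) = (\<lambda>x. 0)" using assms(1) by (auto simp: complex_is_Real_iff)
  ultimately have "((\<lambda>x. 0) has_derivative (\<lambda>h. Im (frechet_derivative f (at x) h))) (at x)"
    by simp
  from has_derivative_unique[OF this has_derivative_const]
  have "(\<lambda>h. Im (frechet_derivative f (at x) h)) = (\<lambda>h. 0)" .
  then show ?thesis by (metis complex_is_Real_iff pderiv_def)
qed

section \<open>Compact support, changes of variable and integration by parts\<close>

lemma compact_support_bounded:
  fixes f :: "real ^ 2 \<Rightarrow> 'b::real_normed_vector"
  assumes "continuous_on UNIV f" "\<And>x. R < norm x \<Longrightarrow> f x = 0"
  obtains B where "0 < B" "\<And>x. norm (f x) \<le> B" "\<And>x. norm (f x) \<le> B * indicator (cball 0 R) x"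
proof -
  have "compact (f ` cball 0 R)"
    by (rule compact_continuous_image) (use assms(1) continuous_on_subset in auto)
  then obtain B where B: "\<forall>y\<in>f ` cball 0 R. norm y \<le> B" using compact_imp_bounded bounded_iff by blast
  have "norm (f x) \<le> max B 1 * indicator (cball 0 R) x" for x
    using B assms(2)[of x] by (cases "norm x \<le> R") (auto simp: indicator_def le_max_iff_disj)
  moreover have "norm (f x) \<le> max B 1" for x
    using B assms(2)[of x] by (cases "norm x \<le> R") (auto simp: indicator_def le_max_iff_disj)
  ultimately show ?thesis by (intro that[of "max B 1"]) auto
qed

lemma integrable_cball_indicator:
  "integrable lborel (\<lambda>x::real ^ 2. B * indicator (cball 0 R) x :: real)"
  by (intro integrable_mult_right integrable_real_indicator) (use emeasure_bounded_finite[of "cball 0 R"] in auto)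

lemma compact_support_integrable:
  fixes f :: "real ^ 2 \<Rightarrow> 'b::{banach, second_countable_topology}"
  assumes "continuous_on UNIV f" "\<And>x. R < norm x \<Longrightarrow> f x = 0"
  shows "integrable lborel f"
proof -
  obtain B where B: "0 < B" "\<And>x. norm (f x) \<le> B * indicator (cball 0 R) x"
    using compact_support_bounded[OF assms] by metis
  have "f \<in> borel_measurable lborel" using assms(1) borel_measurable_continuous_onI by auto
  then show ?thesis
    by (rule Bochner_Integration.integrable_bound[OF integrable_cball_indicator[of B R]])
       (use B in \<open>auto simp: abs_mult intro: order_trans[OF B(2)]\<close>)
qed

lemma lborel_integral_affine:
  fixes f :: "'a::euclidean_space \<Rightarrow> 'b::{banach, second_countable_topology}"
  assumes "c \<noteq> 0" "f \<in> borel_measurable borel"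
  shows "(\<integral>x. f (t + c *\<^sub>R x) \<partial>lborel) = (1 / \<bar>c\<bar> ^ DIM('a)) *\<^sub>R (\<integral>x. f x \<partial>lborel)"
    and "integrable lborel (\<lambda>x. f (t + c *\<^sub>R x)) \<longleftrightarrow> integrable lborel f"
proof -
  note [measurable] = assms(2)
  let ?D = "distr lborel borel (\<lambda>x. t + c *\<^sub>R x) :: 'a measure"
  have L: "(lborel :: 'a measure) = density ?D (\<lambda>_. ennreal (\<bar>c\<bar> ^ DIM('a)))"
    using lborel_affine[OF assms(1), of t] by (simp add: ennreal_power)
  have m: "f \<in> borel_measurable ?D" by simp
  have "(\<integral>x. f x \<partial>lborel) = (\<integral>x. \<bar>c\<bar> ^ DIM('a) *\<^sub>R f x \<partial>?D)"
    by (subst L) (rule integral_density, auto)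
  also have "\<dots> = \<bar>c\<bar> ^ DIM('a) *\<^sub>R (\<integral>x. f (t + c *\<^sub>R x) \<partial>lborel)"
    by (subst integral_distr) auto
  finally show "(\<integral>x. f (t + c *\<^sub>R x) \<partial>lborel) = (1 / \<bar>c\<bar> ^ DIM('a)) *\<^sub>R (\<integral>x. f x \<partial>lborel)"
    using assms(1) by simp
  have "integrable lborel f \<longleftrightarrow> integrable ?D (\<lambda>x. \<bar>c\<bar> ^ DIM('a) *\<^sub>R f x)"
    by (subst L) (rule integrable_density, auto)
  also have "\<dots> \<longleftrightarrow> integrable ?D f"
    using assms(1) integrable_scaleR_right[of "1 / \<bar>c\<bar> ^ DIM('a)" ?D "\<lambda>x. \<bar>c\<bar> ^ DIM('a) *\<^sub>R f x"] by auto
  also have "\<dots> \<longleftrightarrow> integrable lborel (\<lambda>x. f (t + c *\<^sub>R x))"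
    by (rule integrable_distr_eq) auto
  finally show "integrable lborel (\<lambda>x. f (t + c *\<^sub>R x)) \<longleftrightarrow> integrable lborel f" ..
qed

lemma lborel_integral_shift:
  fixes f :: "'a::euclidean_space \<Rightarrow> 'b::{banach, second_countable_topology}"
  assumes "f \<in> borel_measurable borel"
  shows "(\<integral>x. f (x + t) \<partial>lborel) = (\<integral>x. f x \<partial>lborel)"
    and "integrable lborel (\<lambda>x. f (x + t)) \<longleftrightarrow> integrable lborel f"
  using lborel_integral_affine[OF _ assms, of 1 t] by (simp_all add: add.commute)

lemma vector_derivative_quotient:
  assumes "(g has_vector_derivative D) (at 0)"
  shows "((\<lambda>h. (1 / h) *\<^sub>R (g h - g 0)) \<longlongrightarrow> D) (at 0)"
proof -
  have "((\<lambda>h. norm (g h - g 0 - h *\<^sub>R D) / norm h) \<longlongrightarrow> 0) (at 0)"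
    using assms by (simp add: has_vector_derivative_def has_derivative_at)
  moreover have "\<forall>\<^sub>F h in at 0. norm (g h - g 0 - h *\<^sub>R D) / norm h = norm ((1 / h) *\<^sub>R (g h - g 0) - D)"
    unfolding eventually_at_filter
  proof (intro always_eventually allI impI)
    fix h :: real assume "h \<noteq> 0"
    then have "(1 / h) *\<^sub>R (g h - g 0) - D = (1 / h) *\<^sub>R (g h - g 0 - h *\<^sub>R D)"
      by (simp add: scaleR_diff_right)
    then show "norm (g h - g 0 - h *\<^sub>R D) / norm h = norm ((1 / h) *\<^sub>R (g h - g 0) - D)"
      by (simp add: divide_inverse mult.commute)
  qed
  ultimately have "((\<lambda>h. norm ((1 / h) *\<^sub>R (g h - g 0) - D)) \<longlongrightarrow> 0) (at 0)"
    by (simp add: tendsto_cong)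
  then show ?thesis using LIM_zero_cancel tendsto_norm_zero_iff by blast
qed

lemma pderiv_diff_bound:
  assumes d: "\<And>x. f differentiable (at x)" and B: "\<And>x. norm (pderiv i f x) \<le> B"
  shows "norm (f (x + h *\<^sub>R axis i 1) - f x) \<le> B * \<bar>h\<bar>"
proof -
  let ?g = "\<lambda>s. f (x + s *\<^sub>R axis i 1)"
  have "norm (?g h - ?g 0) \<le> B * norm (h - 0)"
  proof (rule differentiable_bound[of UNIV ?g "\<lambda>s k. k *\<^sub>R pderiv i f (x + s *\<^sub>R axis i 1)"])
    show "(?g has_derivative (\<lambda>k. k *\<^sub>R pderiv i f (x + s *\<^sub>R axis i 1))) (at s within UNIV)" for s
      using pderiv_has_vector_derivative[OF d] by (simp add: has_vector_derivative_def)
    show "onorm (\<lambda>k. k *\<^sub>R pderiv i f (x + s *\<^sub>R axis i 1)) \<le> B" for s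
      by (rule onorm_le) (simp add: mult.commute[of B] mult_left_mono B)
  qed auto
  then show ?thesis by simp
qed

text \<open>By translation invariance every difference quotient has integral 0. The quotients
  converge pointwise to the derivative, and the mean value inequality provides the domination needed
  to pass to the limit.\<close>

lemma integral_pderiv_eq_0:
  assumes d: "\<And>x. f differentiable (at x)" and c: "continuous_on UNIV (pderiv i f)"
    and s: "\<And>x. R < norm x \<Longrightarrow> f x = 0"
  shows "(\<integral>x. pderiv i f x \<partial>lborel) = 0"
proof -
  have cf: "continuous_on UNIV f"
    using d differentiable_imp_continuous_within continuous_at_imp_continuous_on by blast
  have [measurable]: "f \<in> borel_measurable borel" "pderiv i f \<in> borel_measurable borel"
    using cf c borel_measurable_continuous_onI by auto
  let ?e = "axis i 1 :: real ^ 2"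
  define r where "r n = 1 / real (Suc n)" for n
  have r: "0 < r n" "r n \<le> 1" for n by (auto simp: r_def)
  define D where "D n x = (1 / r n) *\<^sub>R (f (x + r n *\<^sub>R ?e) - f x)" for n x
  obtain B where B: "0 < B" "\<And>x. norm (pderiv i f x) \<le> B"
    using compact_support_bounded[OF c] pderiv_outside_support[of R f] s by metis
  have fi: "integrable lborel f" by (rule compact_support_integrable[OF cf s])
  have D0: "(\<integral>x. D n x \<partial>lborel) = 0" for n
    unfolding D_def using fi lborel_integral_shift[of f "r n *\<^sub>R ?e"] by simp
  have Dlim: "(\<lambda>n. D n x) \<longlonglongrightarrow> pderiv i f x" for x
  proof -
    have "((\<lambda>s. f (x + s *\<^sub>R ?e)) has_vector_derivative pderiv i f x) (at 0)"
      using pderiv_has_vector_derivative[of f x 0 i] d by simp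
    then have "((\<lambda>h. (1 / h) *\<^sub>R (f (x + h *\<^sub>R ?e) - f x)) \<longlongrightarrow> pderiv i f x) (at 0)"
      using vector_derivative_quotient by fastforce
    moreover have "filterlim r (at 0) sequentially"
      unfolding r_def filterlim_at using LIMSEQ_inverse_real_of_nat by (auto simp: inverse_eq_divide)
    ultimately have "(\<lambda>n. (1 / r n) *\<^sub>R (f (x + r n *\<^sub>R ?e) - f x)) \<longlonglongrightarrow> pderiv i f x"
      by (rule filterlim_compose)
    then show ?thesis by (simp add: D_def)
  qed
  \<comment> \<open>A shift by \<open>r n \<le> 1\<close> enlarges the support by at most 1.\<close>
  have Dbd: "norm (D n x) \<le> B * indicator (cball 0 (R + 1)) x" for n x
  proof (cases "norm x \<le> R + 1")
    case True
    have "norm (f (x + r n *\<^sub>R ?e) - f x) \<le> B * r n"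
      using pderiv_diff_bound[OF d B(2), of x "r n"] r(1)[of n] by simp
    then show ?thesis using True r(1)[of n] by (simp add: D_def pos_divide_le_eq del: scaleR_diff_right scaleR_right_diff_distrib)
  next
    case False
    have "norm x \<le> norm (x + r n *\<^sub>R ?e) + norm (r n *\<^sub>R ?e)"
      by (metis add_diff_cancel norm_triangle_ineq4)
    then have "R < norm (x + r n *\<^sub>R ?e)" using False r[of n] by simp
    then show ?thesis using False s r[of n] by (simp add: D_def)
  qed
  have "(\<lambda>n. \<integral>x. D n x \<partial>lborel) \<longlonglongrightarrow> (\<integral>x. pderiv i f x \<partial>lborel)"
    by (rule integral_dominated_convergence[OF _ _ integrable_cball_indicator[of B "R + 1"]])
       (use Dlim Dbd in \<open>auto simp: D_def\<close>)
  then show ?thesis unfolding D0 by (simp add: LIMSEQ_const_iff)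
qed

lemma pderiv_mult:
  "f differentiable (at x) \<Longrightarrow> g differentiable (at x) \<Longrightarrow>
    pderiv i (\<lambda>x. f x * g x) x = f x * pderiv i g x + pderiv i f x * g x"
  by (subst pderivI[OF has_derivative_mult]) (auto simp: frechet_derivative_works pderiv_def)

text \<open>Compact support is asked of one factor only, so that the other one can be the heat
  kernel.\<close>

lemma integral_by_parts:
  assumes "test_fun f" and g: "\<And>x. g differentiable (at x)" "continuous_on UNIV (pderiv i g)"
  shows "(\<integral>x. g x * pderiv i f x \<partial>lborel) = - (\<integral>x. pderiv i g x * f x \<partial>lborel)"
proof -
  obtain R where R: "\<And>x. R < norm x \<Longrightarrow> f x = 0" using assms test_fun_support by metis
  have R': "\<And>x. R < norm x \<Longrightarrow> pderiv i f x = 0" using R pderiv_outside_support by blast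
  have cg: "continuous_on UNIV g"
    using g differentiable_imp_continuous_within continuous_at_imp_continuous_on by blast
  have f: "f differentiable (at x)" "continuous_on UNIV f" "continuous_on UNIV (pderiv i f)" for x
    using assms(1) by (auto simp: test_fun_smooth test_fun_pderiv smooth_differentiable smooth_continuous)
  have p: "pderiv i (\<lambda>x. g x * f x) = (\<lambda>x. g x * pderiv i f x + pderiv i g x * f x)"
    using pderiv_mult f g by (auto intro!: ext)
  have "(\<integral>x. pderiv i (\<lambda>x. g x * f x) x \<partial>lborel) = 0"
    using R by (intro integral_pderiv_eq_0[where R = R]) (auto simp: p intro!: continuous_intros f g cg differentiable_mult)
  moreover have "integrable lborel (\<lambda>x. g x * pderiv i f x)" "integrable lborel (\<lambda>x. pderiv i g x * f x)"
    using R R' by (auto intro!: compact_support_integrable[where R = R] continuous_intros f g cg)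
  ultimately show ?thesis by (simp add: p add_eq_0_iff)
qed

section \<open>Smooth bump functions\<close>

definition flat_exp :: "nat \<Rightarrow> real \<Rightarrow> real" where
  "flat_exp n t = (if t \<le> 0 then 0 else exp (- (1 / t)) / t ^ n)"

lemma flat_exp_tendsto_0: "((flat_exp n) \<longlongrightarrow> 0) (at_right 0)"
proof -
  have "((\<lambda>t::real. inverse t ^ n / exp (inverse t)) \<longlongrightarrow> 0) (at_right 0)"
    using filterlim_compose[OF tendsto_power_div_exp_0 filterlim_inverse_at_top_right] by simp
  moreover have "\<forall>\<^sub>F t in at_right 0. inverse t ^ n / exp (inverse t) = flat_exp n t"
    unfolding eventually_at_filter
    by (intro always_eventually) (auto simp: flat_exp_def exp_minus field_simps power_inverse)
  ultimately show ?thesis using tendsto_cong by force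
qed

text \<open>The classical function exp(-1/t), flat at 0, is taken together with its quotients by
  powers of t: this family is closed under differentiation up to linear combinations. At 0 the right
  difference quotient of \<open>flat_exp n\<close> is \<open>flat_exp (n + 1)\<close>, which tends
  to 0.\<close>

lemma flat_exp_deriv: "(flat_exp n has_real_derivative flat_exp (n + 2) t - real n * flat_exp (n + 1) t) (at t)"
proof (cases t "0 :: real" rule: linorder_cases)
  case less
  have "(flat_exp n has_real_derivative 0) (at t)"
    by (rule has_field_derivative_transform_within_open[where f = "\<lambda>_. 0" and S = "{..<0}"])
       (use less in \<open>auto simp: flat_exp_def\<close>)
  then show ?thesis using less by (simp add: flat_exp_def)
next
  case equal
  have "((\<lambda>h. flat_exp n h / h) \<longlongrightarrow> 0) (at_right 0)"
    by (rule Lim_transform_eventually[OF flat_exp_tendsto_0[of "n + 1"]])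
       (auto simp: eventually_at_filter flat_exp_def)
  moreover have "((\<lambda>h. flat_exp n h / h) \<longlongrightarrow> 0) (at_left 0)"
    by (rule tendsto_eventually) (auto simp: eventually_at_filter flat_exp_def)
  ultimately have "(\<lambda>h. flat_exp n h / h) \<midarrow>0\<rightarrow> 0" by (simp add: filterlim_at_split)
  then have "(flat_exp n has_real_derivative 0) (at 0)"
    by (simp add: DERIV_def flat_exp_def[of n 0])
  then show ?thesis using equal by (simp add: flat_exp_def)
next
  case greater
  have "((\<lambda>t. exp (- inverse t) * inverse t ^ n) has_real_derivative
      exp (- inverse t) * (inverse t * inverse t) * inverse t ^ n
      - real n * inverse t ^ (n - 1) * (inverse t * inverse t) * exp (- inverse t)) (at t)"
    using greater by (auto intro!: derivative_eq_intros)
  also have "exp (- inverse t) * (inverse t * inverse t) * inverse t ^ n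
      - real n * inverse t ^ (n - 1) * (inverse t * inverse t) * exp (- inverse t)
      = flat_exp (n + 2) t - real n * flat_exp (n + 1) t"
    using greater by (cases n) (simp_all add: flat_exp_def divide_inverse power_inverse mult_ac)
  finally have "((\<lambda>t. exp (- inverse t) * inverse t ^ n) has_real_derivative
      flat_exp (n + 2) t - real n * flat_exp (n + 1) t) (at t)" .
  then show ?thesis
    by (rule has_field_derivative_transform_within_open[where S = "{0<..}"])
       (use greater in \<open>auto simp: flat_exp_def divide_inverse power_inverse\<close>)
qed

text \<open>Smoothness is proved for a whole algebra containing the bumps: it is stable under
  directional derivatives, so \<open>Ck k\<close> follows for all members at once by induction on
  \<open>k\<close>.\<close>

inductive flat_exp_algebra :: "fn \<Rightarrow> bool" where
  flat_exp_algebra_flat_exp: "flat_exp_algebra (\<lambda>x. of_real (flat_exp n (b + a \<bullet> x)))"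
| flat_exp_algebra_const: "flat_exp_algebra (\<lambda>x. c)"
| flat_exp_algebra_add: "flat_exp_algebra f \<Longrightarrow> flat_exp_algebra g \<Longrightarrow> flat_exp_algebra (\<lambda>x. f x + g x)"
| flat_exp_algebra_mult: "flat_exp_algebra f \<Longrightarrow> flat_exp_algebra g \<Longrightarrow> flat_exp_algebra (\<lambda>x. f x * g x)"

lemma flat_exp_algebra_deriv:
  assumes "flat_exp_algebra f"
  shows "\<exists>f'. (\<forall>x. (f has_derivative f' x) (at x)) \<and> (\<forall>v. flat_exp_algebra (\<lambda>x. f' x v))"
  using assms
proof induction
  case (flat_exp_algebra_flat_exp n b a)
  let ?d = "\<lambda>t. flat_exp (n + 2) t - real n * flat_exp (n + 1) t"
  have "((\<lambda>x. complex_of_real (flat_exp n (b + a \<bullet> x))) has_derivative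
      (\<lambda>v. of_real (?d (b + a \<bullet> x) * (a \<bullet> v)))) (at x)" for x
  proof -
    have "(flat_exp n has_derivative (*) (?d (b + a \<bullet> x))) (at (b + a \<bullet> x))"
      using flat_exp_deriv has_field_derivative_def by blast
    moreover have "((\<lambda>x. b + a \<bullet> x) has_derivative (\<lambda>v. a \<bullet> v)) (at x)"
      by (auto intro!: derivative_eq_intros)
    ultimately show ?thesis
      using has_derivative_compose has_derivative_of_real by blast
  qed
  moreover have "flat_exp_algebra (\<lambda>x. of_real (?d (b + a \<bullet> x) * (a \<bullet> v)))" for v
  proof -
    have "flat_exp_algebra (\<lambda>x. of_real (a \<bullet> v) * (of_real (flat_exp (n + 2) (b + a \<bullet> x)) + (- of_real (real n)) * of_real (flat_exp (n + 1) (b + a \<bullet> x))))"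
      by (intro flat_exp_algebra.intros)
    then show ?thesis by (simp add: mult.commute)
  qed
  ultimately show ?case
    by (intro exI[of _ "\<lambda>x v. of_real (?d (b + a \<bullet> x) * (a \<bullet> v))"]) auto
next
  case (flat_exp_algebra_const c)
  show ?case by (rule exI[of _ "\<lambda>_ _. 0"]) (auto intro: flat_exp_algebra.intros)
next
  case (flat_exp_algebra_add f g)
  then obtain f' g' where "\<forall>x. (f has_derivative f' x) (at x)" "\<forall>v. flat_exp_algebra (\<lambda>x. f' x v)"
    "\<forall>x. (g has_derivative g' x) (at x)" "\<forall>v. flat_exp_algebra (\<lambda>x. g' x v)" by blast
  then show ?case
    by (intro exI[of _ "\<lambda>x v. f' x v + g' x v"]) (auto intro: flat_exp_algebra.intros has_derivative_add)
next
  case (flat_exp_algebra_mult f g)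
  then obtain f' g' where "\<forall>x. (f has_derivative f' x) (at x)" "\<forall>v. flat_exp_algebra (\<lambda>x. f' x v)"
    "\<forall>x. (g has_derivative g' x) (at x)" "\<forall>v. flat_exp_algebra (\<lambda>x. g' x v)" by blast
  moreover from this flat_exp_algebra_mult.hyps have "flat_exp_algebra (\<lambda>x. f x * g' x v + f' x v * g x)" for v
    by (intro flat_exp_algebra.flat_exp_algebra_add flat_exp_algebra.flat_exp_algebra_mult) auto
  ultimately show ?case
    by (intro exI[of _ "\<lambda>x v. f x * g' x v + f' x v * g x"] conjI allI has_derivative_mult) blast+
qed

lemma flat_exp_algebra_smooth: "flat_exp_algebra f \<Longrightarrow> smooth f"
proof -
  have "Ck k f" if "flat_exp_algebra f" for k
    using that
  proof (induction k arbitrary: f)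
    case (0 f)
    then obtain f' where "\<forall>x. (f has_derivative f' x) (at x)" using flat_exp_algebra_deriv by blast
    then have "\<forall>x\<in>UNIV. isCont f x" using has_derivative_continuous by blast
    then show ?case by (simp add: continuous_at_imp_continuous_on)
  next
    case (Suc k f)
    then obtain f' where f': "\<forall>x. (f has_derivative f' x) (at x)" "\<forall>v. flat_exp_algebra (\<lambda>x. f' x v)"
      using flat_exp_algebra_deriv by blast
    then have "pderiv i f = (\<lambda>x. f' x (axis i 1))" for i using pderivI by (auto intro!: ext)
    with f' Suc.IH show ?case by (auto intro: differentiableI)
  qed
  then show "flat_exp_algebra f \<Longrightarrow> smooth f" by (simp add: smooth_def)
qed

text \<open>A product of one-dimensional cut-offs that is positive exactly on the open box. The
  parameter \<open>c\<close> sharpens it, since exp(-1/(ct)) tends to 1 as \<open>c\<close>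
  grows.\<close>

definition bump :: "real \<Rightarrow> real ^ 2 \<Rightarrow> real ^ 2 \<Rightarrow> real ^ 2 \<Rightarrow> real" where
  "bump c a b x = (\<Prod>i\<in>UNIV. flat_exp 0 (c * (x $ i - a $ i)) * flat_exp 0 (c * (b $ i - x $ i)))"

lemma bump_props:
  assumes "0 < c"
  shows "0 \<le> bump c a b x" "bump c a b x \<le> 1" "x \<notin> box a b \<Longrightarrow> bump c a b x = 0"
    "x \<in> box a b \<Longrightarrow> 0 < bump c a b x"
proof -
  have e: "0 \<le> flat_exp 0 t" "flat_exp 0 t \<le> 1" for t by (auto simp: flat_exp_def)
  show "0 \<le> bump c a b x" unfolding bump_def by (intro prod_nonneg) (auto simp: e)
  show "bump c a b x \<le> 1" unfolding bump_def by (intro prod_le_1) (auto simp: e mult_le_one)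
  show "bump c a b x = 0" if "x \<notin> box a b"
  proof -
    obtain i where "x $ i \<le> a $ i \<or> b $ i \<le> x $ i"
      using \<open>x \<notin> box a b\<close> by (auto simp: mem_box_cart not_less)
    then have "c * (x $ i - a $ i) \<le> 0 \<or> c * (b $ i - x $ i) \<le> 0"
      using assms by (simp add: mult_le_0_iff)
    then have "flat_exp 0 (c * (x $ i - a $ i)) * flat_exp 0 (c * (b $ i - x $ i)) = 0"
      unfolding flat_exp_def by auto
    then show ?thesis unfolding bump_def by (intro prod_zero) auto
  qed
  show "0 < bump c a b x" if "x \<in> box a b"
    unfolding bump_def using that assms
    by (intro prod_pos) (auto simp: mem_box_cart flat_exp_def not_le intro!: mult_pos_pos)
qed

lemma test_fun_bump:
  assumes "0 < c" shows "test_fun (\<lambda>x. of_real (bump c a b x))"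
proof -
  have "flat_exp_algebra (\<lambda>x. of_real (flat_exp 0 (c * (x $ i - a $ i))))" for i
    using flat_exp_algebra_flat_exp[of 0 "- c * a $ i" "c *\<^sub>R axis i 1"]
    by (simp add: inner_axis' algebra_simps)
  moreover have "flat_exp_algebra (\<lambda>x. of_real (flat_exp 0 (c * (b $ i - x $ i))))" for i
    using flat_exp_algebra_flat_exp[of 0 "c * b $ i" "- c *\<^sub>R axis i 1"]
    by (simp add: inner_axis' algebra_simps)
  ultimately have "flat_exp_algebra (\<lambda>x. of_real (bump c a b x))"
    unfolding bump_def UNIV_2 by (simp add: flat_exp_algebra_mult)
  moreover obtain R where "\<forall>x\<in>box a b. norm x \<le> R" using bounded_box bounded_iff by blast
  then have "\<forall>x. R < norm x \<longrightarrow> complex_of_real (bump c a b x) = 0"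
    using bump_props(3)[OF assms] by force
  ultimately show ?thesis by (simp only: bounded_support flat_exp_algebra_smooth) metis
qed

lemma bump_tendsto_indicator: "(\<lambda>n. bump (real (Suc n)) a b x) \<longlonglongrightarrow> indicator (box a b) x"
proof (cases "x \<in> box a b")
  case True
  have e: "(\<lambda>n. flat_exp 0 (real (Suc n) * t)) \<longlonglongrightarrow> 1" if "0 < t" for t
  proof -
    have "(\<lambda>n. exp (- (1 / t * inverse (real (Suc n))))) \<longlonglongrightarrow> exp (- (1 / t * 0))"
      by (intro tendsto_intros LIMSEQ_inverse_real_of_nat)
    moreover have "flat_exp 0 (real (Suc n) * t) = exp (- (1 / t * inverse (real (Suc n))))" for n
    proof -
      have "\<not> real (Suc n) * t \<le> 0" using that by (simp add: not_le)
      then show ?thesis unfolding flat_exp_def by (simp add: divide_inverse)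
    qed
    ultimately show ?thesis by simp
  qed
  have "(\<lambda>n. bump (real (Suc n)) a b x) \<longlonglongrightarrow> (\<Prod>i::2\<in>UNIV. 1 * 1)"
    unfolding bump_def by (intro tendsto_prod tendsto_mult e) (use True in \<open>auto simp: mem_box_cart\<close>)
  then show ?thesis using True by (simp only: indicator_simps prod.neutral_const mult_1)
next
  case False
  then have "bump (real (Suc n)) a b x = 0" for n by (intro bump_props(3)) auto
  with False show ?thesis by simp
qed

section \<open>Square-integrable functions\<close>

abbreviation sq :: "fn \<Rightarrow> real" where
  "sq f \<equiv> \<integral>x. (norm (f x))\<^sup>2 \<partial>lborel"

lemma Lp_2_iff: "f \<in> Lp 2 \<longleftrightarrow> f \<in> borel_measurable borel \<and> integrable lborel (\<lambda>x. (norm (f x))\<^sup>2)"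
  unfolding Lp_def by simp

lemma Lp_2_measurable: "f \<in> Lp 2 \<Longrightarrow> f \<in> borel_measurable borel"
  by (simp add: Lp_2_iff)

lemma sq_nonneg: "0 \<le> sq f"
  by simp

lemma Lp_norm_2: "(Lp_norm 2 f)\<^sup>2 = sq f"
  unfolding Lp_norm_def by (simp add: powr_half_sqrt)

lemma ennreal_sq: "f \<in> Lp 2 \<Longrightarrow> (\<integral>\<^sup>+x. ennreal ((norm (f x))\<^sup>2) \<partial>lborel) = ennreal (sq f)"
  by (simp add: Lp_2_iff nn_integral_eq_integral)

lemma Lp_2_bound:
  assumes "f \<in> borel_measurable borel" "(\<integral>\<^sup>+x. ennreal ((norm (f x))\<^sup>2) \<partial>lborel) \<le> ennreal B" "0 \<le> B"
  shows "f \<in> Lp 2" "sq f \<le> B"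
proof -
  note [measurable] = assms(1)
  have "(\<integral>\<^sup>+x. ennreal ((norm (f x))\<^sup>2) \<partial>lborel) < \<infinity>"
    using assms(2) by (metis ennreal_less_top infinity_ennreal_def order_le_less_trans)
  then show "f \<in> Lp 2"
    unfolding Lp_2_iff by (auto intro!: integrableI_bounded)
  then show "sq f \<le> B" using ennreal_sq assms by simp
qed

lemma norm_add_sq_le: "(norm (a + b :: complex))\<^sup>2 \<le> 2 * (norm a)\<^sup>2 + 2 * (norm b)\<^sup>2"
proof -
  have "(norm (a + b))\<^sup>2 \<le> (norm a + norm b)\<^sup>2" by (intro power_mono norm_triangle_ineq) auto
  also have "\<dots> \<le> 2 * (norm a)\<^sup>2 + 2 * (norm b)\<^sup>2"
    using zero_le_power2[of "norm a - norm b"] by (simp add: power2_eq_square algebra_simps)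
  finally show ?thesis .
qed

lemma Lp_2_add:
  assumes "f \<in> Lp 2" "g \<in> Lp 2"
  shows "(\<lambda>x. f x + g x) \<in> Lp 2" "sq (\<lambda>x. f x + g x) \<le> 2 * sq f + 2 * sq g"
proof -
  have [measurable]: "f \<in> borel_measurable borel" "g \<in> borel_measurable borel"
    using assms Lp_2_measurable by auto
  have i: "integrable lborel (\<lambda>x. 2 * (norm (f x))\<^sup>2 + 2 * (norm (g x))\<^sup>2)"
    using assms by (auto simp: Lp_2_iff)
  then show 1: "(\<lambda>x. f x + g x) \<in> Lp 2"
    unfolding Lp_2_iff using norm_add_sq_le
    by (auto intro!: Bochner_Integration.integrable_bound[OF i])
  have "sq (\<lambda>x. f x + g x) \<le> (\<integral>x. 2 * (norm (f x))\<^sup>2 + 2 * (norm (g x))\<^sup>2 \<partial>lborel)"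
    using 1 i norm_add_sq_le unfolding Lp_2_iff by (intro integral_mono) auto
  then show "sq (\<lambda>x. f x + g x) \<le> 2 * sq f + 2 * sq g"
    using assms by (simp add: Lp_2_iff)
qed

lemma Lp_2_cmult:
  assumes "f \<in> Lp 2" shows "(\<lambda>x. c * f x) \<in> Lp 2" "sq (\<lambda>x. c * f x) = (norm c)\<^sup>2 * sq f"
  using assms by (auto simp: Lp_2_iff norm_mult power_mult_distrib)

lemma Lp_2_diff:
  assumes "f \<in> Lp 2" "g \<in> Lp 2"
  shows "(\<lambda>x. f x - g x) \<in> Lp 2" "sq (\<lambda>x. f x - g x) \<le> 2 * sq f + 2 * sq g"
  using Lp_2_add[OF assms(1) Lp_2_cmult(1)[OF assms(2), of "-1"]] Lp_2_cmult(2)[OF assms(2), of "-1"]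
  by simp_all

lemma Lp_2_cnj: "f \<in> Lp 2 \<Longrightarrow> (\<lambda>x. cnj (f x)) \<in> Lp 2"
  unfolding Lp_2_iff
  by (auto intro: borel_measurable_continuous_on[where f = cnj] continuous_intros)

lemma Lp_2_zero: "(\<lambda>x. 0) \<in> Lp 2"
  by (simp add: Lp_2_iff)

lemma Lp_2_shift:
  assumes "f \<in> Lp 2" shows "(\<lambda>x. f (x + t)) \<in> Lp 2" "sq (\<lambda>x. f (x + t)) = sq f"
proof -
  have [measurable]: "f \<in> borel_measurable borel" using assms Lp_2_measurable by auto
  show "(\<lambda>x. f (x + t)) \<in> Lp 2"
    using assms lborel_integral_shift(2)[of "\<lambda>x. (norm (f x))\<^sup>2" t] by (simp add: Lp_2_iff)
  show "sq (\<lambda>x. f (x + t)) = sq f"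
    using lborel_integral_shift(1)[of "\<lambda>x. (norm (f x))\<^sup>2" t] by simp
qed

lemma Lp_2_cong_AE:
  assumes "f \<in> Lp 2" "g \<in> borel_measurable borel" "AE x in lborel. f x = g x"
  shows "g \<in> Lp 2" "sq g = sq f"
proof -
  have [measurable]: "f \<in> borel_measurable borel" using assms Lp_2_measurable by auto
  have ae: "AE x in lborel. (norm (f x))\<^sup>2 = (norm (g x))\<^sup>2" using assms(3) by eventually_elim simp
  show "sq g = sq f" using ae by (intro integral_cong_AE) (use assms(2) in auto)
  show "g \<in> Lp 2"
    using assms ae integrable_cong_AE[OF _ _ ae] by (auto simp: Lp_2_iff)
qed

lemma test_fun_Lp_2: "test_fun f \<Longrightarrow> f \<in> Lp 2"
proof -
  assume f: "test_fun f"
  then obtain R where R: "\<And>x. R < norm x \<Longrightarrow> f x = 0" using test_fun_support by metis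
  have c: "continuous_on UNIV f" using f test_fun_smooth smooth_continuous by blast
  then have "integrable lborel (\<lambda>x. (norm (f x))\<^sup>2)"
    using R by (intro compact_support_integrable[where R = R]) (auto intro!: continuous_intros)
  then show "f \<in> Lp 2" using c borel_measurable_continuous_onI by (auto simp: Lp_2_iff)
qed

lemma test_fun_integrable: "test_fun f \<Longrightarrow> integrable lborel f"
  using test_fun_support test_fun_smooth smooth_continuous compact_support_integrable by metis

lemma Lp_2_mult_integrable:
  assumes "f \<in> Lp 2" "g \<in> Lp 2"
  shows "integrable lborel (\<lambda>x. f x * g x)" "integrable lborel (\<lambda>x. norm (f x) * norm (g x))"
proof -
  have [measurable]: "f \<in> borel_measurable borel" "g \<in> borel_measurable borel"
    using assms Lp_2_measurable by auto
  have i: "integrable lborel (\<lambda>x. (norm (f x))\<^sup>2 + (norm (g x))\<^sup>2)"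
    using assms by (auto simp: Lp_2_iff)
  have b: "norm (f x) * norm (g x) \<le> (norm (f x))\<^sup>2 + (norm (g x))\<^sup>2" for x
  proof -
    have "0 \<le> norm (f x) * norm (g x)" by simp
    moreover have "0 \<le> (norm (f x) - norm (g x))\<^sup>2" by simp
    ultimately show ?thesis unfolding power2_diff by linarith
  qed
  show "integrable lborel (\<lambda>x. f x * g x)" "integrable lborel (\<lambda>x. norm (f x) * norm (g x))"
    using b by (auto intro!: Bochner_Integration.integrable_bound[OF i] simp: norm_mult)
qed

lemma Cauchy_Schwarz_Lp_2:
  assumes "f \<in> Lp 2" "g \<in> Lp 2"
  shows "(\<integral>x. norm (f x) * norm (g x) \<partial>lborel)\<^sup>2 \<le> sq f * sq g"
    and "(norm (\<integral>x. f x * g x \<partial>lborel))\<^sup>2 \<le> sq f * sq g"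
proof -
  have [measurable]: "f \<in> borel_measurable borel" "g \<in> borel_measurable borel"
    using assms Lp_2_measurable by auto
  have "ennreal ((\<integral>x. norm (f x) * norm (g x) \<partial>lborel)\<^sup>2)
      = (\<integral>\<^sup>+x. ennreal (norm (f x)) * ennreal (norm (g x)) \<partial>lborel)\<^sup>2"
    using Lp_2_mult_integrable(2)[OF assms]
    by (simp add: ennreal_mult[symmetric] nn_integral_eq_integral ennreal_power)
  also have "\<dots> \<le> (\<integral>\<^sup>+x. (ennreal (norm (f x)))\<^sup>2 \<partial>lborel) * (\<integral>\<^sup>+x. (ennreal (norm (g x)))\<^sup>2 \<partial>lborel)"
    by (rule Cauchy_Schwarz_nn_integral) auto
  also have "\<dots> = ennreal (sq f * sq g)"
    using ennreal_sq[OF assms(1)] ennreal_sq[OF assms(2)] by (simp add: ennreal_power ennreal_mult)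
  finally show 1: "(\<integral>x. norm (f x) * norm (g x) \<partial>lborel)\<^sup>2 \<le> sq f * sq g"
    by simp
  have "norm (\<integral>x. f x * g x \<partial>lborel) \<le> (\<integral>x. norm (f x) * norm (g x) \<partial>lborel)"
    using integral_norm_bound[of lborel "\<lambda>x. f x * g x"] by (simp add: norm_mult)
  then have "(norm (\<integral>x. f x * g x \<partial>lborel))\<^sup>2 \<le> (\<integral>x. norm (f x) * norm (g x) \<partial>lborel)\<^sup>2"
    by (intro power_mono) auto
  also note 1
  finally show "(norm (\<integral>x. f x * g x \<partial>lborel))\<^sup>2 \<le> sq f * sq g" .
qed

text \<open>Minkowski's integral inequality for slices with a common L^2 bound, by Cauchy-Schwarz
  with weight |r| and Tonelli. The bound is asked for only where \<open>r\<close> does not vanish,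
  which lets a mollifier exploit its support and a time integral its restriction to t > 0.\<close>

lemma average_L2:
  fixes r :: "'b::euclidean_space \<Rightarrow> complex"
  assumes F [measurable]: "(\<lambda>(x, z). F x z) \<in> borel_measurable (lborel \<Otimes>\<^sub>M lborel)"
    and r: "integrable lborel r" and B: "0 \<le> B"
    and FB: "\<And>z. r z \<noteq> 0 \<Longrightarrow> (\<integral>\<^sup>+x. ennreal ((norm (F x z))\<^sup>2) \<partial>lborel) \<le> ennreal B"
  shows "(\<lambda>x. \<integral>z. r z * F x z \<partial>lborel) \<in> Lp 2"
    and "sq (\<lambda>x. \<integral>z. r z * F x z \<partial>lborel) \<le> (\<integral>z. norm (r z) \<partial>lborel)\<^sup>2 * B"
    and "AE x in lborel. integrable lborel (\<lambda>z. r z * F x z)"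
proof -
  have [measurable]: "r \<in> borel_measurable borel" using r by auto
  have [measurable]: "(\<lambda>p. F (fst p) (snd p)) \<in> borel_measurable (lborel \<Otimes>\<^sub>M lborel)"
    using F by (simp add: case_prod_unfold)
  define M where "M = (\<integral>z. norm (r z) \<partial>lborel)"
  have M0: "0 \<le> M" unfolding M_def by simp
  have Mr: "(\<integral>\<^sup>+z. ennreal (norm (r z)) \<partial>lborel) = ennreal M"
    unfolding M_def using r by (intro nn_integral_eq_integral) auto
  define N where "N x = (\<integral>\<^sup>+z. ennreal (norm (r z) * norm (F x z)) \<partial>lborel)" for x
  have [measurable]: "N \<in> borel_measurable lborel" unfolding N_def by measurable
  have cs: "(N x)\<^sup>2 \<le> ennreal M * (\<integral>\<^sup>+z. ennreal (norm (r z)) * ennreal ((norm (F x z))\<^sup>2) \<partial>lborel)" for x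
  proof -
    \<comment> \<open>The weight is split evenly between the two factors of Cauchy-Schwarz.\<close>
    let ?s = "\<lambda>z. ennreal (sqrt (norm (r z)))"
    have s: "?s z * ?s z = ennreal (norm (r z))" for z
      by (simp add: ennreal_mult[symmetric])
    have "N x = (\<integral>\<^sup>+z. ?s z * (?s z * ennreal (norm (F x z))) \<partial>lborel)"
      unfolding N_def using s by (simp add: mult.assoc[symmetric] ennreal_mult)
    then have "(N x)\<^sup>2 \<le> (\<integral>\<^sup>+z. (?s z)\<^sup>2 \<partial>lborel) * (\<integral>\<^sup>+z. (?s z * ennreal (norm (F x z)))\<^sup>2 \<partial>lborel)"
      by (simp only:) (rule Cauchy_Schwarz_nn_integral, measurable)
    also have "\<dots> = ennreal M * (\<integral>\<^sup>+z. ennreal (norm (r z)) * ennreal ((norm (F x z))\<^sup>2) \<partial>lborel)"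
      by (simp only: power_mult_distrib) (simp add: power2_eq_square s Mr ennreal_mult)
    finally show ?thesis .
  qed
  have "(\<integral>\<^sup>+x. (N x)\<^sup>2 \<partial>lborel)
      \<le> (\<integral>\<^sup>+x. ennreal M * (\<integral>\<^sup>+z. ennreal (norm (r z)) * ennreal ((norm (F x z))\<^sup>2) \<partial>lborel) \<partial>lborel)"
    by (intro nn_integral_mono cs)
  also have "\<dots> = ennreal M * (\<integral>\<^sup>+x. (\<integral>\<^sup>+z. ennreal (norm (r z)) * ennreal ((norm (F x z))\<^sup>2) \<partial>lborel) \<partial>lborel)"
    by (rule nn_integral_cmult) measurable
  also have "(\<integral>\<^sup>+x. (\<integral>\<^sup>+z. ennreal (norm (r z)) * ennreal ((norm (F x z))\<^sup>2) \<partial>lborel) \<partial>lborel)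
      = (\<integral>\<^sup>+z. (\<integral>\<^sup>+x. ennreal (norm (r z)) * ennreal ((norm (F x z))\<^sup>2) \<partial>lborel) \<partial>lborel)"
    by (rule lborel_pair.Fubini'[symmetric]) measurable
  also have "\<dots> \<le> (\<integral>\<^sup>+z. ennreal (norm (r z)) * ennreal B \<partial>lborel)"
  proof (rule nn_integral_mono)
    fix z
    have "(\<integral>\<^sup>+x. ennreal (norm (r z)) * ennreal ((norm (F x z))\<^sup>2) \<partial>lborel)
        = ennreal (norm (r z)) * (\<integral>\<^sup>+x. ennreal ((norm (F x z))\<^sup>2) \<partial>lborel)"
      by (rule nn_integral_cmult) measurable
    also have "\<dots> \<le> ennreal (norm (r z)) * ennreal B"
      using FB[of z] by (cases "r z = 0") (auto intro!: mult_left_mono)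
    finally show "(\<integral>\<^sup>+x. ennreal (norm (r z)) * ennreal ((norm (F x z))\<^sup>2) \<partial>lborel) \<le> ennreal (norm (r z)) * ennreal B" .
  qed
  also have "\<dots> = ennreal M * ennreal B"
    by (subst nn_integral_multc) (auto simp: Mr)
  finally have N2: "(\<integral>\<^sup>+x. (N x)\<^sup>2 \<partial>lborel) \<le> ennreal (M\<^sup>2 * B)"
    using M0 B by (simp add: mult_left_mono ennreal_mult[symmetric] power2_eq_square mult.assoc)
  then have "(\<integral>\<^sup>+x. (N x)\<^sup>2 \<partial>lborel) \<noteq> \<infinity>"
    by (metis ennreal_less_top infinity_ennreal_def order_le_less_trans less_irrefl)
  then have "AE x in lborel. (N x)\<^sup>2 \<noteq> \<infinity>" by (intro nn_integral_PInf_AE) auto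
  then have fin: "AE x in lborel. N x < \<infinity>"
    by eventually_elim (auto simp: power2_eq_square ennreal_mult_eq_top_iff less_top)
  then show "AE x in lborel. integrable lborel (\<lambda>z. r z * F x z)"
  proof eventually_elim
    case (elim x)
    then show ?case unfolding N_def by (intro integrableI_bounded) (auto simp: norm_mult)
  qed
  have m: "(\<lambda>x. \<integral>z. r z * F x z \<partial>lborel) \<in> borel_measurable lborel"
    by (rule lborel.borel_measurable_lebesgue_integral) measurable
  have le: "ennreal ((norm (\<integral>z. r z * F x z \<partial>lborel))\<^sup>2) \<le> (N x)\<^sup>2" for x
  proof (cases "integrable lborel (\<lambda>z. r z * F x z)")
    case True
    have "ennreal (norm (\<integral>z. r z * F x z \<partial>lborel)) \<le> N x"
      unfolding N_def using integral_norm_bound_ennreal[OF True] by (simp add: norm_mult)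
    then have "(ennreal (norm (\<integral>z. r z * F x z \<partial>lborel)))\<^sup>2 \<le> (N x)\<^sup>2" by (intro power_mono) auto
    then show ?thesis by (simp add: ennreal_power)
  qed (simp add: not_integrable_integral_eq)
  have "(\<integral>\<^sup>+x. ennreal ((norm (\<integral>z. r z * F x z \<partial>lborel))\<^sup>2) \<partial>lborel) \<le> ennreal (M\<^sup>2 * B)"
    using N2 le by (meson nn_integral_mono order_trans)
  then show "(\<lambda>x. \<integral>z. r z * F x z \<partial>lborel) \<in> Lp 2"
    "sq (\<lambda>x. \<integral>z. r z * F x z \<partial>lborel) \<le> (\<integral>z. norm (r z) \<partial>lborel)\<^sup>2 * B"
    using Lp_2_bound[of "\<lambda>x. \<integral>z. r z * F x z \<partial>lborel" "M\<^sup>2 * B"] m B unfolding M_def by auto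
qed

text \<open>The bumps are bounded by the indicator of the box and converge to it, so dominated
  convergence applies; \<open>g\<close> is integrable on a bounded box because it is square
  integrable.\<close>

lemma integral_box_eq_0:
  assumes g: "g \<in> Lp 2"
    and z: "\<And>\<psi>. test_fun \<psi> \<Longrightarrow> (\<And>x. \<psi> x \<in> \<real>) \<Longrightarrow> (\<integral>x. g x * \<psi> x \<partial>lborel) = 0"
  shows "(\<integral>x. indicator (box a b) x *\<^sub>R g x \<partial>lborel) = 0"
    and "integrable lborel (\<lambda>x. indicator (box a b) x *\<^sub>R g x)"
proof -
  have [measurable]: "g \<in> borel_measurable borel" using g Lp_2_measurable by auto
  have "(\<lambda>x. of_real (indicator (box a b) x)) \<in> Lp 2"
    unfolding Lp_2_iff using emeasure_bounded_finite[OF bounded_box, of a b]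
    by (auto intro!: integrable_real_indicator simp: power2_eq_square indicator_inter_arith[symmetric])
  from Lp_2_mult_integrable[OF this g]
  show i: "integrable lborel (\<lambda>x. indicator (box a b) x *\<^sub>R g x)"
    by (simp add: scaleR_conv_of_real)
  define c where "c n = real (Suc n)" for n
  have c: "0 < c n" for n by (simp add: c_def)
  let ?b = "\<lambda>n x. complex_of_real (bump (c n) a b x)"
  have [measurable]: "?b n \<in> borel_measurable borel" for n
    using test_fun_bump[of "c n" a b] test_fun_Lp_2 Lp_2_measurable c by auto
  have "(\<lambda>n. \<integral>x. g x * ?b n x \<partial>lborel) \<longlonglongrightarrow> (\<integral>x. g x * of_real (indicator (box a b) x) \<partial>lborel)"
  proof (rule integral_dominated_convergence)
    show "integrable lborel (\<lambda>x. norm (indicator (box a b) x *\<^sub>R g x))"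
      using i by (rule integrable_norm)
    show "AE x in lborel. (\<lambda>n. g x * ?b n x) \<longlonglongrightarrow> g x * of_real (indicator (box a b) x)"
      unfolding c_def by (intro AE_I2 tendsto_intros bump_tendsto_indicator)
    have "norm (g x * ?b n x) \<le> norm (indicator (box a b) x *\<^sub>R g x)" for n x
      using bump_props(1-3)[of "c n", where a = a and b = b and x = x]
      by (cases "x \<in> box a b") (auto simp: norm_mult c intro!: mult_left_le)
    then show "AE x in lborel. norm (g x * ?b n x) \<le> norm (indicator (box a b) x *\<^sub>R g x)" for n
      by simp
  qed auto
  moreover have "(\<integral>x. g x * ?b n x \<partial>lborel) = 0" for n
    using z test_fun_bump[of "c n"] by (simp add: c)
  ultimately have "(\<integral>x. g x * of_real (indicator (box a b) x) \<partial>lborel) = 0"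
    by (simp add: LIMSEQ_const_iff)
  then show "(\<integral>x. indicator (box a b) x *\<^sub>R g x \<partial>lborel) = 0"
    by (simp add: scaleR_conv_of_real mult.commute)
qed

text \<open>The fundamental lemma of the calculus of variations. The complex measure with density
  \<open>g\<close> on a large box vanishes on all boxes, hence on the sigma-algebra that they
  generate, since boxes are stable under intersection. The test functions are real because
  \<open>homogeneous_unique\<close> has to commute them with conjugation.\<close>

lemma weakly_zero_imp_AE_zero:
  assumes g: "g \<in> Lp 2"
    and z: "\<And>\<psi>. test_fun \<psi> \<Longrightarrow> (\<And>x. \<psi> x \<in> \<real>) \<Longrightarrow> (\<integral>x. g x * \<psi> x \<partial>lborel) = 0"
  shows "AE x in lborel. g x = 0"
proof -
  have [measurable]: "g \<in> borel_measurable borel" using g Lp_2_measurable by auto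
  \<comment> \<open>A square integrable function need not be integrable on the whole plane, hence
    the exhaustion by boxes.\<close>
  define W :: "nat \<Rightarrow> (real ^ 2) set" where "W n = box (- (real n *\<^sub>R One)) (real n *\<^sub>R One)" for n
  have [measurable]: "W n \<in> sets borel" for n unfolding W_def by simp
  have "AE x in lborel. indicator (W n) x *\<^sub>R g x = 0" for n
  proof (rule sigma_finite_measure.density_zero[OF sigma_finite_lborel])
    define h where "h = (\<lambda>x. indicator (W n) x *\<^sub>R g x)"
    have hi: "integrable lborel h" unfolding h_def W_def by (rule integral_box_eq_0[OF g z])
    have [measurable]: "h \<in> borel_measurable borel" using hi by auto
    have hA: "integrable lborel (\<lambda>x. indicator A x *\<^sub>R h x)" if "A \<in> sets borel" for A
      using hi that integrable_mult_indicator by (metis sets_lborel)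
    have h0: "(\<integral>x. h x \<partial>lborel) = 0" unfolding h_def W_def by (rule integral_box_eq_0[OF g z])
    fix A :: "(real ^ 2) set" assume "A \<in> sets lborel"
    then have A: "A \<in> sigma_sets UNIV (range (\<lambda>(a, b). box a b))"
      by (simp add: borel_eq_box)
    have "Int_stable (range (\<lambda>(a, b). box a b :: (real ^ 2) set))"
      by (auto simp: Int_stable_def box_Int_box)
    moreover have "range (\<lambda>(a, b). box a b :: (real ^ 2) set) \<subseteq> Pow UNIV" by simp
    ultimately have "(\<integral>x. indicator A x *\<^sub>R h x \<partial>lborel) = 0"
      using A
    proof (induction rule: sigma_sets_induct_disjoint[consumes 3])
      case (basic A)
      then obtain a b where A: "A = box a b" by auto
      obtain c d where cd: "A \<inter> W n = box c d" unfolding A W_def by (subst (asm) box_Int_box) blast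
      have "(\<integral>x. indicator A x *\<^sub>R h x \<partial>lborel) = (\<integral>x. indicator (box c d) x *\<^sub>R g x \<partial>lborel)"
        unfolding h_def cd[symmetric] by (simp add: indicator_inter_arith)
      then show ?case using integral_box_eq_0[OF g z] by simp
    next
      case empty
      then show ?case by simp
    next
      case (compl A)
      then have "A \<in> sets borel" by (simp add: borel_eq_box)
      then have "(\<integral>x. h x - indicator A x *\<^sub>R h x \<partial>lborel) = 0"
        using hi hA h0 compl by simp
      moreover have "h x - indicator A x *\<^sub>R h x = indicator (UNIV - A) x *\<^sub>R h x" for x
        by (simp add: indicator_def)
      ultimately show ?case by simp
    next
      case (union A)
      then have A: "A i \<in> sets borel" for i by (auto simp: borel_eq_box)
      have "(LINT x:(\<Union>i. A i)|lborel. h x) = (\<Sum>i. (LINT x:(A i)|lborel. h x))"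
        by (rule lebesgue_integral_countable_add)
           (use A union(1) hA in \<open>auto simp: disjoint_family_on_def set_integrable_def\<close>)
      then show ?case using union by (simp add: set_lebesgue_integral_def)
    qed
    then show "set_lebesgue_integral lborel A (\<lambda>x. indicator (W n) x *\<^sub>R g x) = 0"
      by (simp add: set_lebesgue_integral_def h_def)
  next
    show "integrable lborel (\<lambda>x. indicator (W n) x *\<^sub>R g x)"
      unfolding W_def by (rule integral_box_eq_0[OF g z])
  qed
  then have "AE x in lborel. \<forall>n. indicator (W n) x *\<^sub>R g x = 0" unfolding AE_all_countable by blast
  then show ?thesis
  proof eventually_elim
    case (elim x)
    have "x \<in> (\<Union>n. W n)" unfolding W_def using UN_box_eq_UNIV by blast
    then obtain n where "x \<in> W n" by auto
    with elim show ?case by (metis indicator_simps(1) scaleR_one)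
  qed
qed

section \<open>Weak derivatives and \<open>H\<^sup>1\<close>\<close>

lemma is_weak_pderivD:
  "is_weak_pderiv i f g \<Longrightarrow> test_fun \<psi> \<Longrightarrow>
    (\<integral>x. f x * pderiv i \<psi> x \<partial>lborel) = - (\<integral>x. g x * \<psi> x \<partial>lborel)"
  unfolding is_weak_pderiv_def by blast

lemma weak_pderiv_unique:
  assumes "g \<in> Lp 2" "g' \<in> Lp 2" "is_weak_pderiv i f g" "is_weak_pderiv i f g'"
  shows "AE x in lborel. g x = g' x"
proof -
  have "AE x in lborel. g x - g' x = 0"
  proof (rule weakly_zero_imp_AE_zero[OF Lp_2_diff(1)[OF assms(1,2)]])
    fix \<psi> assume t: "test_fun \<psi>"
    then have "(\<integral>x. g x * \<psi> x \<partial>lborel) = (\<integral>x. g' x * \<psi> x \<partial>lborel)"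
      using is_weak_pderivD[OF assms(3)] is_weak_pderivD[OF assms(4)] by (metis neg_equal_iff_equal)
    then show "(\<integral>x. (g x - g' x) * \<psi> x \<partial>lborel) = 0"
      using Lp_2_mult_integrable(1)[OF assms(1) test_fun_Lp_2[OF t]]
        Lp_2_mult_integrable(1)[OF assms(2) test_fun_Lp_2[OF t]]
      by (simp add: left_diff_distrib)
  qed
  then show ?thesis by eventually_elim simp
qed

lemma H1_Lp_2: "f \<in> H1 \<Longrightarrow> f \<in> Lp 2"
  by (simp add: H1_def)

lemma H1_weak_pderiv:
  assumes "f \<in> H1"
  shows "weak_pderiv i f \<in> Lp 2" "is_weak_pderiv i f (weak_pderiv i f)"
proof -
  have "\<exists>g. g \<in> Lp 2 \<and> is_weak_pderiv i f g" using assms by (auto simp: H1_def)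
  from someI_ex[OF this] show "weak_pderiv i f \<in> Lp 2" "is_weak_pderiv i f (weak_pderiv i f)"
    unfolding weak_pderiv_def by auto
qed

lemma H1_I:
  assumes "f \<in> Lp 2" "\<And>i. g i \<in> Lp 2" "\<And>i. is_weak_pderiv i f (g i)"
  shows "f \<in> H1" "AE x in lborel. weak_pderiv i f x = g i x"
proof -
  show "f \<in> H1" using assms by (auto simp: H1_def)
  then show "AE x in lborel. weak_pderiv i f x = g i x"
    using weak_pderiv_unique H1_weak_pderiv assms by blast
qed

lemma is_weak_pderiv_lincomb:
  assumes "f \<in> Lp 2" "f' \<in> Lp 2" "g \<in> Lp 2" "g' \<in> Lp 2"
    and "is_weak_pderiv i f g" "is_weak_pderiv i f' g'"
  shows "is_weak_pderiv i (\<lambda>x. a * f x + b * f' x) (\<lambda>x. a * g x + b * g' x)"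
  unfolding is_weak_pderiv_def
proof (intro allI impI)
  fix \<psi> assume t: "test_fun \<psi>"
  have 1: "\<psi> \<in> Lp 2" "pderiv i \<psi> \<in> Lp 2" using t test_fun_Lp_2 test_fun_pderiv by auto
  have e: "(\<integral>x. (a * u x + b * v x) * w x \<partial>lborel) = a * (\<integral>x. u x * w x \<partial>lborel) + b * (\<integral>x. v x * w x \<partial>lborel)"
    if "u \<in> Lp 2" "v \<in> Lp 2" "w \<in> Lp 2" for u v w
    using Lp_2_mult_integrable(1)[OF that(1,3)] Lp_2_mult_integrable(1)[OF that(2,3)]
    by (simp add: distrib_right mult.assoc)
  show "(\<integral>x. (a * f x + b * f' x) * pderiv i \<psi> x \<partial>lborel) = - (\<integral>x. (a * g x + b * g' x) * \<psi> x \<partial>lborel)"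
    using assms 1 t by (simp add: e is_weak_pderivD)
qed

lemma Lp_2_lincomb:
  "f \<in> Lp 2 \<Longrightarrow> g \<in> Lp 2 \<Longrightarrow> (\<lambda>x. a * f x + b * g x) \<in> Lp 2"
  using Lp_2_add(1) Lp_2_cmult(1) by blast

lemma H1_lincomb:
  assumes "f \<in> H1" "g \<in> H1"
  shows "(\<lambda>x. a * f x + b * g x) \<in> H1"
    and "AE x in lborel. weak_pderiv i (\<lambda>x. a * f x + b * g x) x = a * weak_pderiv i f x + b * weak_pderiv i g x"
proof -
  note I = H1_I[of "\<lambda>x. a * f x + b * g x" "\<lambda>i x. a * weak_pderiv i f x + b * weak_pderiv i g x"]
  show "(\<lambda>x. a * f x + b * g x) \<in> H1"
    by (rule I(1)) (use assms in \<open>auto intro!: Lp_2_lincomb is_weak_pderiv_lincomb H1_weak_pderiv simp: H1_Lp_2\<close>)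
  show "AE x in lborel. weak_pderiv i (\<lambda>x. a * f x + b * g x) x = a * weak_pderiv i f x + b * weak_pderiv i g x"
    by (rule I(2)) (use assms in \<open>auto intro!: Lp_2_lincomb is_weak_pderiv_lincomb H1_weak_pderiv simp: H1_Lp_2\<close>)
qed

lemma H1_cmult: "f \<in> H1 \<Longrightarrow> (\<lambda>x. c * f x) \<in> H1"
  using H1_lincomb(1)[of f f c 0] by simp

lemma H1_diff: "f \<in> H1 \<Longrightarrow> g \<in> H1 \<Longrightarrow> (\<lambda>x. f x - g x) \<in> H1"
  using H1_lincomb(1)[of f g 1 "-1"] by simp

lemma test_fun_is_weak_pderiv: "test_fun f \<Longrightarrow> is_weak_pderiv i f (pderiv i f)"
  unfolding is_weak_pderiv_def
  using integral_by_parts test_fun_smooth smooth_differentiable smooth_continuous smooth_pderiv by blast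

lemma test_fun_H1:
  assumes "test_fun f" shows "f \<in> H1" "AE x in lborel. weak_pderiv i f x = pderiv i f x"
  using H1_I[of f "\<lambda>i. pderiv i f"] assms test_fun_is_weak_pderiv test_fun_Lp_2 test_fun_pderiv
  by auto

lemma test_fun_zero: "test_fun (\<lambda>x. 0)"
  using test_fun_cmult[OF test_fun_bump[of 1], of 0] by simp

lemma H1_zero: "(\<lambda>x. 0) \<in> H1"
  using test_fun_H1(1)[OF test_fun_zero] .

lemma is_weak_pderiv_cong_AE:
  assumes "is_weak_pderiv i f g" "AE x in lborel. f x = f' x"
    "f \<in> borel_measurable borel" "f' \<in> borel_measurable borel"
  shows "is_weak_pderiv i f' g"
  unfolding is_weak_pderiv_def
proof (intro allI impI)
  fix \<psi> assume t: "test_fun \<psi>"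
  then have [measurable]: "pderiv i \<psi> \<in> borel_measurable borel"
    using test_fun_pderiv test_fun_smooth smooth_measurable by blast
  note [measurable] = assms(3,4)
  have "(\<integral>x. f' x * pderiv i \<psi> x \<partial>lborel) = (\<integral>x. f x * pderiv i \<psi> x \<partial>lborel)"
    using assms(2) by (intro integral_cong_AE) auto
  then show "(\<integral>x. f' x * pderiv i \<psi> x \<partial>lborel) = - (\<integral>x. g x * \<psi> x \<partial>lborel)"
    using is_weak_pderivD[OF assms(1) t] by simp
qed

lemma H1_cong_AE:
  assumes "f \<in> H1" "f' \<in> borel_measurable borel" "AE x in lborel. f x = f' x"
  shows "f' \<in> H1" "AE x in lborel. weak_pderiv i f' x = weak_pderiv i f x"
  using H1_I[of f' "\<lambda>i. weak_pderiv i f"] H1_weak_pderiv[OF assms(1)] H1_Lp_2[OF assms(1)]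
    Lp_2_cong_AE(1)[OF H1_Lp_2[OF assms(1)] assms(2,3)] is_weak_pderiv_cong_AE[of _ f _ f'] assms
    Lp_2_measurable
  by auto

section \<open>The sesquilinear forms behind the norms\<close>

definition herm :: "fn \<Rightarrow> fn \<Rightarrow> complex" where
  "herm f g = (\<integral>x. f x * cnj (g x) \<partial>lborel)"

definition H1_herm :: "fn \<Rightarrow> fn \<Rightarrow> complex" where
  "H1_herm f g = (\<Sum>i\<in>UNIV. herm (weak_pderiv i f) (weak_pderiv i g)) + herm f g"

text \<open>The square of \<open>H1_norm\<close>, which unlike the norm is a quadratic form.\<close>

definition Hs :: "fn \<Rightarrow> real" where
  "Hs f = (\<Sum>i\<in>UNIV. sq (weak_pderiv i f)) + sq f"

lemma H1_norm_sq: "(H1_norm f)\<^sup>2 = Hs f"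
  unfolding H1_norm_def Hs_def by (subst real_sqrt_pow2) (auto simp: Lp_norm_2 intro!: add_nonneg_nonneg sum_nonneg)

lemma Hs_nonneg: "0 \<le> Hs f"
  unfolding Hs_def by (auto intro!: add_nonneg_nonneg sum_nonneg)

lemma sq_le_Hs: "sq f \<le> Hs f" "sq (weak_pderiv i f) \<le> Hs f"
proof -
  show "sq f \<le> Hs f" unfolding Hs_def by (simp add: sum_nonneg)
  have "sq (weak_pderiv i f) \<le> (\<Sum>i\<in>UNIV. sq (weak_pderiv i f))"
    by (rule member_le_sum[where f = "\<lambda>i. sq (weak_pderiv i f)"]) auto
  then show "sq (weak_pderiv i f) \<le> Hs f" unfolding Hs_def using sq_nonneg[of f] by linarith
qed

lemma sq_lincomb:
  assumes "f \<in> Lp 2" "g \<in> Lp 2"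
  shows "sq (\<lambda>x. a * f x + b * g x)
    = (norm a)\<^sup>2 * sq f + (norm b)\<^sup>2 * sq g + 2 * Re (a * cnj b * herm f g)"
proof -
  have i: "integrable lborel (\<lambda>x. f x * cnj (g x))"
    using Lp_2_mult_integrable(1)[OF assms(1) Lp_2_cnj[OF assms(2)]] .
  have "(norm (a * f x + b * g x))\<^sup>2
      = (norm a)\<^sup>2 * (norm (f x))\<^sup>2 + (norm b)\<^sup>2 * (norm (g x))\<^sup>2 + 2 * Re (a * cnj b * (f x * cnj (g x)))" for x
    by (simp only: cmod_power2 complex_mult_cnj power_mult_distrib norm_mult flip: norm_mult)
       (simp add: algebra_simps power2_eq_square)
  moreover have "integrable lborel (\<lambda>x. Re (a * cnj b * (f x * cnj (g x))))"
    using i by (intro integrable_Re integrable_mult_right)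
  moreover have "(\<integral>x. Re (a * cnj b * (f x * cnj (g x))) \<partial>lborel) = Re (a * cnj b * herm f g)"
    unfolding herm_def using i by (subst integral_Re) (auto simp del: times_complex.sel)
  ultimately show ?thesis using assms by (simp add: Lp_2_iff del: times_complex.sel)
qed

lemma sq_cong_AE:
  assumes "f \<in> borel_measurable borel" "g \<in> borel_measurable borel" "AE x in lborel. f x = g x"
  shows "sq f = sq g"
proof -
  note [measurable] = assms(1,2)
  have "AE x in lborel. (norm (f x))\<^sup>2 = (norm (g x))\<^sup>2" using assms(3) by eventually_elim simp
  then show ?thesis by (intro integral_cong_AE) auto
qed

lemma Hs_cong_AE:
  assumes "f \<in> H1" "f' \<in> borel_measurable borel" "AE x in lborel. f x = f' x"
  shows "Hs f' = Hs f"
proof -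
  have "sq (weak_pderiv i f') = sq (weak_pderiv i f)" for i
    using H1_weak_pderiv(1)[OF assms(1)] H1_weak_pderiv(1)[OF H1_cong_AE(1)[OF assms]]
    by (intro sq_cong_AE Lp_2_measurable H1_cong_AE(2)[OF assms]) auto
  then show ?thesis
    unfolding Hs_def using Lp_2_cong_AE(2)[OF H1_Lp_2[OF assms(1)] assms(2,3)] by simp
qed

lemma Hs_lincomb:
  assumes "f \<in> H1" "g \<in> H1"
  shows "Hs (\<lambda>x. a * f x + b * g x)
    = (norm a)\<^sup>2 * Hs f + (norm b)\<^sup>2 * Hs g + 2 * Re (a * cnj b * H1_herm f g)"
proof -
  have "sq (weak_pderiv i (\<lambda>x. a * f x + b * g x))
     = (norm a)\<^sup>2 * sq (weak_pderiv i f) + (norm b)\<^sup>2 * sq (weak_pderiv i g)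
       + 2 * Re (a * cnj b * herm (weak_pderiv i f) (weak_pderiv i g))" for i
  proof -
    have "sq (weak_pderiv i (\<lambda>x. a * f x + b * g x)) = sq (\<lambda>x. a * weak_pderiv i f x + b * weak_pderiv i g x)"
      by (intro sq_cong_AE Lp_2_measurable H1_lincomb(2)[OF assms] H1_weak_pderiv(1)[OF H1_lincomb(1)[OF assms]]
          Lp_2_lincomb[OF H1_weak_pderiv(1)[OF assms(1)] H1_weak_pderiv(1)[OF assms(2)]])
    then show ?thesis using sq_lincomb H1_weak_pderiv(1) assms by simp
  qed
  then show ?thesis
    unfolding Hs_def H1_herm_def
    using sq_lincomb[OF H1_Lp_2[OF assms(1)] H1_Lp_2[OF assms(2)]]
    by (simp add: sum.distrib sum_distrib_left distrib_left algebra_simps del: times_complex.sel)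
qed

lemma Hs_cmult: "f \<in> H1 \<Longrightarrow> Hs (\<lambda>x. c * f x) = (norm c)\<^sup>2 * Hs f"
  using Hs_lincomb[of f f c 0] by simp

lemma Hs_add_le:
  assumes "f \<in> H1" "g \<in> H1" shows "Hs (\<lambda>x. f x + g x) \<le> 2 * Hs f + 2 * Hs g"
  using Hs_lincomb[OF assms, of 1 1] Hs_lincomb[OF assms, of 1 "-1"] Hs_nonneg[of "\<lambda>x. 1 * f x + - 1 * g x"]
  by simp

lemma H1_shift:
  assumes "f \<in> H1"
  shows "(\<lambda>x. f (x + t)) \<in> H1" "AE x in lborel. weak_pderiv i (\<lambda>x. f (x + t)) x = weak_pderiv i f (x + t)"
    "Hs (\<lambda>x. f (x + t)) = Hs f"
proof -
  have w: "is_weak_pderiv i (\<lambda>x. f (x + t)) (\<lambda>x. weak_pderiv i f (x + t))" for i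
    unfolding is_weak_pderiv_def
  proof (intro allI impI)
    fix \<psi> assume \<psi>: "test_fun \<psi>"
    define \<eta> where "\<eta> = (\<lambda>x. \<psi> (- t + 1 *\<^sub>R x))"
    have \<eta>: "test_fun \<eta>" unfolding \<eta>_def using \<psi> by (intro test_fun_affine) auto
    have p: "pderiv i \<eta> = (\<lambda>x. pderiv i \<psi> (- t + x))"
      unfolding \<eta>_def using smooth_laplacian_affine(1)[OF test_fun_smooth[OF \<psi>], of i "- t" 1] by simp
    have [measurable]: "f \<in> borel_measurable borel" "weak_pderiv i f \<in> borel_measurable borel"
      "\<eta> \<in> borel_measurable borel" "pderiv i \<eta> \<in> borel_measurable borel"
      using assms H1_weak_pderiv(1) H1_Lp_2 Lp_2_measurable \<eta> test_fun_pderiv test_fun_Lp_2 by blast+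
    have m: "(\<lambda>x. f x * pderiv i \<eta> x) \<in> borel_measurable borel"
      "(\<lambda>x. weak_pderiv i f x * \<eta> x) \<in> borel_measurable borel" by measurable
    have "(\<integral>x. f (x + t) * pderiv i \<psi> x \<partial>lborel) = (\<integral>x. f x * pderiv i \<eta> x \<partial>lborel)"
      using lborel_integral_shift(1)[OF m(1), of t] by (simp add: p)
    also have "\<dots> = - (\<integral>x. weak_pderiv i f x * \<eta> x \<partial>lborel)"
      by (rule is_weak_pderivD[OF H1_weak_pderiv(2)[OF assms] \<eta>])
    also have "(\<integral>x. weak_pderiv i f x * \<eta> x \<partial>lborel) = (\<integral>x. weak_pderiv i f (x + t) * \<psi> x \<partial>lborel)"
      using lborel_integral_shift(1)[OF m(2), of t] by (simp add: \<eta>_def)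
    finally show "(\<integral>x. f (x + t) * pderiv i \<psi> x \<partial>lborel) = - (\<integral>x. weak_pderiv i f (x + t) * \<psi> x \<partial>lborel)" .
  qed
  have L: "(\<lambda>x. f (x + t)) \<in> Lp 2" "\<And>i. (\<lambda>x. weak_pderiv i f (x + t)) \<in> Lp 2"
    using assms H1_weak_pderiv(1) H1_Lp_2 Lp_2_shift(1) by blast+
  show h: "(\<lambda>x. f (x + t)) \<in> H1"
    and ae: "AE x in lborel. weak_pderiv i (\<lambda>x. f (x + t)) x = weak_pderiv i f (x + t)" for i
    using H1_I[of "\<lambda>x. f (x + t)" "\<lambda>i x. weak_pderiv i f (x + t)"] L w by auto
  have "sq (weak_pderiv i (\<lambda>x. f (x + t))) = sq (weak_pderiv i f)" for i
    using Lp_2_cong_AE(2)[OF H1_weak_pderiv(1)[OF h] Lp_2_measurable[OF L(2)] ae]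
      Lp_2_shift(2)[OF H1_weak_pderiv(1)[OF assms], of i t] by simp
  then show "Hs (\<lambda>x. f (x + t)) = Hs f"
    unfolding Hs_def using Lp_2_shift(2)[OF H1_Lp_2[OF assms], of t] by simp
qed

text \<open>Fubini for an average of translates. Translations preserve the L^2 norm, so
  Cauchy-Schwarz bounds the inner integral uniformly in \<open>z\<close>. The map \<open>T\<close>
  is the identity or the reflection for mollifications, and a motion along a coordinate axis in
  \<open>Lp_2_translate_axis\<close>.\<close>

lemma integral_average_swap:
  fixes r :: "'b::euclidean_space \<Rightarrow> complex" and T :: "'b \<Rightarrow> real ^ 2"
  assumes u: "u \<in> Lp 2" and v: "v \<in> Lp 2" and r: "integrable lborel r"
    and T [measurable]: "T \<in> borel_measurable borel"
  shows "(\<integral>x. (\<integral>z. r z * u (x + T z) \<partial>lborel) * v x \<partial>lborel)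
       = (\<integral>z. r z * (\<integral>x. u (x + T z) * v x \<partial>lborel) \<partial>lborel)"
proof -
  have [measurable]: "u \<in> borel_measurable borel" "v \<in> borel_measurable borel" "r \<in> borel_measurable borel"
    using u v r Lp_2_measurable by auto
  let ?f = "\<lambda>(z, x). r z * (u (x + T z) * v x)"
  have fm: "?f \<in> borel_measurable (lborel \<Otimes>\<^sub>M lborel)" by measurable
  have i: "integrable lborel (\<lambda>x. u (x + T z) * v x)"
    and n: "(\<integral>x. norm (u (x + T z) * v x) \<partial>lborel) \<le> sqrt (sq u * sq v)" for z
  proof -
    have us: "(\<lambda>x. u (x + T z)) \<in> Lp 2" by (rule Lp_2_shift(1)[OF u])
    show "integrable lborel (\<lambda>x. u (x + T z) * v x)" by (rule Lp_2_mult_integrable(1)[OF us v])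
    show "(\<integral>x. norm (u (x + T z) * v x) \<partial>lborel) \<le> sqrt (sq u * sq v)"
      using Cauchy_Schwarz_Lp_2(1)[OF us v] Lp_2_shift(2)[OF u, of "T z"]
      by (simp add: norm_mult real_le_rsqrt)
  qed
  have int: "integrable (lborel \<Otimes>\<^sub>M lborel) ?f"
  proof (rule lborel_pair.Fubini_integrable[OF fm])
    show "AE z in lborel. integrable lborel (\<lambda>x. ?f (z, x))" using i by simp
    have "integrable lborel (\<lambda>z. norm (r z) * (\<integral>x. norm (u (x + T z) * v x) \<partial>lborel))"
    proof (rule Bochner_Integration.integrable_bound)
      show "integrable lborel (\<lambda>z. norm (r z) * sqrt (sq u * sq v))" using r by simp
      show "AE z in lborel. norm (norm (r z) * (\<integral>x. norm (u (x + T z) * v x) \<partial>lborel)) \<le> norm (norm (r z) * sqrt (sq u * sq v))"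
        using n by (auto simp: abs_mult intro!: mult_left_mono intro: order_trans[OF n])
    qed (measurable)
    then show "integrable lborel (\<lambda>z. \<integral>x. norm (?f (z, x)) \<partial>lborel)" by (simp add: norm_mult)
  qed
  have "(\<integral>z. r z * (\<integral>x. u (x + T z) * v x \<partial>lborel) \<partial>lborel) = (\<integral>z. (\<integral>x. r z * (u (x + T z) * v x) \<partial>lborel) \<partial>lborel)"
    by simp
  also have "\<dots> = (\<integral>x. (\<integral>z. r z * (u (x + T z) * v x) \<partial>lborel) \<partial>lborel)"
    by (rule lborel_pair.Fubini_integral[symmetric]) (use int in simp)
  also have "\<dots> = (\<integral>x. (\<integral>z. r z * u (x + T z) \<partial>lborel) * v x \<partial>lborel)"
    by (simp add: mult.assoc[symmetric])
  finally show ?thesis ..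
qed

section \<open>Mollification and the modulus of continuity in \<open>L\<^sup>2\<close>\<close>

text \<open>The sign in \<open>x + z\<close> makes this a correlation: it is the convolution for
  even \<open>r\<close>, its value at 0 is the plain integral of \<open>r\<close> against
  \<open>w\<close>, and moving a derivative onto \<open>r\<close> costs a sign.\<close>

definition cnv :: "fn \<Rightarrow> fn \<Rightarrow> fn" where
  "cnv r w x = (\<integral>z. r z * w (x + z) \<partial>lborel)"

lemma cnv_Lp_2:
  assumes "integrable lborel r" "w \<in> Lp 2"
  shows "cnv r w \<in> Lp 2" "sq (cnv r w) \<le> (\<integral>z. norm (r z) \<partial>lborel)\<^sup>2 * sq w"
proof -
  have [measurable]: "w \<in> borel_measurable borel" using assms Lp_2_measurable by auto
  have m: "(\<lambda>(x, z). w (x + z)) \<in> borel_measurable (lborel \<Otimes>\<^sub>M lborel)" by measurable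
  have "(\<integral>\<^sup>+x. ennreal ((norm (w (x + z)))\<^sup>2) \<partial>lborel) \<le> ennreal (sq w)" for z
    using ennreal_sq[OF Lp_2_shift(1)[OF assms(2)]] Lp_2_shift(2)[OF assms(2)] by simp
  from average_L2(1,2)[OF m assms(1) sq_nonneg this]
  show "cnv r w \<in> Lp 2" "sq (cnv r w) \<le> (\<integral>z. norm (r z) \<partial>lborel)\<^sup>2 * sq w"
    unfolding cnv_def[abs_def] by auto
qed

lemma cnv_swap:
  assumes r: "integrable lborel r" and w: "w \<in> Lp 2" and f: "f \<in> Lp 2"
  shows "(\<integral>x. cnv r w x * f x \<partial>lborel) = (\<integral>y. (\<integral>z. r z * f (y - z) \<partial>lborel) * w y \<partial>lborel)"
proof -
  have [measurable]: "w \<in> borel_measurable borel" "f \<in> borel_measurable borel" using w f Lp_2_measurable by auto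
  have "(\<integral>x. w (x + z) * f x \<partial>lborel) = (\<integral>y. f (y + - z) * w y \<partial>lborel)" for z
  proof -
    have "(\<lambda>y. f (y + - z) * w y) \<in> borel_measurable borel" by measurable
    from lborel_integral_shift(1)[OF this, of z] show ?thesis by (simp add: mult.commute)
  qed
  then show ?thesis
    unfolding cnv_def
    using integral_average_swap[OF w f r, of "\<lambda>z. z"] integral_average_swap[OF f w r, of uminus]
    by simp
qed

text \<open>Reflecting the test function flips the sign of its derivative, which cancels the sign in
  the definition of a weak derivative.\<close>

lemma weak_pderiv_reflect:
  assumes f: "f \<in> Lp 2" and g: "g \<in> Lp 2" and w: "is_weak_pderiv i f g" and t: "test_fun \<eta>"
  shows "(\<integral>z. pderiv i \<eta> z * f (y - z) \<partial>lborel) = (\<integral>z. \<eta> z * g (y - z) \<partial>lborel)"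
proof -
  define \<psi> where "\<psi> = (\<lambda>x. \<eta> (y + (- 1) *\<^sub>R x))"
  have \<psi>: "test_fun \<psi>" unfolding \<psi>_def using t by (intro test_fun_affine) auto
  have p: "pderiv i \<psi> = (\<lambda>x. - pderiv i \<eta> (y - x))"
    unfolding \<psi>_def using smooth_laplacian_affine(1)[OF test_fun_smooth[OF t], of i y "- 1"] by simp
  have [measurable]: "f \<in> borel_measurable borel" "g \<in> borel_measurable borel"
    "\<eta> \<in> borel_measurable borel" "pderiv i \<eta> \<in> borel_measurable borel"
    using f g t test_fun_pderiv test_fun_Lp_2 Lp_2_measurable by blast+
  have m: "(\<lambda>z. pderiv i \<eta> z * f (y - z)) \<in> borel_measurable borel"
    "(\<lambda>z. \<eta> z * g (y - z)) \<in> borel_measurable borel" by measurable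
  have "(\<integral>z. pderiv i \<eta> z * f (y - z) \<partial>lborel) = (\<integral>x. pderiv i \<eta> (y - x) * f x \<partial>lborel)"
    using lborel_integral_affine(1)[of "- 1", OF _ m(1), of y] by simp
  also have "\<dots> = - (\<integral>x. f x * pderiv i \<psi> x \<partial>lborel)"
    by (simp add: p mult.commute)
  also have "\<dots> = (\<integral>x. \<psi> x * g x \<partial>lborel)"
    using is_weak_pderivD[OF w \<psi>] by (simp add: mult.commute)
  also have "\<dots> = (\<integral>z. \<eta> z * g (y - z) \<partial>lborel)"
    using lborel_integral_affine(1)[of "- 1", OF _ m(2), of y] by (simp add: \<psi>_def)
  finally show ?thesis .
qed

text \<open>With a test function for \<open>f\<close> this computes the weak derivative of a
  mollification; with an H^1 function for \<open>f\<close> and a derivative for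
  \<open>\<eta>\<close> it is the integration by parts behind \<open>H1_pairing_cnv\<close>.\<close>

lemma cnv_pderiv_swap:
  assumes f: "f \<in> Lp 2" and g: "g \<in> Lp 2" and w: "is_weak_pderiv i f g" and t: "test_fun \<eta>" and v: "v \<in> Lp 2"
  shows "(\<integral>x. cnv (pderiv i \<eta>) v x * f x \<partial>lborel) = (\<integral>x. cnv \<eta> v x * g x \<partial>lborel)"
  using cnv_swap[OF _ v f, of "pderiv i \<eta>"] cnv_swap[OF _ v g, of \<eta>] weak_pderiv_reflect[OF f g w t]
    test_fun_integrable[OF t] test_fun_integrable[OF test_fun_pderiv[OF t]]
  by simp

lemma cnv_H1:
  assumes t: "test_fun \<eta>" and v: "v \<in> Lp 2"
  shows "cnv \<eta> v \<in> H1" "AE x in lborel. weak_pderiv i (cnv \<eta> v) x = - cnv (pderiv i \<eta>) v x"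
proof -
  have L: "cnv \<eta> v \<in> Lp 2" "cnv (pderiv i \<eta>) v \<in> Lp 2" for i
    using cnv_Lp_2(1)[OF _ v] test_fun_integrable t test_fun_pderiv by auto
  have w: "is_weak_pderiv i (cnv \<eta> v) (\<lambda>x. - cnv (pderiv i \<eta>) v x)" for i
    unfolding is_weak_pderiv_def
    using cnv_pderiv_swap[OF test_fun_Lp_2 test_fun_Lp_2[OF test_fun_pderiv] test_fun_is_weak_pderiv t v]
    by simp
  have n: "(\<lambda>x. - cnv (pderiv i \<eta>) v x) \<in> Lp 2" for i
    using Lp_2_cmult(1)[OF L(2), of "- 1"] by simp
  show "cnv \<eta> v \<in> H1" "AE x in lborel. weak_pderiv i (cnv \<eta> v) x = - cnv (pderiv i \<eta>) v x"
    using H1_I[of "cnv \<eta> v" "\<lambda>i x. - cnv (pderiv i \<eta>) v x"] L(1) n w by auto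
qed

lemma cnv_integrand_integrable:
  assumes "r \<in> Lp 2" "w \<in> Lp 2" shows "integrable lborel (\<lambda>z. r z * w (x + z))"
  using Lp_2_mult_integrable(1)[OF assms(1) Lp_2_shift(1)[OF assms(2), of x]] by (simp add: add.commute)

text \<open>Moving all derivatives onto \<open>\<rho>\<close> evaluates the (bilinear) \<open>H\<^sup>1\<close> pairing of \<open>f\<close> with a mollified \<open>w\<close>
  through the distribution \<open>(-\<Delta> + 1) w\<close> alone.\<close>

lemma H1_pairing_cnv:
  assumes f: "f \<in> H1" and t: "test_fun \<rho>" and w: "w \<in> Lp 2"
  shows "(\<Sum>i\<in>UNIV. \<integral>x. weak_pderiv i f x * weak_pderiv i (cnv \<rho> w) x \<partial>lborel) + (\<integral>x. f x * cnv \<rho> w x \<partial>lborel)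
    = (\<integral>x. f x * cnv (\<lambda>z. - laplacian \<rho> z + \<rho> z) w x \<partial>lborel)"
proof -
  note fL = H1_Lp_2[OF f]
  have tp: "test_fun (pderiv i \<rho>)" "test_fun (pderiv i (pderiv i \<rho>))" for i
    using t test_fun_pderiv by auto
  have [measurable]: "weak_pderiv i f \<in> borel_measurable borel" "f \<in> borel_measurable borel"
    "weak_pderiv i (cnv \<rho> w) \<in> borel_measurable borel" "cnv (pderiv i \<rho>) w \<in> borel_measurable borel" for i
    using H1_weak_pderiv(1)[OF f] H1_weak_pderiv(1)[OF cnv_H1(1)[OF t w]] fL
      cnv_Lp_2(1)[OF test_fun_integrable[OF tp(1)] w] Lp_2_measurable by auto
  have 1: "(\<integral>x. weak_pderiv i f x * weak_pderiv i (cnv \<rho> w) x \<partial>lborel)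
      = - (\<integral>x. cnv (pderiv i (pderiv i \<rho>)) w x * f x \<partial>lborel)" for i
  proof -
    have "(\<integral>x. weak_pderiv i f x * weak_pderiv i (cnv \<rho> w) x \<partial>lborel)
        = (\<integral>x. - (cnv (pderiv i \<rho>) w x * weak_pderiv i f x) \<partial>lborel)"
      using cnv_H1(2)[OF t w, of i] by (intro integral_cong_AE) (auto simp: mult.commute)
    also have "\<dots> = - (\<integral>x. cnv (pderiv i (pderiv i \<rho>)) w x * f x \<partial>lborel)"
      using cnv_pderiv_swap[OF fL H1_weak_pderiv[OF f] tp(1) w, of i i] by simp
    finally show ?thesis .
  qed
  have i: "integrable lborel (\<lambda>x. cnv \<eta> w x * f x)" if "test_fun \<eta>" for \<eta>
    using Lp_2_mult_integrable(1)[OF cnv_Lp_2(1)[OF test_fun_integrable[OF that] w] fL] .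
  have "cnv (\<lambda>z. - laplacian \<rho> z + \<rho> z) w x
      = (\<Sum>i\<in>UNIV. - cnv (pderiv i (pderiv i \<rho>)) w x) + cnv \<rho> w x" for x
    unfolding cnv_def laplacian_def
    using cnv_integrand_integrable[OF test_fun_Lp_2[OF tp(2)] w] cnv_integrand_integrable[OF test_fun_Lp_2[OF t] w]
    by (simp add: distrib_right left_diff_distrib sum_distrib_right sum_negf)
  then have "(\<integral>x. f x * cnv (\<lambda>z. - laplacian \<rho> z + \<rho> z) w x \<partial>lborel)
    = (\<integral>x. (\<Sum>i\<in>UNIV. - (cnv (pderiv i (pderiv i \<rho>)) w x * f x)) + cnv \<rho> w x * f x \<partial>lborel)"
    by (simp add: right_diff_distrib sum_distrib_left mult.commute sum_negf)
  also have "\<dots> = (\<Sum>i\<in>UNIV. - (\<integral>x. cnv (pderiv i (pderiv i \<rho>)) w x * f x \<partial>lborel)) + (\<integral>x. cnv \<rho> w x * f x \<partial>lborel)"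
    using i[OF tp(2)] i[OF t] by simp
  finally show ?thesis using 1 by (simp add: mult.commute)
qed

text \<open>A translate of \<open>\<rho>\<close> turns the left side into the distribution
  (-\<Delta> + 1) w applied to one test function. The case \<open>c = 1\<close> is the Green's
  function, the case \<open>c = 0\<close> serves uniqueness.\<close>

lemma distribution_cnv:
  assumes w: "w \<in> Lp 2" and t: "test_fun \<rho>"
    and e: "\<And>\<psi>. test_fun \<psi> \<Longrightarrow> (\<integral>x. w x * (- laplacian \<psi> x + \<psi> x) \<partial>lborel) = c * \<psi> 0"
  shows "cnv (\<lambda>z. - laplacian \<rho> z + \<rho> z) w x = c * \<rho> (- x)"
proof -
  define \<psi> where "\<psi> = (\<lambda>y. \<rho> (- x + 1 *\<^sub>R y))"
  have \<psi>: "test_fun \<psi>" unfolding \<psi>_def using t by (intro test_fun_affine) auto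
  have l: "laplacian \<psi> y = laplacian \<rho> (- x + y)" for y
    unfolding \<psi>_def using smooth_laplacian_affine(2)[OF test_fun_smooth[OF t], of "- x" 1] by simp
  have [measurable]: "w \<in> borel_measurable borel" "\<rho> \<in> borel_measurable borel" "laplacian \<rho> \<in> borel_measurable borel"
    using w t test_fun_laplacian test_fun_Lp_2 Lp_2_measurable by blast+
  have m: "(\<lambda>y. w y * (- laplacian \<rho> (- x + y) + \<rho> (- x + y))) \<in> borel_measurable borel" by measurable
  have "cnv (\<lambda>z. - laplacian \<rho> z + \<rho> z) w x = (\<integral>y. w y * (- laplacian \<psi> y + \<psi> y) \<partial>lborel)"
    unfolding l unfolding \<psi>_def cnv_def
    using lborel_integral_shift(1)[OF m, of x] by (simp add: mult.commute add.commute)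
  then show ?thesis using e[OF \<psi>] by (simp add: \<psi>_def)
qed

text \<open>The fundamental theorem of calculus along an axis writes f(x) - f(x - h e) as the
  integral of g(x - s e) over s in [0, h]. For a weak derivative it is checked against test
  functions, where it becomes the classical theorem; the L^2 bound is then Minkowski's
  inequality.\<close>

lemma Lp_2_translate_axis:
  assumes f: "f \<in> Lp 2" and g: "g \<in> Lp 2" and w: "is_weak_pderiv i f g" and h: "0 \<le> h"
  shows "sq (\<lambda>x. f x - f (x + (- h) *\<^sub>R axis i 1)) \<le> h\<^sup>2 * sq g"
proof -
  let ?e = "axis i 1 :: real ^ 2"
  define r :: "real \<Rightarrow> complex" where "r s = of_real (indicator {0..h} s)" for s
  define I where "I x = (\<integral>s. r s * g (x + (- s) *\<^sub>R ?e) \<partial>lborel)" for x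
  have [measurable]: "f \<in> borel_measurable borel" "g \<in> borel_measurable borel" using f g Lp_2_measurable by auto
  have r: "integrable lborel r" "(\<integral>s. norm (r s) \<partial>lborel) = h"
  proof -
    have "integrable lborel (\<lambda>s. complex_of_real (indicator {0..h} s))"
      by (intro integrable_of_real integrable_real_indicator) (auto simp: emeasure_lborel_Icc_eq)
    then show "integrable lborel r" by (simp add: r_def[abs_def])
    have "norm (r s) = indicator {0..h} s" for s by (simp add: r_def split: split_indicator)
    then show "(\<integral>s. norm (r s) \<partial>lborel) = h" using h by simp
  qed
  have m: "(\<lambda>(x, s). g (x + (- s) *\<^sub>R ?e)) \<in> borel_measurable (lborel \<Otimes>\<^sub>M lborel)" by measurable
  have "(\<integral>\<^sup>+x. ennreal ((norm (g (x + (- s) *\<^sub>R ?e)))\<^sup>2) \<partial>lborel) \<le> ennreal (sq g)" for s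
    using ennreal_sq[OF Lp_2_shift(1)[OF g, of "(- s) *\<^sub>R ?e"]] Lp_2_shift(2)[OF g, of "(- s) *\<^sub>R ?e"] by simp
  from average_L2(1,2)[OF m r(1) sq_nonneg this]
  have I: "I \<in> Lp 2" "sq I \<le> h\<^sup>2 * sq g" unfolding I_def[abs_def] r(2) by auto
  define D where "D x = f x - f (x + (- h) *\<^sub>R ?e)" for x
  have D: "D \<in> Lp 2" unfolding D_def[abs_def] using Lp_2_diff(1)[OF f Lp_2_shift(1)[OF f]] .
  have "AE x in lborel. D x - I x = 0"
  proof (rule weakly_zero_imp_AE_zero[OF Lp_2_diff(1)[OF D I(1)]])
    fix \<psi> assume t: "test_fun \<psi>"
    note \<psi>L = test_fun_Lp_2[OF t]
    have [measurable]: "\<psi> \<in> borel_measurable borel" "pderiv i \<psi> \<in> borel_measurable borel"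
      using t test_fun_pderiv test_fun_Lp_2 Lp_2_measurable by blast+
    have FTC: "(\<integral>s. r s * pderiv i \<psi> (x + s *\<^sub>R ?e) \<partial>lborel) = \<psi> (x + h *\<^sub>R ?e) - \<psi> x" for x
    proof -
      have "(\<integral>s. indicator {0..h} s *\<^sub>R pderiv i \<psi> (x + s *\<^sub>R ?e) \<partial>lborel) = \<psi> (x + h *\<^sub>R ?e) - \<psi> (x + 0 *\<^sub>R ?e)"
      proof (rule integral_FTC_atLeastAtMost[OF h])
        show "((\<lambda>s. \<psi> (x + s *\<^sub>R ?e)) has_vector_derivative pderiv i \<psi> (x + s *\<^sub>R ?e)) (at s within {0..h})" for s
          using pderiv_has_vector_derivative[OF smooth_differentiable[OF test_fun_smooth[OF t]]]
          by (rule has_vector_derivative_at_within)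
        have "continuous_on UNIV (pderiv i \<psi>)" using t test_fun_pderiv test_fun_smooth smooth_continuous by blast
        then show "continuous_on {0..h} (\<lambda>s. pderiv i \<psi> (x + s *\<^sub>R ?e))"
          by (rule continuous_on_compose2) (auto intro!: continuous_intros)
      qed
      moreover have "indicator {0..h} s *\<^sub>R pderiv i \<psi> (x + s *\<^sub>R ?e) = r s * pderiv i \<psi> (x + s *\<^sub>R ?e)" for s
        by (simp add: r_def split: split_indicator)
      ultimately show ?thesis by simp
    qed
    have sh: "(\<integral>x. u (x + (- s) *\<^sub>R ?e) * v x \<partial>lborel) = (\<integral>x. v (x + s *\<^sub>R ?e) * u x \<partial>lborel)"
      if [measurable]: "u \<in> borel_measurable borel" "v \<in> borel_measurable borel" for u v :: fn and s
    proof -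
      have "(\<lambda>x. u (x + (- s) *\<^sub>R ?e) * v x) \<in> borel_measurable borel" by measurable
      from lborel_integral_shift(1)[OF this, of "s *\<^sub>R ?e"] show ?thesis by (simp add: mult.commute)
    qed
    have ws: "(\<integral>x. \<psi> (x + s *\<^sub>R ?e) * g x \<partial>lborel) = - (\<integral>x. pderiv i \<psi> (x + s *\<^sub>R ?e) * f x \<partial>lborel)" for s
    proof -
      have t': "test_fun (\<lambda>x. \<psi> (s *\<^sub>R ?e + 1 *\<^sub>R x))" using t by (intro test_fun_affine) auto
      have "pderiv i (\<lambda>x. \<psi> (s *\<^sub>R ?e + 1 *\<^sub>R x)) = (\<lambda>x. pderiv i \<psi> (s *\<^sub>R ?e + x))"
        using smooth_laplacian_affine(1)[OF test_fun_smooth[OF t], of i "s *\<^sub>R ?e" 1] by simp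
      then show ?thesis using is_weak_pderivD[OF w t'] by (simp add: mult.commute add.commute)
    qed
    have "(\<integral>x. I x * \<psi> x \<partial>lborel) = (\<integral>s. r s * (\<integral>x. g (x + (- s) *\<^sub>R ?e) * \<psi> x \<partial>lborel) \<partial>lborel)"
      unfolding I_def by (rule integral_average_swap[OF g \<psi>L r(1)]) measurable
    also have "\<dots> = - (\<integral>s. r s * (\<integral>x. pderiv i \<psi> (x + s *\<^sub>R ?e) * f x \<partial>lborel) \<partial>lborel)"
      by (simp only: sh ws \<open>g \<in> borel_measurable borel\<close> \<open>\<psi> \<in> borel_measurable borel\<close>) simp
    also have "(\<integral>s. r s * (\<integral>x. pderiv i \<psi> (x + s *\<^sub>R ?e) * f x \<partial>lborel) \<partial>lborel)
        = (\<integral>x. (\<integral>s. r s * pderiv i \<psi> (x + s *\<^sub>R ?e) \<partial>lborel) * f x \<partial>lborel)"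
      by (rule integral_average_swap[OF test_fun_Lp_2[OF test_fun_pderiv[OF t]] f r(1), symmetric]) measurable
    also have "\<dots> = (\<integral>x. \<psi> (x + h *\<^sub>R ?e) * f x \<partial>lborel) - (\<integral>x. \<psi> x * f x \<partial>lborel)"
      unfolding FTC using Lp_2_mult_integrable(1)[OF Lp_2_shift(1)[OF \<psi>L] f] Lp_2_mult_integrable(1)[OF \<psi>L f]
      by (simp add: left_diff_distrib)
    also have "(\<integral>x. \<psi> (x + h *\<^sub>R ?e) * f x \<partial>lborel) = (\<integral>x. f (x + (- h) *\<^sub>R ?e) * \<psi> x \<partial>lborel)"
      by (rule sh[symmetric]) auto
    finally have "(\<integral>x. I x * \<psi> x \<partial>lborel) = (\<integral>x. f x * \<psi> x \<partial>lborel) - (\<integral>x. f (x + (- h) *\<^sub>R ?e) * \<psi> x \<partial>lborel)"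
      by (simp add: mult.commute)
    also have "\<dots> = (\<integral>x. D x * \<psi> x \<partial>lborel)"
      unfolding D_def using Lp_2_mult_integrable(1)[OF Lp_2_shift(1)[OF f, of "(- h) *\<^sub>R ?e"] \<psi>L] Lp_2_mult_integrable(1)[OF f \<psi>L]
      by (simp add: left_diff_distrib)
    finally show "(\<integral>x. (D x - I x) * \<psi> x \<partial>lborel) = 0"
      using Lp_2_mult_integrable(1)[OF D \<psi>L] Lp_2_mult_integrable(1)[OF I(1) \<psi>L]
      by (simp add: left_diff_distrib)
  qed
  then have "AE x in lborel. D x = I x" by eventually_elim simp
  then have "sq D = sq I" using D I(1) Lp_2_measurable sq_cong_AE by blast
  then show ?thesis using I(2) unfolding D_def[abs_def] by simp
qed

text \<open>Regularity of order a / 2 in L^2, the differences being squared. Unlike membership in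
  H^1 it is available for the Green's function, for each a in (0, 2).\<close>

definition modulus :: "real \<Rightarrow> real \<Rightarrow> fn \<Rightarrow> bool" where
  "modulus a A f \<longleftrightarrow> (\<forall>z. sq (\<lambda>x. f (x + z) - f x) \<le> A * norm z powr a)"

lemma sq_minus_commute: "sq (\<lambda>x. f x - g x) = sq (\<lambda>x. g x - f x)"
  by (simp add: norm_minus_commute)

lemma H1_translate:
  assumes f: "f \<in> H1" shows "sq (\<lambda>x. f (x + z) - f x) \<le> 2 * (norm z)\<^sup>2 * Hs f"
proof -
  note fL = H1_Lp_2[OF f]
  have [measurable]: "f \<in> borel_measurable borel" using fL Lp_2_measurable by auto
  have ax: "sq (\<lambda>x. f (x + h *\<^sub>R axis i 1 + c) - f (x + c)) \<le> h\<^sup>2 * sq (weak_pderiv i f)" for h i c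
  proof -
    have m: "(\<lambda>x. (norm (f (x + t) - f x))\<^sup>2) \<in> borel_measurable borel" for t by measurable
    have "sq (\<lambda>x. f (x + h *\<^sub>R axis i 1 + c) - f (x + c)) = sq (\<lambda>x. f (x + h *\<^sub>R axis i 1) - f x)"
      using lborel_integral_shift(1)[OF m[of "h *\<^sub>R axis i 1"], of c] by (simp add: ac_simps)
    also have "\<dots> \<le> h\<^sup>2 * sq (weak_pderiv i f)"
    proof (cases "0 \<le> h")
      case True
      have m': "(\<lambda>x. (norm (f x - f (x + (- h) *\<^sub>R axis i 1)))\<^sup>2) \<in> borel_measurable borel" by measurable
      have "sq (\<lambda>x. f (x + h *\<^sub>R axis i 1) - f x) = sq (\<lambda>x. f x - f (x + (- h) *\<^sub>R axis i 1))"
        using lborel_integral_shift(1)[OF m', of "h *\<^sub>R axis i 1"] by simp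
      then show ?thesis using Lp_2_translate_axis[OF fL H1_weak_pderiv[OF f] True] by simp
    next
      case False
      then show ?thesis
        using Lp_2_translate_axis[OF fL H1_weak_pderiv[OF f], of "- h" i] sq_minus_commute[of f] by simp
    qed
    finally show ?thesis .
  qed
  \<comment> \<open>The translation is made along the two axes in turn, which costs the factor
    2.\<close>
  have z: "z = (z $ 1) *\<^sub>R axis 1 1 + (z $ 2) *\<^sub>R axis 2 1"
    by (simp add: vec_eq_iff forall_2 axis_def)
  let ?c = "(z $ 2) *\<^sub>R axis 2 1 :: real ^ 2"
  have L: "(\<lambda>x. f (x + (z $ 1) *\<^sub>R axis 1 1 + ?c)) \<in> Lp 2" "(\<lambda>x. f (x + ?c)) \<in> Lp 2"
    using Lp_2_shift(1)[OF fL] by (auto simp: add.assoc)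
  have "sq (\<lambda>x. f (x + z) - f x)
      = sq (\<lambda>x. (f (x + (z $ 1) *\<^sub>R axis 1 1 + ?c) - f (x + ?c)) + (f (x + ?c) - f x))"
    by (subst z) (simp add: add.assoc)
  also have "\<dots> \<le> 2 * sq (\<lambda>x. f (x + (z $ 1) *\<^sub>R axis 1 1 + ?c) - f (x + ?c)) + 2 * sq (\<lambda>x. f (x + ?c) - f x)"
    by (intro Lp_2_add(2) Lp_2_diff(1) L fL)
  also have "\<dots> \<le> 2 * ((z $ 1)\<^sup>2 * sq (weak_pderiv 1 f)) + 2 * ((z $ 2)\<^sup>2 * sq (weak_pderiv 2 f))"
    using ax[of "z $ 1" 1 ?c] ax[of "z $ 2" 2 0] by simp
  also have "\<dots> \<le> 2 * ((z $ 1)\<^sup>2 * Hs f) + 2 * ((z $ 2)\<^sup>2 * Hs f)"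
    by (intro add_mono mult_left_mono sq_le_Hs) auto
  also have "\<dots> = 2 * (norm z)\<^sup>2 * Hs f"
    by (simp add: norm_vec_def L2_set_def sum_2 algebra_simps)
  finally show ?thesis .
qed

lemma Lp_2_translate_le: "f \<in> Lp 2 \<Longrightarrow> sq (\<lambda>x. f (x + z) - f x) \<le> 4 * sq f"
  using Lp_2_diff(2)[OF Lp_2_shift(1)[of f z], of f] Lp_2_shift(2)[of f z] by simp

text \<open>Short translations use the gradient, as |z|^2 \<le> |z|^a there; for long ones four
  times the mass is enough.\<close>

lemma H1_modulus:
  assumes f: "f \<in> H1" and a: "0 < a" "a < 2"
  shows "modulus a (4 * Hs f) f"
  unfolding modulus_def
proof
  fix z :: "real ^ 2"
  show "sq (\<lambda>x. f (x + z) - f x) \<le> 4 * Hs f * norm z powr a"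
  proof (cases "norm z \<le> 1")
    case True
    have "(norm z)\<^sup>2 = norm z powr 2" by simp
    also have "\<dots> \<le> norm z powr a"
      using True a powr_mono'[of a 2 "norm z"] by simp
    finally have "2 * (norm z)\<^sup>2 \<le> 4 * norm z powr a" using powr_ge_zero[of "norm z" a] by linarith
    then have "2 * (norm z)\<^sup>2 * Hs f \<le> 4 * (norm z powr a) * Hs f"
      using Hs_nonneg[of f] by (intro mult_right_mono) auto
    then show ?thesis using H1_translate[OF f, of z] by (simp add: ac_simps)
  next
    case False
    then have "1 \<le> norm z powr a" using a by (auto intro!: ge_one_powr_ge_zero)
    then have "4 * Hs f * 1 \<le> 4 * Hs f * norm z powr a" using Hs_nonneg[of f] by (intro mult_left_mono) auto
    then show ?thesis using Lp_2_translate_le[OF H1_Lp_2[OF f], of z] sq_le_Hs(1)[of f] by simp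
  qed
qed

section \<open>The Green's function\<close>

text \<open>Balls are not negligible. This allows a property known almost everywhere to be read off
  at a point where the function concerned is continuous.\<close>

lemma AE_lborel_ex_ball:
  assumes "AE x in lborel. P x" "0 < e" shows "\<exists>x\<in>ball (c :: 'a::euclidean_space) e. P x"
proof (rule ccontr)
  assume n: "\<not> (\<exists>x\<in>ball c e. P x)"
  obtain N where N: "{x \<in> space lborel. \<not> P x} \<subseteq> N" "emeasure lborel N = 0" "N \<in> sets lborel"
    using AE_E[OF assms(1)] by metis
  then have "N \<in> null_sets lebesgue" by (intro null_sets_completionI) auto
  then have "negligible N" by (simp add: negligible_iff_null_sets)
  moreover have "ball c e \<subseteq> N" using n N(1) by auto
  ultimately have "negligible (ball c e)" by (rule negligible_subset)
  then show False using open_not_negligible[of "ball c e"] assms(2) by auto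
qed

lemma cnv_cnj:
  assumes "\<And>z. r z \<in> \<real>" shows "cnv r (\<lambda>y. cnj (w y)) x = cnj (cnv r w x)"
proof -
  have "r z * cnj (w (x + z)) = cnj (r z * w (x + z))" for z
    using assms[of z] by (simp add: Reals_cnj_iff)
  then show ?thesis unfolding cnv_def by (simp add: integral_cnj[symmetric] del: complex_cnj_mult)
qed

text \<open>Continuity of a mollification at 0: the translation is moved onto \<open>\<rho>\<close>,
  then Cauchy-Schwarz applies.\<close>

lemma cnv_near_0:
  assumes t: "test_fun \<rho>" and w: "w \<in> Lp 2"
  shows "(norm (cnv \<rho> w x - cnv \<rho> w 0))\<^sup>2 \<le> 2 * (norm x)\<^sup>2 * Hs \<rho> * sq w"
proof -
  have tL: "\<rho> \<in> Lp 2" using test_fun_Lp_2[OF t] .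
  have s: "(\<lambda>z. \<rho> (z + - x)) \<in> Lp 2" using Lp_2_shift(1)[OF tL] .
  have [measurable]: "w \<in> borel_measurable borel" "\<rho> \<in> borel_measurable borel" using w tL Lp_2_measurable by auto
  have m: "(\<lambda>y. \<rho> (y + - x) * w y) \<in> borel_measurable borel" by measurable
  have "cnv \<rho> w x = (\<integral>y. \<rho> (y + - x) * w y \<partial>lborel)"
    unfolding cnv_def using lborel_integral_shift(1)[OF m, of x] by (simp add: add.commute)
  then have "cnv \<rho> w x - cnv \<rho> w 0 = (\<integral>y. (\<rho> (y + - x) - \<rho> y) * w y \<partial>lborel)"
    unfolding cnv_def using Lp_2_mult_integrable(1)[OF s w] Lp_2_mult_integrable(1)[OF tL w]
    by (simp add: left_diff_distrib)
  also have "(norm \<dots>)\<^sup>2 \<le> sq (\<lambda>y. \<rho> (y + - x) - \<rho> y) * sq w"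
    by (rule Cauchy_Schwarz_Lp_2(2)[OF Lp_2_diff(1)[OF s tL] w])
  also have "\<dots> \<le> 2 * (norm x)\<^sup>2 * Hs \<rho> * sq w"
    using H1_translate[OF test_fun_H1(1)[OF t], of "- x"] by (intro mult_right_mono) auto
  finally show ?thesis .
qed

text \<open>The energy method. The squared H^1 norm of a mollification of \<open>d\<close> is its
  pairing with the mollified distribution (-\<Delta> + 1) d, which vanishes. So the mollification is
  0 almost everywhere and by continuity also at 0, where its value is the integral of
  \<open>d\<close> against \<open>\<rho>\<close>.\<close>

lemma homogeneous_unique:
  assumes d: "d \<in> Lp 2"
    and e: "\<And>\<psi>. test_fun \<psi> \<Longrightarrow> (\<integral>x. d x * (- laplacian \<psi> x + \<psi> x) \<partial>lborel) = 0"
  shows "AE x in lborel. d x = 0"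
proof (rule weakly_zero_imp_AE_zero[OF d])
  fix \<rho> assume t: "test_fun \<rho>" and re: "\<And>x. \<rho> x \<in> \<real>"
  \<comment> \<open>\<open>H1_pairing_cnv\<close> is bilinear; taking the conjugate for one argument
    turns it into a norm, and this uses that \<open>\<rho>\<close> is real.\<close>
  let ?c = "\<lambda>x. cnj (d x)"
  note cL = Lp_2_cnj[OF d]
  have W: "cnv \<rho> d \<in> H1" "cnv \<rho> ?c \<in> H1" using cnv_H1(1) t d cL by auto
  have [measurable]: "weak_pderiv i (cnv \<rho> d) \<in> borel_measurable borel" "weak_pderiv i (cnv \<rho> ?c) \<in> borel_measurable borel" for i
    using H1_weak_pderiv(1)[OF W(1)] H1_weak_pderiv(1)[OF W(2)] Lp_2_measurable by auto
  have "AE x in lborel. weak_pderiv i (cnv \<rho> ?c) x = cnj (weak_pderiv i (cnv \<rho> d) x)" for i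
    using cnv_H1(2)[OF t d, of i] cnv_H1(2)[OF t cL, of i]
  proof eventually_elim
    case (elim x)
    have "pderiv i \<rho> z \<in> \<real>" for z
      using pderiv_real[OF re smooth_differentiable[OF test_fun_smooth[OF t]]] .
    then show ?case using elim by (simp add: cnv_cnj)
  qed
  then have D: "(\<integral>x. weak_pderiv i (cnv \<rho> ?c) x * weak_pderiv i (cnv \<rho> d) x \<partial>lborel) = of_real (sq (weak_pderiv i (cnv \<rho> d)))" for i
  proof -
    have "(\<integral>x. weak_pderiv i (cnv \<rho> ?c) x * weak_pderiv i (cnv \<rho> d) x \<partial>lborel)
        = (\<integral>x. of_real ((norm (weak_pderiv i (cnv \<rho> d) x))\<^sup>2) \<partial>lborel)"
      using \<open>AE x in lborel. weak_pderiv i (cnv \<rho> ?c) x = cnj (weak_pderiv i (cnv \<rho> d) x)\<close>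
    proof (intro integral_cong_AE, goal_cases)
      case 3
      then show ?case
      proof eventually_elim
        case (elim x)
        then show ?case unfolding complex_norm_square by (simp add: mult.commute)
      qed
    qed auto
    then show ?thesis by (simp only: integral_complex_of_real)
  qed
  have E: "(\<integral>x. cnv \<rho> ?c x * cnv \<rho> d x \<partial>lborel) = of_real (sq (cnv \<rho> d))"
  proof -
    have "cnv \<rho> ?c x * cnv \<rho> d x = of_real ((norm (cnv \<rho> d x))\<^sup>2)" for x
      by (simp add: cnv_cnj[OF re] complex_norm_square mult.commute del: of_real_power)
    then show ?thesis by (simp only: integral_complex_of_real)
  qed
  have z: "cnv (\<lambda>z. - laplacian \<rho> z + \<rho> z) d x = 0" for x
    using distribution_cnv[OF d t, of 0 x] e by simp
  have "complex_of_real ((\<Sum>i\<in>UNIV. sq (weak_pderiv i (cnv \<rho> d))) + sq (cnv \<rho> d)) = 0"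
    using H1_pairing_cnv[OF W(2) t d] unfolding D E z by simp
  then have "(\<Sum>i\<in>UNIV. sq (weak_pderiv i (cnv \<rho> d))) + sq (cnv \<rho> d) = 0"
    using of_real_eq_0_iff by blast
  moreover have "0 \<le> (\<Sum>i\<in>UNIV. sq (weak_pderiv i (cnv \<rho> d)))" by (intro sum_nonneg) auto
  ultimately have "sq (cnv \<rho> d) = 0" using sq_nonneg[of "cnv \<rho> d"] by linarith
  then have "AE x in lborel. (norm (cnv \<rho> d x))\<^sup>2 = 0"
    using H1_Lp_2[OF W(1)] by (subst (asm) integral_nonneg_eq_0_iff_AE) (auto simp: Lp_2_iff)
  then have ae: "AE x in lborel. cnv \<rho> d x = 0" by eventually_elim simp
  let ?C = "2 * Hs \<rho> * sq d"
  have C: "0 \<le> ?C" using Hs_nonneg[of \<rho>] sq_nonneg[of d] by simp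
  have "(norm (cnv \<rho> d 0))\<^sup>2 \<le> 0 + \<epsilon>" if \<epsilon>: "0 < \<epsilon>" for \<epsilon>
  proof -
    define \<delta> where "\<delta> = sqrt (\<epsilon> / (?C + 1))"
    have \<delta>: "0 < \<delta>" "\<delta>\<^sup>2 = \<epsilon> / (?C + 1)" using \<epsilon> C by (auto simp: \<delta>_def)
    obtain x where x: "norm x < \<delta>" "cnv \<rho> d x = 0" using AE_lborel_ex_ball[OF ae \<delta>(1), of 0] by auto
    have "(norm (cnv \<rho> d 0))\<^sup>2 \<le> (norm x)\<^sup>2 * ?C" using cnv_near_0[OF t d, of x] x by (simp add: ac_simps)
    also have "\<dots> \<le> \<delta>\<^sup>2 * (?C + 1)" using x C by (intro mult_mono power_mono) auto
    also have "\<dots> = \<epsilon>" using C \<delta>(2) by simp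
    finally show ?thesis by simp
  qed
  then have "(norm (cnv \<rho> d 0))\<^sup>2 \<le> 0" by (rule field_le_epsilon)
  then show "(\<integral>x. d x * \<rho> x \<partial>lborel) = 0" by (simp add: cnv_def mult.commute)
qed

lemma is_greenD:
  "is_green 1 g \<Longrightarrow> g \<in> Lp 2"
  "is_green 1 g \<Longrightarrow> test_fun \<psi> \<Longrightarrow> (\<integral>x. g x * (- laplacian \<psi> x + \<psi> x) \<partial>lborel) = \<psi> 0"
  unfolding is_green_def by auto

lemma green_unique:
  assumes "is_green 1 g" "is_green 1 g'" shows "AE x in lborel. g x = g' x"
proof -
  note L = assms[THEN is_greenD(1)]
  have "AE x in lborel. g x - g' x = 0"
  proof (rule homogeneous_unique[OF Lp_2_diff(1)[OF L]])
    fix \<psi> assume t: "test_fun \<psi>"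
    have "(\<lambda>x. - laplacian \<psi> x + \<psi> x) \<in> Lp 2"
      using Lp_2_lincomb[OF test_fun_Lp_2[OF test_fun_laplacian[OF t]] test_fun_Lp_2[OF t], of "- 1" 1] by simp
    from Lp_2_mult_integrable(1)[OF L(1) this] Lp_2_mult_integrable(1)[OF L(2) this]
    show "(\<integral>x. (g x - g' x) * (- laplacian \<psi> x + \<psi> x) \<partial>lborel) = 0"
      using is_greenD(2)[OF assms(1) t] is_greenD(2)[OF assms(2) t] by (simp add: left_diff_distrib)
  qed
  then show ?thesis by eventually_elim simp
qed

section \<open>The heat kernel and the representation of the Green's function\<close>

definition heat :: "real \<Rightarrow> real ^ 2 \<Rightarrow> real" where
  "heat t x = exp (- (norm x)\<^sup>2 / (4 * t)) / (4 * pi * t)"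

lemma heat_nonneg: "0 < t \<Longrightarrow> 0 \<le> heat t x"
  by (simp add: heat_def)

lemma heat_measurable [measurable]: "(\<lambda>p. heat (f p) (g p)) \<in> borel_measurable M"
  if [measurable]: "f \<in> borel_measurable M" "g \<in> borel_measurable M"
  unfolding heat_def by measurable

text \<open>Each coordinate is Gaussian with variance 2 t; this brings the total mass down to
  dimension one.\<close>

lemma heat_normal_density:
  assumes "0 < t" shows "heat t x = (\<Prod>b\<in>Basis. normal_density 0 (sqrt (2 * t)) (x \<bullet> b))"
proof -
  have "(norm x)\<^sup>2 = x \<bullet> x" by (rule power2_norm_eq_inner)
  also have "\<dots> = (\<Sum>b\<in>Basis. (x \<bullet> b)\<^sup>2)"
    unfolding euclidean_inner[of x x] power2_eq_square ..
  finally have "(norm x)\<^sup>2 = (\<Sum>b\<in>Basis. (x \<bullet> b)\<^sup>2)" .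
  then have "exp (- (norm x)\<^sup>2 / (4 * t)) = (\<Prod>b\<in>Basis. exp (- (x \<bullet> b)\<^sup>2 / (4 * t)))"
    by (simp add: exp_sum[symmetric] sum_negf sum_divide_distrib)
  moreover have "(\<Prod>b\<in>(Basis :: (real ^ 2) set). 1 / sqrt (2 * pi * (2 * t))) = 1 / (4 * pi * t)"
    using assms by (simp add: power_divide)
  ultimately show ?thesis
    unfolding heat_def normal_density_def using assms by (simp add: prod.distrib prod_dividef)
qed

lemma heat_integral:
  assumes "0 < t" shows "integrable lborel (heat t)" "(\<integral>x. heat t x \<partial>lborel) = 1"
proof -
  have "(\<integral>\<^sup>+x. ennreal (heat t x) \<partial>lborel) = (\<integral>\<^sup>+x. (\<Prod>b\<in>Basis. ennreal (normal_density 0 (sqrt (2 * t)) (x \<bullet> b))) \<partial>(lborel :: (real ^ 2) measure))"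
    using assms by (simp add: heat_normal_density prod_ennreal)
  also have "\<dots> = (\<Prod>b\<in>(Basis :: (real ^ 2) set). \<integral>\<^sup>+x. ennreal (normal_density 0 (sqrt (2 * t)) x) \<partial>lborel)"
    by (rule nn_integral_lborel_prod) auto
  also have "\<dots> = 1" using assms by (simp add: nn_integral_eq_integral)
  finally have n: "(\<integral>\<^sup>+x. ennreal (heat t x) \<partial>lborel) = ennreal 1" by simp
  have hm: "heat t \<in> borel_measurable lborel" by measurable
  show "integrable lborel (heat t)"
    using n heat_nonneg[OF assms] by (intro integrableI_nonneg hm) auto
  then show "(\<integral>x. heat t x \<partial>lborel) = 1"
    using n heat_nonneg[OF assms] by (simp add: nn_integral_eq_integral)
qed

text \<open>The semigroup law: the convolution square of the kernel at time t is the kernel at time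
  2 t, by completing the square at the midpoint of 0 and - z.\<close>

lemma heat_product:
  assumes "0 < t"
  shows "integrable lborel (\<lambda>x. heat t x * heat t (x + z))"
    "(\<integral>x. heat t x * heat t (x + z) \<partial>lborel) = heat (2 * t) z"
proof -
  have n: "(norm x)\<^sup>2 + (norm (x + z))\<^sup>2 = 2 * (norm (x + (1 / 2) *\<^sub>R z))\<^sup>2 + (norm z)\<^sup>2 / 2" for x
    by (simp add: power2_norm_eq_inner inner_add_left inner_add_right inner_commute field_simps)
  have e: "heat t x * heat t (x + z) = heat (2 * t) z * heat (t / 2) (x + (1 / 2) *\<^sub>R z)" for x
  proof -
    have "- (norm x)\<^sup>2 / (4 * t) + - (norm (x + z))\<^sup>2 / (4 * t) = - ((norm x)\<^sup>2 + (norm (x + z))\<^sup>2) / (4 * t)"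
      by (simp add: add_divide_distrib diff_divide_distrib)
    also have "\<dots> = - (norm z)\<^sup>2 / (4 * (2 * t)) + - (norm (x + (1 / 2) *\<^sub>R z))\<^sup>2 / (4 * (t / 2))"
      unfolding n using assms by (simp add: field_simps)
    finally have "exp (- (norm x)\<^sup>2 / (4 * t)) * exp (- (norm (x + z))\<^sup>2 / (4 * t))
      = exp (- (norm z)\<^sup>2 / (4 * (2 * t))) * exp (- (norm (x + (1 / 2) *\<^sub>R z))\<^sup>2 / (4 * (t / 2)))"
      by (simp only: exp_add[symmetric])
    then show ?thesis unfolding heat_def using assms by simp
  qed
  have t: "0 < t / 2" using assms by simp
  have m: "heat (t / 2) \<in> borel_measurable borel" by measurable
  show "integrable lborel (\<lambda>x. heat t x * heat t (x + z))"
    unfolding e using heat_integral(1)[OF t] lborel_integral_shift(2)[OF m, of "(1 / 2) *\<^sub>R z"] by simp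
  show "(\<integral>x. heat t x * heat t (x + z) \<partial>lborel) = heat (2 * t) z"
    unfolding e using heat_integral(2)[OF t] lborel_integral_shift(1)[OF m, of "(1 / 2) *\<^sub>R z"] by simp
qed

lemma one_minus_exp_le_powr:
  fixes x :: real
  assumes "0 \<le> x" "0 < b" "b \<le> 1" shows "1 - exp (- x) \<le> x powr b"
proof (cases "x \<le> 1")
  case True
  have "1 - exp (- x) \<le> x" using exp_ge_add_one_self[of "- x"] by simp
  also have "x \<le> x powr b" using powr_mono'[of b 1 x] True assms by simp
  finally show ?thesis .
next
  case False
  then have "1 \<le> x powr b" using assms by (intro ge_one_powr_ge_zero) auto
  then show ?thesis using exp_gt_zero[of "- x"] by linarith
qed

text \<open>Expanding the square and using the semigroup law leaves (1 - exp(-|z|^2 / (8 t))) / (4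
  pi t). The power |z|^a then interpolates between the bounds 1 and x for 1 - exp(-x).\<close>

lemma heat_translate:
  assumes t: "0 < t" and a: "0 < a" "a < 2"
  shows "integrable lborel (\<lambda>x. (heat t (x + z) - heat t x)\<^sup>2)"
    and "(\<integral>x. (heat t (x + z) - heat t x)\<^sup>2 \<partial>lborel) \<le> t powr (- 1 - a / 2) * norm z powr a"
proof -
  have m: "(\<lambda>x. heat t x * heat t (x + 0)) \<in> borel_measurable borel" by measurable
  have i: "integrable lborel (\<lambda>x. heat t (x + z) * heat t (x + z))"
    and I: "(\<integral>x. heat t (x + z) * heat t (x + z) \<partial>lborel) = heat (2 * t) 0"
    using lborel_integral_shift[OF m, of z] heat_product[OF t, of 0] by simp_all
  have e: "(heat t (x + z) - heat t x)\<^sup>2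
      = heat t (x + z) * heat t (x + z) + heat t x * heat t (x + 0) - 2 * (heat t x * heat t (x + z))" for x
    by (simp add: power2_eq_square algebra_simps)
  show "integrable lborel (\<lambda>x. (heat t (x + z) - heat t x)\<^sup>2)"
    unfolding e using i heat_product(1)[OF t] by (intro Bochner_Integration.integrable_diff Bochner_Integration.integrable_add integrable_mult_right)
  have "(\<integral>x. (heat t (x + z) - heat t x)\<^sup>2 \<partial>lborel) = heat (2 * t) 0 + heat (2 * t) 0 - 2 * heat (2 * t) z"
    unfolding e using i I heat_product[OF t, of 0] heat_product[OF t, of z]
    by (subst Bochner_Integration.integral_diff Bochner_Integration.integral_add; simp)+
  also have "\<dots> = 1 / (4 * pi * t) * (1 - exp (- ((norm z)\<^sup>2 / (8 * t))))"
    using t by (simp add: heat_def field_simps)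
  also have "\<dots> \<le> 1 / t * ((norm z)\<^sup>2 / t) powr (a / 2)"
  proof (rule mult_mono)
    have "1 * t \<le> 4 * pi * t" using t pi_gt3 by (intro mult_right_mono) auto
    then show "1 / (4 * pi * t) \<le> 1 / t" using t by (intro divide_left_mono) auto
    have "1 - exp (- ((norm z)\<^sup>2 / (8 * t))) \<le> ((norm z)\<^sup>2 / (8 * t)) powr (a / 2)"
      using t a by (intro one_minus_exp_le_powr) auto
    also have "\<dots> \<le> ((norm z)\<^sup>2 / t) powr (a / 2)"
      using t a by (intro powr_mono2 divide_left_mono) auto
    finally show "1 - exp (- ((norm z)\<^sup>2 / (8 * t))) \<le> ((norm z)\<^sup>2 / t) powr (a / 2)" .
  qed (use t in auto)
  also have "\<dots> = t powr (- 1 - a / 2) * norm z powr a"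
  proof -
    have "((norm z)\<^sup>2) powr (a / 2) = norm z powr a"
      using powr_powr[of "norm z" 2 "a / 2"] by simp
    moreover have "t powr (- 1 - a / 2) = 1 / t * (1 / t powr (a / 2))"
      using t by (simp add: powr_diff powr_minus_divide)
    ultimately show ?thesis using t by (simp add: powr_divide)
  qed
  finally show "(\<integral>x. (heat t (x + z) - heat t x)\<^sup>2 \<partial>lborel) \<le> t powr (- 1 - a / 2) * norm z powr a" .
qed

text \<open>Integrability of the time weights below, from the Gamma integral.\<close>

lemma exp_powr_integrable:
  assumes "s < 1" shows "integrable lborel (\<lambda>t::real. indicator {0<..} t * (exp (- t) * t powr (- s)))"
proof (rule integrableI_nonneg)
  have h: "((\<lambda>t. t powr (1 - s - 1) / exp t) has_integral Gamma (1 - s)) {0..}"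
    using Gamma_integral_real[of "1 - s"] assms by simp
  have "(\<integral>\<^sup>+t. ennreal (indicator {0<..} t * (exp (- t) * t powr (- s))) \<partial>lborel)
      \<le> (\<integral>\<^sup>+t. ennreal (t powr (1 - s - 1) / exp t) * indicator {0..} t \<partial>lborel)"
    by (intro nn_integral_mono) (auto simp: exp_minus field_simps split: split_indicator)
  also have "\<dots> = ennreal (Gamma (1 - s))"
    by (rule nn_integral_has_integral_lebesgue'[OF _ h]) auto
  finally show "(\<integral>\<^sup>+t. ennreal (indicator {0<..} t * (exp (- t) * t powr (- s))) \<partial>lborel) < \<infinity>"
    by (metis ennreal_less_top infinity_ennreal_def order_le_less_trans)
qed auto

lemma AE_lborel_shift:
  assumes "AE x in lborel. P x" shows "AE x in lborel. P (x + z :: 'a::euclidean_space)"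
proof -
  obtain N where N: "{x \<in> space lborel. \<not> P x} \<subseteq> N" "emeasure lborel N = 0" "N \<in> sets lborel"
    using AE_E[OF assms] by metis
  have "AE x in distr lborel borel ((+) z). x \<notin> N"
    unfolding lborel_distr_plus using N(2,3) by (intro AE_not_in) auto
  then have "AE x in lborel. z + x \<notin> N"
    using N(3) by (subst (asm) AE_distr_iff) auto
  then show ?thesis by eventually_elim (use N(1) in \<open>auto simp: add.commute\<close>)
qed

text \<open>The Laplace transform at 1 of the heat semigroup, that is, the kernel of the resolvent
  (-\<Delta> + 1)^(-1).\<close>

definition heat_green :: fn where
  "heat_green x = (\<integral>t. of_real (indicator {0<..} t * (exp (- t) * heat t x)) \<partial>lborel)"

lemma heat_green_Lp_2:
  "heat_green \<in> Lp 2"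
  "AE x in lborel. integrable lborel (\<lambda>t. complex_of_real (indicator {0<..} t * (exp (- t) * heat t x)))"
proof -
  \<comment> \<open>The L^2 norm of \<open>heat t\<close> is of order t^(-1/2). Moving that power
    into the weight \<open>r\<close> makes all slices of \<open>F\<close> bounded in L^2 and keeps
    \<open>r\<close> integrable.\<close>
  define r :: "real \<Rightarrow> complex" where "r t = of_real (indicator {0<..} t * (exp (- t) * t powr (- (1 / 2))))" for t
  define F :: "real ^ 2 \<Rightarrow> real \<Rightarrow> complex" where "F x t = of_real (heat t x * t powr (1 / 2))" for x t
  have m: "(\<lambda>(x, t). F x t) \<in> borel_measurable (lborel \<Otimes>\<^sub>M lborel)" unfolding F_def by measurable
  have r: "integrable lborel r" unfolding r_def[abs_def] by (intro integrable_of_real exp_powr_integrable) simp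
  have "(\<integral>\<^sup>+x. ennreal ((norm (F x t))\<^sup>2) \<partial>lborel) \<le> ennreal 1" if "r t \<noteq> 0" for t
  proof -
    have t: "0 < t" using that by (auto simp: r_def split: split_indicator_asm)
    have e: "(norm (F x t))\<^sup>2 = t * (heat t x * heat t (x + 0))" for x
    proof -
      have "(norm (F x t))\<^sup>2 = (heat t x)\<^sup>2 * (t powr (1 / 2))\<^sup>2" unfolding F_def norm_of_real power2_abs power_mult_distrib ..
      then show ?thesis using t by (simp add: powr_half_sqrt power2_eq_square)
    qed
    have "(\<integral>\<^sup>+x. ennreal ((norm (F x t))\<^sup>2) \<partial>lborel) = ennreal (\<integral>x. t * (heat t x * heat t (x + 0)) \<partial>lborel)"
      unfolding e using heat_product(1)[OF t, of 0] t heat_nonneg[OF t]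
      by (intro nn_integral_eq_integral) (auto simp del: add_0_right)
    also have "(\<integral>x. t * (heat t x * heat t (x + 0)) \<partial>lborel) = t * heat (2 * t) 0"
      using heat_product(2)[OF t, of 0] by simp
    also have "ennreal (t * heat (2 * t) 0) \<le> ennreal 1"
      using t pi_gt3 by (intro ennreal_leI) (simp add: heat_def)
    finally show ?thesis .
  qed
  from average_L2(1,3)[OF m r _ this]
  have 1: "(\<lambda>x. \<integral>t. r t * F x t \<partial>lborel) \<in> Lp 2" "AE x in lborel. integrable lborel (\<lambda>t. r t * F x t)" by auto
  have e: "r t * F x t = of_real (indicator {0<..} t * (exp (- t) * heat t x))" for x t
  proof (cases "0 < t")
    case True
    then have "t powr (- (1 / 2)) * t powr (1 / 2) = 1" by (simp flip: powr_add)
    then have "exp (- t) * t powr (- (1 / 2)) * (heat t x * t powr (1 / 2)) = exp (- t) * heat t x"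
      by (simp only: ac_simps)
    then have "indicator {0<..} t * (exp (- t) * t powr (- (1 / 2))) * (heat t x * t powr (1 / 2)) = indicator {0<..} t * (exp (- t) * heat t x)"
      by (simp only: mult.assoc)
    then show ?thesis unfolding r_def F_def by (simp only: of_real_mult[symmetric])
  qed (simp add: r_def)
  show "heat_green \<in> Lp 2" using 1(1) unfolding e heat_green_def[abs_def] .
  show "AE x in lborel. integrable lborel (\<lambda>t. complex_of_real (indicator {0<..} t * (exp (- t) * heat t x)))"
    using 1(2) unfolding e .
qed

lemma heat_green_modulus:
  assumes a: "0 < a" "a < 2" shows "\<exists>C\<ge>0. modulus a C heat_green"
proof -
  \<comment> \<open>The differences of \<open>heat t\<close> have L^2 norm of order t^(-1/2 - a/4),
    hence this exponent; t^(-s) is integrable at 0 precisely when a < 2.\<close>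
  define s where "s = 1 / 2 + a / 4"
  define r :: "real \<Rightarrow> complex" where "r t = of_real (indicator {0<..} t * (exp (- t) * t powr (- s)))" for t
  have r: "integrable lborel r" unfolding r_def[abs_def] s_def using a by (intro integrable_of_real exp_powr_integrable) simp
  define C where "C = (\<integral>t. norm (r t) \<partial>lborel)\<^sup>2"
  have "sq (\<lambda>x. heat_green (x + z) - heat_green x) \<le> C * norm z powr a" for z
  proof -
    define F :: "real ^ 2 \<Rightarrow> real \<Rightarrow> complex" where "F x t = of_real ((heat t (x + z) - heat t x) * t powr s)" for x t
    have m: "(\<lambda>(x, t). F x t) \<in> borel_measurable (lborel \<Otimes>\<^sub>M lborel)" unfolding F_def by measurable
    have "(\<integral>\<^sup>+x. ennreal ((norm (F x t))\<^sup>2) \<partial>lborel) \<le> ennreal (norm z powr a)" if "r t \<noteq> 0" for t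
    proof -
      have t: "0 < t" using that by (auto simp: r_def split: split_indicator_asm)
      have ts: "(t powr s)\<^sup>2 = t powr (1 + a / 2)"
        unfolding power2_eq_square powr_add[symmetric] s_def by simp
      have e: "(norm (F x t))\<^sup>2 = t powr (1 + a / 2) * (heat t (x + z) - heat t x)\<^sup>2" for x
        unfolding F_def norm_of_real power2_abs power_mult_distrib ts by simp
      have "(\<integral>\<^sup>+x. ennreal ((norm (F x t))\<^sup>2) \<partial>lborel)
          = ennreal (\<integral>x. t powr (1 + a / 2) * (heat t (x + z) - heat t x)\<^sup>2 \<partial>lborel)"
        unfolding e using heat_translate(1)[OF t a, of z] by (intro nn_integral_eq_integral) auto
      also have "\<dots> \<le> ennreal (t powr (1 + a / 2) * (t powr (- 1 - a / 2) * norm z powr a))"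
        using heat_translate(2)[OF t a, of z] by (intro ennreal_leI) (auto intro!: mult_left_mono)
      also have "t powr (1 + a / 2) * (t powr (- 1 - a / 2) * norm z powr a) = norm z powr a"
        using t by (simp add: mult.assoc[symmetric] powr_add[symmetric])
      finally show ?thesis .
    qed
    from average_L2(1,2)[OF m r _ this]
    have 1: "(\<lambda>x. \<integral>t. r t * F x t \<partial>lborel) \<in> Lp 2" "sq (\<lambda>x. \<integral>t. r t * F x t \<partial>lborel) \<le> C * norm z powr a"
      unfolding C_def by auto
    let ?H = "\<lambda>x t. complex_of_real (indicator {0<..} t * (exp (- t) * heat t x))"
    have e: "r t * F x t = ?H (x + z) t - ?H x t" for x t
    proof (cases "0 < t")
      case True
      then have "t powr (- s) * t powr s = 1" by (simp flip: powr_add)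
      moreover have "exp (- t) * t powr (- s) * ((heat t (x + z) - heat t x) * t powr s)
          = exp (- t) * (heat t (x + z) - heat t x) * (t powr (- s) * t powr s)"
        by (simp only: ac_simps)
      ultimately have "exp (- t) * t powr (- s) * ((heat t (x + z) - heat t x) * t powr s) = exp (- t) * heat t (x + z) - exp (- t) * heat t x"
        by (simp add: right_diff_distrib)
      then have "indicator {0<..} t * (exp (- t) * t powr (- s)) * ((heat t (x + z) - heat t x) * t powr s)
          = indicator {0<..} t * (exp (- t) * heat t (x + z)) - indicator {0<..} t * (exp (- t) * heat t x)"
        by (simp only: mult.assoc right_diff_distrib[symmetric])
      then show ?thesis unfolding r_def F_def by (simp only: of_real_mult[symmetric] of_real_diff[symmetric])
    qed (simp add: r_def)
    have ae: "AE x in lborel. integrable lborel (?H (x + z))"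
      by (rule AE_lborel_shift[OF heat_green_Lp_2(2)])
    have "AE x in lborel. heat_green (x + z) - heat_green x = (\<integral>t. r t * F x t \<partial>lborel)"
      using heat_green_Lp_2(2) ae by eventually_elim (simp add: e heat_green_def)
    with Lp_2_measurable[OF Lp_2_diff(1)[OF Lp_2_shift(1)[OF heat_green_Lp_2(1)] heat_green_Lp_2(1)]] Lp_2_measurable[OF 1(1)]
    have "sq (\<lambda>x. heat_green (x + z) - heat_green x) = sq (\<lambda>x. \<integral>t. r t * F x t \<partial>lborel)"
      by (rule sq_cong_AE)
    then show ?thesis using 1(2) by simp
  qed
  then show ?thesis unfolding modulus_def C_def by (intro exI[of _ C]) (auto simp: C_def)
qed

lemma heat_has_derivative:
  assumes "0 < t"
  shows "(heat t has_derivative (\<lambda>h. - (x \<bullet> h) / (2 * t) * heat t x)) (at x)"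
  unfolding heat_def power2_norm_eq_inner
  by (rule derivative_eq_intros refl | simp)+ (use assms in \<open>auto simp: inner_commute field_simps\<close>)

lemma heat_continuous: "0 < t \<Longrightarrow> continuous_on UNIV (heat t)"
  by (rule continuous_at_imp_continuous_on) (blast intro: has_derivative_continuous heat_has_derivative)

lemma heat_test_integrable:
  assumes t: "0 < t" and \<psi>: "test_fun \<psi>"
  shows "integrable lborel (\<lambda>x. complex_of_real (heat t x) * \<psi> x)"
proof -
  obtain R where R: "\<And>x. R < norm x \<Longrightarrow> \<psi> x = 0" using \<psi> test_fun_support by metis
  show ?thesis
    by (rule compact_support_integrable[where R = R])
       (use R smooth_continuous[OF test_fun_smooth[OF \<psi>]] in \<open>auto intro!: continuous_intros heat_continuous[OF t]\<close>)
qed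

lemma heat_pderiv:
  assumes t: "0 < t"
  shows "(\<lambda>x. complex_of_real (heat t x)) differentiable (at x)"
    and "pderiv i (\<lambda>x. of_real (heat t x)) = (\<lambda>x. of_real (- (x $ i) / (2 * t) * heat t x))"
    and "(\<lambda>x. complex_of_real (- (x $ i) / (2 * t) * heat t x)) differentiable (at x)"
    and "pderiv i (\<lambda>x. of_real (- (x $ i) / (2 * t) * heat t x))
      = (\<lambda>x. of_real ((- 1 / (2 * t) + (x $ i)\<^sup>2 / (4 * t\<^sup>2)) * heat t x))"
proof -
  have d: "((\<lambda>x. complex_of_real (heat t x)) has_derivative (\<lambda>h. of_real (- (x \<bullet> h) / (2 * t) * heat t x))) (at x)" for x
    by (rule has_derivative_of_real[OF heat_has_derivative[OF t]])
  then show "(\<lambda>x. complex_of_real (heat t x)) differentiable (at x)" by (rule differentiableI)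
  show "pderiv i (\<lambda>x. of_real (heat t x)) = (\<lambda>x. of_real (- (x $ i) / (2 * t) * heat t x))"
    using pderivI[OF d] by (auto simp: inner_axis)
  have "((\<lambda>x. - (x $ i) / (2 * t) * heat t x) has_derivative
      (\<lambda>h. - (x $ i) / (2 * t) * (- (x \<bullet> h) / (2 * t) * heat t x) + - (h $ i) / (2 * t) * heat t x)) (at x)" for x
    using t by (intro has_derivative_mult heat_has_derivative) (auto intro!: derivative_eq_intros bounded_linear_imp_has_derivative[OF bounded_linear_vec_nth])
  from has_derivative_of_real[OF this]
  have d2: "((\<lambda>x. complex_of_real (- (x $ i) / (2 * t) * heat t x)) has_derivative
      (\<lambda>h. of_real (- (x $ i) / (2 * t) * (- (x \<bullet> h) / (2 * t) * heat t x) + - (h $ i) / (2 * t) * heat t x))) (at x)" for x .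
  then show "(\<lambda>x. complex_of_real (- (x $ i) / (2 * t) * heat t x)) differentiable (at x)" by (rule differentiableI)
  have e: "- (x $ i) / (2 * t) * (- (x \<bullet> axis i 1) / (2 * t) * heat t x) + - (axis i 1 $ i) / (2 * t) * heat t x
      = (- 1 / (2 * t) + (x $ i)\<^sup>2 / (4 * t\<^sup>2)) * heat t x" for x
    by (simp add: inner_axis power2_eq_square field_simps)
  show "pderiv i (\<lambda>x. of_real (- (x $ i) / (2 * t) * heat t x))
      = (\<lambda>x. of_real ((- 1 / (2 * t) + (x $ i)\<^sup>2 / (4 * t\<^sup>2)) * heat t x))"
    by (intro ext) (simp only: pderivI[OF d2] e)
qed

text \<open>Two integrations by parts in each variable; on the right the heat kernel has been
  replaced by its image under 1 - \<Delta>.\<close>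

lemma heat_laplacian:
  assumes t: "0 < t" and \<psi>: "test_fun \<psi>"
  shows "(\<integral>x. of_real (heat t x) * (- laplacian \<psi> x + \<psi> x) \<partial>lborel)
    = (\<integral>x. of_real ((1 + 1 / t - (norm x)\<^sup>2 / (4 * t\<^sup>2)) * heat t x) * \<psi> x \<partial>lborel)"
proof -
  have ch: "continuous_on UNIV (heat t)"
    by (rule heat_continuous[OF t])
  have c2: "continuous_on UNIV (\<lambda>x. complex_of_real (- (x $ i) / (2 * t) * heat t x))"
    "continuous_on UNIV (\<lambda>x. complex_of_real ((- 1 / (2 * t) + (x $ i)\<^sup>2 / (4 * t\<^sup>2)) * heat t x))" for i
    using t by (auto intro!: continuous_intros ch)
  obtain R where R: "\<And>x. R < norm x \<Longrightarrow> \<psi> x = 0" using \<psi> test_fun_support by metis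
  have R2: "pderiv i (pderiv i \<psi>) x = 0" if "R < norm x" for x i
    by (rule pderiv_outside_support[where R = R]) (use that R pderiv_outside_support[where R = R] in auto)
  have c\<psi>: "continuous_on UNIV \<psi>" "continuous_on UNIV (pderiv i (pderiv i \<psi>))" for i
    using \<psi> test_fun_pderiv test_fun_smooth smooth_continuous by blast+
  let ?q = "\<lambda>i x. complex_of_real ((- 1 / (2 * t) + (x $ i)\<^sup>2 / (4 * t\<^sup>2)) * heat t x)"
  have ibp: "(\<integral>x. of_real (heat t x) * pderiv i (pderiv i \<psi>) x \<partial>lborel) = (\<integral>x. ?q i x * \<psi> x \<partial>lborel)" for i
    using integral_by_parts[OF test_fun_pderiv[OF \<psi>], of "\<lambda>x. of_real (heat t x)" i i]
      integral_by_parts[OF \<psi>, of "\<lambda>x. of_real (- (x $ i) / (2 * t) * heat t x)" i]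
      heat_pderiv[OF t] c2 by simp
  have int: "integrable lborel (\<lambda>x. of_real (heat t x) * pderiv i (pderiv i \<psi>) x)"
    "integrable lborel (\<lambda>x. of_real (heat t x) * \<psi> x)" "integrable lborel (\<lambda>x. ?q i x * \<psi> x)" for i
    by (rule compact_support_integrable[where R = R]; use t R R2 in \<open>auto intro!: continuous_intros ch c\<psi>\<close>)+
  have "(\<integral>x. of_real (heat t x) * (- laplacian \<psi> x + \<psi> x) \<partial>lborel)
      = (\<integral>x. (\<Sum>i\<in>UNIV. - (of_real (heat t x) * pderiv i (pderiv i \<psi>) x)) + of_real (heat t x) * \<psi> x \<partial>lborel)"
    by (simp add: laplacian_def distrib_left sum_distrib_left sum_negf right_diff_distrib)
  also have "\<dots> = (\<Sum>i\<in>UNIV. - (\<integral>x. ?q i x * \<psi> x \<partial>lborel)) + (\<integral>x. of_real (heat t x) * \<psi> x \<partial>lborel)"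
    using int(1,2) ibp by simp
  also have "\<dots> = (\<integral>x. (\<Sum>i\<in>UNIV. - (?q i x * \<psi> x)) + of_real (heat t x) * \<psi> x \<partial>lborel)"
    using int(2,3) by simp
  also have "\<dots> = (\<integral>x. of_real ((1 + 1 / t - (norm x)\<^sup>2 / (4 * t\<^sup>2)) * heat t x) * \<psi> x \<partial>lborel)"
  proof (rule Bochner_Integration.integral_cong[OF refl])
    fix x :: "real ^ 2"
    have "(norm x)\<^sup>2 = (x $ 1)\<^sup>2 + (x $ 2)\<^sup>2"
      by (simp add: norm_vec_def L2_set_def sum_2)
    then have c: "1 + 1 / t - (norm x)\<^sup>2 / (4 * t\<^sup>2)
      = - (- 1 / (2 * t) + (x $ 1)\<^sup>2 / (4 * t\<^sup>2)) - (- 1 / (2 * t) + (x $ 2)\<^sup>2 / (4 * t\<^sup>2)) + 1"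
      by (simp add: add_divide_distrib)
    show "(\<Sum>i\<in>UNIV. - (?q i x * \<psi> x)) + of_real (heat t x) * \<psi> x
        = of_real ((1 + 1 / t - (norm x)\<^sup>2 / (4 * t\<^sup>2)) * heat t x) * \<psi> x"
      unfolding sum_2 c by (simp add: algebra_simps)
  qed
  finally show ?thesis .
qed

text \<open>This is the heat equation: exp(-t) times (1 - \<Delta>) of the kernel is minus the time
  derivative of exp(-t) times the kernel.\<close>

lemma heat_time_derivative:
  assumes "0 < t"
  shows "((\<lambda>t. - (exp (- t) * heat t x)) has_real_derivative
    exp (- t) * ((1 + 1 / t - (norm x)\<^sup>2 / (4 * t\<^sup>2)) * heat t x)) (at t)"
  unfolding heat_def using assms
  by (auto intro!: derivative_eq_intros simp: field_simps power2_eq_square)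

text \<open>Fubini and the fundamental theorem of calculus in time. The interval stays away from t =
  0, where the kernel is unbounded.\<close>

lemma heat_slab:
  assumes s: "0 < s" "s \<le> T" and \<psi>: "test_fun \<psi>"
  shows "(\<integral>t. indicator {s..T} t *\<^sub>R (of_real (exp (- t)) * (\<integral>x. of_real (heat t x) * (- laplacian \<psi> x + \<psi> x) \<partial>lborel)) \<partial>lborel)
    = of_real (exp (- s)) * (\<integral>x. of_real (heat s x) * \<psi> x \<partial>lborel) - of_real (exp (- T)) * (\<integral>x. of_real (heat T x) * \<psi> x \<partial>lborel)"
proof -
  define k where "k t x = exp (- t) * ((1 + 1 / t - (norm x)\<^sup>2 / (4 * t\<^sup>2)) * heat t x)" for t and x :: "real ^ 2"
  obtain R where R: "0 < R" "\<And>x. R < norm x \<Longrightarrow> \<psi> x = 0" using \<psi> test_fun_support by metis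
  have c\<psi>: "continuous_on UNIV \<psi>" using \<psi> test_fun_smooth smooth_continuous by blast
  obtain B where B: "0 < B" "\<And>x. norm (\<psi> x) \<le> B * indicator (cball 0 R) x"
    using compact_support_bounded[OF c\<psi> R(2)] by metis
  have [measurable]: "\<psi> \<in> borel_measurable borel" using c\<psi> borel_measurable_continuous_onI by auto
  define f :: "real \<times> (real ^ 2) \<Rightarrow> complex" where "f = (\<lambda>(t, x). indicator {s..T} t *\<^sub>R (of_real (k t x) * \<psi> x))"
  have fm: "f \<in> borel_measurable (lborel \<Otimes>\<^sub>M lborel)" unfolding f_def k_def by measurable
  have [measurable]: "cball (0 :: real ^ 2) R \<in> sets borel" by simp
  \<comment> \<open>The polynomial factor and the prefactor of the kernel are estimated at t = s and
    |x| = R, the exponentials by 1.\<close>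
  define K where "K = (1 + 1 / s + R\<^sup>2 / (4 * s\<^sup>2)) * (1 / (4 * pi * s))"
  have K: "\<bar>k t x\<bar> \<le> K" if t: "s \<le> t" and x: "norm x \<le> R" for t x
  proof -
    have "\<bar>1 + 1 / t - (norm x)\<^sup>2 / (4 * t\<^sup>2)\<bar> \<le> 1 + 1 / t + (norm x)\<^sup>2 / (4 * t\<^sup>2)"
      using s t by (auto simp: abs_le_iff)
    also have "\<dots> \<le> 1 + 1 / s + R\<^sup>2 / (4 * s\<^sup>2)"
      using s t x by (intro add_mono frac_le mult_left_mono power_mono) auto
    finally have 1: "\<bar>1 + 1 / t - (norm x)\<^sup>2 / (4 * t\<^sup>2)\<bar> \<le> 1 + 1 / s + R\<^sup>2 / (4 * s\<^sup>2)" .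
    have 2: "\<bar>heat t x\<bar> \<le> 1 / (4 * pi * s)"
      unfolding heat_def using s t by (auto simp: abs_mult intro!: frac_le)
    have "\<bar>k t x\<bar> = exp (- t) * (\<bar>1 + 1 / t - (norm x)\<^sup>2 / (4 * t\<^sup>2)\<bar> * \<bar>heat t x\<bar>)"
      by (simp add: k_def abs_mult)
    also have "\<dots> \<le> 1 * K" unfolding K_def using s t 1 2 by (intro mult_mono) auto
    finally show ?thesis by simp
  qed
  have K0: "0 \<le> K" using K[of s 0] R(1) by simp
  have fb: "norm (f (t, x)) \<le> indicator {s..T} t * (K * B * indicator (cball 0 R) x)" for t x
  proof (cases "t \<in> {s..T} \<and> norm x \<le> R")
    case True
    then have "\<bar>k t x\<bar> * norm (\<psi> x) \<le> K * B"
      using K[of t x] B(2)[of x] K0 by (intro mult_mono) auto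
    then show ?thesis using True by (simp add: f_def norm_mult)
  qed (auto simp: f_def R(2))
  have int: "integrable (lborel \<Otimes>\<^sub>M lborel) f"
  proof (rule Bochner_Integration.integrable_bound[OF _ fm])
    have "integrable (lborel \<Otimes>\<^sub>M lborel) (\<lambda>(t, x). (indicator {s..T} t :: real) * (K * B * indicator (cball 0 R) (x :: real ^ 2)))"
    proof (rule lborel_pair.Fubini_integrable)
      have i: "integrable lborel (indicator {s..T} :: real \<Rightarrow> real)"
        by (intro integrable_real_indicator) (auto simp: emeasure_lborel_Icc_eq)
      show "integrable lborel (\<lambda>t. \<integral>x. norm (case (t, x) of (t, x) \<Rightarrow> indicator {s..T} t * (K * B * indicator (cball 0 R) (x :: real ^ 2))) \<partial>lborel)"
        using K0 B(1) i by (simp add: abs_mult)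
      show "AE t in lborel. integrable lborel (\<lambda>x. case (t, x) of (t, x) \<Rightarrow> indicator {s..T} t * (K * B * indicator (cball 0 R) (x :: real ^ 2)))"
        using integrable_cball_indicator by (simp add: mult.assoc[symmetric])
    qed measurable
    then show "integrable (lborel \<Otimes>\<^sub>M lborel) (\<lambda>p. (indicator {s..T} (fst p) :: real) * (K * B * indicator (cball 0 R) (snd p :: real ^ 2)))"
      by (simp add: case_prod_unfold)
    show "AE p in lborel \<Otimes>\<^sub>M lborel. norm (f p) \<le> norm ((indicator {s..T} (fst p) :: real) * (K * B * indicator (cball 0 R) (snd p)))"
    proof (intro AE_I2)
      fix p
      show "norm (f p) \<le> norm ((indicator {s..T} (fst p) :: real) * (K * B * indicator (cball 0 R) (snd p)))"
        using fb[of "fst p" "snd p"] by (auto intro: order_trans[OF _ abs_ge_self])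
    qed
  qed
  have inner: "(\<integral>x. f (t, x) \<partial>lborel) = indicator {s..T} t *\<^sub>R (of_real (exp (- t)) * (\<integral>x. of_real (heat t x) * (- laplacian \<psi> x + \<psi> x) \<partial>lborel))" for t
  proof (cases "t \<in> {s..T}")
    case True
    then have t: "0 < t" using s by simp
    show ?thesis unfolding heat_laplacian[OF t \<psi>] using True by (simp add: f_def k_def mult.assoc)
  next
    case False
    then have "indicator {s..T} t = (0 :: real)" by (rule indicator_simps(2))
    then show ?thesis unfolding f_def by (simp only: case_prod_conv scaleR_zero_left integral_zero)
  qed
  have outer: "(\<integral>t. f (t, x) \<partial>lborel) = (of_real (exp (- s) * heat s x) - of_real (exp (- T) * heat T x)) * \<psi> x" for x
  proof -
    have "(\<integral>t. indicator {s..T} t *\<^sub>R k t x \<partial>lborel) = - (exp (- T) * heat T x) - - (exp (- s) * heat s x)"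
    proof (rule integral_FTC_atLeastAtMost[OF s(2)])
      show "((\<lambda>t. - (exp (- t) * heat t x)) has_vector_derivative k t x) (at t within {s..T})" if "s \<le> t" for t
      proof -
        have "0 < t" using that s by simp
        from heat_time_derivative[OF this, of x]
        have "((\<lambda>t. - (exp (- t) * heat t x)) has_real_derivative k t x) (at t)" unfolding k_def .
        then show ?thesis
          by (rule has_vector_derivative_at_within[OF has_real_derivative_iff_has_vector_derivative[THEN iffD1]])
      qed
      show "continuous_on {s..T} (\<lambda>t. k t x)"
        unfolding k_def heat_def using s by (auto intro!: continuous_intros)
    qed
    then have "(\<integral>t. complex_of_real (indicator {s..T} t *\<^sub>R k t x) \<partial>lborel) = of_real (exp (- s) * heat s x) - of_real (exp (- T) * heat T x)"
      by (simp only: integral_complex_of_real) simp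
    moreover have "f (t, x) = complex_of_real (indicator {s..T} t *\<^sub>R k t x) * \<psi> x" for t
      by (simp add: f_def scaleR_conv_of_real)
    ultimately show ?thesis by simp
  qed
  have "(\<integral>t. (\<integral>x. f (t, x) \<partial>lborel) \<partial>lborel) = (\<integral>x. (\<integral>t. f (t, x) \<partial>lborel) \<partial>lborel)"
    by (rule lborel_pair.Fubini_integral[symmetric, where f = "\<lambda>t x. f (t, x)"]) (use int in simp)
  then show ?thesis
    unfolding inner outer using heat_test_integrable[OF _ \<psi>, of s] heat_test_integrable[OF _ \<psi>, of T] s
    by (simp add: left_diff_distrib mult.assoc)
qed

text \<open>An approximate identity: the substitution of sqrt(s) x for x moves the parameter into
  the test function.\<close>

lemma heat_tendsto:
  assumes \<psi>: "test_fun \<psi>" and s: "\<And>n. 0 < s n" "s \<longlonglongrightarrow> 0"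
  shows "(\<lambda>n. \<integral>x. of_real (heat (s n) x) * \<psi> x \<partial>lborel) \<longlonglongrightarrow> \<psi> 0"
proof -
  have c\<psi>: "continuous_on UNIV \<psi>" using \<psi> test_fun_smooth smooth_continuous by blast
  have [measurable]: "\<psi> \<in> borel_measurable borel" using c\<psi> borel_measurable_continuous_onI by auto
  obtain R where R: "\<And>x. R < norm x \<Longrightarrow> \<psi> x = 0" using \<psi> test_fun_support by metis
  obtain B where B: "\<And>x. norm (\<psi> x) \<le> B" using compact_support_bounded[OF c\<psi> R] by metis
  have e: "(\<integral>x. of_real (heat (s n) x) * \<psi> x \<partial>lborel) = (\<integral>x. of_real (heat 1 x) * \<psi> (sqrt (s n) *\<^sub>R x) \<partial>lborel)" for n
  proof -
    have m: "(\<lambda>x. complex_of_real (heat (s n) x) * \<psi> x) \<in> borel_measurable borel" by measurable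
    have h: "heat (s n) (sqrt (s n) *\<^sub>R x) = heat 1 x / s n" for x
      using s(1)[of n] by (simp add: heat_def power_mult_distrib field_simps)
    have "(\<integral>x. complex_of_real (heat (s n) (sqrt (s n) *\<^sub>R x)) * \<psi> (sqrt (s n) *\<^sub>R x) \<partial>lborel)
        = (1 / s n) *\<^sub>R (\<integral>x. of_real (heat (s n) x) * \<psi> x \<partial>lborel)"
      using lborel_integral_affine(1)[OF _ m, of "sqrt (s n)" 0] s(1)[of n] by simp
    moreover have "(\<integral>x. complex_of_real (heat (s n) (sqrt (s n) *\<^sub>R x)) * \<psi> (sqrt (s n) *\<^sub>R x) \<partial>lborel)
        = (\<integral>x. (1 / s n) *\<^sub>R (of_real (heat 1 x) * \<psi> (sqrt (s n) *\<^sub>R x)) \<partial>lborel)"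
      unfolding h by (intro Bochner_Integration.integral_cong refl) (simp add: scaleR_conv_of_real[where 'a = complex])
    ultimately show ?thesis using s(1)[of n] by simp
  qed
  have "(\<lambda>n. \<integral>x. of_real (heat 1 x) * \<psi> (sqrt (s n) *\<^sub>R x) \<partial>lborel) \<longlonglongrightarrow> (\<integral>x. of_real (heat 1 x) * \<psi> 0 \<partial>lborel)"
  proof (rule integral_dominated_convergence)
    show "integrable lborel (\<lambda>x. heat 1 x * B)" using heat_integral(1)[of 1] by simp
    have "(\<lambda>n. \<psi> (sqrt (s n) *\<^sub>R x)) \<longlonglongrightarrow> \<psi> (sqrt 0 *\<^sub>R x)" for x
    proof (rule isCont_tendsto_compose[where g = \<psi>])
      show "isCont \<psi> (sqrt 0 *\<^sub>R x)" using c\<psi> by (simp add: continuous_on_eq_continuous_at)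
      show "(\<lambda>n. sqrt (s n) *\<^sub>R x) \<longlonglongrightarrow> sqrt 0 *\<^sub>R x" by (intro tendsto_intros s(2))
    qed
    then show "AE x in lborel. (\<lambda>n. of_real (heat 1 x) * \<psi> (sqrt (s n) *\<^sub>R x)) \<longlonglongrightarrow> of_real (heat 1 x) * \<psi> 0"
      by (intro AE_I2 tendsto_intros) simp
    show "AE x in lborel. norm (of_real (heat 1 x) * \<psi> (sqrt (s n) *\<^sub>R x)) \<le> heat 1 x * B" for n
      using B heat_nonneg[of 1] by (auto simp: norm_mult intro!: mult_left_mono)
  qed measurable
  moreover have "(\<integral>x. of_real (heat 1 x) * \<psi> 0 \<partial>lborel) = \<psi> 0"
    using heat_integral[of 1] by simp
  ultimately show ?thesis unfolding e by (simp only:)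
qed

text \<open>The half-line t > 0 is exhausted by the slabs of \<open>heat_slab\<close>. The lower end
  contributes \<psi>(0) by \<open>heat_tendsto\<close>, and the upper end is killed by the factor
  exp(-T).\<close>

lemma is_green_heat_green: "is_green 1 heat_green"
  unfolding is_green_def
proof (intro conjI allI impI heat_green_Lp_2(1))
  fix \<psi> assume \<psi>: "test_fun \<psi>"
  define v where "v x = - laplacian \<psi> x + \<psi> x" for x
  have tv: "test_fun v"
    using test_fun_add[OF test_fun_cmult[OF test_fun_laplacian[OF \<psi>], of "- 1"] \<psi>] by (simp add: v_def[abs_def])
  have cv: "continuous_on UNIV v" using tv test_fun_smooth smooth_continuous by blast
  have [measurable]: "v \<in> borel_measurable borel" using cv borel_measurable_continuous_onI by auto
  obtain R where R: "\<And>x. R < norm x \<Longrightarrow> v x = 0" using tv test_fun_support by metis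
  obtain B where B: "0 < B" "\<And>x. norm (v x) \<le> B" using compact_support_bounded[OF cv R] by metis
  define J where "J t = (\<integral>x. of_real (heat t x) * v x \<partial>lborel)" for t
  have J: "norm (J t) \<le> B" and hv: "integrable lborel (\<lambda>x. complex_of_real (heat t x) * v x)"
    and hn: "(\<integral>x. norm (complex_of_real (heat t x) * v x) \<partial>lborel) \<le> B" if t: "0 < t" for t
  proof -
    have b: "norm (complex_of_real (heat t x) * v x) \<le> heat t x * B" for x
      using B heat_nonneg[OF t] by (auto simp: norm_mult intro!: mult_left_mono)
    have i: "integrable lborel (\<lambda>x. heat t x * B)" using heat_integral(1)[OF t] by simp
    show "integrable lborel (\<lambda>x. complex_of_real (heat t x) * v x)"
      by (rule Bochner_Integration.integrable_bound[OF i]) (use b in \<open>auto intro: order_trans[OF _ abs_ge_self]\<close>)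
    then have "(\<integral>x. norm (complex_of_real (heat t x) * v x) \<partial>lborel) \<le> (\<integral>x. heat t x * B \<partial>lborel)"
      using i b by (intro integral_mono) auto
    then show "(\<integral>x. norm (complex_of_real (heat t x) * v x) \<partial>lborel) \<le> B"
      using heat_integral(2)[OF t] by simp
    then show "norm (J t) \<le> B"
      unfolding J_def by (rule order_trans[OF integral_norm_bound])
  qed
  define r :: "real \<Rightarrow> real" where "r t = indicator {0<..} t * exp (- t)" for t
  have ri: "integrable lborel r"
  proof -
    have "(\<lambda>t::real. indicator {0<..} t * (exp (- t) * t powr (- 0))) = r"
      by (auto simp: r_def split: split_indicator)
    then show ?thesis using exp_powr_integrable[of 0] by simp
  qed
  have [measurable]: "r \<in> borel_measurable borel" unfolding r_def by measurable
  let ?f = "\<lambda>(t, x). complex_of_real (r t * heat t x) * v x"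
  have Jm [measurable]: "J \<in> borel_measurable borel"
  proof -
    have "J \<in> borel_measurable lborel"
      unfolding J_def by (rule lborel.borel_measurable_lebesgue_integral) measurable
    then show ?thesis by simp
  qed
  have int: "integrable (lborel \<Otimes>\<^sub>M lborel) ?f"
  proof (rule lborel_pair.Fubini_integrable)
    show "?f \<in> borel_measurable (lborel \<Otimes>\<^sub>M lborel)" by measurable
    show "AE t in lborel. integrable lborel (\<lambda>x. ?f (t, x))"
    proof (intro AE_I2)
      fix t
      show "integrable lborel (\<lambda>x. ?f (t, x))"
        using integrable_mult_right[of "complex_of_real (r t)", OF hv[of t]]
        by (cases "0 < t") (auto simp: r_def mult.assoc)
    qed
    have "integrable lborel (\<lambda>t. r t * (\<integral>x. norm (complex_of_real (heat t x) * v x) \<partial>lborel))"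
    proof (rule Bochner_Integration.integrable_bound)
      show "integrable lborel (\<lambda>t. r t * B)" using ri by simp
      show "AE t in lborel. norm (r t * (\<integral>x. norm (complex_of_real (heat t x) * v x) \<partial>lborel)) \<le> norm (r t * B)"
        using hn B(1) by (intro AE_I2) (auto simp: r_def abs_mult intro!: mult_left_mono split: split_indicator)
    qed measurable
    moreover have "(\<integral>x. norm (?f (t, x)) \<partial>lborel) = r t * (\<integral>x. norm (complex_of_real (heat t x) * v x) \<partial>lborel)" for t
      by (simp add: norm_mult abs_mult mult.assoc r_def split: split_indicator)
    ultimately show "integrable lborel (\<lambda>t. \<integral>x. norm (?f (t, x)) \<partial>lborel)" by (simp only:)
  qed
  have "(\<integral>x. heat_green x * v x \<partial>lborel) = (\<integral>x. (\<integral>t. ?f (t, x) \<partial>lborel) \<partial>lborel)"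
  proof -
    have "?f (t, x) = of_real (indicator {0<..} t * (exp (- t) * heat t x)) * v x" for t x
      by (simp add: r_def mult.assoc)
    then show ?thesis unfolding heat_green_def by (simp only: integral_mult_left_zero)
  qed
  also have "\<dots> = (\<integral>t. (\<integral>x. ?f (t, x) \<partial>lborel) \<partial>lborel)"
    by (rule lborel_pair.Fubini_integral[where f = "\<lambda>t x. ?f (t, x)"]) (use int in simp)
  also have "\<dots> = (\<integral>t. of_real (r t) * J t \<partial>lborel)"
    by (simp add: J_def mult.assoc)
  finally have G: "(\<integral>x. heat_green x * v x \<partial>lborel) = (\<integral>t. of_real (r t) * J t \<partial>lborel)" .
  define s where "s n = inverse (real (Suc n))" for n
  define T where "T n = real (Suc n)" for n
  have s: "0 < s n" "s n \<le> 1" "1 \<le> T n" for n by (auto simp: s_def T_def field_simps)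
  have s0: "s \<longlonglongrightarrow> 0" unfolding s_def by (rule LIMSEQ_inverse_real_of_nat)
  have Tinf: "filterlim T at_top sequentially"
    unfolding T_def by (rule filterlim_compose[OF filterlim_real_sequentially filterlim_Suc])
  define A where "A n = (\<integral>t. indicator {s n..T n} t *\<^sub>R (of_real (exp (- t)) * J t) \<partial>lborel)" for n
  have A1: "A \<longlonglongrightarrow> (\<integral>t. of_real (r t) * J t \<partial>lborel)"
    unfolding A_def
  proof (rule integral_dominated_convergence)
    show "integrable lborel (\<lambda>t. r t * B)" using ri by simp
    show "AE t in lborel. (\<lambda>n. indicator {s n..T n} t *\<^sub>R (of_real (exp (- t)) * J t)) \<longlonglongrightarrow> of_real (r t) * J t"
    proof (intro AE_I2 tendsto_eventually)
      fix t :: real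
      show "\<forall>\<^sub>F n in sequentially. indicator {s n..T n} t *\<^sub>R (of_real (exp (- t)) * J t) = of_real (r t) * J t"
      proof (cases "0 < t")
        case True
        have "\<forall>\<^sub>F n in sequentially. s n < t" using s0 True by (rule order_tendstoD)
        moreover have "\<forall>\<^sub>F n in sequentially. t \<le> T n" using Tinf by (simp add: filterlim_at_top)
        ultimately show ?thesis by eventually_elim (use True in \<open>simp add: r_def\<close>)
      next
        case False
        then have "t \<notin> {s n..T n}" for n using s(1)[of n] by auto
        then show ?thesis using False by (simp add: r_def)
      qed
    qed
    show "AE t in lborel. norm (indicator {s n..T n} t *\<^sub>R (of_real (exp (- t)) * J t)) \<le> r t * B" for n
    proof (intro AE_I2)
      fix t :: real
      show "norm (indicator {s n..T n} t *\<^sub>R (of_real (exp (- t)) * J t)) \<le> r t * B"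
        using J[of t] s(1)[of n] B(1) by (auto simp: r_def norm_mult split: split_indicator)
    qed
  qed measurable
  have A2: "A n = of_real (exp (- s n)) * (\<integral>x. of_real (heat (s n) x) * \<psi> x \<partial>lborel)
      - of_real (exp (- T n)) * (\<integral>x. of_real (heat (T n) x) * \<psi> x \<partial>lborel)" for n
    unfolding A_def J_def v_def using s[of n] by (intro heat_slab \<psi>) auto
  have h0: "(\<lambda>n. of_real (exp (- s n)) * (\<integral>x. of_real (heat (s n) x) * \<psi> x \<partial>lborel)) \<longlonglongrightarrow> of_real (exp (- 0)) * \<psi> 0"
    by (intro tendsto_intros s0 heat_tendsto \<psi> s)
  have h1: "(\<lambda>n. of_real (exp (- T n)) * (\<integral>x. of_real (heat (T n) x) * \<psi> x \<partial>lborel)) \<longlonglongrightarrow> 0"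
  proof -
    have c\<psi>: "continuous_on UNIV \<psi>" using \<psi> test_fun_smooth smooth_continuous by blast
    obtain R' where R': "\<And>x. R' < norm x \<Longrightarrow> \<psi> x = 0" using \<psi> test_fun_support by metis
    obtain B' where B': "\<And>x. norm (\<psi> x) \<le> B'" using compact_support_bounded[OF c\<psi> R'] by metis
    have "norm (\<integral>x. of_real (heat (T n) x) * \<psi> x \<partial>lborel) \<le> B'" for n
    proof -
      have t: "0 < T n" using s(3)[of n] by simp
      have "norm (\<integral>x. of_real (heat (T n) x) * \<psi> x \<partial>lborel) \<le> (\<integral>x. heat (T n) x * B' \<partial>lborel)"
      proof (rule Bochner_Integration.integral_norm_bound_integral)
        show "norm (of_real (heat (T n) x) * \<psi> x) \<le> heat (T n) x * B'" for x
          using B'[of x] heat_nonneg[OF t, of x] by (auto simp: norm_mult intro!: mult_left_mono)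
      qed (use heat_test_integrable[OF t \<psi>] heat_integral(1)[OF t] in auto)
      then show ?thesis using heat_integral(2)[OF t] by simp
    qed
    then have le: "norm (of_real (exp (- T n)) * (\<integral>x. of_real (heat (T n) x) * \<psi> x \<partial>lborel)) \<le> exp (- T n) * B'" for n
      by (simp add: norm_mult)
    have "(\<lambda>n. exp (- T n) * B') \<longlonglongrightarrow> 0 * B'"
      by (intro tendsto_intros filterlim_compose[OF exp_at_bot] filterlim_compose[OF filterlim_uminus_at_bot_at_top Tinf])
    then have lim: "(\<lambda>n. exp (- T n) * B') \<longlonglongrightarrow> 0" by simp
    show ?thesis by (rule Lim_null_comparison[OF always_eventually[OF allI[OF le]] lim])
  qed
  have "A \<longlonglongrightarrow> \<psi> 0" using tendsto_diff[OF h0 h1] unfolding A2 by simp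
  then have "(\<integral>t. of_real (r t) * J t \<partial>lborel) = \<psi> 0" using A1 LIMSEQ_unique by blast
  then show "(\<integral>x. heat_green x * (- laplacian \<psi> x + of_real 1 * \<psi> x) \<partial>lborel) = \<psi> 0"
    using G by (simp add: v_def)
qed

text \<open>The explicit solution shows that the choice in \<open>green\<close> has something to
  choose; by \<open>green_unique\<close> its moduli and its realness then pass to the chosen
  representative.\<close>

lemma is_green_green: "is_green 1 (green 1)"
  unfolding green_def by (rule someI[where P = "is_green 1", OF is_green_heat_green])

lemma green_Lp_2: "green 1 \<in> Lp 2"
  by (rule is_greenD(1)[OF is_green_green])

lemma green_AE_heat_green: "AE x in lborel. green 1 x = heat_green x"
  by (rule green_unique[OF is_green_green is_green_heat_green])

lemma modulus_cong_AE:
  assumes m: "modulus a A f" and f: "f \<in> borel_measurable borel" "g \<in> borel_measurable borel"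
    and ae: "AE x in lborel. g x = f x"
  shows "modulus a A g"
  unfolding modulus_def
proof
  fix z
  note [measurable] = f
  have "AE x in lborel. g (x + z) - g x = f (x + z) - f x"
    using ae AE_lborel_shift[OF ae, of z] by eventually_elim simp
  moreover have "(\<lambda>x. g (x + z) - g x) \<in> borel_measurable borel" "(\<lambda>x. f (x + z) - f x) \<in> borel_measurable borel"
    by measurable
  ultimately have "sq (\<lambda>x. g (x + z) - g x) = sq (\<lambda>x. f (x + z) - f x)"
    by (intro sq_cong_AE)
  then show "sq (\<lambda>x. g (x + z) - g x) \<le> A * norm z powr a" using m unfolding modulus_def by simp
qed

lemma green_modulus:
  assumes "0 < a" "a < 2" shows "\<exists>C\<ge>0. modulus a C (green 1)"
proof -
  obtain C where "0 \<le> C" "modulus a C heat_green" using heat_green_modulus[OF assms] by blast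
  moreover from this(2) have "modulus a C (green 1)"
    by (rule modulus_cong_AE) (use heat_green_Lp_2(1) green_Lp_2 Lp_2_measurable green_AE_heat_green in auto)
  ultimately show ?thesis by blast
qed

lemma cnv_green_real:
  assumes "\<And>z. r z \<in> \<real>" shows "cnj (cnv r (green 1) x) = cnv r (green 1) x"
proof -
  have hg: "cnj (heat_green x) = heat_green x" for x
    unfolding heat_green_def by (simp only: Bochner_Integration.integral_cnj[symmetric] complex_cnj_complex_of_real)
  have ae: "AE y in lborel. cnj (green 1 y) = green 1 y"
    using green_AE_heat_green by eventually_elim (simp add: hg)
  show ?thesis
    unfolding cnv_def Bochner_Integration.integral_cnj[symmetric]
  proof (cases "(\<lambda>z. r z * green 1 (x + z)) \<in> borel_measurable lborel")
    case True
    moreover from True have "(\<lambda>z. cnj (r z * green 1 (x + z))) \<in> borel_measurable lborel"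
      by (intro borel_measurable_continuous_on[where f = cnj] continuous_intros)
    moreover have "AE z in lborel. cnj (r z * green 1 (x + z)) = r z * green 1 (x + z)"
      using AE_lborel_shift[OF ae, of x] by eventually_elim (use assms in \<open>simp add: Reals_cnj_iff add.commute\<close>)
    ultimately show "(\<integral>z. cnj (r z * green 1 (x + z)) \<partial>lborel) = (\<integral>z. r z * green 1 (x + z) \<partial>lborel)"
      by (intro integral_cong_AE)
  next
    \<comment> \<open>An integrand that is not integrable has integral 0 by convention, here on both
      sides.\<close>
    case False
    then show "(\<integral>z. cnj (r z * green 1 (x + z)) \<partial>lborel) = (\<integral>z. r z * green 1 (x + z) \<partial>lborel)"
    proof -
      have "\<not> integrable lborel (\<lambda>z. r z * green 1 (x + z))" using False borel_measurable_integrable by blast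
      then show ?thesis unfolding Bochner_Integration.integral_cnj by (simp add: not_integrable_integral_eq)
    qed
  qed
qed

text \<open>Where \<open>|f| > s\<close>, the average of \<open>f\<close> over a square of side \<open>2 \<surd>m / s\<close> is too small to account for \<open>f\<close>,
  so that \<open>f\<close> is controlled by its oscillation at that scale.\<close>

lemma Lp_2_tail:
  assumes f: "f \<in> Lp 2" and md: "modulus a A f" and A: "0 \<le> A" and a: "0 < a"
    and m: "sq f \<le> m" "0 < m" and s: "0 < s"
  shows "(\<integral>\<^sup>+x. ennreal ((norm (f x))\<^sup>2) * indicator {x. s < norm (f x)} x \<partial>lborel)
    \<le> ennreal (4 * A * (4 * sqrt m / s) powr a)"
proof -
  have [measurable]: "f \<in> borel_measurable borel" using f Lp_2_measurable by auto
  \<comment> \<open>The side of the square satisfies h^2 s^2 = 4 m: where |f(x)| > s, the mass term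
    2 m is then at most half of h^2 |f(x)|^2 and can be absorbed.\<close>
  define h where "h = 2 * sqrt m / s"
  have h: "0 < h" "h\<^sup>2 * s\<^sup>2 = 4 * m" using m s by (auto simp: h_def power_divide power_mult_distrib)
  define Q :: "(real ^ 2) set" where "Q = cbox 0 (\<chi> i. h)"
  have [measurable]: "Q \<in> sets borel" unfolding Q_def by simp
  have eQ: "emeasure lborel Q = ennreal (h\<^sup>2)"
  proof -
    have "emeasure lborel Q = (\<Prod>b\<in>Basis. ((\<chi> i. h) - 0 :: real ^ 2) \<bullet> b)"
      unfolding Q_def by (rule emeasure_lborel_cbox) (use h in \<open>auto simp: Basis_vec_def inner_axis\<close>)
    also have "(\<Prod>b\<in>Basis. ((\<chi> i. h) - 0 :: real ^ 2) \<bullet> b) = (\<Prod>b\<in>(Basis :: (real ^ 2) set). h)"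
      by (rule prod.cong) (auto simp: Basis_vec_def inner_axis)
    finally show ?thesis by simp
  qed
  have nQ: "norm z \<le> 4 * sqrt m / s" if "z \<in> Q" for z
  proof -
    have z: "0 \<le> z $ i" "z $ i \<le> h" for i using that by (auto simp: Q_def mem_box_cart)
    have "norm z \<le> \<bar>z $ 1\<bar> + \<bar>z $ 2\<bar>" using norm_le_l1_cart[of z] by (simp add: sum_2)
    then show ?thesis using z[of 1] z[of 2] by (simp add: h_def)
  qed
  define X where "X x = (\<integral>\<^sup>+z. indicator Q z * ennreal ((norm (f (x + z) - f x))\<^sup>2) \<partial>lborel)" for x
  have [measurable]: "X \<in> borel_measurable lborel" unfolding X_def by measurable
  have pt: "ennreal (h\<^sup>2) * (ennreal ((norm (f x))\<^sup>2) * indicator {x. s < norm (f x)} x) \<le> 4 * X x" for x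
  proof (cases "s < norm (f x) \<and> X x \<noteq> \<infinity>")
    case False
    then show ?thesis by (auto simp: ennreal_mult_eq_top_iff)
  next
    case True
    then obtain r where r: "0 \<le> r" "X x = ennreal r" by (cases "X x" rule: ennreal_cases) auto
    have "ennreal (h\<^sup>2 * (norm (f x))\<^sup>2) = (\<integral>\<^sup>+z. ennreal ((norm (f x))\<^sup>2) * indicator Q z \<partial>lborel)"
      by (subst nn_integral_cmult_indicator) (simp_all add: eQ ennreal_mult mult.commute)
    also have "\<dots> \<le> (\<integral>\<^sup>+z. 2 * (indicator Q z * ennreal ((norm (f (x + z) - f x))\<^sup>2)) + 2 * ennreal ((norm (f (x + z)))\<^sup>2) \<partial>lborel)"
    proof (rule nn_integral_mono)
      fix z
      have "(norm (f x))\<^sup>2 \<le> 2 * (norm (f (x + z) - f x))\<^sup>2 + 2 * (norm (f (x + z)))\<^sup>2"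
        using norm_add_sq_le[of "f x - f (x + z)" "f (x + z)"] by (simp add: norm_minus_commute)
      then have "ennreal ((norm (f x))\<^sup>2) \<le> 2 * ennreal ((norm (f (x + z) - f x))\<^sup>2) + 2 * ennreal ((norm (f (x + z)))\<^sup>2)"
        by (simp add: ennreal_plus[symmetric] ennreal_mult'[symmetric] ennreal_leI
            flip: ennreal_numeral del: ennreal_plus)
      then show "ennreal ((norm (f x))\<^sup>2) * indicator Q z
          \<le> 2 * (indicator Q z * ennreal ((norm (f (x + z) - f x))\<^sup>2)) + 2 * ennreal ((norm (f (x + z)))\<^sup>2)"
        by (auto split: split_indicator)
    qed
    also have "\<dots> = 2 * X x + 2 * (\<integral>\<^sup>+z. ennreal ((norm (f (x + z)))\<^sup>2) \<partial>lborel)"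
      unfolding X_def by (subst nn_integral_add) (auto simp: nn_integral_cmult)
    also have "(\<integral>\<^sup>+z. ennreal ((norm (f (x + z)))\<^sup>2) \<partial>lborel) = ennreal (sq f)"
      using ennreal_sq[OF Lp_2_shift(1)[OF f, of x]] Lp_2_shift(2)[OF f, of x] by (simp add: add.commute)
    also have "2 * X x + 2 * ennreal (sq f) = ennreal (2 * r + 2 * sq f)"
      using r by (simp add: ennreal_plus ennreal_mult' flip: ennreal_numeral)
    finally have "h\<^sup>2 * (norm (f x))\<^sup>2 \<le> 2 * r + 2 * sq f"
      using r(1) by (subst (asm) ennreal_le_iff) auto
    also have "\<dots> \<le> 2 * r + h\<^sup>2 * s\<^sup>2 / 2" using h(2) m by simp
    also have "\<dots> \<le> 2 * r + h\<^sup>2 * (norm (f x))\<^sup>2 / 2"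
      using True s by (intro add_left_mono divide_right_mono mult_left_mono power_mono) auto
    finally have "h\<^sup>2 * (norm (f x))\<^sup>2 \<le> 4 * r" by simp
    then have "ennreal (h\<^sup>2 * (norm (f x))\<^sup>2) \<le> ennreal (4 * r)" by (rule ennreal_leI)
    then show ?thesis using True r by (simp add: ennreal_mult' flip: ennreal_numeral)
  qed
  have "(\<integral>\<^sup>+x. X x \<partial>lborel) = (\<integral>\<^sup>+z. (\<integral>\<^sup>+x. indicator Q z * ennreal ((norm (f (x + z) - f x))\<^sup>2) \<partial>lborel) \<partial>lborel)"
    unfolding X_def by (rule lborel_pair.Fubini'[symmetric]) measurable
  also have "\<dots> \<le> (\<integral>\<^sup>+z. ennreal (A * (4 * sqrt m / s) powr a) * indicator Q z \<partial>lborel)"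
  proof (rule nn_integral_mono)
    fix z
    have "(\<integral>\<^sup>+x. indicator Q z * ennreal ((norm (f (x + z) - f x))\<^sup>2) \<partial>lborel) = indicator Q z * ennreal (sq (\<lambda>x. f (x + z) - f x))"
      using ennreal_sq[OF Lp_2_diff(1)[OF Lp_2_shift(1)[OF f, of z] f]] by (subst nn_integral_cmult) auto
    also have "\<dots> \<le> ennreal (A * (4 * sqrt m / s) powr a) * indicator Q z"
    proof (cases "z \<in> Q")
      case True
      have "sq (\<lambda>x. f (x + z) - f x) \<le> A * norm z powr a" using md unfolding modulus_def by blast
      also have "\<dots> \<le> A * (4 * sqrt m / s) powr a"
        using A a nQ[OF True] by (intro mult_left_mono powr_mono2) auto
      finally show ?thesis using True by (simp add: ennreal_leI)
    qed simp
    finally show "(\<integral>\<^sup>+x. indicator Q z * ennreal ((norm (f (x + z) - f x))\<^sup>2) \<partial>lborel) \<le> ennreal (A * (4 * sqrt m / s) powr a) * indicator Q z" .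
  qed
  also have "\<dots> = ennreal (A * (4 * sqrt m / s) powr a) * ennreal (h\<^sup>2)"
    by (subst nn_integral_cmult_indicator) (auto simp: eQ)
  finally have XI: "(\<integral>\<^sup>+x. X x \<partial>lborel) \<le> ennreal (A * (4 * sqrt m / s) powr a) * ennreal (h\<^sup>2)" .
  have "ennreal (h\<^sup>2) * (\<integral>\<^sup>+x. ennreal ((norm (f x))\<^sup>2) * indicator {x. s < norm (f x)} x \<partial>lborel)
      = (\<integral>\<^sup>+x. ennreal (h\<^sup>2) * (ennreal ((norm (f x))\<^sup>2) * indicator {x. s < norm (f x)} x) \<partial>lborel)"
    by (rule nn_integral_cmult[symmetric]) measurable
  also have "\<dots> \<le> (\<integral>\<^sup>+x. 4 * X x \<partial>lborel)" by (rule nn_integral_mono) (rule pt)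
  also have "\<dots> = 4 * (\<integral>\<^sup>+x. X x \<partial>lborel)" by (rule nn_integral_cmult) measurable
  also have "4 * (\<integral>\<^sup>+x. X x \<partial>lborel) \<le> ennreal 4 * (ennreal (A * (4 * sqrt m / s) powr a) * ennreal (h\<^sup>2))"
    using mult_left_mono[OF XI, of 4] by simp
  also have "\<dots> = ennreal (4 * (A * (4 * sqrt m / s) powr a * h\<^sup>2))"
    using A by (simp only: ennreal_mult[symmetric] mult_nonneg_nonneg powr_ge_zero zero_le_power2 zero_le_numeral)
  also have "\<dots> = ennreal (h\<^sup>2 * (4 * A * (4 * sqrt m / s) powr a))" by (simp only: ac_simps)
  also have "\<dots> = ennreal (h\<^sup>2) * ennreal (4 * A * (4 * sqrt m / s) powr a)"
    using A by (intro ennreal_mult) auto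
  finally have "ennreal (h\<^sup>2) * (\<integral>\<^sup>+x. ennreal ((norm (f x))\<^sup>2) * indicator {x. s < norm (f x)} x \<partial>lborel)
      \<le> ennreal (h\<^sup>2) * ennreal (4 * A * (4 * sqrt m / s) powr a)" .
  then show ?thesis
    using h(1) by (subst (asm) ennreal_mult_le_mult_iff) auto
qed

section \<open>The Gagliardo-Nirenberg inequality\<close>

definition Np :: "real \<Rightarrow> fn \<Rightarrow> real" where
  "Np p f = (\<integral>x. norm (f x) powr p \<partial>lborel)"

lemma Np_nonneg: "0 \<le> Np p f"
  unfolding Np_def by simp

lemma Lp_norm_powr: "p \<noteq> 0 \<Longrightarrow> Lp_norm p f powr p = Np p f"
  unfolding Lp_norm_def using Np_nonneg[of p f] by (simp add: powr_powr Np_def)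

lemma dyadic_level:
  assumes "0 < S" "S < t" shows "\<exists>j. 2 ^ j * S < t \<and> t \<le> 2 ^ Suc j * (S :: real)"
proof -
  obtain k where "t / S < 2 ^ k" using real_arch_pow[of 2 "t / S"] by auto
  then have ex: "t \<le> 2 ^ k * S" using assms by (simp add: field_simps)
  define k' where "k' = (LEAST k. t \<le> 2 ^ k * S)"
  have k': "t \<le> 2 ^ k' * S" unfolding k'_def using ex by (rule LeastI)
  have "k' \<noteq> 0" using k' assms by (intro notI) simp
  then obtain j where j: "k' = Suc j" by (cases k') auto
  have "\<not> t \<le> 2 ^ j * S" using not_less_Least[of j "\<lambda>k. t \<le> 2 ^ k * S"] j unfolding k'_def by simp
  then show ?thesis using k' j by (intro exI[of _ j]) auto
qed

text \<open>Cut at height \<open>S\<close>. Below it |f|^p \<le> S^(p-2) |f|^2; above it the tail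
  bounds on dyadic levels sum to a geometric series of ratio 2^(p-2-a) < 1. The height stays free:
  it is chosen according to the required smallness in \<open>Np_size_bound\<close> and equal to 1
  where the smallness comes from \<open>m\<close>. Optimising it would give the usual product
  form.\<close>

lemma Gagliardo_Nirenberg:
  fixes a p :: real
  assumes a: "0 < a" and p: "2 < p" "p < 2 + a"
  obtains C where "0 \<le> C"
    "\<And>f A m (S :: real). f \<in> Lp 2 \<Longrightarrow> modulus a A f \<Longrightarrow> 0 \<le> A \<Longrightarrow> sq f \<le> m \<Longrightarrow> 0 < m \<Longrightarrow> 0 < S \<Longrightarrow>
      integrable lborel (\<lambda>x. norm (f x) powr p)
      \<and> Np p f \<le> S powr (p - 2) * m + C * (S powr (p - 2 - a) * m powr (a / 2) * A)"
proof
  define q where "q = 2 powr (p - 2 - a)"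
  have q: "0 < q" "q < 1" using p by (auto simp: q_def powr_less_one)
  define C where "C = 4 * 4 powr a * 2 powr (p - 2) / (1 - q)"
  show "0 \<le> C" using q by (simp add: C_def)
  fix f and A m S :: real
  assume f: "f \<in> Lp 2" and md: "modulus a A f" and A: "0 \<le> A" and m: "sq f \<le> m" "0 < m" and S: "0 < S"
  have [measurable]: "f \<in> borel_measurable borel" using f Lp_2_measurable by auto
  define K where "K = 4 * A * 4 powr a * m powr (a / 2) * 2 powr (p - 2) * S powr (p - 2 - a)"
  have K: "0 \<le> K" using A by (simp add: K_def)
  have lev: "(2 ^ Suc j * S) powr (p - 2) * (4 * A * (4 * sqrt m / (2 ^ j * S)) powr a) = K * q ^ j" for j
  proof -
    have 1: "(2 ^ Suc j * S) powr (p - 2) = 2 powr (p - 2) * (2 ^ j) powr (p - 2) * S powr (p - 2)"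
      using S by (simp add: powr_mult mult.assoc)
    have 2: "(4 * sqrt m / (2 ^ j * S)) powr a = 4 powr a * m powr (a / 2) / ((2 ^ j) powr a * S powr a)"
      using S m by (simp add: powr_mult powr_divide powr_half_sqrt[symmetric] powr_powr)
    have 3: "q ^ j = (2 ^ j) powr (p - 2) / (2 ^ j) powr a"
    proof -
      have "q ^ j = 2 powr (real j * (p - 2 - a))" unfolding q_def by (simp add: powr_power)
      also have "\<dots> = (2 ^ j) powr (p - 2 - a)" by (simp add: powr_powr[symmetric] powr_realpow)
      finally show ?thesis by (simp add: powr_diff)
    qed
    have 4: "S powr (p - 2 - a) = S powr (p - 2) / S powr a" by (simp add: powr_diff)
    show ?thesis unfolding 1 2 3 4 K_def by (simp add: field_simps)
  qed
  let ?T = "\<lambda>j x. ennreal ((2 ^ Suc j * S) powr (p - 2)) * (ennreal ((norm (f x))\<^sup>2) * indicator {x. 2 ^ j * S < norm (f x)} x)"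
  have pt: "ennreal (norm (f x) powr p) \<le> ennreal (S powr (p - 2)) * ennreal ((norm (f x))\<^sup>2) + (\<Sum>j. ?T j x)" for x
  proof -
    have e: "norm (f x) powr p = norm (f x) powr (p - 2) * (norm (f x))\<^sup>2"
      using powr_add[of "norm (f x)" "p - 2" 2] by simp
    show ?thesis
    proof (cases "norm (f x) \<le> S")
      case True
      have "norm (f x) powr p \<le> S powr (p - 2) * (norm (f x))\<^sup>2"
        unfolding e using True p by (intro mult_right_mono powr_mono2) auto
      then have "ennreal (norm (f x) powr p) \<le> ennreal (S powr (p - 2)) * ennreal ((norm (f x))\<^sup>2)"
        by (simp add: ennreal_mult[symmetric] ennreal_leI)
      then show ?thesis by (rule order_trans) simp
    next
      case False
      then obtain j where j: "2 ^ j * S < norm (f x)" "norm (f x) \<le> 2 ^ Suc j * S"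
        using dyadic_level[OF S, of "norm (f x)"] by auto
      have "norm (f x) powr p \<le> (2 ^ Suc j * S) powr (p - 2) * (norm (f x))\<^sup>2"
        unfolding e using j p by (intro mult_right_mono powr_mono2) auto
      then have "ennreal (norm (f x) powr p) \<le> ?T j x"
        using j by (simp add: ennreal_mult[symmetric] ennreal_leI)
      also have "\<dots> \<le> (\<Sum>j. ?T j x)" using sum_le_suminf[of "\<lambda>j. ?T j x" "{j}"] by simp
      finally show ?thesis by (rule order_trans) simp
    qed
  qed
  have "(\<integral>\<^sup>+x. ennreal (norm (f x) powr p) \<partial>lborel)
      \<le> (\<integral>\<^sup>+x. ennreal (S powr (p - 2)) * ennreal ((norm (f x))\<^sup>2) + (\<Sum>j. ?T j x) \<partial>lborel)"
    by (rule nn_integral_mono) (rule pt)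
  also have "\<dots> = ennreal (S powr (p - 2)) * ennreal (sq f) + (\<Sum>j. \<integral>\<^sup>+x. ?T j x \<partial>lborel)"
    by (subst nn_integral_add) (auto simp: nn_integral_cmult nn_integral_suminf ennreal_sq[OF f])
  also have "\<dots> \<le> ennreal (S powr (p - 2)) * ennreal m + (\<Sum>j. ennreal (K * q ^ j))"
  proof (intro add_mono suminf_le)
    show "ennreal (S powr (p - 2)) * ennreal (sq f) \<le> ennreal (S powr (p - 2)) * ennreal m"
      using m by (intro mult_left_mono ennreal_leI) auto
    fix j
    have "(\<integral>\<^sup>+x. ?T j x \<partial>lborel) = ennreal ((2 ^ Suc j * S) powr (p - 2)) * (\<integral>\<^sup>+x. ennreal ((norm (f x))\<^sup>2) * indicator {x. 2 ^ j * S < norm (f x)} x \<partial>lborel)"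
      by (rule nn_integral_cmult) measurable
    also have "\<dots> \<le> ennreal ((2 ^ Suc j * S) powr (p - 2)) * ennreal (4 * A * (4 * sqrt m / (2 ^ j * S)) powr a)"
      using S by (intro mult_left_mono Lp_2_tail[OF f md A a m]) auto
    also have "\<dots> = ennreal (K * q ^ j)" using A by (simp only: ennreal_mult[symmetric] lev powr_ge_zero mult_nonneg_nonneg zero_le_numeral)
    finally show "(\<integral>\<^sup>+x. ?T j x \<partial>lborel) \<le> ennreal (K * q ^ j)" .
  qed auto
  also have "(\<Sum>j. ennreal (K * q ^ j)) = ennreal (K * (1 / (1 - q)))"
    using q K by (subst suminf_ennreal2) (auto simp: summable_mult suminf_mult suminf_geometric summable_geometric)
  also have "ennreal (S powr (p - 2)) * ennreal m + ennreal (K * (1 / (1 - q)))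
      = ennreal (S powr (p - 2) * m + C * (S powr (p - 2 - a) * m powr (a / 2) * A))"
  proof -
    have "K * (1 / (1 - q)) = C * (S powr (p - 2 - a) * m powr (a / 2) * A)"
      unfolding K_def C_def by (simp add: field_simps)
    moreover have "0 \<le> C * (S powr (p - 2 - a) * m powr (a / 2) * A)" using A \<open>0 \<le> C\<close> by simp
    ultimately show ?thesis using m by (simp add: ennreal_mult[symmetric] ennreal_plus[symmetric] del: ennreal_plus)
  qed
  finally have le: "(\<integral>\<^sup>+x. ennreal (norm (f x) powr p) \<partial>lborel)
      \<le> ennreal (S powr (p - 2) * m + C * (S powr (p - 2 - a) * m powr (a / 2) * A))" .
  then have "(\<integral>\<^sup>+x. ennreal (norm (f x) powr p) \<partial>lborel) < \<infinity>"
    unfolding infinity_ennreal_def by (rule order_le_less_trans[OF _ ennreal_less_top])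
  then have i: "integrable lborel (\<lambda>x. norm (f x) powr p)" by (intro integrableI_nonneg) auto
  have "ennreal (Np p f) \<le> ennreal (S powr (p - 2) * m + C * (S powr (p - 2 - a) * m powr (a / 2) * A))"
    using le i unfolding Np_def by (simp add: nn_integral_eq_integral)
  moreover have "0 \<le> S powr (p - 2) * m + C * (S powr (p - 2 - a) * m powr (a / 2) * A)"
    using m A \<open>0 \<le> C\<close> by simp
  ultimately show "integrable lborel (\<lambda>x. norm (f x) powr p)
      \<and> Np p f \<le> S powr (p - 2) * m + C * (S powr (p - 2 - a) * m powr (a / 2) * A)"
    using i by simp
qed

section \<open>Points of the plane have zero capacity\<close>

lemma sq_lacunary_sum:
  assumes b: "\<And>k. b k \<in> borel_measurable borel" and B: "\<And>k x. norm (b k x) \<le> 2 ^ k * B" and B0: "0 \<le> B"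
    and i: "\<And>k. integrable lborel (b k)" and L: "\<And>k. (\<integral>x. norm (b k x) \<partial>lborel) \<le> (1 / 2) ^ k * L" and L0: "0 \<le> L"
  shows "(\<lambda>x. \<Sum>k<n. b k x) \<in> Lp 2 \<and> sq (\<lambda>x. \<Sum>k<n. b k x) \<le> 3 * real n * B * L"
proof (induction n)
  case 0
  then show ?case using Lp_2_zero by simp
next
  case (Suc n)
  note [measurable] = b
  let ?S = "\<lambda>x. \<Sum>k<n. b k x"
  have Sb: "norm (?S x) \<le> 2 ^ n * B" for x
  proof -
    have "norm (?S x) \<le> (\<Sum>k<n. 2 ^ k * B)" by (rule sum_norm_le) (rule B)
    also have "\<dots> = (2 ^ n - 1) * B" by (simp add: sum_distrib_right[symmetric] sum_power2 mask_eq_sum_exp geometric_sum)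
    also have "\<dots> \<le> 2 ^ n * B" using B0 by (simp add: mult_right_mono)
    finally show ?thesis .
  qed
  \<comment> \<open>The terms may grow like 2^k in sup norm but shrink like 2^(-k) in L^1. Each new
    one therefore adds at most 3 B L to the squared norm, which grows linearly in the number of
    terms instead of quadratically.\<close>
  have pt: "(norm (?S x + b n x))\<^sup>2 \<le> (norm (?S x))\<^sup>2 + 3 * (2 ^ n * B) * norm (b n x)" for x
  proof -
    have "(norm (?S x + b n x))\<^sup>2 \<le> (norm (?S x) + norm (b n x))\<^sup>2" by (intro power_mono norm_triangle_ineq) auto
    also have "\<dots> = (norm (?S x))\<^sup>2 + (2 * norm (?S x) + norm (b n x)) * norm (b n x)"
      by (simp add: power2_eq_square algebra_simps)
    also have "\<dots> \<le> (norm (?S x))\<^sup>2 + 3 * (2 ^ n * B) * norm (b n x)"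
      using Sb[of x] B[of n x] by (intro add_left_mono mult_right_mono) auto
    finally show ?thesis .
  qed
  have ig: "integrable lborel (\<lambda>x. (norm (?S x))\<^sup>2 + 3 * (2 ^ n * B) * norm (b n x))"
    using Suc.IH i[of n] by (auto simp: Lp_2_iff)
  have L2: "(\<lambda>x. ?S x + b n x) \<in> Lp 2"
    unfolding Lp_2_iff
    by (intro conjI Bochner_Integration.integrable_bound[OF ig]) (use pt in \<open>auto intro: order_trans[OF _ abs_ge_self]\<close>)
  have "sq (\<lambda>x. ?S x + b n x) \<le> (\<integral>x. (norm (?S x))\<^sup>2 + 3 * (2 ^ n * B) * norm (b n x) \<partial>lborel)"
    by (intro integral_mono ig pt) (use L2 in \<open>simp add: Lp_2_iff\<close>)
  also have "\<dots> = sq ?S + 3 * (2 ^ n * B) * (\<integral>x. norm (b n x) \<partial>lborel)"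
    using Suc.IH i[of n] by (simp add: Lp_2_iff)
  also have "\<dots> \<le> 3 * real n * B * L + 3 * (2 ^ n * B) * ((1 / 2) ^ n * L)"
    using Suc.IH L[of n] B0 by (intro add_mono mult_left_mono) auto
  also have "\<dots> = 3 * real (Suc n) * B * L"
    by (simp add: power_divide algebra_simps)
  finally show ?case using L2 by simp
qed

text \<open>The mean of n dyadic dilates of one bump. In the plane a dilation preserves the
  Dirichlet integral, and gradients at different scales are nearly orthogonal, so the squared norm
  is of order n / n^2 while the value at 0 stays 1.\<close>

lemma zero_capacity:
  assumes "0 < \<epsilon>" obtains \<psi> where "test_fun \<psi>" "\<psi> 0 = 1" "Hs \<psi> \<le> \<epsilon>"
proof -
  define z0 where "z0 = complex_of_real (bump 1 (\<chi> i. - 1) (\<chi> i. 1) 0)"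
  have z0: "z0 \<noteq> 0" using bump_props(4)[of 1 0 "\<chi> i. - 1" "\<chi> i. 1"] by (auto simp: z0_def mem_box_cart)
  define \<zeta> :: fn where "\<zeta> x = (1 / z0) * of_real (bump 1 (\<chi> i. - 1) (\<chi> i. 1) x)" for x
  have t: "test_fun \<zeta>" unfolding \<zeta>_def[abs_def] by (intro test_fun_cmult test_fun_bump) simp
  have \<zeta>0: "\<zeta> 0 = 1" using z0 by (simp add: \<zeta>_def z0_def)
  \<comment> \<open>The exponent \<open>e\<close> is 0 for the function itself and 1 for its
    gradient, where the chain rule brings the factor 2^k.\<close>
  have bd: "\<exists>B L. 0 \<le> B \<and> 0 \<le> L \<and> (\<forall>n. sq (\<lambda>x. \<Sum>k<n. 2 ^ (e * k) * \<eta> (2 ^ k *\<^sub>R x)) \<le> 3 * real n * B * L)"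
    if t: "test_fun \<eta>" and e: "e \<le> 1" for \<eta> and e :: nat
  proof -
    have c: "continuous_on UNIV \<eta>" using t test_fun_smooth smooth_continuous by blast
    have [measurable]: "\<eta> \<in> borel_measurable borel" using c borel_measurable_continuous_onI by auto
    obtain R where R: "\<And>x. R < norm x \<Longrightarrow> \<eta> x = 0" using t test_fun_support by metis
    obtain B where B: "0 < B" "\<And>x. norm (\<eta> x) \<le> B" using compact_support_bounded[OF c R] by metis
    define L where "L = (\<integral>x. norm (\<eta> x) \<partial>lborel)"
    let ?b = "\<lambda>k x. 2 ^ (e * k) * \<eta> (2 ^ k *\<^sub>R x)"
    have e2: "(2 :: real) ^ (e * k) \<le> 2 ^ k" for k using e by (intro power_increasing) auto
    have nb: "norm (?b k x) = 2 ^ (e * k) * norm (\<eta> (2 ^ k *\<^sub>R x))" for k x by (simp add: norm_mult norm_power)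
    have "(\<lambda>x. \<Sum>k<n. ?b k x) \<in> Lp 2 \<and> sq (\<lambda>x. \<Sum>k<n. ?b k x) \<le> 3 * real n * B * L" for n
    proof (rule sq_lacunary_sum)
      show "?b k \<in> borel_measurable borel" for k by measurable
      show "norm (?b k x) \<le> 2 ^ k * B" for k x unfolding nb using e2 B by (intro mult_mono) auto
      show "integrable lborel (?b k)" for k
        using lborel_integral_affine(2)[of "2 ^ k" \<eta> 0] test_fun_integrable[OF t] by simp
      show "(\<integral>x. norm (?b k x) \<partial>lborel) \<le> (1 / 2) ^ k * L" for k
      proof -
        have p4: "(2 :: real) ^ (k * 2) = 4 ^ k" by (simp add: mult.commute[of k 2] power_mult)
        have "(\<integral>x. norm (\<eta> (2 ^ k *\<^sub>R x)) \<partial>lborel) = (1 / 4) ^ k * L"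
          using lborel_integral_affine(1)[of "2 ^ k" "\<lambda>x. norm (\<eta> x)" 0]
          by (simp add: L_def power_mult[symmetric] power_divide mult.commute p4)
        then have "(\<integral>x. norm (?b k x) \<partial>lborel) = 2 ^ (e * k) * ((1 / 4) ^ k * L)"
          unfolding nb by simp
        also have "\<dots> \<le> 2 ^ k * ((1 / 4) ^ k * L)"
          using e2 by (intro mult_right_mono) (auto simp: L_def)
        also have "\<dots> = (1 / 2) ^ k * L"
          by (simp add: mult.assoc[symmetric] power_mult_distrib[symmetric])
        finally show ?thesis .
      qed
    qed (use B in \<open>auto simp: L_def\<close>)
    then show ?thesis using B by (intro exI[of _ B] exI[of _ L]) (auto simp: L_def)
  qed
  obtain B0 L0 where b0: "0 \<le> B0" "0 \<le> L0" "\<And>n. sq (\<lambda>x. \<Sum>k<n. 2 ^ (0 * k) * \<zeta> (2 ^ k *\<^sub>R x)) \<le> 3 * real n * B0 * L0"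
    using bd[OF t, of 0] by auto
  let ?P = "\<lambda>i K. 0 \<le> K \<and> (\<forall>n. sq (\<lambda>x. \<Sum>k<n. 2 ^ (1 * k) * pderiv i \<zeta> (2 ^ k *\<^sub>R x)) \<le> 3 * real n * K)"
  have "\<exists>K. ?P i K" for i
  proof -
    obtain B L where "0 \<le> B" "0 \<le> L"
      "\<forall>n. sq (\<lambda>x. \<Sum>k<n. 2 ^ (1 * k) * pderiv i \<zeta> (2 ^ k *\<^sub>R x)) \<le> 3 * real n * B * L"
      using bd[OF test_fun_pderiv[OF t], of 1 i] by auto
    then show ?thesis by (intro exI[of _ "B * L"]) (simp add: mult.assoc)
  qed
  then have "\<forall>i. \<exists>K. ?P i K" by (rule allI)
  from choice[OF this] obtain K where K': "\<forall>i. ?P i (K i)" by (rule exE)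
  have K: "0 \<le> K i" "sq (\<lambda>x. \<Sum>k<n. 2 ^ (1 * k) * pderiv i \<zeta> (2 ^ k *\<^sub>R x)) \<le> 3 * real n * K i" for i n
    using spec[OF K', of i] by (simp_all only:)
  define M where "M = 3 * (B0 * L0 + (\<Sum>i\<in>UNIV. K i))"
  obtain n where n: "M / \<epsilon> < real n" "0 < n" using reals_Archimedean2[of "max 1 (M / \<epsilon>)"] by auto
  define \<psi> where "\<psi> x = of_real (1 / real n) * (\<Sum>k<n. \<zeta> (0 + 2 ^ k *\<^sub>R x))" for x
  have t\<zeta>: "test_fun (\<lambda>x. \<zeta> (0 + 2 ^ k *\<^sub>R x))" for k by (rule test_fun_affine[OF t]) simp
  have t\<psi>: "test_fun \<psi>"
    unfolding \<psi>_def[abs_def] by (intro test_fun_cmult test_fun_sum t\<zeta>) (use n in auto)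
  have p: "pderiv i \<psi> x = of_real (1 / real n) * (\<Sum>k<n. 2 ^ (1 * k) * pderiv i \<zeta> (2 ^ k *\<^sub>R x))" for i x
  proof -
    have d: "(\<lambda>x. \<zeta> (0 + 2 ^ k *\<^sub>R x)) differentiable (at x)" for k x
      using smooth_differentiable[OF test_fun_smooth[OF t\<zeta>]] .
    have "pderiv i (\<lambda>x. \<Sum>k<j. \<zeta> (0 + 2 ^ k *\<^sub>R x)) x = (\<Sum>k<j. 2 ^ (1 * k) * pderiv i \<zeta> (2 ^ k *\<^sub>R x))" for j
    proof (induction j)
      case 0
      have "pderiv i (\<lambda>x. 0) x = 0" by (rule pderiv_eq_0[of UNIV]) auto
      then show ?case by simp
    next
      case (Suc j)
      then show ?case
        using pderiv_add[OF differentiable_sum d, of "{..<j}" "\<lambda>k x. \<zeta> (0 + 2 ^ k *\<^sub>R x)" x i j] d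
          fun_cong[OF smooth_laplacian_affine(1)[OF test_fun_smooth[OF t], of i 0 "2 ^ j"], of x]
        by simp
    qed
    then show ?thesis
      unfolding \<psi>_def[abs_def] using d by (subst pderiv_cmult) (auto intro!: differentiable_sum)
  qed
  have n2: "sq (\<lambda>x. of_real (1 / real n) * g x) = (1 / real n)\<^sup>2 * sq g" for g :: fn
    by (simp add: norm_mult norm_divide power_divide)
  have "Hs \<psi> = (\<Sum>i\<in>UNIV. sq (pderiv i \<psi>)) + sq \<psi>"
  proof -
    have "sq (weak_pderiv i \<psi>) = sq (pderiv i \<psi>)" for i
      using test_fun_H1[OF t\<psi>] H1_weak_pderiv(1) test_fun_Lp_2[OF test_fun_pderiv[OF t\<psi>]] Lp_2_measurable
      by (intro sq_cong_AE) auto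
    then show ?thesis by (simp add: Hs_def)
  qed
  also have "\<dots> \<le> (\<Sum>i\<in>UNIV. (1 / real n)\<^sup>2 * (3 * real n * K i)) + (1 / real n)\<^sup>2 * (3 * real n * B0 * L0)"
  proof (intro add_mono sum_mono)
    fix i
    show "sq (pderiv i \<psi>) \<le> (1 / real n)\<^sup>2 * (3 * real n * K i)"
      unfolding p[abs_def] n2 by (intro mult_left_mono K) auto
    show "sq \<psi> \<le> (1 / real n)\<^sup>2 * (3 * real n * B0 * L0)"
      unfolding \<psi>_def[abs_def] n2 using b0(3)[of n] by (intro mult_left_mono) auto
  qed
  also have "\<dots> = M / real n"
    using n by (simp add: M_def sum_2 power2_eq_square field_simps)
  also have "\<dots> \<le> \<epsilon>" using n assms by (simp add: field_simps)
  finally have "Hs \<psi> \<le> \<epsilon>" .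
  moreover have "\<psi> 0 = 1" using n by (simp add: \<psi>_def \<zeta>0)
  ultimately show ?thesis using that t\<psi> by blast
qed

section \<open>The energy domain\<close>

lemma norm_sum3_sq: "(norm (a + b + c :: complex))\<^sup>2 \<le> 3 * ((norm a)\<^sup>2 + (norm b)\<^sup>2 + (norm c)\<^sup>2)"
proof -
  have "(norm (a + b + c))\<^sup>2 \<le> (norm a + norm b + norm c)\<^sup>2"
    by (intro power_mono order_trans[OF norm_triangle_ineq] add_right_mono norm_triangle_ineq) auto
  also have "\<dots> \<le> 3 * ((norm a)\<^sup>2 + (norm b)\<^sup>2 + (norm c)\<^sup>2)"
    using zero_le_power2[of "norm a - norm b"] zero_le_power2[of "norm a - norm c"] zero_le_power2[of "norm b - norm c"]
    by (simp add: power2_eq_square algebra_simps)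
  finally show ?thesis .
qed

text \<open>One derivative is moved back onto \<open>f\<close>. Cauchy-Schwarz is then applied to
  three terms separately, which explains the 9.\<close>

lemma H1_pairing_bound:
  assumes f: "f \<in> H1" and t: "test_fun \<psi>"
  shows "(norm (\<integral>x. f x * (- laplacian \<psi> x + \<psi> x) \<partial>lborel))\<^sup>2 \<le> 9 * Hs f * Hs \<psi>"
proof -
  note fL = H1_Lp_2[OF f] and \<psi>L = test_fun_Lp_2[OF t]
  have tp: "test_fun (pderiv i \<psi>)" "test_fun (pderiv i (pderiv i \<psi>))" for i
    using t test_fun_pderiv by auto
  have i: "integrable lborel (\<lambda>x. f x * pderiv i (pderiv i \<psi>) x)" "integrable lborel (\<lambda>x. f x * \<psi> x)" for i
    using Lp_2_mult_integrable(1)[OF fL test_fun_Lp_2] t tp by auto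
  let ?a = "\<lambda>i. \<integral>x. weak_pderiv i f x * pderiv i \<psi> x \<partial>lborel"
  have s: "sq (pderiv i \<psi>) \<le> Hs \<psi>" for i
  proof -
    have "sq (weak_pderiv i \<psi>) = sq (pderiv i \<psi>)"
      using test_fun_H1[OF t] H1_weak_pderiv(1)[OF test_fun_H1(1)[OF t]] test_fun_Lp_2[OF tp(1)] Lp_2_measurable
      by (intro sq_cong_AE) auto
    then show ?thesis using sq_le_Hs(2)[where f = \<psi> and i = i] by simp
  qed
  have a: "(norm (?a i))\<^sup>2 \<le> Hs f * Hs \<psi>" for i
  proof -
    have "(norm (?a i))\<^sup>2 \<le> sq (weak_pderiv i f) * sq (pderiv i \<psi>)"
      by (rule Cauchy_Schwarz_Lp_2(2)[OF H1_weak_pderiv(1)[OF f] test_fun_Lp_2[OF tp(1)]])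
    also have "\<dots> \<le> Hs f * Hs \<psi>" by (intro mult_mono sq_le_Hs s Hs_nonneg sq_nonneg)
    finally show ?thesis .
  qed
  have b: "(norm (\<integral>x. f x * \<psi> x \<partial>lborel))\<^sup>2 \<le> Hs f * Hs \<psi>"
  proof -
    have "(norm (\<integral>x. f x * \<psi> x \<partial>lborel))\<^sup>2 \<le> sq f * sq \<psi>" by (rule Cauchy_Schwarz_Lp_2(2)[OF fL \<psi>L])
    also have "\<dots> \<le> Hs f * Hs \<psi>" by (intro mult_mono sq_le_Hs Hs_nonneg sq_nonneg)
    finally show ?thesis .
  qed
  have "(\<integral>x. f x * (- laplacian \<psi> x + \<psi> x) \<partial>lborel)
      = (\<integral>x. (f x * \<psi> x - f x * pderiv 1 (pderiv 1 \<psi>) x) - f x * pderiv 2 (pderiv 2 \<psi>) x \<partial>lborel)"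
    by (simp add: laplacian_def sum_2 algebra_simps)
  also have "\<dots> = (\<integral>x. f x * \<psi> x \<partial>lborel) + ?a 1 + ?a 2"
    using i is_weak_pderivD[OF H1_weak_pderiv(2)[OF f] tp(1)] by simp
  finally show ?thesis using norm_sum3_sq[of "\<integral>x. f x * \<psi> x \<partial>lborel" "?a 1" "?a 2"] a[of 1] a[of 2] b by simp
qed

text \<open>Test u with (-\<Delta> + 1) \<psi> where \<psi>(0) = 1: the Green's function contributes
  exactly q, and the regular part at most a constant times the product of its H^1 norm with that of
  \<psi>. The latter is arbitrarily small by \<open>zero_capacity\<close>.\<close>

lemma charge_small:
  assumes "0 < \<epsilon>"
  obtains C where "0 \<le> C"
    "\<And>u q. u \<in> Lp 2 \<Longrightarrow> (\<lambda>x. u x - q * green 1 x) \<in> H1 \<Longrightarrow> (norm q)\<^sup>2 \<le> C * sq u + \<epsilon> * Hs (\<lambda>x. u x - q * green 1 x)"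
proof -
  \<comment> \<open>18 is twice the constant of \<open>H1_pairing_bound\<close>, the 2 coming from
    squaring a sum of two terms.\<close>
  obtain \<psi> where \<psi>: "test_fun \<psi>" "\<psi> 0 = 1" "Hs \<psi> \<le> \<epsilon> / 18" using zero_capacity[of "\<epsilon> / 18"] assms by auto
  define v where "v x = - laplacian \<psi> x + \<psi> x" for x
  have vL: "v \<in> Lp 2"
    using Lp_2_lincomb[OF test_fun_Lp_2[OF test_fun_laplacian[OF \<psi>(1)]] test_fun_Lp_2[OF \<psi>(1)], of "- 1" 1] by (simp add: v_def[abs_def])
  show ?thesis
  proof (rule that[of "2 * sq v"])
    fix u q assume u: "u \<in> Lp 2" and f: "(\<lambda>x. u x - q * green 1 x) \<in> H1"
    let ?f = "\<lambda>x. u x - q * green 1 x"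
    have i: "integrable lborel (\<lambda>x. u x * v x)" "integrable lborel (\<lambda>x. ?f x * v x)"
      using Lp_2_mult_integrable(1)[OF u vL] Lp_2_mult_integrable(1)[OF H1_Lp_2[OF f] vL] by auto
    have "q = q * (\<integral>x. green 1 x * v x \<partial>lborel)"
      using is_greenD(2)[OF is_green_green \<psi>(1)] \<psi>(2) by (simp add: v_def)
    also have "\<dots> = (\<integral>x. u x * v x - ?f x * v x \<partial>lborel)" by (simp add: left_diff_distrib mult.assoc)
    also have "\<dots> = (\<integral>x. u x * v x \<partial>lborel) + - (\<integral>x. ?f x * v x \<partial>lborel)" using i by simp
    finally have "(norm q)\<^sup>2 \<le> 2 * (norm (\<integral>x. u x * v x \<partial>lborel))\<^sup>2 + 2 * (norm (- (\<integral>x. ?f x * v x \<partial>lborel)))\<^sup>2"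
      using norm_add_sq_le by metis
    also have "\<dots> \<le> 2 * (sq u * sq v) + 2 * (9 * Hs ?f * Hs \<psi>)"
      using Cauchy_Schwarz_Lp_2(2)[OF u vL] H1_pairing_bound[OF f \<psi>(1)] by (simp add: v_def)
    also have "\<dots> \<le> 2 * (sq u * sq v) + 2 * (9 * Hs ?f * (\<epsilon> / 18))"
      using \<psi>(3) Hs_nonneg[of ?f] by (intro add_left_mono mult_left_mono) auto
    finally show "(norm q)\<^sup>2 \<le> 2 * sq v * sq u + \<epsilon> * Hs ?f" by (simp add: mult.commute mult.left_commute)
  qed simp
qed

text \<open>Otherwise the zero function could be written with charge - c, and
  \<open>charge_small\<close> would bound |c|^2 by arbitrarily small multiples of one fixed
  number.\<close>

lemma green_not_H1:
  assumes "(\<lambda>x. c * green 1 x) \<in> H1" shows "c = 0"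
proof -
  let ?H = "Hs (\<lambda>x. 0 - (- c) * green 1 x)"
  have h: "(\<lambda>x. 0 - (- c) * green 1 x) \<in> H1" using assms by simp
  have "(norm c)\<^sup>2 \<le> 0 + e" if e: "0 < e" for e
  proof -
    have pos: "0 < e / (?H + 1)" using e Hs_nonneg by (intro divide_pos_pos add_nonneg_pos) auto
    obtain C where "0 \<le> C" and C: "\<And>u q. u \<in> Lp 2 \<Longrightarrow> (\<lambda>x. u x - q * green 1 x) \<in> H1 \<Longrightarrow>
        (norm q)\<^sup>2 \<le> C * sq u + e / (?H + 1) * Hs (\<lambda>x. u x - q * green 1 x)"
      using charge_small[OF pos] by blast
    from C[OF Lp_2_zero h] have "(norm c)\<^sup>2 \<le> e / (?H + 1) * ?H" by simp
    also have "\<dots> \<le> e" using e Hs_nonneg[of "\<lambda>x. 0 - (- c) * green 1 x"] by (simp add: field_simps)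
    finally show ?thesis by simp
  qed
  then have "(norm c)\<^sup>2 \<le> 0" by (rule field_le_epsilon)
  then show ?thesis by simp
qed

text \<open>Two decompositions differ by a multiple of the Green's function that lies in H^1, so the
  definite description in \<open>charge\<close> does denote.\<close>

lemma charge_eq:
  assumes "(\<lambda>x. u x - q * green 1 x) \<in> H1" shows "charge u = q"
  unfolding charge_def
proof (rule the_equality)
  fix q' assume "(\<lambda>x. u x - q' * green 1 x) \<in> H1"
  from H1_diff[OF assms this] have "(\<lambda>x. (q' - q) * green 1 x) \<in> H1" by (simp add: left_diff_distrib)
  then show "q' = q" using green_not_H1 by force
qed (rule assms)

lemma energy_domD:
  assumes "u \<in> energy_dom"
  shows "u \<in> Lp 2" "regular_part u \<in> H1"
  using assms charge_eq unfolding energy_dom_def regular_part_def by auto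

lemma energy_dom_decomp: "u x = regular_part u x + charge u * green 1 x"
  by (simp add: regular_part_def)

lemma energy_dom_I:
  assumes "f \<in> H1"
  shows "(\<lambda>x. f x + q * green 1 x) \<in> energy_dom" "charge (\<lambda>x. f x + q * green 1 x) = q"
    "regular_part (\<lambda>x. f x + q * green 1 x) = f"
proof -
  have h: "(\<lambda>x. (f x + q * green 1 x) - q * green 1 x) \<in> H1" using assms by simp
  show c: "charge (\<lambda>x. f x + q * green 1 x) = q" by (rule charge_eq[OF h])
  show "regular_part (\<lambda>x. f x + q * green 1 x) = f" by (simp add: regular_part_def c)
  have "(\<lambda>x. f x + q * green 1 x) \<in> Lp 2" using Lp_2_lincomb[OF H1_Lp_2[OF assms] green_Lp_2, of 1 q] by simp
  then show "(\<lambda>x. f x + q * green 1 x) \<in> energy_dom" unfolding energy_dom_def using h by blast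
qed

lemma H1_energy_dom:
  assumes "f \<in> H1" shows "f \<in> energy_dom" "charge f = 0" "regular_part f = f"
  using energy_dom_I[OF assms, of 0] by simp_all

lemma energy_dom_lincomb:
  assumes u: "u \<in> energy_dom" and v: "v \<in> energy_dom"
  shows "(\<lambda>x. a * u x + b * v x) \<in> energy_dom"
    "charge (\<lambda>x. a * u x + b * v x) = a * charge u + b * charge v"
    "regular_part (\<lambda>x. a * u x + b * v x) = (\<lambda>x. a * regular_part u x + b * regular_part v x)"
proof -
  let ?f = "\<lambda>x. a * regular_part u x + b * regular_part v x" and ?q = "a * charge u + b * charge v"
  have e: "(\<lambda>x. a * u x + b * v x) = (\<lambda>x. ?f x + ?q * green 1 x)"
    by (auto simp: energy_dom_decomp[of u] energy_dom_decomp[of v] algebra_simps)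
  have h: "?f \<in> H1" using H1_lincomb(1) energy_domD(2) u v by blast
  show "(\<lambda>x. a * u x + b * v x) \<in> energy_dom" "charge (\<lambda>x. a * u x + b * v x) = ?q"
    "regular_part (\<lambda>x. a * u x + b * v x) = ?f"
    unfolding e using energy_dom_I[OF h] by auto
qed

lemma energy_dom_cmult:
  assumes u: "u \<in> energy_dom"
  shows "(\<lambda>x. a * u x) \<in> energy_dom" "charge (\<lambda>x. a * u x) = a * charge u"
    "regular_part (\<lambda>x. a * u x) = (\<lambda>x. a * regular_part u x)"
  using energy_dom_lincomb[OF u u, of a 0] by simp_all

lemma energy_dom_modulus:
  assumes a: "0 < a" "a < 2"
  obtains K where "0 \<le> K"
    "\<And>u. u \<in> energy_dom \<Longrightarrow> modulus a (K * (Hs (regular_part u) + (norm (charge u))\<^sup>2)) u"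
proof -
  obtain C where C: "0 \<le> C" "modulus a C (green 1)" using green_modulus[OF a] by blast
  show ?thesis
  proof (rule that[of "8 + 2 * C"])
    fix u assume u: "u \<in> energy_dom"
    let ?f = "regular_part u" and ?q = "charge u"
    note f = energy_domD(2)[OF u]
    show "modulus a ((8 + 2 * C) * (Hs ?f + (norm ?q)\<^sup>2)) u"
      unfolding modulus_def
    proof
      fix z
      let ?g = "\<lambda>x. green 1 (x + z) - green 1 x"
      have gL: "?g \<in> Lp 2" using Lp_2_diff(1)[OF Lp_2_shift(1)[OF green_Lp_2] green_Lp_2] .
      have "sq (\<lambda>x. u (x + z) - u x) = sq (\<lambda>x. (?f (x + z) - ?f x) + ?q * ?g x)"
        by (simp add: energy_dom_decomp[of u] algebra_simps)
      also have "\<dots> \<le> 2 * sq (\<lambda>x. ?f (x + z) - ?f x) + 2 * sq (\<lambda>x. ?q * ?g x)"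
        using f by (intro Lp_2_add(2) Lp_2_diff(1) Lp_2_shift(1) Lp_2_cmult(1) gL H1_Lp_2)
      also have "\<dots> = 2 * sq (\<lambda>x. ?f (x + z) - ?f x) + 2 * ((norm ?q)\<^sup>2 * sq ?g)"
        using Lp_2_cmult(2)[OF gL] by simp
      also have "\<dots> \<le> 2 * (4 * Hs ?f * norm z powr a) + 2 * ((norm ?q)\<^sup>2 * (C * norm z powr a))"
        using H1_modulus[OF f a] C(2) unfolding modulus_def by (intro add_mono mult_left_mono) auto
      also have "\<dots> \<le> (8 + 2 * C) * (Hs ?f + (norm ?q)\<^sup>2) * norm z powr a"
      proof -
        have "0 \<le> C * Hs ?f * norm z powr a" "0 \<le> (norm ?q)\<^sup>2 * norm z powr a" using C Hs_nonneg[of ?f] by auto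
        then show ?thesis by (simp add: algebra_simps)
      qed
      finally show "sq (\<lambda>x. u (x + z) - u x) \<le> (8 + 2 * C) * (Hs ?f + (norm ?q)\<^sup>2) * norm z powr a" .
    qed
  qed (use C in simp)
qed

section \<open>L^p bounds and coercivity on the energy domain\<close>

abbreviation size_sq :: "fn \<Rightarrow> real" where
  "size_sq u \<equiv> Hs (regular_part u) + (norm (charge u))\<^sup>2"

lemma size_sq_nonneg: "0 \<le> size_sq u"
  using Hs_nonneg by simp

text \<open>The modulus exponent is a = p / 2: both conditions p < 2 + a and a < 2 then amount to p
  < 4.\<close>

lemma energy_dom_Np:
  fixes p :: real
  assumes p: "2 < p" "p < 4"
  obtains C where "0 \<le> C"
    "\<And>u m S. u \<in> energy_dom \<Longrightarrow> sq u \<le> m \<Longrightarrow> 0 < m \<Longrightarrow> 0 < S \<Longrightarrow>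
      integrable lborel (\<lambda>x. norm (u x) powr p)
      \<and> Np p u \<le> S powr (p - 2) * m + C * (S powr (p / 2 - 2) * m powr (p / 4) * size_sq u)"
proof -
  obtain K where K: "0 \<le> K" "\<And>u. u \<in> energy_dom \<Longrightarrow> modulus (p / 2) (K * size_sq u) u"
    using energy_dom_modulus[of "p / 2"] p by auto
  obtain C where C: "0 \<le> C"
    "\<And>f A m (S :: real). f \<in> Lp 2 \<Longrightarrow> modulus (p / 2) A f \<Longrightarrow> 0 \<le> A \<Longrightarrow> sq f \<le> m \<Longrightarrow> 0 < m \<Longrightarrow> 0 < S \<Longrightarrow>
      integrable lborel (\<lambda>x. norm (f x) powr p)
      \<and> Np p f \<le> S powr (p - 2) * m + C * (S powr (p - 2 - p / 2) * m powr (p / 2 / 2) * A)"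
    by (rule Gagliardo_Nirenberg[of "p / 2" p]) (use p in auto)
  show ?thesis
  proof (rule that[of "C * K"])
    show "0 \<le> C * K" using C K by simp
    fix u and m S :: real assume u: "u \<in> energy_dom" "sq u \<le> m" "0 < m" "0 < S"
    have e: "p - 2 - p / 2 = p / 2 - 2" "p / 2 / 2 = p / 4" by (auto simp: field_simps)
    have "0 \<le> K * size_sq u" using K(1) size_sq_nonneg by simp
    from C(2)[OF energy_domD(1)[OF u(1)] K(2)[OF u(1)] this u(2-4)]
    show "integrable lborel (\<lambda>x. norm (u x) powr p)
      \<and> Np p u \<le> S powr (p - 2) * m + C * K * (S powr (p / 2 - 2) * m powr (p / 4) * size_sq u)"
      unfolding e by (simp add: ac_simps)
  qed
qed

lemma energy_dom_Lp:
  fixes p :: real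
  assumes p: "2 < p" "p < 4" and u: "u \<in> energy_dom"
  shows "integrable lborel (\<lambda>x. norm (u x) powr p)"
proof -
  obtain C where C: "0 \<le> C"
    "\<And>u m S. u \<in> energy_dom \<Longrightarrow> sq u \<le> m \<Longrightarrow> 0 < m \<Longrightarrow> 0 < S \<Longrightarrow>
      integrable lborel (\<lambda>x. norm (u x) powr p)
      \<and> Np p u \<le> S powr (p - 2) * m + C * (S powr (p / 2 - 2) * m powr (p / 4) * size_sq u)"
    using energy_dom_Np[OF p] by blast
  have "sq u \<le> sq u + 1" "0 < sq u + 1" using sq_nonneg[of u] by linarith+
  from C(2)[OF u this zero_less_one] show ?thesis by blast
qed

text \<open>The exponent p / 2 - 2 of the cut height is negative, so a large height makes the
  coefficient of \<open>size_sq u\<close> as small as desired.\<close>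

lemma Np_size_bound:
  fixes p \<mu> \<epsilon> :: real
  assumes p: "2 < p" "p < 4" and \<mu>: "0 < \<mu>" and \<epsilon>: "0 < \<epsilon>"
  obtains K where "0 \<le> K" "\<And>u. u \<in> energy_dom \<Longrightarrow> sq u \<le> \<mu> \<Longrightarrow> Np p u \<le> K + \<epsilon> * size_sq u"
proof -
  obtain C where C: "0 \<le> C"
    "\<And>u m S. u \<in> energy_dom \<Longrightarrow> sq u \<le> m \<Longrightarrow> 0 < m \<Longrightarrow> 0 < S \<Longrightarrow>
      integrable lborel (\<lambda>x. norm (u x) powr p)
      \<and> Np p u \<le> S powr (p - 2) * m + C * (S powr (p / 2 - 2) * m powr (p / 4) * size_sq u)"
    using energy_dom_Np[OF p] by blast
  define D where "D = C * \<mu> powr (p / 4) + 1"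
  have D: "0 < D" "C * \<mu> powr (p / 4) \<le> D" using C by (auto simp: D_def intro: add_nonneg_pos)
  define S where "S = (\<epsilon> / D) powr (1 / (p / 2 - 2))"
  have S: "0 < S" "S powr (p / 2 - 2) = \<epsilon> / D" using \<epsilon> D p by (auto simp: S_def powr_powr)
  show ?thesis
  proof (rule that[of "S powr (p - 2) * \<mu>"])
    fix u assume u: "u \<in> energy_dom" "sq u \<le> \<mu>"
    have "C * (S powr (p / 2 - 2) * \<mu> powr (p / 4) * size_sq u) = (C * \<mu> powr (p / 4)) * (\<epsilon> / D * size_sq u)"
      unfolding S(2) by simp
    also have "\<dots> \<le> D * (\<epsilon> / D * size_sq u)"
      using D \<epsilon> size_sq_nonneg[of u] by (intro mult_right_mono) auto
    also have "\<dots> = \<epsilon> * size_sq u" using D by simp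
    finally show "Np p u \<le> S powr (p - 2) * \<mu> + \<epsilon> * size_sq u"
      using C(2)[OF u \<mu> S(1)] by linarith
  qed (use \<mu> in simp)
qed

text \<open>Whatever the sign and size of \<open>B\<close>, \<open>charge_small\<close> trades |q|^2
  for a small share of the H^1 norm, and \<open>Np_size_bound\<close> does the same for the L^p
  term.\<close>

lemma coercive:
  fixes p \<mu> B :: real
  assumes p: "2 < p" "p < 4" and \<mu>: "0 < \<mu>"
  obtains K where "0 \<le> K" "\<And>u. u \<in> energy_dom \<Longrightarrow> sq u \<le> \<mu> \<Longrightarrow>
    size_sq u / 8 - K \<le> Hs (regular_part u) / 2 - B * (norm (charge u))\<^sup>2 - Np p u / p"
proof -
  obtain K where K: "0 \<le> K" "\<And>u. u \<in> energy_dom \<Longrightarrow> sq u \<le> \<mu> \<Longrightarrow> Np p u \<le> K + 1 / 8 * size_sq u"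
    using Np_size_bound[OF p \<mu>, of "1 / 8"] by auto
  \<comment> \<open>The coefficient 1/2 of the H^1 norm is spent as 1/4 on the charge, 1/8 on the
    L^p term and 1/8 on the conclusion. The extra 1/4 next to |B| produces a positive multiple of
    the squared charge.\<close>
  define \<delta> where "\<delta> = 1 / (4 * \<bar>B\<bar> + 4)"
  have \<delta>: "0 < \<delta>" "(\<bar>B\<bar> + 1 / 4) * \<delta> \<le> 1 / 4" by (auto simp: \<delta>_def field_simps)
  obtain C where C: "0 \<le> C"
    "\<And>u q. u \<in> Lp 2 \<Longrightarrow> (\<lambda>x. u x - q * green 1 x) \<in> H1 \<Longrightarrow> (norm q)\<^sup>2 \<le> C * sq u + \<delta> * Hs (\<lambda>x. u x - q * green 1 x)"
    using charge_small[OF \<delta>(1)] by blast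
  show ?thesis
  proof (rule that[of "K + (\<bar>B\<bar> + 1 / 4) * (C * \<mu>)"])
    show "0 \<le> K + (\<bar>B\<bar> + 1 / 4) * (C * \<mu>)" using K C \<mu> by simp
    fix u assume u: "u \<in> energy_dom" "sq u \<le> \<mu>"
    let ?H = "Hs (regular_part u)" and ?Q = "(norm (charge u))\<^sup>2"
    have "?Q \<le> C * sq u + \<delta> * ?H"
      using C(2)[OF energy_domD(1)[OF u(1)], of "charge u"] energy_domD(2)[OF u(1)] by (simp add: regular_part_def[abs_def])
    also have "\<dots> \<le> C * \<mu> + \<delta> * ?H" using u(2) C(1) by (intro add_right_mono mult_left_mono)
    finally have "(\<bar>B\<bar> + 1 / 4) * ?Q \<le> (\<bar>B\<bar> + 1 / 4) * (C * \<mu> + \<delta> * ?H)" by (intro mult_left_mono) auto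
    also have "\<dots> = (\<bar>B\<bar> + 1 / 4) * (C * \<mu>) + (\<bar>B\<bar> + 1 / 4) * \<delta> * ?H" by (simp add: algebra_simps)
    also have "\<dots> \<le> (\<bar>B\<bar> + 1 / 4) * (C * \<mu>) + 1 / 4 * ?H"
      using \<delta>(2) Hs_nonneg by (intro add_left_mono mult_right_mono) auto
    finally have 1: "\<bar>B\<bar> * ?Q + ?Q / 4 \<le> (\<bar>B\<bar> + 1 / 4) * (C * \<mu>) + ?H / 4" by (simp add: algebra_simps)
    have 2: "Np p u / p \<le> Np p u" using p Np_nonneg[of p u] by (simp add: divide_le_eq mult_le_cancel_left1)
    have 3: "B * ?Q \<le> \<bar>B\<bar> * ?Q" by (intro mult_right_mono) auto
    show "size_sq u / 8 - (K + (\<bar>B\<bar> + 1 / 4) * (C * \<mu>)) \<le> ?H / 2 - B * ?Q - Np p u / p"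
    proof -
      have "h / 8 + q / 8 - (K + X) \<le> h / 2 - b - n" if "b' + q / 4 \<le> X + h / 4" "n \<le> N" "b \<le> b'" "N \<le> K + 1 / 8 * (h + q)"
        for h q b b' n N X :: real
        using that by (simp add: field_simps)
      from this[OF 1 2 3 K(2)[OF u]] show ?thesis by (simp add: add_divide_distrib)
    qed
  qed
qed

lemma energy1_eq:
  assumes "p \<noteq> 0"
  shows "energy1 p \<sigma> u = (Hs (regular_part u) - sq u) / 2
    + (norm (charge u))\<^sup>2 / 2 * (\<sigma> + (euler_mascheroni - ln 2) / (2 * pi)) - Np p u / p"
  unfolding energy1_def using assms by (simp add: H1_norm_sq Lp_norm_2 Lp_norm_powr)

section \<open>Convexity of the L^p term\<close>

lemma powr_convex_combination:
  fixes x y s p :: real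
  assumes "0 \<le> x" "0 \<le> y" "0 \<le> s" "s \<le> 1" "1 \<le> p"
  shows "((1 - s) * x + s * y) powr p \<le> (1 - s) * x powr p + s * y powr p"
proof -
  have pw: "t powr p \<le> t" if "0 \<le> t" "t \<le> 1" for t :: real
    using powr_mono'[of 1 p t] that assms(5) by simp
  show ?thesis
  proof (cases "x = 0 \<or> y = 0")
    case True
    then show ?thesis
      using assms pw[of s] pw[of "1 - s"] by (auto simp: powr_mult intro!: mult_right_mono)
  next
    case False
    then show ?thesis
      using convex_onD[OF powr_convex[OF assms(5)], of s x y] assms by simp
  qed
qed

lemma norm_powr_convex:
  fixes a b :: complex and s p :: real
  assumes "0 \<le> s" "s \<le> 1" "1 \<le> p"
  shows "norm ((1 - s) *\<^sub>R a + s *\<^sub>R b) powr p \<le> (1 - s) * norm a powr p + s * norm b powr p"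
proof -
  have "norm ((1 - s) *\<^sub>R a + s *\<^sub>R b) \<le> (1 - s) * norm a + s * norm b"
    using norm_triangle_ineq[of "(1 - s) *\<^sub>R a" "s *\<^sub>R b"] assms by simp
  then have "norm ((1 - s) *\<^sub>R a + s *\<^sub>R b) powr p \<le> ((1 - s) * norm a + s * norm b) powr p"
    using assms by (intro powr_mono2) auto
  also have "\<dots> \<le> (1 - s) * norm a powr p + s * norm b powr p"
    using assms by (intro powr_convex_combination) auto
  finally show ?thesis .
qed

lemma Np_midpoint:
  fixes p :: real
  assumes p: "1 \<le> p" and i: "integrable lborel (\<lambda>x. norm (f x) powr p)" "integrable lborel (\<lambda>x. norm (g x) powr p)"
    "integrable lborel (\<lambda>x. norm ((f x + g x) / 2) powr p)"
  shows "2 * Np p (\<lambda>x. (f x + g x) / 2) \<le> Np p f + Np p g"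
proof -
  have pt: "norm ((f x + g x) / 2) powr p \<le> (norm (f x) powr p + norm (g x) powr p) / 2" for x
  proof -
    have "(f x + g x) / 2 = (1 - 1 / 2) *\<^sub>R f x + (1 / 2) *\<^sub>R g x"
      by (simp add: scaleR_conv_of_real[where 'a = complex] field_simps)
    then show ?thesis using norm_powr_convex[of "1 / 2" p "f x" "g x"] p by (simp only:) simp
  qed
  have "Np p (\<lambda>x. (f x + g x) / 2) \<le> (\<integral>x. (norm (f x) powr p + norm (g x) powr p) / 2 \<partial>lborel)"
    unfolding Np_def by (intro integral_mono i pt) (use i in auto)
  also have "\<dots> = (Np p f + Np p g) / 2" unfolding Np_def using i by simp
  finally show ?thesis by simp
qed

lemma Np_cmult: "Np p (\<lambda>x. c * f x) = norm c powr p * Np p f"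
  unfolding Np_def by (simp add: norm_mult powr_mult)

section \<open>Strict order of the charges\<close>

lemma energy_dom_real_lincomb:
  fixes a b :: real
  assumes u: "u \<in> energy_dom" and v: "v \<in> energy_dom"
  defines "w \<equiv> \<lambda>x. of_real a * u x + of_real b * v x"
  shows "w \<in> energy_dom" "charge w = of_real a * charge u + of_real b * charge v"
    "Hs (regular_part w) = a\<^sup>2 * Hs (regular_part u) + b\<^sup>2 * Hs (regular_part v)
      + 2 * a * b * Re (H1_herm (regular_part u) (regular_part v))"
    "sq w = a\<^sup>2 * sq u + b\<^sup>2 * sq v + 2 * a * b * Re (herm u v)"
proof -
  show "w \<in> energy_dom" "charge w = of_real a * charge u + of_real b * charge v"
    unfolding w_def by (rule energy_dom_lincomb[OF u v])+
  have e: "Re (of_real a * cnj (of_real b) * z) = a * b * Re z" for z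
    by (simp flip: of_real_mult)
  show "Hs (regular_part w) = a\<^sup>2 * Hs (regular_part u) + b\<^sup>2 * Hs (regular_part v)
      + 2 * a * b * Re (H1_herm (regular_part u) (regular_part v))"
    unfolding w_def energy_dom_lincomb(3)[OF u v]
    using Hs_lincomb[OF energy_domD(2)[OF u] energy_domD(2)[OF v], of "of_real a" "of_real b"] by (simp only: e) simp
  show "sq w = a\<^sup>2 * sq u + b\<^sup>2 * sq v + 2 * a * b * Re (herm u v)"
    unfolding w_def
    using sq_lincomb[OF energy_domD(1)[OF u] energy_domD(1)[OF v], of "of_real a" "of_real b"] by (simp only: e) simp
qed

lemma mass_constraint_iff:
  "(u, v) \<in> mass_constraint \<mu> \<longleftrightarrow> u \<in> energy_dom \<and> v \<in> energy_dom \<and> sq u + sq v = \<mu>"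
  by (auto simp: mass_constraint_def Lp_norm_2)

lemma ground_state_le:
  assumes "ground_state p1 p2 \<sigma>1 \<sigma>2 \<beta> \<mu> U" "V \<in> mass_constraint \<mu>"
  shows "energy p1 p2 \<sigma>1 \<sigma>2 \<beta> U \<le> energy p1 p2 \<sigma>1 \<sigma>2 \<beta> V"
proof -
  have "ereal (energy p1 p2 \<sigma>1 \<sigma>2 \<beta> U) \<le> ereal (energy p1 p2 \<sigma>1 \<sigma>2 \<beta> V)"
    using assms unfolding ground_state_def by (metis INF_lower)
  then show ?thesis by simp
qed

text \<open>Divide by s and let s tend to 0: a quantity of first order cannot be dominated by one of
  second order.\<close>

lemma rotation_gap:
  fixes D M q :: real
  assumes "0 < D" "0 \<le> M"
    and "\<And>s c. 0 < s \<Longrightarrow> 0 < c \<Longrightarrow> s\<^sup>2 + c\<^sup>2 = 1 \<Longrightarrow> s * c * D \<le> s\<^sup>2 * M"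
  shows False
proof -
  define s where "s = min (1 / 2) (D / (4 * (M + 1)))"
  define c where "c = sqrt (1 - s\<^sup>2)"
  have s: "0 < s" "s \<le> 1 / 2" "s \<le> D / (4 * (M + 1))"
    using assms(1,2) by (simp_all only: s_def min.cobounded1 min.cobounded2) simp
  have s3: "s * (4 * (M + 1)) \<le> D" using s(3) assms(2) by (subst (asm) pos_le_divide_eq) auto
  have s2: "s\<^sup>2 \<le> 1 / 4" using power_mono[OF s(2), of 2] s(1) by (simp add: power_divide)
  have c2: "c\<^sup>2 = 1 - s\<^sup>2" unfolding c_def using s2 by (intro real_sqrt_pow2) auto
  have c: "1 / 2 \<le> c" unfolding c_def using s2 by (intro real_le_rsqrt) (simp add: power_divide)
  have "s * c * D \<le> s\<^sup>2 * M" using s c c2 by (intro assms(3)) auto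
  then have "c * D \<le> s * M" using s(1) by (simp add: power2_eq_square mult.assoc)
  moreover have "1 / 2 * D \<le> c * D" using c assms(1) by (intro mult_right_mono) auto
  moreover have "s * M \<le> s * (M + 1)" using s by simp
  ultimately show False using s3 assms(1) by simp
qed

text \<open>If the charges agreed, exchanging the components would give a second ground state. Rotating
  the pair then changes the energy to first order, while the \<open>L\<^sup>p\<close> terms at the angles \<open>\<plusminus>t\<close>
  are controlled to second order by convexity alone.\<close>

lemma ground_state_charges:
  fixes p \<mu> \<beta> \<sigma>1 \<sigma>2 :: real
  assumes p: "2 < p" "p < 4" and \<beta>: "0 < \<beta>" and \<sigma>: "\<sigma>1 < \<sigma>2"
    and gs: "ground_state p p \<sigma>1 \<sigma>2 \<beta> \<mu> (u1, u2)"
    and c1: "charge u1 \<in> \<real>" "0 < Re (charge u1)" and c2: "charge u2 \<in> \<real>" "0 < Re (charge u2)"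
  shows "Re (charge u2) < Re (charge u1)"
proof -
  define q1 q2 where "q1 = Re (charge u1)" and "q2 = Re (charge u2)"
  have q: "charge u1 = of_real q1" "charge u2 = of_real q2" "0 < q1" "0 < q2"
    using c1 c2 by (simp_all add: q1_def q2_def)
  have p0: "p \<noteq> 0" using p by simp
  define k where "k = (euler_mascheroni - ln 2) / (2 * pi :: real)"
  have u: "u1 \<in> energy_dom" "u2 \<in> energy_dom" "sq u1 + sq u2 = \<mu>"
    using gs unfolding ground_state_def mass_constraint_iff by auto
  note E = energy1_eq[OF p0, folded k_def]
  have nr: "(norm (complex_of_real x))\<^sup>2 = x\<^sup>2" for x by simp
  define H N where "H = Hs (regular_part u1) + Hs (regular_part u2)" and "N = Np p u1 + Np p u2"
  have EU: "energy p p \<sigma>1 \<sigma>2 \<beta> (u1, u2) = (H - \<mu>) / 2 + q1\<^sup>2 / 2 * (\<sigma>1 + k) + q2\<^sup>2 / 2 * (\<sigma>2 + k) - N / p - \<beta> * (q1 * q2)"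
    unfolding energy_def E H_def N_def u(3)[symmetric]
    by (simp add: q algebra_simps add_divide_distrib diff_divide_distrib)
  have "energy p p \<sigma>1 \<sigma>2 \<beta> (u1, u2) \<le> energy p p \<sigma>1 \<sigma>2 \<beta> (u2, u1)"
    by (rule ground_state_le[OF gs]) (use u in \<open>auto simp: mass_constraint_iff\<close>)
  also have "\<dots> = (H - \<mu>) / 2 + q2\<^sup>2 / 2 * (\<sigma>1 + k) + q1\<^sup>2 / 2 * (\<sigma>2 + k) - N / p - \<beta> * (q1 * q2)"
    unfolding energy_def E H_def N_def u(3)[symmetric]
    by (simp add: q algebra_simps add_divide_distrib diff_divide_distrib)
  finally have "0 \<le> (\<sigma>2 - \<sigma>1) * (q1\<^sup>2 - q2\<^sup>2)" unfolding EU by (simp add: field_simps)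
  then have "q2\<^sup>2 \<le> q1\<^sup>2" using \<sigma> by (simp add: zero_le_mult_iff)
  then have "q2 \<le> q1" using q by (simp add: power2_le_iff_abs_le)
  moreover have "q1 \<noteq> q2"
  proof
    assume eq: "q1 = q2"
    \<comment> \<open>Here s and c are the sine and cosine of the angle. The left side is the
      first-order gain from moving charge to the component of smaller strength; the right side
      collects what is of second order.\<close>
    have "s * c * (q1\<^sup>2 * (\<sigma>2 - \<sigma>1)) \<le> s\<^sup>2 * (2 * \<beta> * q1\<^sup>2 + 2 * N / p)"
      if s: "0 < s" and c: "0 < c" and sc: "s\<^sup>2 + c\<^sup>2 = 1" for s c :: real
    proof -
      define w where "w a b = (\<lambda>x. of_real a * u1 x + of_real b * u2 x)" for a b :: real
      have wD: "w a b \<in> energy_dom" "charge (w a b) = of_real ((a + b) * q1)" for a b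
        using energy_dom_real_lincomb(1,2)[OF u(1,2), of a b] eq by (simp_all add: w_def q algebra_simps)
      have wH: "Hs (regular_part (w a b)) = a\<^sup>2 * Hs (regular_part u1) + b\<^sup>2 * Hs (regular_part u2)
          + 2 * a * b * Re (H1_herm (regular_part u1) (regular_part u2))"
        "sq (w a b) = a\<^sup>2 * sq u1 + b\<^sup>2 * sq u2 + 2 * a * b * Re (herm u1 u2)" for a b
        unfolding w_def by (rule energy_dom_real_lincomb(3,4)[OF u(1,2)])+
      have EV: "energy p p \<sigma>1 \<sigma>2 \<beta> (w a b, w a' b')
        = (Hs (regular_part (w a b)) + Hs (regular_part (w a' b')) - (sq (w a b) + sq (w a' b'))) / 2
          + ((a + b) * q1)\<^sup>2 / 2 * (\<sigma>1 + k) + ((a' + b') * q1)\<^sup>2 / 2 * (\<sigma>2 + k)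
          - (Np p (w a b) + Np p (w a' b')) / p - \<beta> * ((a + b) * q1 * ((a' + b') * q1))" for a b a' b'
        unfolding energy_def fst_conv snd_conv E wD nr
        by (simp add: algebra_simps add_divide_distrib diff_divide_distrib flip: of_real_mult)
      have m: "sq (w s c) + sq (w c (- s)) = \<mu>" "sq (w c s) + sq (w (- s) c) = \<mu>"
        "Hs (regular_part (w s c)) + Hs (regular_part (w c (- s))) = H"
        "Hs (regular_part (w c s)) + Hs (regular_part (w (- s) c)) = H"
      proof -
        have "a\<^sup>2 * x + b\<^sup>2 * y + 2 * a * b * z + ((a')\<^sup>2 * x + (b')\<^sup>2 * y + 2 * a' * b' * z) = x + y"
          if "a\<^sup>2 + (a')\<^sup>2 = 1" "b\<^sup>2 + (b')\<^sup>2 = 1" "a * b + a' * b' = 0" for a b a' b' x y z :: real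
        proof -
          have "a\<^sup>2 * x + b\<^sup>2 * y + 2 * a * b * z + ((a')\<^sup>2 * x + (b')\<^sup>2 * y + 2 * a' * b' * z)
            = (a\<^sup>2 + (a')\<^sup>2) * x + (b\<^sup>2 + (b')\<^sup>2) * y + 2 * z * (a * b + a' * b')" by (simp add: algebra_simps)
          then show ?thesis unfolding that by simp
        qed
        note r = this
        show "sq (w s c) + sq (w c (- s)) = \<mu>" "sq (w c s) + sq (w (- s) c) = \<mu>"
          unfolding wH u(3)[symmetric] by (rule r; use sc in \<open>simp add: add.commute\<close>)+
        show "Hs (regular_part (w s c)) + Hs (regular_part (w c (- s))) = H"
          "Hs (regular_part (w c s)) + Hs (regular_part (w (- s) c)) = H"
          unfolding wH H_def by (rule r; use sc in \<open>simp add: add.commute\<close>)+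
      qed
      \<comment> \<open>The competitors are the rotation by the angle, and the rotation by its
        opposite followed by an exchange. In both of them the charge of the first component is (s +
        c) q1 and that of the second (c - s) q1.\<close>
      have 1: "energy p p \<sigma>1 \<sigma>2 \<beta> (u1, u2) \<le> energy p p \<sigma>1 \<sigma>2 \<beta> (w s c, w c (- s))"
        "energy p p \<sigma>1 \<sigma>2 \<beta> (u1, u2) \<le> energy p p \<sigma>1 \<sigma>2 \<beta> (w c s, w (- s) c)"
        by (rule ground_state_le[OF gs]; use wD m in \<open>auto simp: mass_constraint_iff\<close>)+
      have mid: "2 * (c powr p * Np p v) \<le> Np p f + Np p g"
        if fg: "f \<in> energy_dom" "g \<in> energy_dom" "v \<in> energy_dom" and e: "\<And>x. f x + g x = 2 * (of_real c * v x)" for f g v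
      proof -
        have e': "(f x + g x) / 2 = of_real c * v x" for x using e by simp
        have "2 * Np p (\<lambda>x. (f x + g x) / 2) \<le> Np p f + Np p g"
        proof (rule Np_midpoint)
          show "integrable lborel (\<lambda>x. norm ((f x + g x) / 2) powr p)"
            unfolding e' using energy_dom_Lp[OF p energy_dom_cmult(1)[OF fg(3)]] .
        qed (use p energy_dom_Lp[OF p] fg in auto)
        then show ?thesis unfolding e' Np_cmult using c by simp
      qed
      \<comment> \<open>The components that are close to u1 are c u1 - s u2 and c u1 + s u2: in
        their sum the first-order terms cancel. The same happens for u2 below.\<close>
      have 2: "2 * (c powr p * Np p u1) \<le> Np p (w c (- s)) + Np p (w c s)"
        by (rule mid[OF wD(1) wD(1) u(1)]) (simp add: w_def)
      have 3: "2 * (c powr p * Np p u2) \<le> Np p (w s c) + Np p (w (- s) c)"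
        by (rule mid[OF wD(1) wD(1) u(2)]) (simp add: w_def)
      \<comment> \<open>As c \<le> 1 and p < 4, c^p is at least c^4 = (1 - s^2)^2, so the loss is of
        second order.\<close>
      have cp: "1 - 2 * s\<^sup>2 \<le> c powr p"
      proof -
        have "c\<^sup>2 \<le> 1\<^sup>2" unfolding power_one using sc zero_le_power2[of s] by linarith
        then have "c \<le> 1" by (rule power2_le_imp_le) simp
        then have "c powr 4 \<le> c powr p" using powr_mono'[of p 4 c] p c by simp
        moreover have "c powr 4 = (c\<^sup>2)\<^sup>2" using c by simp
        moreover have "(c\<^sup>2)\<^sup>2 = (1 - s\<^sup>2)\<^sup>2"
        proof -
          have "c\<^sup>2 = 1 - s\<^sup>2" using sc by linarith
          then show ?thesis by (rule arg_cong)
        qed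
        moreover have "1 - 2 * s\<^sup>2 \<le> (1 - s\<^sup>2)\<^sup>2" by (simp add: power2_diff)
        ultimately show ?thesis by linarith
      qed
      have N0: "0 \<le> N" unfolding N_def using Np_nonneg by (intro add_nonneg_nonneg)
      have "(1 - 2 * s\<^sup>2) * (2 * N) \<le> c powr p * (2 * N)" using cp N0 by (intro mult_right_mono) auto
      also have "\<dots> \<le> Np p (w s c) + Np p (w c (- s)) + (Np p (w c s) + Np p (w (- s) c))"
        using 2 3 by (simp add: N_def algebra_simps)
      finally have 4: "(1 - 2 * s\<^sup>2) * (2 * N) / p \<le> (Np p (w s c) + Np p (w c (- s))) / p + (Np p (w c s) + Np p (w (- s) c)) / p"
        using p by (simp add: add_divide_distrib[symmetric] divide_right_mono)
      have "2 * energy p p \<sigma>1 \<sigma>2 \<beta> (u1, u2) \<le> energy p p \<sigma>1 \<sigma>2 \<beta> (w s c, w c (- s)) + energy p p \<sigma>1 \<sigma>2 \<beta> (w c s, w (- s) c)"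
        using 1 by linarith
      also have "\<dots> = (H - \<mu>) + ((s + c)\<^sup>2 * q1\<^sup>2 * (\<sigma>1 + k) + (c - s)\<^sup>2 * q1\<^sup>2 * (\<sigma>2 + k))
          - ((Np p (w s c) + Np p (w c (- s))) / p + (Np p (w c s) + Np p (w (- s) c)) / p) - 2 * \<beta> * ((s + c) * (c - s) * q1\<^sup>2)"
        unfolding EV m by (simp add: power_mult_distrib power2_eq_square field_simps)
      also have "\<dots> \<le> (H - \<mu>) + ((s + c)\<^sup>2 * q1\<^sup>2 * (\<sigma>1 + k) + (c - s)\<^sup>2 * q1\<^sup>2 * (\<sigma>2 + k))
          - (1 - 2 * s\<^sup>2) * (2 * N) / p - 2 * \<beta> * ((s + c) * (c - s) * q1\<^sup>2)"
        using 4 by linarith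
      also have "(s + c)\<^sup>2 = 1 + 2 * s * c" using sc by (simp add: power2_sum)
      also have "(c - s)\<^sup>2 = 1 - 2 * s * c" using sc by (simp add: power2_diff)
      also have "(s + c) * (c - s) = 1 - 2 * s\<^sup>2" using sc by (simp add: power2_eq_square algebra_simps)
      finally have "2 * energy p p \<sigma>1 \<sigma>2 \<beta> (u1, u2) \<le> (H - \<mu>) + ((1 + 2 * s * c) * q1\<^sup>2 * (\<sigma>1 + k) + (1 - 2 * s * c) * q1\<^sup>2 * (\<sigma>2 + k))
          - (1 - 2 * s\<^sup>2) * (2 * N) / p - 2 * \<beta> * ((1 - 2 * s\<^sup>2) * q1\<^sup>2)" .
      moreover have "2 * energy p p \<sigma>1 \<sigma>2 \<beta> (u1, u2) = (H - \<mu>) + (q1\<^sup>2 * (\<sigma>1 + k) + q1\<^sup>2 * (\<sigma>2 + k)) - 2 * N / p - 2 * \<beta> * q1\<^sup>2"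
        unfolding EU eq by (simp add: power2_eq_square field_simps)
      moreover have "(1 - 2 * s\<^sup>2) * (2 * N) / p = 2 * N / p - 2 * (s\<^sup>2 * (2 * N / p))"
        by (simp add: left_diff_distrib diff_divide_distrib)
      ultimately have "2 * (s * c * (q1\<^sup>2 * (\<sigma>2 - \<sigma>1))) \<le> 2 * (s\<^sup>2 * (2 * N / p)) + 2 * (s\<^sup>2 * (2 * \<beta> * q1\<^sup>2))"
        by (simp add: algebra_simps)
      then show ?thesis by (simp add: distrib_left)
    qed
    moreover have "0 < q1\<^sup>2 * (\<sigma>2 - \<sigma>1)" using q \<sigma> by simp
    moreover have "0 \<le> 2 * \<beta> * q1\<^sup>2 + 2 * N / p" using \<beta> p Np_nonneg[of p u1] Np_nonneg[of p u2] by (simp add: N_def)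
    ultimately show False using rotation_gap[of "q1\<^sup>2 * (\<sigma>2 - \<sigma>1)" "2 * \<beta> * q1\<^sup>2 + 2 * N / p"] by blast
  qed
  ultimately show ?thesis unfolding q1_def q2_def by simp
qed

section \<open>Non-vanishing in \<open>L\<^sup>p\<close>\<close>

text \<open>The two normalisations together make \<open>\<rho>\<close> nonnegative up to null sets,
  and mollification a contraction in L^2. Evenness turns the correlation \<open>cnv\<close> into a
  convolution.\<close>

definition mollifier :: "real \<Rightarrow> fn \<Rightarrow> bool" where
  "mollifier h \<rho> \<longleftrightarrow> test_fun \<rho> \<and> (\<forall>x. \<rho> x \<in> \<real>) \<and> (\<forall>x. \<rho> (- x) = \<rho> x) \<and> (\<integral>x. \<rho> x \<partial>lborel) = 1
    \<and> (\<integral>x. norm (\<rho> x) \<partial>lborel) = 1 \<and> (\<forall>x. \<rho> x \<noteq> 0 \<longrightarrow> norm x \<le> h)"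

lemma bump_integral_pos:
  assumes "0 < r" shows "0 < (\<integral>x. bump 1 (\<chi> i. - r) (\<chi> i. r) x \<partial>lborel)"
proof -
  let ?b = "bump 1 (\<chi> i. - r) (\<chi> i. r)"
  have "integrable lborel (\<lambda>x. Re (complex_of_real (?b x)))"
    by (intro integrable_Re test_fun_integrable test_fun_bump) simp
  then have i: "integrable lborel ?b" by simp
  have n: "0 \<le> ?b x" for x by (rule bump_props(1)) simp
  have "(\<integral>x. ?b x \<partial>lborel) \<noteq> 0"
  proof
    assume "(\<integral>x. ?b x \<partial>lborel) = 0"
    then have "AE x in lborel. ?b x = 0" using i n by (subst (asm) integral_nonneg_eq_0_iff_AE) auto
    from AE_lborel_ex_ball[OF this assms, of 0] obtain x where x: "norm x < r" "?b x = 0" by auto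
    have "\<bar>x $ i\<bar> < r" for i using component_le_norm_cart[of x i] x(1) by simp
    then have "x \<in> box (\<chi> i. - r) (\<chi> i. r)" by (auto simp: mem_box_cart abs_less_iff minus_less_iff)
    then have "0 < ?b x" by (intro bump_props(4)) auto
    with x(2) show False by simp
  qed
  then show ?thesis using n by (simp add: less_le)
qed

lemma mollifier_exists:
  assumes "0 < h" shows "\<exists>\<rho>. mollifier h \<rho>"
proof -
  \<comment> \<open>The box of half side h / 2 lies in the ball of radius h.\<close>
  define r where "r = h / 2"
  have r: "0 < r" using assms by (simp add: r_def)
  let ?b = "bump 1 (\<chi> i. - r) (\<chi> i. r)"
  define Z where "Z = (\<integral>x. ?b x \<partial>lborel)"
  have Z: "0 < Z" unfolding Z_def by (rule bump_integral_pos[OF r])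
  define \<rho> :: fn where "\<rho> x = of_real (1 / Z) * of_real (?b x)" for x
  have t: "test_fun \<rho>" unfolding \<rho>_def[abs_def] by (intro test_fun_cmult test_fun_bump) simp
  have n: "0 \<le> ?b x" for x by (rule bump_props(1)) simp
  have 1: "(\<integral>x. complex_of_real (?b x) \<partial>lborel) = of_real Z" unfolding Z_def by (rule integral_complex_of_real)
  have "norm (\<rho> x) = 1 / Z * ?b x" for x using n[of x] Z by (simp add: \<rho>_def norm_mult norm_divide)
  then have 2: "(\<integral>x. norm (\<rho> x) \<partial>lborel) = 1" using Z by (simp add: Z_def[symmetric])
  have ev: "?b (- x) = ?b x" for x
    unfolding bump_def by (rule prod.cong) (auto simp: mult.commute add.commute)
  have "norm x \<le> h" if "\<rho> x \<noteq> 0" for x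
  proof -
    have "x \<in> box (\<chi> i. - r) (\<chi> i. r)" using that bump_props(3)[of 1 x] by (force simp: \<rho>_def)
    then have "\<bar>x $ i\<bar> \<le> r" for i by (auto simp: mem_box_cart abs_le_iff minus_le_iff intro: less_imp_le)
    from this[of 1] this[of 2] show ?thesis using norm_le_l1_cart[of x] by (simp add: sum_2 r_def)
  qed
  moreover have "(\<integral>x. \<rho> x \<partial>lborel) = 1" unfolding \<rho>_def using 1 Z by simp
  moreover have "\<rho> x \<in> \<real>" "\<rho> (- x) = \<rho> x" for x
    unfolding \<rho>_def ev of_real_mult[symmetric] by (rule Reals_of_real refl)+
  ultimately have "mollifier h \<rho>"
    unfolding mollifier_def using t 2 by blast
  then show ?thesis by blast
qed

text \<open>Mollification commutes with translations and is an L^2 contraction.\<close>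

lemma cnv_modulus:
  assumes \<rho>: "mollifier h \<rho>" and f: "f \<in> Lp 2" and m: "modulus a A f"
  shows "modulus a A (cnv \<rho> f)"
  unfolding modulus_def
proof
  fix z
  have t: "test_fun \<rho>" using \<rho> by (simp add: mollifier_def)
  note \<rho>L = test_fun_Lp_2[OF t]
  have "cnv \<rho> f (x + z) - cnv \<rho> f x = cnv \<rho> (\<lambda>x. f (x + z) - f x) x" for x
    unfolding cnv_def
    using cnv_integrand_integrable[OF \<rho>L f, of "x + z"] cnv_integrand_integrable[OF \<rho>L f, of x]
    by (simp add: right_diff_distrib add.assoc add.commute[of z])
  then have "sq (\<lambda>x. cnv \<rho> f (x + z) - cnv \<rho> f x) = sq (cnv \<rho> (\<lambda>x. f (x + z) - f x))" by simp
  also have "\<dots> \<le> (\<integral>z. norm (\<rho> z) \<partial>lborel)\<^sup>2 * sq (\<lambda>x. f (x + z) - f x)"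
    by (rule cnv_Lp_2(2)[OF test_fun_integrable[OF t] Lp_2_diff(1)[OF Lp_2_shift(1)[OF f] f]])
  also have "\<dots> \<le> A * norm z powr a" using \<rho> m by (simp add: mollifier_def modulus_def)
  finally show "sq (\<lambda>x. cnv \<rho> f (x + z) - cnv \<rho> f x) \<le> A * norm z powr a" .
qed

text \<open>The error is an average of the differences f(x) - f(x + z) over |z| \<le> h, so
  Minkowski's inequality applies.\<close>

lemma mollifier_error:
  assumes \<rho>: "mollifier h \<rho>" and f: "f \<in> Lp 2" and m: "modulus a A f" and A: "0 \<le> A" and a: "0 < a"
  shows "sq (\<lambda>x. f x - cnv \<rho> f x) \<le> A * h powr a" "modulus a (4 * A) (\<lambda>x. f x - cnv \<rho> f x)"
proof -
  have t: "test_fun \<rho>" and i1: "(\<integral>x. \<rho> x \<partial>lborel) = 1" "(\<integral>x. norm (\<rho> x) \<partial>lborel) = 1"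
    and sup: "\<And>x. \<rho> x \<noteq> 0 \<Longrightarrow> norm x \<le> h" using \<rho> by (auto simp: mollifier_def)
  note \<rho>L = test_fun_Lp_2[OF t] and \<rho>i = test_fun_integrable[OF t]
  have cL: "cnv \<rho> f \<in> Lp 2" by (rule cnv_Lp_2(1)[OF \<rho>i f])
  have [measurable]: "f \<in> borel_measurable borel" using f Lp_2_measurable by auto
  define F where "F x z = f x - f (x + z)" for x z
  have F: "(\<lambda>(x, z). F x z) \<in> borel_measurable (lborel \<Otimes>\<^sub>M lborel)" unfolding F_def by measurable
  have Fb: "(\<integral>\<^sup>+x. ennreal ((norm (F x z))\<^sup>2) \<partial>lborel) \<le> ennreal (A * h powr a)" if "\<rho> z \<noteq> 0" for z
  proof -
    have "(\<integral>\<^sup>+x. ennreal ((norm (F x z))\<^sup>2) \<partial>lborel) = ennreal (sq (\<lambda>x. f (x + z) - f x))"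
      using ennreal_sq[OF Lp_2_diff(1)[OF Lp_2_shift(1)[OF f, of z] f]] by (simp add: F_def norm_minus_commute)
    also have "\<dots> \<le> ennreal (A * h powr a)"
    proof (rule ennreal_leI)
      have "sq (\<lambda>x. f (x + z) - f x) \<le> A * norm z powr a" using m by (simp add: modulus_def)
      also have "\<dots> \<le> A * h powr a" using sup[OF that] a A by (intro mult_left_mono powr_mono2) auto
      finally show "sq (\<lambda>x. f (x + z) - f x) \<le> A * h powr a" .
    qed
    finally show ?thesis .
  qed
  have "f x - cnv \<rho> f x = (\<integral>z. \<rho> z * F x z \<partial>lborel)" for x
    unfolding cnv_def F_def using cnv_integrand_integrable[OF \<rho>L f, of x] \<rho>i i1(1)
    by (simp add: right_diff_distrib)
  then show "sq (\<lambda>x. f x - cnv \<rho> f x) \<le> A * h powr a"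
    using average_L2(2)[OF F \<rho>i _ Fb] A i1(2) by simp
  show "modulus a (4 * A) (\<lambda>x. f x - cnv \<rho> f x)"
    unfolding modulus_def
  proof
    fix z
    have "sq (\<lambda>x. (f (x + z) - cnv \<rho> f (x + z)) - (f x - cnv \<rho> f x))
        = sq (\<lambda>x. (f (x + z) - f x) - (cnv \<rho> f (x + z) - cnv \<rho> f x))" by (simp add: algebra_simps)
    also have "\<dots> \<le> 2 * sq (\<lambda>x. f (x + z) - f x) + 2 * sq (\<lambda>x. cnv \<rho> f (x + z) - cnv \<rho> f x)"
      by (intro Lp_2_diff Lp_2_shift(1) f cL)
    also have "\<dots> \<le> 2 * (A * norm z powr a) + 2 * (A * norm z powr a)"
      using m cnv_modulus[OF \<rho> f m] unfolding modulus_def by (intro add_mono mult_left_mono) auto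
    finally show "sq (\<lambda>x. (f (x + z) - cnv \<rho> f (x + z)) - (f x - cnv \<rho> f x)) \<le> 4 * A * norm z powr a" by simp
  qed
qed

text \<open>The L^2 error is small with h while its modulus stays bounded, so the
  Gagliardo-Nirenberg inequality makes the L^p error small too. The scale is the same for all
  functions with the given modulus, which covers both a bounded set of H^1 and the Green's
  function.\<close>

lemma mollifier_error_small:
  fixes p A \<eta> :: real
  assumes p: "2 < p" "p < 4" and A: "0 \<le> A" and \<eta>: "0 < \<eta>"
  obtains h where "0 < h"
    "\<And>\<rho> f. mollifier h \<rho> \<Longrightarrow> f \<in> Lp 2 \<Longrightarrow> modulus (p / 2) A f \<Longrightarrow>
      sq (\<lambda>x. f x - cnv \<rho> f x) \<le> \<eta> \<and> integrable lborel (\<lambda>x. norm (f x - cnv \<rho> f x) powr p)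
      \<and> Np p (\<lambda>x. f x - cnv \<rho> f x) \<le> \<eta>"
proof -
  have GN: "\<exists>C\<ge>0. \<forall>f A m S. f \<in> Lp 2 \<longrightarrow> modulus (p / 2) A f \<longrightarrow> 0 \<le> A \<longrightarrow> sq f \<le> m \<longrightarrow> 0 < m \<longrightarrow> 0 < (S :: real) \<longrightarrow>
      integrable lborel (\<lambda>x. norm (f x) powr p)
      \<and> Np p f \<le> S powr (p - 2) * m + C * (S powr (p - 2 - p / 2) * m powr (p / 2 / 2) * A)"
    by (rule Gagliardo_Nirenberg[of "p / 2" p]) (use p in auto)
  then obtain C where C: "0 \<le> C"
    "\<And>f A m S. f \<in> Lp 2 \<Longrightarrow> modulus (p / 2) A f \<Longrightarrow> 0 \<le> A \<Longrightarrow> sq f \<le> m \<Longrightarrow> 0 < m \<Longrightarrow> 0 < (S :: real) \<Longrightarrow>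
      integrable lborel (\<lambda>x. norm (f x) powr p)
      \<and> Np p f \<le> S powr (p - 2) * m + C * (S powr (p - 2 - p / 2) * m powr (p / 2 / 2) * A)"
    by blast
  \<comment> \<open>The mass bound is A h^(p/2) + h and the cut height 1. The summand h keeps the
    mass bound positive when A = 0, as the interpolation inequality requires.\<close>
  have "((\<lambda>h. A * h powr (p / 2) + h + C * ((A * h powr (p / 2) + h) powr (p / 4) * (4 * A))) \<longlongrightarrow> 0 + C * (0 powr (p / 4) * (4 * A))) (at_right 0)"
  proof -
    have "((\<lambda>h::real. h powr (p / 2)) \<longlongrightarrow> 0) (at_right 0)"
      by (rule tendsto_zero_powrI[where b = "p / 2"]) (use p in \<open>auto intro!: tendsto_eq_intros simp: eventually_at_filter\<close>)
    then have 1: "((\<lambda>h. A * h powr (p / 2) + h) \<longlongrightarrow> A * 0 + 0) (at_right 0)"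
      by (intro tendsto_intros)
    then have 1: "((\<lambda>h. A * h powr (p / 2) + h) \<longlongrightarrow> 0) (at_right 0)" by simp
    have 2: "((\<lambda>h. (A * h powr (p / 2) + h) powr (p / 4)) \<longlongrightarrow> 0) (at_right 0)"
      by (rule tendsto_zero_powrI[where b = "p / 4", OF 1])
         (use p A in \<open>auto simp: eventually_at_filter intro!: always_eventually\<close>)
    have "((\<lambda>h. A * h powr (p / 2) + h + C * ((A * h powr (p / 2) + h) powr (p / 4) * (4 * A))) \<longlongrightarrow> 0 + C * (0 * (4 * A))) (at_right 0)"
      by (intro tendsto_intros 1 2)
    then show ?thesis by simp
  qed
  then have "((\<lambda>h. A * h powr (p / 2) + h + C * ((A * h powr (p / 2) + h) powr (p / 4) * (4 * A))) \<longlongrightarrow> 0) (at_right 0)"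
    using p by simp
  then have "\<forall>\<^sub>F h in at_right 0. A * h powr (p / 2) + h + C * ((A * h powr (p / 2) + h) powr (p / 4) * (4 * A)) < \<eta>"
    using \<eta> by (rule order_tendstoD)
  moreover have "\<forall>\<^sub>F h in at_right (0::real). 0 < h" by (simp add: eventually_at_filter)
  ultimately have "\<forall>\<^sub>F h in at_right 0. 0 < h \<and> A * h powr (p / 2) + h + C * ((A * h powr (p / 2) + h) powr (p / 4) * (4 * A)) < \<eta>"
    by eventually_elim simp
  then obtain h where h: "0 < h" "A * h powr (p / 2) + h + C * ((A * h powr (p / 2) + h) powr (p / 4) * (4 * A)) < \<eta>"
    using eventually_happens'[OF trivial_limit_at_right_real] by blast
  show ?thesis
  proof (rule that[OF h(1)])
    fix \<rho> f assume \<rho>: "mollifier h \<rho>" and f: "f \<in> Lp 2" and m: "modulus (p / 2) A f"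
    let ?d = "\<lambda>x. f x - cnv \<rho> f x"
    let ?m = "A * h powr (p / 2) + h"
    have t: "test_fun \<rho>" using \<rho> by (simp add: mollifier_def)
    have dL: "?d \<in> Lp 2" by (rule Lp_2_diff(1)[OF f cnv_Lp_2(1)[OF test_fun_integrable[OF t] f]])
    have p2: "0 < p / 2" using p by simp
    note me = mollifier_error[OF \<rho> f m A p2]
    have sm: "sq ?d \<le> ?m" "0 < ?m" using me(1) h(1) A by (auto intro: add_nonneg_pos)
    have A4: "0 \<le> 4 * A" using A by simp
    from C(2)[OF dL me(2) A4 sm zero_less_one]
    have i: "integrable lborel (\<lambda>x. norm (?d x) powr p)" and N: "Np p ?d \<le> ?m + C * (?m powr (p / 4) * (4 * A))"
      by auto
    have "0 \<le> C * (?m powr (p / 4) * (4 * A))" using C(1) A by simp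
    then show "sq ?d \<le> \<eta> \<and> integrable lborel (\<lambda>x. norm (?d x) powr p) \<and> Np p ?d \<le> \<eta>"
      using i N sm(1) h(2) by linarith
  qed
qed

lemma Np_add_le:
  fixes p :: real
  assumes p: "1 \<le> p" and i: "integrable lborel (\<lambda>x. norm (f x) powr p)" "integrable lborel (\<lambda>x. norm (g x) powr p)"
    and fg: "f \<in> borel_measurable borel" "g \<in> borel_measurable borel"
  shows "Np p (\<lambda>x. f x + g x) \<le> 2 powr p * (Np p f + Np p g)" "integrable lborel (\<lambda>x. norm (f x + g x) powr p)"
proof -
  note [measurable] = fg
  have pt: "norm (f x + g x) powr p \<le> 2 powr p * (norm (f x) powr p + norm (g x) powr p)" for x
  proof -
    have "norm (f x + g x) \<le> 2 * max (norm (f x)) (norm (g x))" using norm_triangle_ineq[of "f x" "g x"] by linarith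
    then have "norm (f x + g x) powr p \<le> (2 * max (norm (f x)) (norm (g x))) powr p" using p by (intro powr_mono2) auto
    also have "\<dots> = 2 powr p * max (norm (f x)) (norm (g x)) powr p" by (simp add: powr_mult)
    also have "\<dots> \<le> 2 powr p * (norm (f x) powr p + norm (g x) powr p)" by (intro mult_left_mono) (auto simp: max_def)
    finally show ?thesis .
  qed
  have ib: "integrable lborel (\<lambda>x. 2 powr p * (norm (f x) powr p + norm (g x) powr p))" using i by simp
  show i': "integrable lborel (\<lambda>x. norm (f x + g x) powr p)"
    by (rule Bochner_Integration.integrable_bound[OF ib]) (use pt in \<open>auto intro: order_trans[OF _ abs_ge_self]\<close>)
  have "Np p (\<lambda>x. f x + g x) \<le> (\<integral>x. 2 powr p * (norm (f x) powr p + norm (g x) powr p) \<partial>lborel)"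
    unfolding Np_def by (intro integral_mono i' ib pt)
  then show "Np p (\<lambda>x. f x + g x) \<le> 2 powr p * (Np p f + Np p g)" unfolding Np_def using i by simp
qed

text \<open>Convexity gives this Lipschitz bound with a constant that does not involve \<open>\<tau>\<close>.\<close>

lemma Np_perturb:
  fixes p \<tau> :: real
  assumes p: "1 \<le> p" and i: "integrable lborel (\<lambda>x. norm (f x) powr p)" "integrable lborel (\<lambda>x. norm (g x) powr p)"
    and fg: "f \<in> borel_measurable borel" "g \<in> borel_measurable borel" and \<tau>: "0 \<le> \<tau>" "\<tau> \<le> 1"
  shows "Np p f - \<tau> * (2 powr p * (Np p f + Np p g)) \<le> Np p (\<lambda>x. f x + of_real \<tau> * g x)"
proof -
  let ?s = "1 - \<tau>"
  have ic: "integrable lborel (\<lambda>x. norm (c * g x) powr p)" for c using i(2) by (simp add: norm_mult powr_mult)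
  have [measurable]: "(\<lambda>x. c * g x) \<in> borel_measurable borel" for c :: complex using fg(2) by measurable
  note a1 = Np_add_le[OF p i(1) ic fg(1)]
  have pt: "norm (f x) powr p \<le> ?s * norm (f x + of_real \<tau> * g x) powr p + \<tau> * norm (f x + (- of_real ?s) * g x) powr p" for x
  proof -
    \<comment> \<open>\<open>f\<close> lies on the segment from f + \<tau> g to f - (1 - \<tau>) g,
      at the fraction \<tau>. At the far end the coefficient of g has modulus at most 1, which keeps
      the constant free of \<tau>.\<close>
    have "f x = (1 - \<tau>) *\<^sub>R (f x + of_real \<tau> * g x) + \<tau> *\<^sub>R (f x + (- of_real ?s) * g x)"
      by (simp add: scaleR_conv_of_real[where 'a = complex] algebra_simps)
    then show ?thesis using norm_powr_convex[OF \<tau> p, of "f x + of_real \<tau> * g x" "f x + (- of_real ?s) * g x"] by (simp only:)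
  qed
  have i1: "integrable lborel (\<lambda>x. norm (f x + of_real \<tau> * g x) powr p)"
    and i2: "integrable lborel (\<lambda>x. norm (f x + (- of_real ?s) * g x) powr p)" by (rule a1(2); measurable)+
  have "Np p f \<le> ?s * Np p (\<lambda>x. f x + of_real \<tau> * g x) + \<tau> * Np p (\<lambda>x. f x + (- of_real ?s) * g x)"
  proof -
    have "Np p f \<le> (\<integral>x. ?s * norm (f x + of_real \<tau> * g x) powr p + \<tau> * norm (f x + (- of_real ?s) * g x) powr p \<partial>lborel)"
      unfolding Np_def by (intro integral_mono i pt) (use i1 i2 in auto)
    then show ?thesis unfolding Np_def using i1 i2 by simp
  qed
  moreover have "?s * Np p (\<lambda>x. f x + of_real \<tau> * g x) \<le> Np p (\<lambda>x. f x + of_real \<tau> * g x)"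
    using \<tau> Np_nonneg by (simp add: mult_left_le_one_le)
  moreover have "\<tau> * Np p (\<lambda>x. f x + (- of_real ?s) * g x) \<le> \<tau> * (2 powr p * (Np p f + Np p g))"
  proof (intro mult_left_mono \<tau>(1))
    have "Np p (\<lambda>x. f x + (- of_real ?s) * g x) \<le> 2 powr p * (Np p f + Np p (\<lambda>x. (- of_real ?s) * g x))"
      by (rule a1(1)) measurable
    also have "\<dots> \<le> 2 powr p * (Np p f + Np p g)"
    proof -
      have "norm (- complex_of_real ?s) powr p * Np p g \<le> 1 * Np p g"
        using \<tau> p Np_nonneg[of p g] by (intro mult_right_mono powr_le1) (auto simp flip: of_real_diff of_real_minus simp del: of_real_diff of_real_minus)
      then show ?thesis unfolding Np_cmult by simp
    qed
    finally show "Np p (\<lambda>x. f x + (- of_real ?s) * g x) \<le> 2 powr p * (Np p f + Np p g)" .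
  qed
  ultimately show ?thesis by linarith
qed

text \<open>If the mollification stayed below c everywhere, the integral of its p-th power would be
  at most c^(p-2) times its mass, hence small; the mollification error is small by the choice of h.
  Together they could not reach \<delta>.\<close>

lemma nonvanishing:
  fixes p M \<delta> :: real
  assumes p: "2 < p" "p < 4" and M: "0 \<le> M" and \<delta>: "0 < \<delta>"
  obtains h c where "0 < h" "0 < c"
    "\<And>\<rho> f. mollifier h \<rho> \<Longrightarrow> f \<in> H1 \<Longrightarrow> Hs f \<le> M \<Longrightarrow> \<delta> \<le> Np p f \<Longrightarrow> \<exists>y. c \<le> norm (cnv \<rho> f y)"
proof -
  \<comment> \<open>\<open>Np_add_le\<close> is applied to two terms of size \<eta> and costs the
    factor 2^p, which leaves \<delta> / 2.\<close>
  define \<eta> where "\<eta> = \<delta> / (4 * 2 powr p)"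
  have \<eta>: "0 < \<eta>" using \<delta> by (simp add: \<eta>_def)
  have M4: "0 \<le> 4 * M" using M by simp
  obtain h where h: "0 < h"
    "\<And>\<rho> f. mollifier h \<rho> \<Longrightarrow> f \<in> Lp 2 \<Longrightarrow> modulus (p / 2) (4 * M) f \<Longrightarrow>
      sq (\<lambda>x. f x - cnv \<rho> f x) \<le> \<eta> \<and> integrable lborel (\<lambda>x. norm (f x - cnv \<rho> f x) powr p)
      \<and> Np p (\<lambda>x. f x - cnv \<rho> f x) \<le> \<eta>"
    using mollifier_error_small[OF p M4 \<eta>] by blast
  define c where "c = (\<eta> / (M + 1)) powr (1 / (p - 2))"
  have c: "0 < c" "c powr (p - 2) = \<eta> / (M + 1)" using \<eta> M p by (auto simp: c_def powr_powr)
  show ?thesis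
  proof (rule that[OF h(1) c(1)])
    fix \<rho> f assume \<rho>: "mollifier h \<rho>" and f: "f \<in> H1" and fM: "Hs f \<le> M" and N: "\<delta> \<le> Np p f"
    note fL = H1_Lp_2[OF f]
    have t: "test_fun \<rho>" and i1: "(\<integral>x. norm (\<rho> x) \<partial>lborel) = 1" using \<rho> by (auto simp: mollifier_def)
    have "modulus (p / 2) (4 * Hs f) f" by (rule H1_modulus[OF f]) (use p in auto)
    then have "modulus (p / 2) (4 * M) f"
      unfolding modulus_def using fM by (meson mult_left_mono mult_right_mono order_trans powr_ge_zero zero_le_numeral)
    from h(2)[OF \<rho> fL this]
    have d: "integrable lborel (\<lambda>x. norm (f x - cnv \<rho> f x) powr p)" "Np p (\<lambda>x. f x - cnv \<rho> f x) \<le> \<eta>" by auto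
    have cH: "cnv \<rho> f \<in> H1" by (rule cnv_H1(1)[OF t fL])
    have ci: "integrable lborel (\<lambda>x. norm (cnv \<rho> f x) powr p)"
      by (rule energy_dom_Lp[OF p H1_energy_dom(1)[OF cH]])
    have cs: "sq (cnv \<rho> f) \<le> M"
      using cnv_Lp_2(2)[OF test_fun_integrable[OF t] fL] i1 sq_le_Hs(1)[of f] fM by simp
    show "\<exists>y. c \<le> norm (cnv \<rho> f y)"
    proof (rule ccontr)
      assume "\<not> (\<exists>y. c \<le> norm (cnv \<rho> f y))"
      then have lt: "norm (cnv \<rho> f y) \<le> c" for y by (simp add: not_le less_imp_le)
      have "Np p (cnv \<rho> f) \<le> (\<integral>y. c powr (p - 2) * (norm (cnv \<rho> f y))\<^sup>2 \<partial>lborel)"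
        unfolding Np_def
      proof (intro integral_mono ci)
        show "integrable lborel (\<lambda>y. c powr (p - 2) * (norm (cnv \<rho> f y))\<^sup>2)"
          using H1_Lp_2[OF cH] by (simp add: Lp_2_iff)
        fix y
        have "norm (cnv \<rho> f y) powr p = norm (cnv \<rho> f y) powr (p - 2) * (norm (cnv \<rho> f y))\<^sup>2"
          using powr_add[of "norm (cnv \<rho> f y)" "p - 2" 2] by simp
        also have "\<dots> \<le> c powr (p - 2) * (norm (cnv \<rho> f y))\<^sup>2"
          using lt[of y] p by (intro mult_right_mono powr_mono2) auto
        finally show "norm (cnv \<rho> f y) powr p \<le> c powr (p - 2) * (norm (cnv \<rho> f y))\<^sup>2" .
      qed
      also have "\<dots> = \<eta> / (M + 1) * sq (cnv \<rho> f)" by (simp add: c(2))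
      also have "\<dots> \<le> \<eta> / (M + 1) * (M + 1)" using cs \<eta> M by (intro mult_left_mono) auto
      also have "\<dots> = \<eta>" using M by simp
      finally have cn: "Np p (cnv \<rho> f) \<le> \<eta>" .
      have dm: "(\<lambda>x. f x - cnv \<rho> f x) \<in> borel_measurable borel"
        using Lp_2_measurable[OF Lp_2_diff(1)[OF fL H1_Lp_2[OF cH]]] .
      have "Np p (\<lambda>x. cnv \<rho> f x + (f x - cnv \<rho> f x)) \<le> 2 powr p * (Np p (cnv \<rho> f) + Np p (\<lambda>x. f x - cnv \<rho> f x))"
        using p by (intro Np_add_le(1) ci d(1) dm Lp_2_measurable[OF H1_Lp_2[OF cH]]) auto
      also have "\<dots> \<le> 2 powr p * (\<eta> + \<eta>)" using cn d(2) by (intro mult_left_mono add_mono) auto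
      also have "\<dots> = \<delta> / 2" by (simp add: \<eta>_def)
      finally show False using N \<delta> by simp
    qed
  qed
qed

section \<open>The infimum of the single-component energy\<close>

lemma Hs_test_fun:
  assumes t: "test_fun \<psi>" shows "Hs \<psi> = (\<Sum>i\<in>UNIV. sq (pderiv i \<psi>)) + sq \<psi>"
proof -
  have "sq (weak_pderiv i \<psi>) = sq (pderiv i \<psi>)" for i
    using test_fun_H1[OF t] H1_weak_pderiv(1) test_fun_Lp_2[OF test_fun_pderiv[OF t]] Lp_2_measurable
    by (intro sq_cong_AE) auto
  then show ?thesis by (simp add: Hs_def)
qed

text \<open>For components of mass 0, which cannot be rescaled to positive mass.\<close>

lemma energy_dom_null:
  assumes u: "u \<in> energy_dom" and z: "sq u = 0"
  shows "charge u = 0" "Hs (regular_part u) = 0" "Np p u = 0"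
proof -
  note uL = energy_domD(1)[OF u]
  have "AE x in lborel. (norm (u x))\<^sup>2 = 0"
    using uL z by (subst (asm) integral_nonneg_eq_0_iff_AE) (auto simp: Lp_2_iff)
  then have ae: "AE x in lborel. 0 = u x" by eventually_elim simp
  from H1_cong_AE(1)[OF H1_zero Lp_2_measurable[OF uL] ae] have uH: "u \<in> H1" .
  then show "charge u = 0" by (rule H1_energy_dom(2))
  have "Hs u = Hs (\<lambda>x. 0)" by (rule Hs_cong_AE[OF H1_zero Lp_2_measurable[OF uL] ae])
  also have "\<dots> = 0" using Hs_cmult[OF H1_zero, of 0] by simp
  finally show "Hs (regular_part u) = 0" using H1_energy_dom(3)[OF uH] by simp
  have "Np p u = (\<integral>x. 0 \<partial>(lborel :: (real ^ 2) measure))"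
    unfolding Np_def
  proof (intro integral_cong_AE)
    have [measurable]: "u \<in> borel_measurable borel" using Lp_2_measurable[OF uL] .
    show "(\<lambda>x. norm (u x) powr p) \<in> borel_measurable lborel" by measurable
    show "AE x in lborel. norm (u x) powr p = 0" using ae by eventually_elim auto
  qed auto
  then show "Np p u = 0" by simp
qed

text \<open>The part of the energy that is homogeneous of degree 2, as opposed to p.\<close>

definition quadratic :: "real \<Rightarrow> fn \<Rightarrow> real" where
  "quadratic \<sigma> u = (Hs (regular_part u) - sq u) / 2
    + (norm (charge u))\<^sup>2 / 2 * (\<sigma> + (euler_mascheroni - ln 2) / (2 * pi))"

lemma energy1_split: "p \<noteq> 0 \<Longrightarrow> energy1 p \<sigma> u = quadratic \<sigma> u - Np p u / p"
  by (simp add: energy1_eq quadratic_def)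

lemma energy_scaling:
  fixes s :: real
  assumes u: "u \<in> energy_dom" and s: "0 \<le> s"
  defines "w \<equiv> \<lambda>x. of_real s * u x"
  shows "w \<in> energy_dom" "sq w = s\<^sup>2 * sq u" "quadratic \<sigma> w = s\<^sup>2 * quadratic \<sigma> u" "Np p w = s powr p * Np p u"
proof -
  show "w \<in> energy_dom" unfolding w_def by (rule energy_dom_cmult(1)[OF u])
  show q: "sq w = s\<^sup>2 * sq u" unfolding w_def using Lp_2_cmult(2)[OF energy_domD(1)[OF u], of "of_real s"] by simp
  have "charge w = of_real s * charge u" "regular_part w = (\<lambda>x. of_real s * regular_part u x)"
    unfolding w_def by (rule energy_dom_cmult(2,3)[OF u])+
  then have "Hs (regular_part w) = s\<^sup>2 * Hs (regular_part u)" "(norm (charge w))\<^sup>2 = s\<^sup>2 * (norm (charge u))\<^sup>2"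
    using Hs_cmult[OF energy_domD(2)[OF u], of "of_real s"] by (simp_all add: norm_mult power_mult_distrib)
  then show "quadratic \<sigma> w = s\<^sup>2 * quadratic \<sigma> u" unfolding quadratic_def q by (simp add: algebra_simps add_divide_distrib diff_divide_distrib)
  show "Np p w = s powr p * Np p u" unfolding w_def Np_cmult using s by simp
qed

text \<open>The term with \<open>B\<close> leaves room for the interaction of two components, which
  is at most \<beta> / 2 times the sum of their squared charges.\<close>

lemma energy1_coercive:
  fixes p \<mu> :: real
  assumes p: "2 < p" "p < 4" and \<mu>: "0 < \<mu>"
  obtains K where "0 \<le> K" "\<And>u. u \<in> energy_dom \<Longrightarrow> sq u \<le> \<mu> \<Longrightarrow> size_sq u / 8 - K \<le> energy1 p \<sigma> u - B * (norm (charge u))\<^sup>2"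
proof -
  define k where "k = (\<sigma> + (euler_mascheroni - ln 2) / (2 * pi)) / 2"
  obtain K where K: "0 \<le> K" "\<And>u. u \<in> energy_dom \<Longrightarrow> sq u \<le> \<mu> \<Longrightarrow>
    size_sq u / 8 - K \<le> Hs (regular_part u) / 2 - (B - k) * (norm (charge u))\<^sup>2 - Np p u / p"
    using coercive[OF p \<mu>] by blast
  show ?thesis
  proof (rule that[of "K + \<mu> / 2"])
    show "0 \<le> K + \<mu> / 2" using K \<mu> by simp
    fix u assume u: "u \<in> energy_dom" "sq u \<le> \<mu>"
    have "energy1 p \<sigma> u = (Hs (regular_part u) - sq u) / 2 + (norm (charge u))\<^sup>2 * k - Np p u / p"
      using p by (simp add: energy1_eq k_def)
    then have "energy1 p \<sigma> u - B * (norm (charge u))\<^sup>2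
      = (Hs (regular_part u) / 2 - (B - k) * (norm (charge u))\<^sup>2 - Np p u / p) - sq u / 2"
      by (simp add: algebra_simps diff_divide_distrib)
    then show "size_sq u / 8 - (K + \<mu> / 2) \<le> energy1 p \<sigma> u - B * (norm (charge u))\<^sup>2"
      using K(2)[OF u] u(2) by simp
  qed
qed

lemma test_fun_nonzero:
  obtains \<psi> where "test_fun \<psi>" "0 < sq \<psi>" "\<And>p. 2 < p \<Longrightarrow> p < 4 \<Longrightarrow> 0 < Np p \<psi>"
proof -
  define \<psi> :: fn where "\<psi> x = of_real (bump 1 (\<chi> i. - 1) (\<chi> i. 1) x)" for x
  have t: "test_fun \<psi>" unfolding \<psi>_def[abs_def] by (rule test_fun_bump) simp
  have nz: "\<not> (AE x in lborel. \<psi> x = 0)"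
  proof
    assume "AE x in lborel. \<psi> x = 0"
    then have "(\<integral>x. \<psi> x \<partial>lborel) = (\<integral>x. 0 \<partial>(lborel :: (real ^ 2) measure))"
      using Lp_2_measurable[OF test_fun_Lp_2[OF t]] by (intro integral_cong_AE) auto
    then have "complex_of_real (\<integral>x. bump 1 (\<chi> i. - 1) (\<chi> i. 1) x \<partial>lborel) = 0"
      unfolding \<psi>_def integral_complex_of_real by simp
    then show False using bump_integral_pos[of 1] by simp
  qed
  have "sq \<psi> \<noteq> 0"
  proof
    assume "sq \<psi> = 0"
    then have "AE x in lborel. (norm (\<psi> x))\<^sup>2 = 0"
      using test_fun_Lp_2[OF t] by (subst (asm) integral_nonneg_eq_0_iff_AE) (auto simp: Lp_2_iff)
    then have "AE x in lborel. \<psi> x = 0" by eventually_elim simp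
    with nz show False ..
  qed
  moreover have "Np p \<psi> \<noteq> 0" if p: "2 < p" "p < 4" for p
  proof
    assume "Np p \<psi> = 0"
    then have "AE x in lborel. norm (\<psi> x) powr p = 0"
      using energy_dom_Lp[OF p H1_energy_dom(1)[OF test_fun_H1(1)[OF t]]] unfolding Np_def
      by (subst (asm) integral_nonneg_eq_0_iff_AE) auto
    then have "AE x in lborel. \<psi> x = 0" by eventually_elim simp
    with nz show False ..
  qed
  ultimately show ?thesis using that[OF t] sq_nonneg[of \<psi>] Np_nonneg[of _ \<psi>] by (metis less_le)
qed

text \<open>A real-valued version of \<open>energy1_inf\<close>. The two agree once the energies are
  known to form a nonempty set that is bounded below, see \<open>energy1_inf_eq\<close>.\<close>

definition energy_inf :: "real \<Rightarrow> real \<Rightarrow> real \<Rightarrow> real" where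
  "energy_inf p \<sigma> m = Inf (energy1 p \<sigma> ` {v \<in> energy_dom. sq v = m})"

text \<open>Spreading a fixed profile out, \<open>v(x) = a \<lambda> f(\<lambda> x)\<close>, makes the kinetic energy of order \<open>\<lambda>\<^sup>2\<close>
  but the potential energy of the larger order \<open>\<lambda>\<^sup>p\<^sup>-\<^sup>2\<close>.\<close>

lemma negative_energy:
  fixes p m :: real
  assumes p: "2 < p" "p < 4" and m: "0 < m"
  obtains v where "v \<in> energy_dom" "sq v = m" "energy1 p \<sigma> v < 0"
proof -
  obtain f where f: "test_fun f" "0 < sq f" "0 < Np p f" using test_fun_nonzero p by metis
  define a where "a = sqrt (m / sq f)"
  have a: "0 < a" "a\<^sup>2 * sq f = m" using m f(2) by (auto simp: a_def)
  define G where "G = a\<^sup>2 * (\<Sum>i\<in>UNIV. sq (pderiv i f))"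
  define N where "N = a powr p * Np p f / p"
  have G: "0 \<le> G" unfolding G_def by (intro mult_nonneg_nonneg sum_nonneg) auto
  have N: "0 < N" using a f p by (simp add: N_def)
  \<comment> \<open>Chosen such that l^2 = l^(p-2) N / (G + 1): the kinetic part l^2 G / 2 is then
    at most half of the potential part l^(p-2) N.\<close>
  define l where "l = (N / (G + 1)) powr (1 / (4 - p))"
  have l: "0 < l" "l powr (4 - p) = N / (G + 1)" using N G p by (auto simp: l_def powr_powr)
  define v where "v x = of_real (a * l) * f (0 + l *\<^sub>R x)" for x
  have t: "test_fun (\<lambda>x. f (0 + l *\<^sub>R x))" using f(1) l by (intro test_fun_affine) auto
  have tv: "test_fun v" unfolding v_def[abs_def] by (rule test_fun_cmult[OF t])
  have sc: "sq (\<lambda>x. of_real c * g (0 + l *\<^sub>R x)) = (c / l)\<^sup>2 * sq g" if "test_fun g" for g and c :: real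
  proof -
    have [measurable]: "g \<in> borel_measurable borel" using Lp_2_measurable[OF test_fun_Lp_2[OF that]] .
    show ?thesis
      using lborel_integral_affine(1)[of l "\<lambda>x. (norm (g x))\<^sup>2" 0] l
      by (simp add: norm_mult power_mult_distrib power_divide)
  qed
  have sqv: "sq v = m" unfolding v_def[abs_def] sc[OF f(1)] using a l by simp
  have pd: "pderiv i v = (\<lambda>x. of_real (a * l\<^sup>2) * pderiv i f (0 + l *\<^sub>R x))" for i
  proof
    fix x
    show "pderiv i v x = of_real (a * l\<^sup>2) * pderiv i f (0 + l *\<^sub>R x)"
      unfolding v_def[abs_def]
      using pderiv_cmult[OF smooth_differentiable[OF test_fun_smooth[OF t]], of i "of_real (a * l)" x]
        fun_cong[OF smooth_laplacian_affine(1)[OF test_fun_smooth[OF f(1)], of i 0 l], of x]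
      by (simp add: power2_eq_square)
  qed
  have Hv: "Hs v - sq v = l\<^sup>2 * G"
    unfolding Hs_test_fun[OF tv] pd sc[OF test_fun_pderiv[OF f(1)]] G_def using l
    by (simp add: sum_distrib_left power_mult_distrib power2_eq_square field_simps)
  have Nv: "Np p v / p = l powr (p - 2) * N"
  proof -
    have [measurable]: "f \<in> borel_measurable borel" using Lp_2_measurable[OF test_fun_Lp_2[OF f(1)]] .
    have "Np p (\<lambda>x. f (0 + l *\<^sub>R x)) = Np p f / l\<^sup>2"
      using lborel_integral_affine(1)[of l "\<lambda>x. norm (f x) powr p" 0] l by (simp add: Np_def)
    moreover have "norm (complex_of_real (a * l)) = a * l" using a l by (simp only: norm_of_real) simp
    ultimately show ?thesis
      unfolding v_def[abs_def] Np_cmult N_def using a l by (simp add: powr_mult powr_diff)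
  qed
  note vH = H1_energy_dom[OF test_fun_H1(1)[OF tv]]
  have "energy1 p \<sigma> v = l\<^sup>2 * G / 2 - l powr (p - 2) * N"
    using p by (simp add: energy1_eq vH Hv Nv)
  also have "l\<^sup>2 = l powr (p - 2) * l powr (4 - p)" using powr_add[of l "p - 2" "4 - p"] l(1) by simp
  also have "l powr (p - 2) * l powr (4 - p) * G / 2 - l powr (p - 2) * N = l powr (p - 2) * N * (G / (G + 1) / 2 - 1)"
    unfolding l(2) by (simp add: algebra_simps)
  also have "\<dots> < 0"
  proof -
    have "G / (G + 1) \<le> 1" using G by simp
    moreover have "w / 2 - 1 < 0" if "w \<le> 1" for w :: real using that by simp
    ultimately have "G / (G + 1) / 2 - 1 < 0" by blast
    then show ?thesis using l N by (intro mult_pos_neg) auto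
  qed
  finally show ?thesis using that[OF vH(1) sqv] by simp
qed

context
  fixes p \<sigma> :: real
  assumes p: "2 < p" "p < 4"
begin

lemma energy_inf_bdd: "0 < m \<Longrightarrow> bdd_below (energy1 p \<sigma> ` {v \<in> energy_dom. sq v = m})"
proof -
  assume m: "0 < m"
  obtain K where "0 \<le> K" and K: "\<And>u. u \<in> energy_dom \<Longrightarrow> sq u \<le> m \<Longrightarrow> size_sq u / 8 - K \<le> energy1 p \<sigma> u - 0 * (norm (charge u))\<^sup>2"
    using energy1_coercive[OF p m] by blast
  have "- K \<le> energy1 p \<sigma> u" if "u \<in> energy_dom" "sq u = m" for u
  proof -
    have "size_sq u / 8 - K \<le> energy1 p \<sigma> u" using K[OF that(1)] that(2) by simp
    moreover have "0 \<le> size_sq u / 8" using size_sq_nonneg[of u] by (rule divide_nonneg_nonneg) simp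
    ultimately show ?thesis by linarith
  qed
  then show ?thesis by (intro bdd_belowI[of _ "- K"]) auto
qed

lemma energy_inf_le: "0 < m \<Longrightarrow> v \<in> energy_dom \<Longrightarrow> sq v = m \<Longrightarrow> energy_inf p \<sigma> m \<le> energy1 p \<sigma> v"
  unfolding energy_inf_def by (intro cInf_lower energy_inf_bdd) auto

lemma energy_inf_nonempty:
  assumes "0 < m" shows "energy1 p \<sigma> ` {v \<in> energy_dom. sq v = m} \<noteq> {}"
proof -
  obtain v where "v \<in> energy_dom" "sq v = m" "energy1 p \<sigma> v < 0" by (rule negative_energy[OF p assms])
  then show ?thesis by auto
qed

lemma energy_inf_approx:
  assumes m: "0 < m" and \<epsilon>: "0 < \<epsilon>"
  obtains v where "v \<in> energy_dom" "sq v = m" "energy1 p \<sigma> v < energy_inf p \<sigma> m + \<epsilon>"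
proof -
  have "Inf (energy1 p \<sigma> ` {v \<in> energy_dom. sq v = m}) < energy_inf p \<sigma> m + \<epsilon>" using \<epsilon> by (simp add: energy_inf_def)
  then obtain y where "y \<in> energy1 p \<sigma> ` {v \<in> energy_dom. sq v = m}" "y < energy_inf p \<sigma> m + \<epsilon>"
    using cInf_lessD[OF energy_inf_nonempty[OF m]] by blast
  then show ?thesis using that by auto
qed

lemma energy_inf_neg:
  assumes m: "0 < m" shows "energy_inf p \<sigma> m < 0"
proof -
  obtain v where "v \<in> energy_dom" "sq v = m" "energy1 p \<sigma> v < 0" by (rule negative_energy[OF p m])
  then show ?thesis using energy_inf_le[OF m] by (auto intro: order_le_less_trans)
qed

lemma energy1_inf_eq: "0 < m \<Longrightarrow> energy1_inf p \<sigma> m = ereal (energy_inf p \<sigma> m)"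
  unfolding energy1_inf_def energy_inf_def Lp_norm_2
  using ereal_Inf'[OF energy_inf_bdd energy_inf_nonempty] by (simp add: image_image)

lemma energy_inf_scale:
  assumes u: "u \<in> energy_dom" "0 < sq u" and m: "0 < m"
  shows "energy_inf p \<sigma> m \<le> m / sq u * quadratic \<sigma> u - (m / sq u) powr (p / 2) * Np p u / p"
proof -
  define r where "r = m / sq u"
  have r: "0 < r" using u m by (simp add: r_def)
  have s: "0 \<le> sqrt r" using r by simp
  note sc = energy_scaling[OF u(1) s]
  have "(sqrt r) powr p = r powr (p / 2)" using r by (simp add: powr_half_sqrt[symmetric] powr_powr)
  then have "energy1 p \<sigma> (\<lambda>x. of_real (sqrt r) * u x) = r * quadratic \<sigma> u - r powr (p / 2) * Np p u / p"
    using energy1_split[of p \<sigma> "\<lambda>x. of_real (sqrt r) * u x"] sc(3)[of \<sigma>] sc(4)[of p] p r by simp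
  moreover have "sq (\<lambda>x. of_real (sqrt r) * u x) = m" using sc(2) r u(2) by (simp add: r_def)
  ultimately show ?thesis using energy_inf_le[OF m sc(1)] unfolding r_def by simp
qed

text \<open>Multiplication by sqrt(r) with r \<ge> 1 scales the quadratic part by r, but the
  negative part by the larger r^(p/2).\<close>

lemma energy_inf_scale_up:
  assumes u: "u \<in> energy_dom" "0 < sq u" and m: "sq u \<le> m"
  shows "energy_inf p \<sigma> m \<le> m / sq u * energy1 p \<sigma> u"
proof -
  define r where "r = m / sq u"
  have r: "1 \<le> r" using u m by (simp add: r_def)
  have "r * Np p u / p \<le> r powr (p / 2) * Np p u / p"
    using powr_mono[of 1 "p / 2" r] r p Np_nonneg[of p u] by (intro divide_right_mono mult_right_mono) auto
  then show ?thesis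
    using energy_inf_scale[OF u, of m] u m energy1_split[of p \<sigma> u] p
    by (simp add: right_diff_distrib r_def)
qed

text \<open>For competitors whose mass is only close to \<open>m\<close>: rescaling them to the
  exact mass costs an amount linear in the mass defect.\<close>

lemma energy_inf_near:
  assumes u: "u \<in> energy_dom" "0 < sq u" and m: "0 < m"
  shows "energy_inf p \<sigma> m \<le> energy1 p \<sigma> u + \<bar>m / sq u - 1\<bar> * (\<bar>quadratic \<sigma> u\<bar> + Np p u)"
proof -
  define r where "r = m / sq u"
  have r: "0 < r" using u m by (simp add: r_def)
  note N = Np_nonneg[of p u]
  \<comment> \<open>For r < 1 the exponent p / 2 \<le> 2 reduces this to 1 - r^2 \<le> 2 (1 -
    r).\<close>
  have "1 - r powr (p / 2) \<le> 2 * \<bar>r - 1\<bar>"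
  proof (cases "1 \<le> r")
    case True
    then have "1 \<le> r powr (p / 2)" using p by (intro ge_one_powr_ge_zero) auto
    then have "1 - r powr (p / 2) \<le> 0" by simp
    then show ?thesis by (rule order_trans) simp
  next
    case False
    then have "r powr 2 \<le> r powr (p / 2)" using r p by (intro powr_mono') auto
    then have "1 - r powr (p / 2) \<le> 1 - r\<^sup>2" using r by simp
    also have "\<dots> \<le> 2 * (1 - r)" using zero_le_power2[of "r - 1"] by (simp add: power2_diff)
    also have "\<dots> = 2 * \<bar>r - 1\<bar>" using False by simp
    finally show ?thesis .
  qed
  then have "(1 - r powr (p / 2)) * (Np p u / p) \<le> 2 * \<bar>r - 1\<bar> * (Np p u / p)"
    using N p by (intro mult_right_mono) auto
  also have "\<dots> \<le> \<bar>r - 1\<bar> * Np p u"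
  proof -
    have "2 * (Np p u / p) \<le> Np p u" using p mult_right_mono[of 2 p "Np p u"] N by (simp add: field_simps)
    then have "\<bar>r - 1\<bar> * (2 * (Np p u / p)) \<le> \<bar>r - 1\<bar> * Np p u" by (intro mult_left_mono) auto
    then show ?thesis by (simp add: mult.assoc mult.left_commute)
  qed
  finally have 1: "(1 - r powr (p / 2)) * (Np p u / p) \<le> \<bar>r - 1\<bar> * Np p u" .
  have 2: "(r - 1) * quadratic \<sigma> u \<le> \<bar>r - 1\<bar> * \<bar>quadratic \<sigma> u\<bar>"
    by (metis abs_ge_self abs_mult)
  have "r * quadratic \<sigma> u - r powr (p / 2) * Np p u / p
      = energy1 p \<sigma> u + (r - 1) * quadratic \<sigma> u + (1 - r powr (p / 2)) * (Np p u / p)"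
    using energy1_split[of p \<sigma> u] p by (simp add: algebra_simps)
  then show ?thesis
    using energy_inf_scale[OF u m] 1 2 unfolding r_def[symmetric] by (simp add: distrib_left)
qed

lemma energy1_null: "u \<in> energy_dom \<Longrightarrow> sq u = 0 \<Longrightarrow> energy1 p \<sigma>' u = 0"
  using energy_dom_null[of u] p by (simp add: energy1_eq)

text \<open>Both components are scaled up to mass m, and the two inequalities are weighted by the
  mass fractions, which sum to 1.\<close>

lemma energy_inf_subadditive:
  assumes u: "u1 \<in> energy_dom" "u2 \<in> energy_dom" "sq u1 + sq u2 = m" and m: "0 < m"
  shows "energy_inf p \<sigma> m \<le> energy1 p \<sigma> u1 + energy1 p \<sigma> u2"
proof -
  have n: "0 \<le> sq u1" "0 \<le> sq u2" by (rule sq_nonneg)+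
  consider "sq u1 = 0" | "sq u2 = 0" | "0 < sq u1" "0 < sq u2" using n by linarith
  then show ?thesis
  proof cases
    case 1
    then show ?thesis using energy_inf_le[OF m u(2)] u energy1_null[OF u(1)] by simp
  next
    case 2
    then show ?thesis using energy_inf_le[OF m u(1)] u energy1_null[OF u(2)] by simp
  next
    case 3
    have le: "sq u1 \<le> m" "sq u2 \<le> m" using u n by auto
    have "sq u1 / m * energy_inf p \<sigma> m \<le> sq u1 / m * (m / sq u1 * energy1 p \<sigma> u1)"
      using energy_inf_scale_up[OF u(1) 3(1) le(1)] 3 m by (intro mult_left_mono) auto
    moreover have "sq u2 / m * energy_inf p \<sigma> m \<le> sq u2 / m * (m / sq u2 * energy1 p \<sigma> u2)"
      using energy_inf_scale_up[OF u(2) 3(2) le(2)] 3 m by (intro mult_left_mono) auto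
    moreover have "sq u1 / m * energy_inf p \<sigma> m + sq u2 / m * energy_inf p \<sigma> m = energy_inf p \<sigma> m"
      using u(3) m by (simp add: add_divide_distrib[symmetric] distrib_right[symmetric])
    ultimately show ?thesis using 3 m by simp
  qed
qed

lemma energy_inf_subadditive':
  assumes u: "u \<in> energy_dom" "sq u + m' = m" and m: "0 < m" "0 < m'"
  shows "energy_inf p \<sigma> m \<le> energy1 p \<sigma> u + energy_inf p \<sigma> m'"
proof (rule field_le_epsilon)
  fix e :: real assume "0 < e"
  then obtain v where v: "v \<in> energy_dom" "sq v = m'" "energy1 p \<sigma> v < energy_inf p \<sigma> m' + e"
    using energy_inf_approx[OF m(2)] by blast
  have "energy_inf p \<sigma> m \<le> energy1 p \<sigma> u + energy1 p \<sigma> v"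
    by (rule energy_inf_subadditive[OF u(1) v(1) _ m(1)]) (use u v in simp)
  then show "energy_inf p \<sigma> m \<le> energy1 p \<sigma> u + energy_inf p \<sigma> m' + e" using v(3) by linarith
qed

lemma energy_inf_mono:
  assumes "0 < m'" "m' \<le> m" shows "energy_inf p \<sigma> m \<le> energy_inf p \<sigma> m'"
proof (rule field_le_epsilon)
  fix e :: real assume e: "0 < e"
  \<comment> \<open>Capping the error makes the energy of the near-minimiser negative, so that
    scaling up lowers it further.\<close>
  have "0 < min e (- energy_inf p \<sigma> m')" using e energy_inf_neg[OF assms(1)] by simp
  then obtain v where v: "v \<in> energy_dom" "sq v = m'" "energy1 p \<sigma> v < energy_inf p \<sigma> m' + min e (- energy_inf p \<sigma> m')"
    using energy_inf_approx[OF assms(1)] by blast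
  have neg: "energy1 p \<sigma> v < 0" using v(3) by linarith
  have "energy_inf p \<sigma> m \<le> m / m' * energy1 p \<sigma> v" using energy_inf_scale_up[OF v(1)] v(2) assms by simp
  also have "\<dots> \<le> 1 * energy1 p \<sigma> v" using neg assms by (intro mult_right_mono_neg) auto
  finally show "energy_inf p \<sigma> m \<le> energy_inf p \<sigma> m' + e" using v(3) by linarith
qed

end

section \<open>Functions without charge are not almost minimal\<close>

lemma mollifier_mono: "mollifier h \<rho> \<Longrightarrow> h \<le> h' \<Longrightarrow> mollifier h' \<rho>"
  unfolding mollifier_def by (meson order_trans)

text \<open>The rigorous form of the statement that pairing with the Green's function is evaluation
  at 0: mollifying the Green's function mollifies the point value. Conjugation disappears because
  the mollified Green's function is real.\<close>

lemma H1_herm_cnv_green: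
  assumes f: "f \<in> H1" and \<rho>: "mollifier h \<rho>"
  shows "H1_herm f (cnv \<rho> (green 1)) = cnv \<rho> f 0"
proof -
  let ?G = "cnv \<rho> (green 1)"
  have t: "test_fun \<rho>" and re: "\<And>x. \<rho> x \<in> \<real>" and ev: "\<And>x. \<rho> (- x) = \<rho> x" using \<rho> by (auto simp: mollifier_def)
  note G = cnv_H1[OF t green_Lp_2]
  have pr: "pderiv i \<rho> z \<in> \<real>" for i z
    using pderiv_real[OF re smooth_differentiable[OF test_fun_smooth[OF t]]] .
  have "herm (weak_pderiv i f) (weak_pderiv i ?G) = (\<integral>x. weak_pderiv i f x * weak_pderiv i ?G x \<partial>lborel)" for i
    unfolding herm_def
  proof (intro integral_cong_AE)
    have [measurable]: "weak_pderiv i f \<in> borel_measurable borel" "weak_pderiv i ?G \<in> borel_measurable borel"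
      using H1_weak_pderiv(1)[OF f] H1_weak_pderiv(1)[OF G(1)] Lp_2_measurable by auto
    have [measurable]: "(\<lambda>x. cnj (weak_pderiv i ?G x)) \<in> borel_measurable borel"
      using Lp_2_cnj[OF H1_weak_pderiv(1)[OF G(1)]] Lp_2_measurable by auto
    show "(\<lambda>x. weak_pderiv i f x * cnj (weak_pderiv i ?G x)) \<in> borel_measurable lborel"
      "(\<lambda>x. weak_pderiv i f x * weak_pderiv i ?G x) \<in> borel_measurable lborel" by measurable
    show "AE x in lborel. weak_pderiv i f x * cnj (weak_pderiv i ?G x) = weak_pderiv i f x * weak_pderiv i ?G x"
      using G(2)[of i] by eventually_elim (simp add: cnv_green_real[OF pr])
  qed
  moreover have "herm f ?G = (\<integral>x. f x * ?G x \<partial>lborel)"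
    unfolding herm_def by (simp add: cnv_green_real[OF re])
  ultimately have "H1_herm f ?G = (\<integral>x. f x * cnv (\<lambda>z. - laplacian \<rho> z + \<rho> z) (green 1) x \<partial>lborel)"
    unfolding H1_herm_def using H1_pairing_cnv[OF f t green_Lp_2] by simp
  also have "\<dots> = (\<integral>x. f x * \<rho> x \<partial>lborel)"
    using distribution_cnv[OF green_Lp_2 t, of 1] is_greenD(2)[OF is_green_green] by (simp add: ev)
  also have "\<dots> = cnv \<rho> f 0" by (simp add: cnv_def mult.commute)
  finally show ?thesis .
qed

lemma Re_unit_le: "norm \<theta> = 1 \<Longrightarrow> \<bar>Re (cnj \<theta> * z)\<bar> \<le> norm z"
  using abs_Re_le_cmod[of "cnj \<theta> * z"] by (simp add: norm_mult)

lemma herm_bound: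
  assumes "f \<in> Lp 2" "g \<in> Lp 2" shows "(norm (herm f g))\<^sup>2 \<le> sq f * sq g"
  using Cauchy_Schwarz_Lp_2(2)[OF assms(1) Lp_2_cnj[OF assms(2)]] by (simp add: herm_def)

lemma herm_bound':
  assumes "f \<in> Lp 2" "g \<in> Lp 2" shows "norm (herm f g) \<le> (sq f + sq g) / 2"
proof (rule power2_le_imp_le)
  have "sq f * sq g \<le> ((sq f + sq g) / 2)\<^sup>2"
    using zero_le_power2[of "sq f - sq g"] by (simp add: power2_eq_square field_simps)
  then show "(norm (herm f g))\<^sup>2 \<le> ((sq f + sq g) / 2)\<^sup>2" using herm_bound[OF assms] by linarith
qed (use sq_nonneg[of f] sq_nonneg[of g] in simp)

lemma herm_diff:
  assumes "f \<in> Lp 2" "g \<in> Lp 2" "h \<in> Lp 2" shows "herm f (\<lambda>x. g x - h x) = herm f g - herm f h"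
  unfolding herm_def
  using Lp_2_mult_integrable(1)[OF assms(1) Lp_2_cnj[OF assms(2)]] Lp_2_mult_integrable(1)[OF assms(1) Lp_2_cnj[OF assms(3)]]
  by (simp add: right_diff_distrib)

text \<open>Positivity of the squared norm of f \<plusminus> \<theta> g.\<close>

lemma H1_herm_bound:
  assumes f: "f \<in> H1" and g: "g \<in> H1" and \<theta>: "norm \<theta> = 1"
  shows "\<bar>Re (cnj \<theta> * H1_herm f g)\<bar> \<le> (Hs f + Hs g) / 2"
  using Hs_lincomb[OF f g, of 1 \<theta>] Hs_lincomb[OF f g, of 1 "- \<theta>"] \<theta>
    Hs_nonneg[of "\<lambda>x. 1 * f x + \<theta> * g x"] Hs_nonneg[of "\<lambda>x. 1 * f x + (- \<theta>) * g x"]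
  by (auto simp: abs_le_iff simp del: times_complex.sel)

context
  fixes p \<sigma> :: real
  assumes p: "2 < p" "p < 4"
begin

lemma energy_ingredients_bound:
  fixes M :: real
  assumes M: "0 < M"
  obtains A where "0 \<le> A" "\<And>v. v \<in> energy_dom \<Longrightarrow> sq v \<le> M \<Longrightarrow> size_sq v \<le> M \<Longrightarrow> \<bar>quadratic \<sigma> v\<bar> + Np p v \<le> A"
proof -
  obtain K where K: "0 \<le> K" "\<And>u. u \<in> energy_dom \<Longrightarrow> sq u \<le> M \<Longrightarrow> Np p u \<le> K + 1 * size_sq u"
    using Np_size_bound[OF p M zero_less_one] by blast
  define s where "s = \<bar>\<sigma> + (euler_mascheroni - ln 2) / (2 * pi)\<bar>"
  show ?thesis
  proof (rule that[of "M + M * s + (K + M)"])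
    show "0 \<le> M + M * s + (K + M)" using M K by (simp add: s_def)
    fix v assume v: "v \<in> energy_dom" "sq v \<le> M" "size_sq v \<le> M"
    have q: "(norm (charge v))\<^sup>2 \<le> M" "Hs (regular_part v) \<le> M"
      using v(3) Hs_nonneg[of "regular_part v"] zero_le_power2[of "norm (charge v)"] by linarith+
    have "\<bar>(Hs (regular_part v) - sq v) / 2\<bar> \<le> M"
    proof -
      have "\<bar>(h - n) / 2\<bar> \<le> M" if "0 \<le> h" "h \<le> M" "0 \<le> n" "n \<le> M" for h n :: real
        using that by (auto simp: abs_le_iff field_simps)
      from this[OF Hs_nonneg q(2) sq_nonneg v(2)] show ?thesis .
    qed
    moreover have "\<bar>(norm (charge v))\<^sup>2 / 2 * (\<sigma> + (euler_mascheroni - ln 2) / (2 * pi))\<bar> \<le> M * s"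
      unfolding s_def abs_mult
    proof (intro mult_right_mono abs_ge_zero)
      show "\<bar>(norm (charge v))\<^sup>2 / 2\<bar> \<le> M" using q(1) zero_le_power2[of "norm (charge v)"] M by simp
    qed
    ultimately have "\<bar>quadratic \<sigma> v\<bar> \<le> M + M * s" unfolding quadratic_def by linarith
    moreover have "Np p v \<le> K + M" using K(2)[OF v(1,2)] v(3) by simp
    ultimately show "\<bar>quadratic \<sigma> v\<bar> + Np p v \<le> M + M * s + (K + M)" by linarith
  qed
qed

text \<open>Compare a regular \<open>f\<close> with \<open>f + t \<theta> green\<close> and \<open>f - t \<theta> G\<close>, where \<open>G\<close> is a regular function close to
  the Green's function; adding multiples of \<open>f\<close> keeps the masses fixed to first order. All
  first-order terms cancel, except that only the regular perturbation sees the \<open>H\<^sup>1\<close> pairing with \<open>f\<close>.\<close>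

lemma comparison:
  fixes \<epsilon> M :: real
  assumes \<epsilon>: "0 < \<epsilon>" and M: "0 \<le> M"
  obtains K where "0 < K"
    "\<And>f G \<theta> t e m. f \<in> H1 \<Longrightarrow> Hs f \<le> M \<Longrightarrow> \<epsilon> \<le> sq f \<Longrightarrow> 0 < m \<Longrightarrow> G \<in> H1 \<Longrightarrow> norm \<theta> = 1 \<Longrightarrow>
      0 \<le> t \<Longrightarrow> t \<le> 1 \<Longrightarrow> 0 < e \<Longrightarrow> e \<le> 1 \<Longrightarrow> sq (\<lambda>x. green 1 x - G x) \<le> e\<^sup>2 \<Longrightarrow>
      integrable lborel (\<lambda>x. norm (green 1 x - G x) powr p) \<Longrightarrow> Np p (\<lambda>x. green 1 x - G x) \<le> e powr p \<Longrightarrow>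
      K * (t * e + t\<^sup>2 * (1 + Hs G)) \<le> 1 \<Longrightarrow>
      2 * energy_inf p \<sigma> m \<le> 2 * energy1 p \<sigma> f - t * Re (cnj \<theta> * H1_herm f G)
        + K * (t * e + t\<^sup>2 * (1 + Hs G) + \<bar>m - sq f\<bar>)"
proof -
  let ?g = "green 1"
  \<comment> \<open>\<open>X\<close>, \<open>X'\<close> and \<open>Y\<close> bound the pairings of f
    with the Green's function and with G, and the resulting correction of f. \<open>A1\<close> is
    for the mass errors, \<open>S\<close> for the size of the competitors, \<open>A2\<close> for
    their energies, \<open>A3\<close> and \<open>A4\<close> for the errors in the quadratic and the
    L^p terms, \<open>D\<close> for the return to mass m.\<close>
  define \<gamma> where "\<gamma> = sq ?g"
  define X where "X = (M + \<gamma>) / 2"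
  define Y where "Y = X / \<epsilon>"
  define X' where "X' = X + (M + 1)"
  define A1 where "A1 = 2 * (M + 1) + M * Y\<^sup>2 + \<gamma> + 2 * Y * X' + 1"
  define s where "s = \<sigma> + (euler_mascheroni - ln 2) / (2 * pi)"
  define S where "S = 2 * (1 + Y)\<^sup>2 * M + 3 + M + A1"
  have \<gamma>: "0 \<le> \<gamma>" unfolding \<gamma>_def by (rule sq_nonneg)
  have X: "0 \<le> X" "0 \<le> Y" "0 \<le> X'" using \<gamma> M \<epsilon> by (simp_all add: X_def Y_def X'_def)
  have A1: "1 \<le> A1" using X M \<gamma> by (simp add: A1_def)
  have S0: "0 < S" using M A1 by (simp add: S_def add_nonneg_pos)
  obtain A2 where A2: "0 \<le> A2" "\<And>v. v \<in> energy_dom \<Longrightarrow> sq v \<le> S \<Longrightarrow> size_sq v \<le> S \<Longrightarrow> \<bar>quadratic \<sigma> v\<bar> + Np p v \<le> A2"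
    using energy_ingredients_bound[OF S0] by blast
  define A3 where "A3 = Y\<^sup>2 * M + A1 + \<bar>s\<bar> + 1 + Y * (M + 1)"
  define A4 where "A4 = 2 powr p * (A2 + 1)"
  define D where "D = 2 * A2 * (2 / \<epsilon>)"
  have D: "0 \<le> D" using A2 \<epsilon> by (simp add: D_def)
  have A3: "0 \<le> A3" using X M A1 by (simp add: A3_def)
  have A4: "0 \<le> A4" using A2 by (simp add: A4_def)
  \<comment> \<open>By the summand 2 A1 / \<epsilon> the smallness hypothesis keeps the masses of
    both competitors above \<epsilon> / 2; the other summands collect the errors.\<close>
  define K where "K = 1 + 2 * A1 / \<epsilon> + A3 + A4 + D + D * A1"
  have K: "1 \<le> K" "2 * A1 / \<epsilon> \<le> K" "A3 + A4 + D * A1 \<le> K" "D \<le> K"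
    using A1 A3 A4 D \<epsilon> by (simp_all add: K_def)
  show ?thesis
  proof (rule that[of K])
    show "0 < K" using K(1) by simp
    fix f G and \<theta> :: complex and t e m :: real
    assume f: "f \<in> H1" "Hs f \<le> M" "\<epsilon> \<le> sq f" and m: "0 < m" and G: "G \<in> H1" and \<theta>: "norm \<theta> = 1"
      and t: "0 \<le> t" "t \<le> 1" and e: "0 < e" "e \<le> 1"
      and d2: "sq (\<lambda>x. ?g x - G x) \<le> e\<^sup>2" and di: "integrable lborel (\<lambda>x. norm (?g x - G x) powr p)"
      and dp: "Np p (\<lambda>x. ?g x - G x) \<le> e powr p"
      and small: "K * (t * e + t\<^sup>2 * (1 + Hs G)) \<le> 1"
    define n H HG \<omega> where "n = sq f" and "H = Hs f" and "HG = Hs G" and "\<omega> = t * e + t\<^sup>2 * (1 + HG)"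
    note fL = H1_Lp_2[OF f(1)] and GL = H1_Lp_2[OF G]
    have HG0: "0 \<le> HG" unfolding HG_def by (rule Hs_nonneg)
    have H0: "0 \<le> H" "H \<le> M" using f(2) Hs_nonneg[of f] by (auto simp: H_def)
    have n: "0 < n" "\<epsilon> \<le> n" "n \<le> M" using f(2,3) \<epsilon> sq_le_Hs(1)[of f] by (auto simp: n_def)
    have te: "0 \<le> t * e" "0 \<le> t\<^sup>2 * (1 + HG)" using t e HG0 by auto
    have \<omega>: "0 \<le> \<omega>" "t * e \<le> \<omega>" "t\<^sup>2 * (1 + HG) \<le> \<omega>" using te by (auto simp: \<omega>_def)
    have t2: "t\<^sup>2 \<le> \<omega>" "t\<^sup>2 * HG \<le> \<omega>"
    proof -
      have "t\<^sup>2 * (1 + HG) = t\<^sup>2 + t\<^sup>2 * HG" by (simp add: distrib_left)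
      moreover have "0 \<le> t\<^sup>2 * HG" "0 \<le> t\<^sup>2" using HG0 by auto
      ultimately show "t\<^sup>2 \<le> \<omega>" "t\<^sup>2 * HG \<le> \<omega>" using \<omega>(3) by (linarith | argo)+
    qed
    have K\<omega>: "K * \<omega> \<le> 1" using small by (simp add: \<omega>_def HG_def)
    have \<omega>1: "\<omega> \<le> 1" using K\<omega> mult_right_mono[OF K(1) \<omega>(1)] by (linarith | argo)
    have A1\<omega>: "A1 * \<omega> \<le> \<epsilon> / 2"
    proof -
      have "2 * A1 / \<epsilon> * \<omega> \<le> 1" using mult_right_mono[OF K(2) \<omega>(1)] K\<omega> by (linarith | argo)
      then show ?thesis using \<epsilon> by (simp add: field_simps)
    qed
    define x x' l where "x = Re (cnj \<theta> * herm f ?g)" and "x' = Re (cnj \<theta> * herm f G)" and "l = Re (cnj \<theta> * H1_herm f G)"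
    have x: "\<bar>x\<bar> \<le> X"
      using Re_unit_le[OF \<theta>, of "herm f ?g"] herm_bound'[OF fL green_Lp_2, folded n_def \<gamma>_def] n(3)
      unfolding x_def X_def by argo
    have xx: "\<bar>x - x'\<bar> \<le> (M + 1) * e"
    proof -
      have dL: "(\<lambda>x. ?g x - G x) \<in> Lp 2" by (rule Lp_2_diff(1)[OF green_Lp_2 GL])
      have "(norm (herm f (\<lambda>x. ?g x - G x)))\<^sup>2 \<le> n * e\<^sup>2"
        using herm_bound[OF fL dL] mult_left_mono[OF d2, of n] n(1) unfolding n_def by (linarith | argo)
      also have "\<dots> \<le> ((M + 1) * e)\<^sup>2"
      proof -
        have "n \<le> (M + 1)\<^sup>2" using n M zero_le_power2[of M] unfolding power2_sum one_power2 by (linarith | argo)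
        then show ?thesis unfolding power_mult_distrib by (intro mult_right_mono) auto
      qed
      finally have "norm (herm f (\<lambda>x. ?g x - G x)) \<le> (M + 1) * e"
        by (rule power2_le_imp_le) (use M e in simp)
      moreover have "x - x' = Re (cnj \<theta> * herm f (\<lambda>x. ?g x - G x))"
        unfolding x_def x'_def herm_diff[OF fL green_Lp_2 GL] by (simp add: algebra_simps)
      ultimately show ?thesis using Re_unit_le[OF \<theta>, of "herm f (\<lambda>x. ?g x - G x)"] by (linarith | argo)
    qed
    have x': "\<bar>x'\<bar> \<le> X'"
    proof -
      have "(M + 1) * e \<le> M + 1" using e M by (simp add: mult_left_le)
      then show ?thesis using x xx unfolding X'_def by (linarith | argo)
    qed
    \<comment> \<open>Adding t \<theta> times the Green's function to f changes the mass by 2 t x to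
      first order, and multiplying f by 1 - t y with y = x / n undoes this. The same y with the
      opposite sign serves G, up to the difference x - x', which is of order e.\<close>
    define y where "y = x / n"
    have xy: "x = n * y" using n(1) by (simp add: y_def)
    have y: "\<bar>y\<bar> \<le> Y"
    proof -
      have "\<bar>x\<bar> / n \<le> X / \<epsilon>" using x n \<epsilon> X(1) by (intro frac_le) auto
      then show ?thesis using n(1) by (simp add: y_def Y_def abs_divide)
    qed
    have ty: "\<bar>t * y\<bar> \<le> Y" using y t X by (simp add: abs_mult mult_le_one mult_left_le_one_le order_trans[of "t * \<bar>y\<bar>" "\<bar>y\<bar>"])
    have y2: "y\<^sup>2 \<le> Y\<^sup>2" using y X(2) by (simp add: abs_le_square_iff[symmetric])
    define a1 a2 where "a1 = 1 - t * y" and "a2 = 1 + t * y"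
    have ab: "a1\<^sup>2 \<le> (1 + Y)\<^sup>2" "a2\<^sup>2 \<le> (1 + Y)\<^sup>2" "a1 + a2 = 2"
      using ty X(2) by (auto simp: a1_def a2_def abs_le_square_iff[symmetric])
    define v1 v2 where "v1 = (\<lambda>x. of_real a1 * f x + (of_real t * \<theta>) * ?g x)"
      and "v2 = (\<lambda>x. of_real a2 * f x + (- of_real t * \<theta>) * G x)"
    have h1: "(\<lambda>x. of_real a1 * f x) \<in> H1" by (rule H1_cmult[OF f(1)])
    note D1 = energy_dom_I[OF h1, of "of_real t * \<theta>", folded v1_def]
    have h2: "v2 \<in> H1" unfolding v2_def by (rule H1_lincomb(1)[OF f(1) G])
    note D2 = H1_energy_dom[OF h2]
    have nt: "(norm (of_real t * \<theta>))\<^sup>2 = t\<^sup>2" "(norm (- of_real t * \<theta>))\<^sup>2 = t\<^sup>2" "(norm (complex_of_real c))\<^sup>2 = c\<^sup>2" for c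
      using \<theta> by (simp_all add: norm_mult)
    have Rr: "Re (of_real a * cnj (of_real b * \<theta>) * z) = a * b * Re (cnj \<theta> * z)"
      "Re (of_real a * cnj (- of_real b * \<theta>) * z) = - (a * b * Re (cnj \<theta> * z))" for a b z
      by (simp_all add: algebra_simps)
    have H1v: "Hs (regular_part v1) = a1\<^sup>2 * H"
      unfolding D1(3) H_def using Hs_cmult[OF f(1), of "of_real a1"] by simp
    have s1: "sq v1 = a1\<^sup>2 * n + t\<^sup>2 * \<gamma> + 2 * (a1 * t * x)"
      unfolding v1_def sq_lincomb[OF fL green_Lp_2] nt Rr n_def \<gamma>_def x_def ..
    have s2: "sq v2 = a2\<^sup>2 * n + t\<^sup>2 * sq G + 2 * - (a2 * t * x')"
      unfolding v2_def sq_lincomb[OF fL GL] nt Rr n_def x'_def ..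
    have H2v: "Hs v2 = a2\<^sup>2 * H + t\<^sup>2 * HG + 2 * - (a2 * t * l)"
      unfolding v2_def Hs_lincomb[OF f(1) G] nt Rr H_def HG_def l_def ..
    have lb: "\<bar>l\<bar> \<le> (M + HG) / 2"
      using H1_herm_bound[OF f(1) G \<theta>, folded l_def HG_def H_def] H0 by argo
    have e1: "sq v1 - n = t\<^sup>2 * (\<gamma> - n * y\<^sup>2)"
      unfolding s1 xy a1_def by (simp add: power2_eq_square algebra_simps)
    have e2: "sq v2 - n = 2 * (t * (x - x')) + t\<^sup>2 * (n * y\<^sup>2 - 2 * (y * x') + sq G)"
      unfolding s2 xy a2_def by (simp add: power2_eq_square algebra_simps)
    have ny: "0 \<le> n * y\<^sup>2" "n * y\<^sup>2 \<le> M * Y\<^sup>2" using n M y2 by (auto intro: mult_mono)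
    have b1: "\<bar>sq v1 - n\<bar> \<le> A1 * \<omega>"
    proof -
      have "\<bar>\<gamma> - n * y\<^sup>2\<bar> \<le> A1"
      proof -
        have "0 \<le> 2 * Y * X'" using X by simp
        then show ?thesis using ny \<gamma> M unfolding A1_def by (linarith | argo)
      qed
      then have "t\<^sup>2 * \<bar>\<gamma> - n * y\<^sup>2\<bar> \<le> \<omega> * A1" using t2(1) A1 \<omega> by (intro mult_mono) auto
      then show ?thesis unfolding e1 abs_mult by (simp add: mult.commute)
    qed
    have b2: "\<bar>sq v2 - n\<bar> \<le> A1 * \<omega>"
    proof -
      have u1: "\<bar>2 * (t * (x - x'))\<bar> \<le> 2 * (M + 1) * \<omega>"
      proof -
        have "t * \<bar>x - x'\<bar> \<le> t * ((M + 1) * e)" using xx t by (intro mult_left_mono) auto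
        also have "\<dots> = (M + 1) * (t * e)" by simp
        also have "\<dots> \<le> (M + 1) * \<omega>" using \<omega>(2) M by (intro mult_left_mono) auto
        finally show ?thesis using t by (simp add: abs_mult distrib_right)
      qed
      have yx: "\<bar>y * x'\<bar> \<le> Y * X'" unfolding abs_mult using y x' X by (intro mult_mono) auto
      have "\<bar>n * y\<^sup>2 - 2 * (y * x') + sq G\<bar> \<le> M * Y\<^sup>2 + 2 * (Y * X') + HG"
        using ny yx sq_le_Hs(1)[of G] sq_nonneg[of G] unfolding HG_def by (linarith | argo)
      also have "\<dots> \<le> (M * Y\<^sup>2 + 2 * Y * X' + 1) * (1 + HG)"
      proof -
        have "0 \<le> (M * Y\<^sup>2 + 2 * Y * X') * HG" using M X HG0 by simp
        then show ?thesis by (simp add: algebra_simps)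
      qed
      finally have "t\<^sup>2 * \<bar>n * y\<^sup>2 - 2 * (y * x') + sq G\<bar> \<le> t\<^sup>2 * ((M * Y\<^sup>2 + 2 * Y * X' + 1) * (1 + HG))"
        by (intro mult_left_mono) auto
      also have "\<dots> = (M * Y\<^sup>2 + 2 * Y * X' + 1) * (t\<^sup>2 * (1 + HG))" by simp
      also have "\<dots> \<le> (M * Y\<^sup>2 + 2 * Y * X' + 1) * \<omega>" using \<omega>(3) M X by (intro mult_left_mono) auto
      finally have "\<bar>t\<^sup>2 * (n * y\<^sup>2 - 2 * (y * x') + sq G)\<bar> \<le> (M * Y\<^sup>2 + 2 * Y * X' + 1) * \<omega>" by (simp add: abs_mult)
      with u1 have "\<bar>sq v2 - n\<bar> \<le> (2 * (M + 1) + (M * Y\<^sup>2 + 2 * Y * X' + 1)) * \<omega>"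
        unfolding e2 distrib_right by (linarith | argo)
      also have "\<dots> \<le> A1 * \<omega>" using \<gamma> \<omega>(1) by (intro mult_right_mono) (auto simp: A1_def)
      finally show ?thesis .
    qed
    have vs: "\<epsilon> / 2 \<le> sq v1" "\<epsilon> / 2 \<le> sq v2" "sq v1 \<le> S" "sq v2 \<le> S"
    proof -
      have "A1 * \<omega> \<le> A1" using A1 \<omega>1 by (simp add: mult_left_le)
      moreover have "0 \<le> 2 * (1 + Y)\<^sup>2 * M" using M by simp
      ultimately show "\<epsilon> / 2 \<le> sq v1" "\<epsilon> / 2 \<le> sq v2" "sq v1 \<le> S" "sq v2 \<le> S"
        using b1 b2 A1\<omega> n unfolding S_def by (linarith | argo)+
    qed
    have sz: "size_sq v1 \<le> S" "size_sq v2 \<le> S"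
    proof -
      have "a1\<^sup>2 * H \<le> (1 + Y)\<^sup>2 * M" "a2\<^sup>2 * H \<le> (1 + Y)\<^sup>2 * M" using ab H0 by (auto intro: mult_mono)
      moreover have "Hs v2 \<le> 2 * (a2\<^sup>2 * H) + 2 * (t\<^sup>2 * HG)"
        unfolding v2_def using Hs_add_le[OF H1_cmult[OF f(1), of "of_real a2"] H1_cmult[OF G, of "- of_real t * \<theta>"]]
          Hs_cmult[OF f(1), of "of_real a2"] Hs_cmult[OF G, of "- of_real t * \<theta>"] nt
        by (simp only: H_def HG_def)
      moreover have "0 \<le> (1 + Y)\<^sup>2 * M" using M by simp
      moreover have "(norm (charge v1))\<^sup>2 = t\<^sup>2" unfolding D1(2) nt ..
      moreover have "(norm (charge v2))\<^sup>2 = 0" unfolding D2(2) by simp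
      ultimately show "size_sq v1 \<le> S" "size_sq v2 \<le> S"
        unfolding H1v D2(3) S_def using t2 \<omega>1 M A1 by (linarith | argo)+
    qed
    have I: "energy_inf p \<sigma> m \<le> energy1 p \<sigma> v + A2 * ((2 / \<epsilon>) * (\<bar>m - n\<bar> + A1 * \<omega>))"
      if v: "v \<in> energy_dom" "\<epsilon> / 2 \<le> sq v" "sq v \<le> S" "size_sq v \<le> S" "\<bar>sq v - n\<bar> \<le> A1 * \<omega>" for v
    proof -
      have p0: "0 < sq v" using v(2) \<epsilon> by (linarith | argo)
      have "\<bar>m / sq v - 1\<bar> = \<bar>m - sq v\<bar> / sq v" using p0 by (simp add: field_simps abs_divide)
      also have "\<dots> \<le> (\<bar>m - n\<bar> + A1 * \<omega>) / (\<epsilon> / 2)" using v(2,5) \<epsilon> by (intro frac_le) auto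
      also have "\<dots> = (2 / \<epsilon>) * (\<bar>m - n\<bar> + A1 * \<omega>)" by simp
      finally have r: "\<bar>m / sq v - 1\<bar> \<le> (2 / \<epsilon>) * (\<bar>m - n\<bar> + A1 * \<omega>)" .
      have "\<bar>m / sq v - 1\<bar> * (\<bar>quadratic \<sigma> v\<bar> + Np p v) \<le> ((2 / \<epsilon>) * (\<bar>m - n\<bar> + A1 * \<omega>)) * A2"
      proof (intro mult_mono r A2(2) v)
        show "0 \<le> (2 / \<epsilon>) * (\<bar>m - n\<bar> + A1 * \<omega>)" using \<epsilon> A1 \<omega> by simp
        show "0 \<le> \<bar>quadratic \<sigma> v\<bar> + Np p v" using Np_nonneg[of p v] by simp
      qed
      then show ?thesis using energy_inf_near[OF p v(1) p0 m, of \<sigma>] by (simp only: mult.commute[of A2])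
    qed
    have I2: "2 * energy_inf p \<sigma> m \<le> energy1 p \<sigma> v1 + energy1 p \<sigma> v2 + D * (\<bar>m - n\<bar> + A1 * \<omega>)"
    proof -
      define z where "z = A2 * ((2 / \<epsilon>) * (\<bar>m - n\<bar> + A1 * \<omega>))"
      have "D * (\<bar>m - n\<bar> + A1 * \<omega>) = z + z" unfolding z_def by (simp add: D_def)
      then show ?thesis
        using I[OF D1(1) vs(1,3) sz(1) b1, folded z_def] I[OF D2(1) vs(2,4) sz(2) b2, folded z_def] by argo
    qed
    \<comment> \<open>The first-order changes in the H^1 norm of f cancel because a1 + a2 = 2. Only
      - t l survives: the multiple of the Green's function in v1 is no part of its regular part,
      whereas G is part of v2.\<close>
    have Q: "quadratic \<sigma> v1 + quadratic \<sigma> v2 \<le> H - n - t * l + A3 * \<omega>"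
    proof -
      have "quadratic \<sigma> v1 + quadratic \<sigma> v2
          = (a1\<^sup>2 * H - sq v1) / 2 + t\<^sup>2 / 2 * s + (a2\<^sup>2 * H + t\<^sup>2 * HG + 2 * - (a2 * t * l) - sq v2) / 2"
        unfolding quadratic_def H1v D1(2) nt D2(2,3) H2v s_def by simp
      also have "\<dots> = H - n - t * l + (t\<^sup>2 * (y\<^sup>2 * H) - (sq v1 - n) / 2 - (sq v2 - n) / 2 + t\<^sup>2 * s / 2 + t\<^sup>2 * HG / 2 - t\<^sup>2 * (y * l))"
        unfolding a1_def a2_def by (simp add: power2_eq_square algebra_simps add_divide_distrib diff_divide_distrib)
      also have "\<dots> \<le> H - n - t * l + A3 * \<omega>"
      proof -
        have "t\<^sup>2 * (y\<^sup>2 * H) \<le> \<omega> * (Y\<^sup>2 * M)" using t2 y2 H0 \<omega> by (intro mult_mono) auto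
        moreover have "t\<^sup>2 * s \<le> \<omega> * \<bar>s\<bar>" using t2 \<omega> by (intro order_trans[OF mult_left_mono[OF abs_ge_self] mult_right_mono]) auto
        moreover have "- (t\<^sup>2 * (y * l)) \<le> \<omega> * (Y * (M + 1))"
        proof -
          have "\<bar>y * l\<bar> \<le> Y * ((M + 1) * (1 + HG))"
          proof -
            have "(M + 1) * (1 + HG) = M + 1 + HG + M * HG" by (simp add: algebra_simps)
            then have "\<bar>l\<bar> \<le> (M + 1) * (1 + HG)" using lb HG0 M mult_nonneg_nonneg[OF M HG0] by argo
            then show ?thesis unfolding abs_mult using y X by (intro mult_mono) auto
          qed
          then have "t\<^sup>2 * \<bar>y * l\<bar> \<le> t\<^sup>2 * (Y * ((M + 1) * (1 + HG)))" by (intro mult_left_mono) auto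
          also have "\<dots> = (t\<^sup>2 * (1 + HG)) * (Y * (M + 1))" by simp
          also have "\<dots> \<le> \<omega> * (Y * (M + 1))" using \<omega> X M by (intro mult_right_mono) auto
          finally have "t\<^sup>2 * \<bar>y * l\<bar> \<le> \<omega> * (Y * (M + 1))" .
          moreover have "- (t\<^sup>2 * (y * l)) \<le> t\<^sup>2 * \<bar>y * l\<bar>" using abs_ge_minus_self[of "t\<^sup>2 * (y * l)"] by (simp add: abs_mult)
          ultimately show ?thesis by (linarith | argo)
        qed
        moreover have "0 \<le> \<omega> * \<bar>s\<bar>" using \<omega> by simp
        moreover have "A3 * \<omega> = \<omega> * (Y\<^sup>2 * M) + A1 * \<omega> + \<omega> * \<bar>s\<bar> + \<omega> + \<omega> * (Y * (M + 1))"
          by (simp add: A3_def algebra_simps)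
        ultimately show ?thesis using b1 b2 t2(2) \<omega>(1) by (linarith | argo)
      qed
      finally show ?thesis .
    qed
    have Np2: "2 * Np p f - 2 * (A4 * \<omega>) \<le> Np p v1 + Np p v2"
    proof -
      \<comment> \<open>Normalised so that the midpoint of the competitors is f + t e d with
        \<open>Np p d \<le> 1\<close>: by convexity at the midpoint the L^p terms lose an amount of
        order t e only.\<close>
      define d where "d x = (\<theta> / of_real (2 * e)) * (?g x - G x)" for x
      have dm: "d \<in> borel_measurable borel"
        unfolding d_def[abs_def] using Lp_2_measurable[OF Lp_2_cmult(1)[OF Lp_2_diff(1)[OF green_Lp_2 GL]]] .
      have ddi: "integrable lborel (\<lambda>x. norm (d x) powr p)"
        unfolding d_def norm_mult using di e by (simp add: powr_mult)
      have dN: "Np p d \<le> 1"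
      proof -
        have "Np p d = (1 / (2 * e)) powr p * Np p (\<lambda>x. ?g x - G x)"
          unfolding d_def[abs_def] Np_cmult using \<theta> e by (simp add: norm_divide norm_mult)
        also have "\<dots> \<le> (1 / (2 * e)) powr p * e powr p" using dp by (intro mult_left_mono) auto
        also have "\<dots> = (1 / 2) powr p" using e by (simp add: powr_mult[symmetric])
        also have "\<dots> \<le> 1" using p by (intro powr_le1) auto
        finally show ?thesis .
      qed
      have fN: "Np p f \<le> A2"
      proof -
        have fD: "f \<in> energy_dom" "size_sq f = H" using H1_energy_dom[OF f(1)] by (simp_all add: H_def)
        have "0 \<le> (1 + Y)\<^sup>2 * M" using M by simp
        then have "M \<le> S" using A1 unfolding S_def by (linarith | argo)
        then have "\<bar>quadratic \<sigma> f\<bar> + Np p f \<le> A2"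
          using A2(2)[OF fD(1)] fD(2) H0 n(3) by (simp add: n_def)
        then show ?thesis by simp
      qed
      have te01: "0 \<le> t * e" "t * e \<le> 1" using te \<omega> \<omega>1 by (linarith | argo)+
      have fi: "integrable lborel (\<lambda>x. norm (f x) powr p)" by (rule energy_dom_Lp[OF p H1_energy_dom(1)[OF f(1)]])
      have mid: "(v1 x + v2 x) / 2 = f x + of_real (t * e) * d x" for x
      proof -
        have "v1 x + v2 x = of_real (a1 + a2) * f x + of_real t * \<theta> * (?g x - G x)"
          by (simp add: v1_def v2_def algebra_simps)
        then have v: "v1 x + v2 x = 2 * f x + of_real t * \<theta> * (?g x - G x)" by (simp only: ab(3)) simp
        have de: "of_real (t * e) * d x = of_real t * \<theta> * (?g x - G x) / 2" unfolding d_def using e by simp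
        show ?thesis unfolding v de by (simp add: add_divide_distrib)
      qed
      have p1: "1 \<le> p" using p by simp
      have "Np p f - t * e * (2 powr p * (Np p f + Np p d)) \<le> Np p (\<lambda>x. f x + of_real (t * e) * d x)"
        by (rule Np_perturb[OF p1 fi ddi Lp_2_measurable[OF fL] dm te01])
      moreover have "2 * Np p (\<lambda>x. (v1 x + v2 x) / 2) \<le> Np p v1 + Np p v2"
      proof (rule Np_midpoint[OF p1 energy_dom_Lp[OF p D1(1)] energy_dom_Lp[OF p D2(1)]])
        have av: "of_real (1 / 2) * v1 x + of_real (1 / 2) * v2 x = (v1 x + v2 x) / 2" for x by (simp add: field_simps)
        show "integrable lborel (\<lambda>x. norm ((v1 x + v2 x) / 2) powr p)"
          using energy_dom_Lp[OF p energy_dom_lincomb(1)[OF D1(1) D2(1), of "of_real (1 / 2)" "of_real (1 / 2)"]]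
          by (simp only: av)
      qed
      moreover have "t * e * (2 powr p * (Np p f + Np p d)) \<le> \<omega> * A4"
        unfolding A4_def using fN dN \<omega> te01 Np_nonneg[of p f] Np_nonneg[of p d] by (intro mult_mono add_mono) auto
      ultimately show ?thesis unfolding mid by (simp only: mult.commute[of A4])
    qed
    have pp: "p \<noteq> 0" using p by simp
    have ef: "2 * energy1 p \<sigma> f = H - n - 2 * Np p f / p"
      unfolding energy1_split[OF pp] quadratic_def H_def n_def H1_energy_dom(2,3)[OF f(1)] by simp
    have Nq: "2 * Np p f / p - A4 * \<omega> \<le> (Np p v1 + Np p v2) / p"
    proof -
      have "2 * (A4 * \<omega>) / p \<le> A4 * \<omega>" using p mult_right_mono[of 2 p "A4 * \<omega>"] A4 \<omega> by (simp add: field_simps)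
      moreover have "(2 * Np p f - 2 * (A4 * \<omega>)) / p \<le> (Np p v1 + Np p v2) / p" using Np2 p by (intro divide_right_mono) auto
      ultimately show ?thesis by (simp add: diff_divide_distrib)
    qed
    have "energy1 p \<sigma> v1 + energy1 p \<sigma> v2 \<le> 2 * energy1 p \<sigma> f - t * l + A3 * \<omega> + A4 * \<omega>"
      using Q Nq ef energy1_split[OF pp, of \<sigma> v1] energy1_split[OF pp, of \<sigma> v2] by (simp add: add_divide_distrib)
    then have "2 * energy_inf p \<sigma> m \<le> 2 * energy1 p \<sigma> f - t * l + ((A3 + A4 + D * A1) * \<omega> + D * \<bar>m - n\<bar>)"
      using I2 by (simp add: algebra_simps)
    also have "(A3 + A4 + D * A1) * \<omega> + D * \<bar>m - n\<bar> \<le> K * \<omega> + K * \<bar>m - n\<bar>"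
      using K \<omega>(1) by (intro add_mono mult_right_mono) auto
    finally show "2 * energy_inf p \<sigma> m \<le> 2 * energy1 p \<sigma> f - t * Re (cnj \<theta> * H1_herm f G)
        + K * (t * e + t\<^sup>2 * (1 + Hs G) + \<bar>m - sq f\<bar>)"
      unfolding l_def \<omega>_def n_def HG_def by (simp add: distrib_left)
  qed
qed

end

lemma H1_energy1: "p \<noteq> 0 \<Longrightarrow> f \<in> H1 \<Longrightarrow> energy1 p \<sigma> f = (Hs f - sq f) / 2 - Np p f / p"
  by (simp add: energy1_split quadratic_def H1_energy_dom)

lemma Np_shift:
  assumes "f \<in> H1" shows "Np p (\<lambda>x. f (x + y)) = Np p f"
proof -
  have [measurable]: "f \<in> borel_measurable borel" using Lp_2_measurable[OF H1_Lp_2[OF assms]] .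
  show ?thesis unfolding Np_def using lborel_integral_shift(1)[of "\<lambda>x. norm (f x) powr p" y] by simp
qed

context
  fixes p \<sigma> :: real
  assumes p: "2 < p" "p < 4"
begin

text \<open>Mollifier, regularised Green's function and step t are all fixed before f, which makes
  the gap uniform. The slack in the mass serves \<open>gap_energy_dom\<close>, where removing the
  charge from a function alters its mass.\<close>

lemma strict_gap:
  fixes \<epsilon> M :: real
  assumes \<epsilon>: "0 < \<epsilon>" and M: "0 \<le> M"
  obtains c K where "0 < c" "0 \<le> K"
    "\<And>f m. f \<in> H1 \<Longrightarrow> Hs f \<le> M \<Longrightarrow> \<epsilon> \<le> m \<Longrightarrow> energy_inf p \<sigma> m + c \<le> energy1 p \<sigma> f + K * \<bar>m - sq f\<bar>"
proof -
  have p0: "p \<noteq> 0" using p by simp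
  define \<kappa> where "\<kappa> = - energy_inf p \<sigma> \<epsilon>"
  have \<kappa>: "0 < \<kappa>" using energy_inf_neg[OF p \<epsilon>] by (simp add: \<kappa>_def)
  have I\<kappa>: "energy_inf p \<sigma> m \<le> - \<kappa>" if "\<epsilon> \<le> m" for m
    using energy_inf_mono[OF p \<epsilon> that, of \<sigma>] by (simp add: \<kappa>_def)
  have M1: "0 < M + 1" using M by simp
  obtain K0 where K0: "0 \<le> K0"
    "\<And>u. u \<in> energy_dom \<Longrightarrow> sq u \<le> M + 1 \<Longrightarrow> size_sq u / 8 - K0 \<le> energy1 p \<sigma> u - 0 * (norm (charge u))\<^sup>2"
    using energy1_coercive[OF p M1, of \<sigma> 0] by blast
  \<comment> \<open>Below this threshold the L^p part of the energy is at most \<kappa> / 2, while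
    the infimum is at most - \<kappa>.\<close>
  define \<delta> where "\<delta> = p * \<kappa> / 2"
  have \<delta>: "0 < \<delta>" using p \<kappa> by (simp add: \<delta>_def)
  obtain h0 c0 where h0: "0 < h0" and c0: "0 < c0"
    and nv: "\<And>\<rho> f. mollifier h0 \<rho> \<Longrightarrow> f \<in> H1 \<Longrightarrow> Hs f \<le> M \<Longrightarrow> \<delta> \<le> Np p f \<Longrightarrow> \<exists>y. c0 \<le> norm (cnv \<rho> f y)"
    using nonvanishing[OF p M \<delta>] by blast
  have \<epsilon>2: "0 < \<epsilon> / 2" using \<epsilon> by simp
  obtain K2 where K2: "0 < K2"
    and cmp: "\<And>f G \<theta> t e m. f \<in> H1 \<Longrightarrow> Hs f \<le> M \<Longrightarrow> \<epsilon> / 2 \<le> sq f \<Longrightarrow> 0 < m \<Longrightarrow> G \<in> H1 \<Longrightarrow> norm \<theta> = 1 \<Longrightarrow>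
      0 \<le> t \<Longrightarrow> t \<le> 1 \<Longrightarrow> 0 < e \<Longrightarrow> e \<le> 1 \<Longrightarrow> sq (\<lambda>x. green 1 x - G x) \<le> e\<^sup>2 \<Longrightarrow>
      integrable lborel (\<lambda>x. norm (green 1 x - G x) powr p) \<Longrightarrow> Np p (\<lambda>x. green 1 x - G x) \<le> e powr p \<Longrightarrow>
      K2 * (t * e + t\<^sup>2 * (1 + Hs G)) \<le> 1 \<Longrightarrow>
      2 * energy_inf p \<sigma> m \<le> 2 * energy1 p \<sigma> f - t * Re (cnj \<theta> * H1_herm f G)
        + K2 * (t * e + t\<^sup>2 * (1 + Hs G) + \<bar>m - sq f\<bar>)"
    by (rule comparison[OF p \<epsilon>2 M]) blast
  \<comment> \<open>The accuracy e comes first, so that K2 e is at most a quarter of the gain c0 per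
    unit of t. It determines the regularised Green's function, whose norm then limits t.\<close>
  define e where "e = min 1 (c0 / (4 * K2))"
  have e: "0 < e" "e \<le> 1" using c0 K2 by (simp_all add: e_def)
  have K2e: "K2 * e \<le> c0 / 4"
  proof -
    have "e \<le> c0 / (4 * K2)" by (simp add: e_def)
    then show ?thesis using K2 by (simp add: field_simps)
  qed
  obtain A where A: "0 \<le> A" "modulus (p / 2) A (green 1)" using green_modulus[of "p / 2"] p by auto
  define \<eta> where "\<eta> = min (e\<^sup>2) (e powr p)"
  have \<eta>: "0 < \<eta>" using e by (simp add: \<eta>_def)
  obtain h1 where h1: "0 < h1"
    and small: "\<And>\<rho> f. mollifier h1 \<rho> \<Longrightarrow> f \<in> Lp 2 \<Longrightarrow> modulus (p / 2) A f \<Longrightarrow>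
      sq (\<lambda>x. f x - cnv \<rho> f x) \<le> \<eta> \<and> integrable lborel (\<lambda>x. norm (f x - cnv \<rho> f x) powr p)
      \<and> Np p (\<lambda>x. f x - cnv \<rho> f x) \<le> \<eta>"
    by (rule mollifier_error_small[OF p A(1) \<eta>]) blast
  have "0 < min h0 h1" using h0 h1 by simp
  then obtain \<rho> where "mollifier (min h0 h1) \<rho>" using mollifier_exists by blast
  then have \<rho>: "mollifier h0 \<rho>" "mollifier h1 \<rho>" by (auto elim: mollifier_mono)
  define G where "G = cnv \<rho> (green 1)"
  have t\<rho>: "test_fun \<rho>" using \<rho>(1) by (simp add: mollifier_def)
  have G: "G \<in> H1" unfolding G_def by (rule cnv_H1(1)[OF t\<rho> green_Lp_2])
  note sm = small[OF \<rho>(2) green_Lp_2 A(2), folded G_def]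
  have sm': "sq (\<lambda>x. green 1 x - G x) \<le> e\<^sup>2" "Np p (\<lambda>x. green 1 x - G x) \<le> e powr p"
    "integrable lborel (\<lambda>x. norm (green 1 x - G x) powr p)"
    using sm by (auto simp: \<eta>_def)
  define HG where "HG = Hs G"
  have HG: "0 \<le> HG" unfolding HG_def by (rule Hs_nonneg)
  \<comment> \<open>The last bound controls the term with t^2 (1 + HG), the middle one yields the
    smallness hypothesis of \<open>comparison\<close>. Altogether the error is at most half of the
    gain t c0.\<close>
  define t where "t = min 1 (min (2 / c0) (c0 / (4 * K2 * (1 + HG))))"
  have t: "0 < t" "t \<le> 1" using c0 K2 HG by (simp_all add: t_def)
  have t\<omega>: "K2 * (t * e + t\<^sup>2 * (1 + HG)) \<le> t * c0 / 2" "t * c0 / 2 \<le> 1"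
  proof -
    have "t \<le> c0 / (4 * K2 * (1 + HG))" "t \<le> 2 / c0" by (simp_all add: t_def)
    have "t * (4 * K2 * (1 + HG)) \<le> c0"
      using mult_right_mono[OF \<open>t \<le> c0 / _\<close>, of "4 * K2 * (1 + HG)"] K2 HG by simp
    then have 1: "K2 * (t * (1 + HG)) \<le> c0 / 4" by (simp add: algebra_simps)
    have 2: "t * c0 / 2 \<le> 1" using \<open>t \<le> 2 / c0\<close> c0 by (simp add: field_simps)
    have "K2 * (t * e + t\<^sup>2 * (1 + HG)) = t * (K2 * e) + t * (K2 * (t * (1 + HG)))"
      by (simp add: power2_eq_square algebra_simps)
    also have "\<dots> \<le> t * (c0 / 4) + t * (c0 / 4)" using 1 K2e t by (intro add_mono mult_left_mono) auto
    also have "\<dots> = t * c0 / 2" by simp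
    finally show "K2 * (t * e + t\<^sup>2 * (1 + HG)) \<le> t * c0 / 2" .
    show "t * c0 / 2 \<le> 1" by (rule 2)
  qed
  define c where "c = min (\<kappa> / 2) (t * c0 / 4)"
  have c: "0 < c" "c \<le> \<kappa> / 2" "c \<le> t * c0 / 4" using \<kappa> t c0 by (simp_all add: c_def)
  define K where "K = K2 + 2 * K0 / \<epsilon>"
  have K: "0 \<le> K" "K2 \<le> K" "2 * K0 / \<epsilon> \<le> K" using K2 K0 \<epsilon> by (simp_all add: K_def)
  show ?thesis
  proof (rule that[OF c(1) K(1)])
    fix f m assume f: "f \<in> H1" "Hs f \<le> M" and m: "\<epsilon> \<le> m"
    define n where "n = sq f"
    have nH: "n \<le> Hs f" "0 \<le> n" unfolding n_def by (rule sq_le_Hs(1), rule sq_nonneg)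
    have E: "energy1 p \<sigma> f = (Hs f - n) / 2 - Np p f / p" unfolding n_def by (rule H1_energy1[OF p0 f(1)])
    have Kn: "0 \<le> K * \<bar>m - n\<bar>" using K by simp
    have m0: "0 < m" using m \<epsilon> by simp
    \<comment> \<open>In turn: the mass is off by a fixed amount and the term with K pays for
      everything; the L^p norm is too small; or some average of f has modulus at least c0.\<close>
    consider (A) "\<epsilon> / 2 \<le> \<bar>m - n\<bar>" | (B) "\<epsilon> / 2 \<le> n" "Np p f < \<delta>" | (C) "\<epsilon> / 2 \<le> n" "\<delta> \<le> Np p f"
      using m by linarith
    then show "energy_inf p \<sigma> m + c \<le> energy1 p \<sigma> f + K * \<bar>m - sq f\<bar>"
    proof cases
      case A
      have "2 * K0 / \<epsilon> * (\<epsilon> / 2) \<le> K * \<bar>m - n\<bar>" using K K0 A \<epsilon> by (intro mult_mono) auto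
      then have "K0 \<le> K * \<bar>m - n\<bar>" using \<epsilon> by simp
      moreover have "- K0 \<le> energy1 p \<sigma> f"
      proof -
        have "sq f \<le> M + 1" using nH f(2) unfolding n_def by linarith
        from K0(2)[OF H1_energy_dom(1)[OF f(1)] this] have "size_sq f / 8 - K0 \<le> energy1 p \<sigma> f" by simp
        moreover have "0 \<le> size_sq f / 8" using size_sq_nonneg[of f] by (rule divide_nonneg_nonneg) simp
        ultimately show ?thesis by linarith
      qed
      ultimately show ?thesis using I\<kappa>[OF m] c(2) \<kappa> unfolding n_def by (linarith | argo)
    next
      case B
      have "Np p f / p \<le> \<kappa> / 2" using B(2) p by (simp add: \<delta>_def field_simps)
      then show ?thesis using I\<kappa>[OF m] c(2) Kn nH(1) unfolding E unfolding n_def by (linarith | argo)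
    next
      case C
      obtain y where y: "c0 \<le> norm (cnv \<rho> f y)" using nv[OF \<rho>(1) f C(2)] by blast
      define f' where "f' x = f (x + y)" for x
      have f': "f' \<in> H1" "Hs f' = Hs f" "sq f' = n"
        unfolding f'_def[abs_def] n_def by (rule H1_shift(1)[OF f(1)] H1_shift(3)[OF f(1)] Lp_2_shift(2)[OF H1_Lp_2[OF f(1)]])+
      have E': "energy1 p \<sigma> f' = energy1 p \<sigma> f"
        unfolding H1_energy1[OF p0 f'(1)] E f' unfolding f'_def[abs_def] Np_shift[OF f(1)] ..
      define l where "l = cnv \<rho> f y"
      have "cnv \<rho> f' 0 = l" by (simp add: cnv_def f'_def l_def add.commute)
      then have l: "H1_herm f' G = l" using H1_herm_cnv_green[OF f'(1) \<rho>(1)] by (simp add: G_def)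
      have l0: "l \<noteq> 0" "c0 \<le> norm l" using y c0 by (auto simp: l_def)
      \<comment> \<open>The phase of the perturbation is that of the average of f, so that the
        pairing becomes its modulus.\<close>
      have \<theta>: "norm (sgn l) = 1" using l0 by (simp add: norm_sgn)
      have "cnj (sgn l) * l = of_real (norm l)"
        using l0 by (simp add: sgn_eq complex_norm_square[symmetric] mult.commute power2_eq_square)
      then have Rl: "Re (cnj (sgn l) * H1_herm f' G) = norm l" unfolding l by simp
      have "2 * energy_inf p \<sigma> m \<le> 2 * energy1 p \<sigma> f' - t * Re (cnj (sgn l) * H1_herm f' G)
          + K2 * (t * e + t\<^sup>2 * (1 + Hs G) + \<bar>m - sq f'\<bar>)"
      proof (rule cmp[OF f'(1) _ _ m0 G \<theta> less_imp_le[OF t(1)] t(2) e sm'(1,3,2)])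
        show "Hs f' \<le> M" unfolding f' by (rule f(2))
        show "\<epsilon> / 2 \<le> sq f'" unfolding f' by (rule C(1))
        show "K2 * (t * e + t\<^sup>2 * (1 + Hs G)) \<le> 1" using t\<omega> unfolding HG_def by linarith
      qed
      then have "2 * energy_inf p \<sigma> m \<le> 2 * energy1 p \<sigma> f - t * norm l + K2 * (t * e + t\<^sup>2 * (1 + HG)) + K2 * \<bar>m - n\<bar>"
        unfolding E' Rl f'(3) HG_def[symmetric] by (simp only: distrib_left add.assoc)
      moreover have "t * c0 \<le> t * norm l" using l0 t by (intro mult_left_mono) auto
      moreover have "K2 * \<bar>m - n\<bar> \<le> K * \<bar>m - n\<bar>" using K by (intro mult_right_mono) auto
      ultimately have "2 * energy_inf p \<sigma> m + 2 * c \<le> 2 * energy1 p \<sigma> f + 2 * (K * \<bar>m - n\<bar>)"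
        using t\<omega>(1) c(3) Kn by (linarith | argo)
      then show ?thesis unfolding n_def by simp
    qed
  qed
qed

text \<open>\<open>strict_gap\<close> is applied to the regular part. Removing the charge costs
  amounts linear in |q| in the mass, the quadratic part and the L^p term, since q^2 \<le> q (M + 1)
  for bounded size.\<close>

lemma gap_energy_dom:
  fixes \<epsilon> M :: real
  assumes \<epsilon>: "0 < \<epsilon>" and M: "0 < M"
  obtains c K where "0 < c" "0 \<le> K"
    "\<And>u. u \<in> energy_dom \<Longrightarrow> \<epsilon> \<le> sq u \<Longrightarrow> sq u \<le> M \<Longrightarrow> size_sq u \<le> M \<Longrightarrow>
      energy_inf p \<sigma> (sq u) + c \<le> energy1 p \<sigma> u + K * norm (charge u)"
proof -
  have p0: "p \<noteq> 0" using p by simp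
  obtain c K1 where c: "0 < c" and K1: "0 \<le> K1"
    and gap: "\<And>f m. f \<in> H1 \<Longrightarrow> Hs f \<le> M \<Longrightarrow> \<epsilon> \<le> m \<Longrightarrow> energy_inf p \<sigma> m + c \<le> energy1 p \<sigma> f + K1 * \<bar>m - sq f\<bar>"
    using strict_gap[OF \<epsilon> less_imp_le[OF M]] by blast
  obtain A where A: "0 \<le> A" "\<And>v. v \<in> energy_dom \<Longrightarrow> sq v \<le> M \<Longrightarrow> size_sq v \<le> M \<Longrightarrow> \<bar>quadratic \<sigma> v\<bar> + Np p v \<le> A"
    using energy_ingredients_bound[OF p M] by blast
  define \<gamma> s N where "\<gamma> = sq (green 1)" and "s = \<bar>\<sigma> + (euler_mascheroni - ln 2) / (2 * pi)\<bar>" and "N = Np p (green 1)"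
  have \<gamma>: "0 \<le> \<gamma>" "0 \<le> s" "0 \<le> N" unfolding \<gamma>_def s_def N_def by (rule sq_nonneg, rule abs_ge_zero, rule Np_nonneg)
  define B where "B = (M + 1) * \<gamma> + (M + \<gamma>)"
  define C where "C = B / 2 + (M + 1) * s / 2 + 2 powr p * (A + N)"
  have B: "0 \<le> B" using M \<gamma> by (simp add: B_def)
  have C: "0 \<le> C" using M \<gamma> A B by (simp add: C_def)
  define K where "K = K1 * B + C + A + c"
  have K: "0 \<le> K" "K1 * B + C \<le> K" "A + c \<le> K" using K1 B C A c by (simp_all add: K_def)
  show ?thesis
  proof (rule that[OF c K(1)])
    fix u assume u: "u \<in> energy_dom" "\<epsilon> \<le> sq u" "sq u \<le> M" "size_sq u \<le> M"
    define f q n where "f = regular_part u" and "q = norm (charge u)" and "n = sq u"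
    have fH: "f \<in> H1" unfolding f_def by (rule energy_domD(2)[OF u(1)])
    note fL = H1_Lp_2[OF fH]
    have q0: "0 \<le> q" by (simp add: q_def)
    have q2: "q\<^sup>2 \<le> M" "Hs f \<le> M"
      using u(4) Hs_nonneg[of f] zero_le_power2[of q] unfolding f_def q_def by (linarith | argo)+
    have q1: "q \<le> M + 1"
    proof -
      have "2 * q \<le> q\<^sup>2 + 1" using zero_le_power2[of "q - 1"] by (simp add: power2_eq_square algebra_simps)
      then show ?thesis using q2(1) q0 by linarith
    qed
    have qq: "q\<^sup>2 \<le> q * (M + 1)" unfolding power2_eq_square using q1 q0 by (intro mult_left_mono)
    have fn: "sq f \<le> M" using sq_le_Hs(1)[of f] q2(2) by (rule order_trans)
    have uf: "u = (\<lambda>x. 1 * f x + charge u * green 1 x)" unfolding f_def using energy_dom_decomp[of u] by auto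
    have "n = (norm (1 :: complex))\<^sup>2 * sq f + q\<^sup>2 * \<gamma> + 2 * Re (1 * cnj (charge u) * herm f (green 1))"
      unfolding n_def q_def \<gamma>_def by (subst uf) (rule sq_lincomb[OF fL green_Lp_2])
    moreover have "\<bar>Re (1 * cnj (charge u) * herm f (green 1))\<bar> \<le> q * ((M + \<gamma>) / 2)"
    proof -
      have "norm (herm f (green 1)) \<le> (M + \<gamma>) / 2"
        using herm_bound'[OF fL green_Lp_2, folded \<gamma>_def] fn by (linarith | argo)
      then have "q * norm (herm f (green 1)) \<le> q * ((M + \<gamma>) / 2)" using q0 by (intro mult_left_mono)
      then show ?thesis
        using abs_Re_le_cmod[of "1 * cnj (charge u) * herm f (green 1)"] by (simp only: norm_mult complex_mod_cnj norm_one q_def mult_1)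
    qed
    moreover have "0 \<le> q\<^sup>2 * \<gamma>" "q\<^sup>2 * \<gamma> \<le> q * (M + 1) * \<gamma>" using \<gamma> qq by (simp, intro mult_right_mono)
    moreover have "q * B = q * (M + 1) * \<gamma> + 2 * (q * ((M + \<gamma>) / 2))" by (simp add: B_def algebra_simps)
    ultimately have nf: "\<bar>n - sq f\<bar> \<le> q * B" unfolding norm_one one_power2 mult_1 by (linarith | argo)
    have E: "energy1 p \<sigma> u = (Hs f - n) / 2 + q\<^sup>2 / 2 * (\<sigma> + (euler_mascheroni - ln 2) / (2 * pi)) - Np p u / p"
      unfolding energy1_split[OF p0] quadratic_def f_def q_def n_def ..
    have I: "energy_inf p \<sigma> n < 0" using energy_inf_neg[OF p] u(2) \<epsilon> by (simp add: n_def)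
    have NA: "Np p u \<le> A" "- A \<le> energy1 p \<sigma> u"
    proof -
      have "\<bar>quadratic \<sigma> u\<bar> + Np p u \<le> A" by (rule A(2)[OF u(1,3,4)])
      moreover have "Np p u / p \<le> Np p u" using Np_nonneg[of p u] p mult_right_mono[of 1 p "Np p u"] by (simp add: field_simps)
      ultimately show "Np p u \<le> A" "- A \<le> energy1 p \<sigma> u"
        unfolding energy1_split[OF p0] using Np_nonneg[of p u] by (linarith | argo)+
    qed
    have "energy_inf p \<sigma> n + c \<le> energy1 p \<sigma> u + K * q"
    \<comment> \<open>\<open>Np_perturb\<close> needs its parameter, here q, in [0, 1]. For larger q
      the term K q alone outweighs the bounded energy.\<close>
    proof (cases "q \<le> 1")
      case True
      define g where "g = (\<lambda>x. (- sgn (charge u)) * green 1 x)"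
      have gi: "integrable lborel (\<lambda>x. norm (g x) powr p)" "g \<in> borel_measurable borel"
      proof -
        have gg: "(\<lambda>x. 0 + 1 * green 1 x) \<in> energy_dom" by (rule energy_dom_I(1)) (rule H1_zero)
        then have "green 1 \<in> energy_dom" by simp
        then have *: "g \<in> energy_dom" unfolding g_def by (rule energy_dom_cmult(1))
        show "integrable lborel (\<lambda>x. norm (g x) powr p)" by (rule energy_dom_Lp[OF p *])
        show "g \<in> borel_measurable borel" using Lp_2_measurable[OF energy_domD(1)[OF *]] .
      qed
      have gN: "Np p g \<le> N"
      proof -
        have "norm (- sgn (charge u)) powr p \<le> 1" using p by (intro powr_le1) (auto simp: norm_sgn)
        then show ?thesis unfolding g_def Np_cmult N_def[symmetric] using \<gamma>(3) by (simp add: mult_left_le_one_le)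
      qed
      have fu: "f x = u x + of_real q * g x" for x
        unfolding f_def g_def regular_part_def q_def by (cases "charge u = 0") (simp_all add: sgn_eq)
      have p1: "1 \<le> p" using p by simp
      have "Np p u - q * (2 powr p * (Np p u + Np p g)) \<le> Np p f"
        using Np_perturb[OF p1 energy_dom_Lp[OF p u(1)] gi(1) Lp_2_measurable[OF energy_domD(1)[OF u(1)]] gi(2) q0 True]
        unfolding fu[symmetric] by simp
      moreover have "q * (2 powr p * (Np p u + Np p g)) \<le> q * (2 powr p * (A + N))"
        using q0 NA gN by (intro mult_left_mono add_mono) auto
      ultimately have "Np p u - q * (2 powr p * (A + N)) \<le> Np p f" by (linarith | argo)
      then have "(Np p u - q * (2 powr p * (A + N))) / p \<le> Np p f / p" using p by (intro divide_right_mono) auto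
      moreover have "q * (2 powr p * (A + N)) / p \<le> q * (2 powr p * (A + N))"
      proof -
        have "0 \<le> q * (2 powr p * (A + N))" using q0 A \<gamma> by simp
        then show ?thesis using p by (simp add: divide_le_eq mult_left_mono[of 1 p, simplified])
      qed
      ultimately have nN: "Np p u / p - Np p f / p \<le> q * (2 powr p * (A + N))" unfolding diff_divide_distrib by (linarith | argo)
      have sb: "- (q * ((M + 1) * s)) \<le> q\<^sup>2 * (\<sigma> + (euler_mascheroni - ln 2) / (2 * pi))"
      proof -
        have "q\<^sup>2 * s \<le> q * (M + 1) * s" using qq \<gamma> by (intro mult_right_mono)
        moreover have "\<bar>q\<^sup>2 * (\<sigma> + (euler_mascheroni - ln 2) / (2 * pi))\<bar> = q\<^sup>2 * s" unfolding s_def abs_mult by simp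
        ultimately show ?thesis by (simp only: mult.assoc)
      qed
      have "energy_inf p \<sigma> n + c \<le> energy1 p \<sigma> f + K1 * \<bar>n - sq f\<bar>"
        using u(2) by (intro gap fH q2) (simp add: n_def)
      also have "\<dots> \<le> energy1 p \<sigma> f + K1 * (q * B)" using nf K1 by (intro add_left_mono mult_left_mono)
      also have "energy1 p \<sigma> f \<le> energy1 p \<sigma> u + q * C"
      proof -
        have "q * C = q * B / 2 + q * ((M + 1) * s) / 2 + q * (2 powr p * (A + N))" by (simp add: C_def algebra_simps add_divide_distrib)
        moreover have "q\<^sup>2 / 2 * (\<sigma> + (euler_mascheroni - ln 2) / (2 * pi)) = q\<^sup>2 * (\<sigma> + (euler_mascheroni - ln 2) / (2 * pi)) / 2" by simp
        ultimately show ?thesis using nN sb nf unfolding E H1_energy1[OF p0 fH] by (linarith | argo)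
      qed
      also have "energy1 p \<sigma> u + q * C + K1 * (q * B) = energy1 p \<sigma> u + (K1 * B + C) * q" by (simp add: algebra_simps)
      also have "\<dots> \<le> energy1 p \<sigma> u + K * q" using K q0 by (intro add_left_mono mult_right_mono)
      finally show ?thesis by simp
    next
      case False
      have "(A + c) * 1 \<le> K * q" using K False A c by (intro mult_mono) auto
      then show ?thesis using NA(2) I by (linarith | argo)
    qed
    then show "energy_inf p \<sigma> (sq u) + c \<le> energy1 p \<sigma> u + K * norm (charge u)" by (simp only: n_def q_def)
  qed
qed

end

section \<open>Large \<open>\<sigma>\<^sub>2\<close>\<close>

text \<open>Lets both components be measured with the strength of the first and compared with the
  same infimum, so that the strength of the second appears only as a penalty on its charge.\<close>

lemma energy1_change_strength:
  assumes "p \<noteq> 0" shows "energy1 p \<sigma>' u = energy1 p \<sigma> u + (\<sigma>' - \<sigma>) / 2 * (norm (charge u))\<^sup>2"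
  using assms by (simp add: energy1_split quadratic_def field_simps)

lemma ground_state_le_energy_inf:
  assumes p: "2 < p" "p < 4" and \<mu>: "0 < \<mu>" and gs: "ground_state p p \<sigma> \<sigma>' \<beta> \<mu> U"
  shows "energy p p \<sigma> \<sigma>' \<beta> U \<le> energy_inf p \<sigma> \<mu>"
proof (rule field_le_epsilon)
  fix \<epsilon> :: real assume "0 < \<epsilon>"
  then obtain v where v: "v \<in> energy_dom" "sq v = \<mu>" "energy1 p \<sigma> v < energy_inf p \<sigma> \<mu> + \<epsilon>"
    using energy_inf_approx[OF p \<mu>] by blast
  note z = H1_energy_dom[OF H1_zero]
  have "(v, \<lambda>x. 0) \<in> mass_constraint \<mu>" using v z(1) by (simp add: mass_constraint_iff)
  from ground_state_le[OF gs this]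
  have "energy p p \<sigma> \<sigma>' \<beta> U \<le> energy1 p \<sigma> v + energy1 p \<sigma>' (\<lambda>x. 0)" by (simp add: energy_def z(2))
  moreover have "energy1 p \<sigma>' (\<lambda>x. 0) = 0" by (rule energy1_null[OF p z(1)]) simp
  ultimately show "energy p p \<sigma> \<sigma>' \<beta> U \<le> energy_inf p \<sigma> \<mu> + \<epsilon>" using v(3) by linarith
qed

lemma ground_state_strong_interaction:
  fixes p \<sigma> \<beta> \<mu> \<epsilon> :: real
  assumes p: "2 < p" "p < 4" and \<beta>: "0 < \<beta>" and \<mu>: "0 < \<mu>" and \<epsilon>: "0 < \<epsilon>"
  obtains S where "\<And>\<sigma>' u1 u2. S \<le> \<sigma>' \<Longrightarrow> ground_state p p \<sigma> \<sigma>' \<beta> \<mu> (u1, u2) \<Longrightarrow>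
    sq u2 < \<epsilon> \<and> \<bar>energy p p \<sigma> \<sigma>' \<beta> (u1, u2) - energy_inf p \<sigma> \<mu>\<bar> < \<epsilon>"
proof -
  have p0: "p \<noteq> 0" using p by simp
  define I where "I = energy_inf p \<sigma> \<mu>"
  have I: "I < 0" unfolding I_def by (rule energy_inf_neg[OF p \<mu>])
  obtain K0 where K0: "0 \<le> K0"
    "\<And>u. u \<in> energy_dom \<Longrightarrow> sq u \<le> \<mu> \<Longrightarrow> size_sq u / 8 - K0 \<le> energy1 p \<sigma> u - \<beta> / 2 * (norm (charge u))\<^sup>2"
    using energy1_coercive[OF p \<mu>, of \<sigma> "\<beta> / 2"] by blast
  \<comment> \<open>The two coercivity inequalities add up to a total size of at most 8 * 2 K0,
    because the energy of a ground state is negative. The bound is independent of \<sigma>'.\<close>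
  define M where "M = \<mu> + 16 * K0"
  have M: "0 < M" "\<mu> \<le> M" "16 * K0 \<le> M" using \<mu> K0 by (simp_all add: M_def)
  obtain c K where c: "0 < c" and K: "0 \<le> K"
    and gap: "\<And>u. u \<in> energy_dom \<Longrightarrow> \<epsilon> \<le> sq u \<Longrightarrow> sq u \<le> M \<Longrightarrow> size_sq u \<le> M \<Longrightarrow>
      energy_inf p \<sigma> (sq u) + c \<le> energy1 p \<sigma> u + K * norm (charge u)"
    using gap_energy_dom[OF p \<epsilon> M(1)] by blast
  define B where "B = \<beta> * (M + 1)"
  have B: "0 < B" using \<beta> M by (simp add: B_def)
  define r where "r = min \<epsilon> c"
  have r: "0 < r" "r \<le> \<epsilon>" "r \<le> c" using \<epsilon> c by (simp_all add: r_def)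
  define L where "L = K + B"
  have L: "0 < L" using K B by (simp add: L_def)
  \<comment> \<open>Above \<open>S\<close> the estimate (\<sigma>' - \<sigma>) |q2| \<le> 2 B proved
    below forces (K + B) |q2| < r.\<close>
  define S where "S = \<sigma> + 1 + L * (2 * B) / r"
  show ?thesis
  proof (rule that[of S])
    fix \<sigma>' u1 u2 assume \<sigma>': "S \<le> \<sigma>'" and gs: "ground_state p p \<sigma> \<sigma>' \<beta> \<mu> (u1, u2)"
    define \<Delta> where "\<Delta> = \<sigma>' - \<sigma>"
    have "0 \<le> L * (2 * B) / r" using L B r by simp
    then have \<Delta>: "0 < \<Delta>" "L * (2 * B) / r < \<Delta>" using \<sigma>' unfolding S_def \<Delta>_def by linarith+
    have u: "u1 \<in> energy_dom" "u2 \<in> energy_dom" "sq u1 + sq u2 = \<mu>"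
      using gs unfolding ground_state_def mass_constraint_iff by auto
    have um: "sq u1 \<le> \<mu>" "sq u2 \<le> \<mu>" using u(3) sq_nonneg[of u1] sq_nonneg[of u2] by linarith+
    define q1 q2 E e1 e2 z where "q1 = norm (charge u1)" and "q2 = norm (charge u2)"
      and "E = energy p p \<sigma> \<sigma>' \<beta> (u1, u2)" and "e1 = energy1 p \<sigma> u1" and "e2 = energy1 p \<sigma> u2"
      and "z = Re (charge u1 * cnj (charge u2))"
    have q: "0 \<le> q1" "0 \<le> q2" by (simp_all add: q1_def q2_def)
    have EI: "E \<le> I" unfolding E_def I_def by (rule ground_state_le_energy_inf[OF p \<mu> gs])
    have Ee: "E = e1 + e2 + \<Delta> / 2 * q2\<^sup>2 - \<beta> * z"
      unfolding E_def energy_def \<Delta>_def e1_def e2_def q2_def z_def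
      using energy1_change_strength[OF p0, of \<sigma>' u2 \<sigma>] by simp
    have "z \<le> q1 * q2"
      unfolding z_def q1_def q2_def using complex_Re_le_cmod[of "charge u1 * cnj (charge u2)"] by (simp add: norm_mult)
    then have bz: "\<beta> * z \<le> \<beta> * (q1 * q2)" using \<beta> by (intro mult_left_mono) auto
    have "2 * (q1 * q2) \<le> q1\<^sup>2 + q2\<^sup>2" using sum_squares_bound[of q1 q2] by (simp add: mult.assoc)
    then have "\<beta> / 2 * (2 * (q1 * q2)) \<le> \<beta> / 2 * (q1\<^sup>2 + q2\<^sup>2)" using \<beta> by (intro mult_left_mono) auto
    then have bq: "\<beta> * (q1 * q2) \<le> \<beta> / 2 * q1\<^sup>2 + \<beta> / 2 * q2\<^sup>2" by (simp add: distrib_left)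
    have "0 \<le> \<Delta> / 2 * q2\<^sup>2" using \<Delta> by simp
    moreover have "size_sq u1 / 8 - K0 \<le> e1 - \<beta> / 2 * q1\<^sup>2" "size_sq u2 / 8 - K0 \<le> e2 - \<beta> / 2 * q2\<^sup>2"
      unfolding e1_def e2_def q1_def q2_def by (rule K0(2)[OF u(1) um(1)], rule K0(2)[OF u(2) um(2)])
    ultimately have sz: "size_sq u1 \<le> M" "size_sq u2 \<le> M"
      using Ee EI I bz bq M(3) size_sq_nonneg[of u1] size_sq_nonneg[of u2] by argo+
    have q1M: "q1 \<le> M + 1"
    proof -
      have "q1\<^sup>2 \<le> M" using sz(1) Hs_nonneg[of "regular_part u1"] unfolding q1_def by linarith
      moreover have "2 * q1 \<le> q1\<^sup>2 + 1" using sum_squares_bound[of q1 1] by simp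
      ultimately show ?thesis using q(1) by linarith
    qed
    have "\<beta> * q1 * q2 \<le> \<beta> * (M + 1) * q2" using q1M \<beta> q by (intro mult_right_mono mult_left_mono) auto
    then have bB: "\<beta> * (q1 * q2) \<le> B * q2" by (simp add: B_def mult.assoc)
    have I12: "I \<le> e1 + e2" unfolding I_def e1_def e2_def by (rule energy_inf_subadditive[OF p u \<mu>])
    \<comment> \<open>The infimum cancels between the upper and the lower bound for E and leaves the
      penalty against the interaction; dividing by q2 shows that q2 is of order 1 /
      \<Delta>.\<close>
    have "\<Delta> / 2 * q2\<^sup>2 \<le> B * q2" using I12 Ee EI bz bB by linarith
    then have \<Delta>q: "\<Delta> * q2 \<le> 2 * B"
    proof (cases "q2 = 0")
      case False
      then have "0 < q2" using q by simp
      moreover have "\<Delta> * q2 * q2 \<le> 2 * B * q2" using \<open>\<Delta> / 2 * q2\<^sup>2 \<le> B * q2\<close> by (simp add: power2_eq_square)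
      ultimately show ?thesis by simp
    qed (use B in simp)
    have Lq: "L * q2 < r"
    proof -
      have "\<Delta> * (L * q2) = L * (\<Delta> * q2)" by simp
      also have "\<dots> \<le> L * (2 * B)" using \<Delta>q L by (intro mult_left_mono) auto
      also have "\<dots> < \<Delta> * r" using \<Delta>(2) r(1) by (simp add: pos_divide_less_eq)
      finally show ?thesis using \<Delta>(1) by simp
    qed
    have Lqd: "L * q2 = K * q2 + B * q2" by (simp add: L_def distrib_right)
    have Kq: "0 \<le> K * q2" "0 \<le> B * q2" using K B q by simp_all
    have dq: "0 \<le> \<Delta> / 2 * q2\<^sup>2" using \<Delta> by simp
    have "\<bar>E - I\<bar> < \<epsilon>" using EI I12 Ee bz bB Lq Lqd Kq dq r by linarith
    moreover have "sq u2 < \<epsilon>"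
    proof (rule ccontr)
      assume "\<not> sq u2 < \<epsilon>"
      then have s2: "\<epsilon> \<le> sq u2" by simp
      \<comment> \<open>The gap and subadditivity give I + c \<le> e1 + e2 + K q2, whereas e1 + e2
        \<le> I + B q2. Hence c \<le> L q2 < r \<le> c.\<close>
      have "energy_inf p \<sigma> (sq u2) + c \<le> e2 + K * q2"
        unfolding e2_def q2_def by (rule gap[OF u(2) s2 order_trans[OF um(2) M(2)] sz(2)])
      moreover have "I \<le> e1 + energy_inf p \<sigma> (sq u2)"
        unfolding I_def e1_def by (rule energy_inf_subadditive'[OF p u(1,3) \<mu> less_le_trans[OF \<epsilon> s2]])
      ultimately show False using EI Ee bz bB Lq Lqd dq r by linarith
    qed
    ultimately show "sq u2 < \<epsilon> \<and> \<bar>energy p p \<sigma> \<sigma>' \<beta> (u1, u2) - energy_inf p \<sigma> \<mu>\<bar> < \<epsilon>"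
      unfolding E_def I_def by blast
  qed
qed

theorem theorem1p5:
  fixes p1 p2 \<beta> \<mu> \<sigma>1 :: real
  assumes "p1 = p2" and "2 < p1" and "p1 < 4" and "0 < \<beta>" and "0 < \<mu>"
  shows "(\<forall>\<sigma>2 u1 u2. \<sigma>1 < \<sigma>2 \<and> ground_state p1 p2 \<sigma>1 \<sigma>2 \<beta> \<mu> (u1, u2)
            \<and> charge u1 \<in> \<real> \<and> 0 < Re (charge u1)
            \<and> charge u2 \<in> \<real> \<and> 0 < Re (charge u2)
          \<longrightarrow> Re (charge u2) < Re (charge u1))
       \<and> (\<forall>U :: real \<Rightarrow> fn \<times> fn.
            (\<forall>\<sigma>2>\<sigma>1. ground_state p1 p2 \<sigma>1 \<sigma>2 \<beta> \<mu> (U \<sigma>2))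
          \<longrightarrow> ((\<lambda>\<sigma>2. (Lp_norm 2 (fst (U \<sigma>2)))\<^sup>2) \<longlongrightarrow> \<mu>) at_top
            \<and> ((\<lambda>\<sigma>2. ereal (energy p1 p2 \<sigma>1 \<sigma>2 \<beta> (U \<sigma>2))) \<longlongrightarrow> energy1_inf p1 \<sigma>1 \<mu>) at_top)"
proof (intro conjI allI impI)
  fix \<sigma>2 u1 u2
  assume a: "\<sigma>1 < \<sigma>2 \<and> ground_state p1 p2 \<sigma>1 \<sigma>2 \<beta> \<mu> (u1, u2)
    \<and> charge u1 \<in> \<real> \<and> 0 < Re (charge u1) \<and> charge u2 \<in> \<real> \<and> 0 < Re (charge u2)"
  show "Re (charge u2) < Re (charge u1)"
    by (rule ground_state_charges[OF assms(2,3,4), of \<sigma>1 \<sigma>2 \<mu>]) (use a assms(1) in auto)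
next
  fix U :: "real \<Rightarrow> fn \<times> fn"
  assume gs: "\<forall>\<sigma>2>\<sigma>1. ground_state p1 p2 \<sigma>1 \<sigma>2 \<beta> \<mu> (U \<sigma>2)"
  have *: "\<forall>\<^sub>F \<sigma>2 in at_top. \<bar>(Lp_norm 2 (fst (U \<sigma>2)))\<^sup>2 - \<mu>\<bar> < \<epsilon>
      \<and> \<bar>energy p1 p2 \<sigma>1 \<sigma>2 \<beta> (U \<sigma>2) - energy_inf p1 \<sigma>1 \<mu>\<bar> < \<epsilon>" if \<epsilon>: "0 < \<epsilon>" for \<epsilon>
  proof -
    obtain S where S: "\<And>\<sigma>' u1 u2. S \<le> \<sigma>' \<Longrightarrow> ground_state p1 p1 \<sigma>1 \<sigma>' \<beta> \<mu> (u1, u2) \<Longrightarrow>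
        sq u2 < \<epsilon> \<and> \<bar>energy p1 p1 \<sigma>1 \<sigma>' \<beta> (u1, u2) - energy_inf p1 \<sigma>1 \<mu>\<bar> < \<epsilon>"
      using ground_state_strong_interaction[OF assms(2-5) \<epsilon>] by blast
    show ?thesis
      \<comment> \<open>The values of \<open>U\<close> are known to be ground states only above
        \<sigma>1.\<close>
      using eventually_ge_at_top[of S] eventually_gt_at_top[of \<sigma>1]
    proof eventually_elim
      case (elim \<sigma>2)
      obtain u1 u2 where U: "U \<sigma>2 = (u1, u2)" by fastforce
      have g: "ground_state p1 p1 \<sigma>1 \<sigma>2 \<beta> \<mu> (u1, u2)" using gs elim(2) U assms(1) by metis
      have m: "sq u1 + sq u2 = \<mu>" using g unfolding ground_state_def mass_constraint_iff by auto
      have n: "(Lp_norm 2 u1)\<^sup>2 = sq u1" by (rule Lp_norm_2)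
      have "\<bar>sq u1 - \<mu>\<bar> < \<epsilon>" using S[OF elim(1) g] m sq_nonneg[of u2] by linarith
      then show ?case using S[OF elim(1) g] unfolding U assms(1)[symmetric] fst_conv n by blast
    qed
  qed
  show "((\<lambda>\<sigma>2. (Lp_norm 2 (fst (U \<sigma>2)))\<^sup>2) \<longlongrightarrow> \<mu>) at_top"
    unfolding tendsto_iff dist_real_def
  proof (intro allI impI)
    fix \<epsilon> :: real assume "0 < \<epsilon>"
    from *[OF this] show "\<forall>\<^sub>F \<sigma>2 in at_top. \<bar>(Lp_norm 2 (fst (U \<sigma>2)))\<^sup>2 - \<mu>\<bar> < \<epsilon>" by eventually_elim blast
  qed
  have "((\<lambda>\<sigma>2. energy p1 p2 \<sigma>1 \<sigma>2 \<beta> (U \<sigma>2)) \<longlongrightarrow> energy_inf p1 \<sigma>1 \<mu>) at_top"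
    unfolding tendsto_iff dist_real_def
  proof (intro allI impI)
    fix \<epsilon> :: real assume "0 < \<epsilon>"
    from *[OF this] show "\<forall>\<^sub>F \<sigma>2 in at_top. \<bar>energy p1 p2 \<sigma>1 \<sigma>2 \<beta> (U \<sigma>2) - energy_inf p1 \<sigma>1 \<mu>\<bar> < \<epsilon>" by eventually_elim blast
  qed
  then show "((\<lambda>\<sigma>2. ereal (energy p1 p2 \<sigma>1 \<sigma>2 \<beta> (U \<sigma>2))) \<longlongrightarrow> energy1_inf p1 \<sigma>1 \<mu>) at_top"
    unfolding energy1_inf_eq[OF assms(2,3,5)] by (rule tendsto_ereal)
qed

end
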